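(* The Double Whitney Umbrellas $A_1^\pm$ are, in addition to smooth graphs, the only stable Legendrian graph singularities. That is, a Legendrian graph germ generated by a tangential family germ is stable under small tangential deformations if and only if it is smooth or it has a singularity of type $A_1^+$ or $A_1^-$.
   Context: All objects are of class $C^\infty$. A map $f:\mathbb{R}^2\to\mathbb{R}^2$, $(\xi,t)\mapsto f(\xi,t)$, with $\partial_t f$ nowhere zero parameterizes the 1-parameter family of immersed curves $\Gamma_\xi$ parameterized by $f(\xi,\cdot)$. It is a tangential family if $f(\cdot,0)$ parameterizes an embedded smooth curve $\gamma$ (the support) and $\Gamma_\xi$ is tangent to $\gamma$ at $f(\xi,0)$ for every $\xi$. A tangential family germ is the germ of such an $f$ at $(\xi,t)=(0,0)$, with $f(0,0)=0$. A $p$-parameter deformation $F:\mathbb{R}^2\times\mathbb{R}^p\to\mathbb{R}^2$ of a tangential family $f=F(\cdot;0)$ is tangential if $F_\lambda:=F(\cdot;\lambda)$ is a tangential family for every $\lambda$. $PT^*\mathbb{R}^2$ is the projectivized cotangent bundle of the plane (the 3-manifold of contact elements). The Legendrian lift of an immersed plane curve is the curve in $PT^*\mathbb{R}^2$ formed by its tangent contact elements. The Legendrian graph of a tangential family is the surface in $PT^*\mathbb{R}^2$ formed by the Legendrian lifts of all the curves $\Gamma_\xi$. It is parameterized by sending $(\xi,t)$ to the contact element at $f(\xi,t)$ tangent to $\Gamma_\xi$, and its germ is taken at the image of $(0,0)$. Two parameterized surface germs are diffeomorphic if their parameterizations $(\mathbb{R}^2,0)\to(\mathbb{R}^3,0)$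 coincide up to diffeomorphism germs of source and target (Left-Right equivalence). A surface germ has a singularity of type $A_1^\pm$ (Double Whitney Umbrella) if it is diffeomorphic to the surface germ parameterized at the origin by $(\xi,t^2,t^3\pm t\xi^{2})$. A Legendrian graph is stable (under small tangential deformations) if for every small enough tangential deformation of the tangential family generating it, the initial and the deformed graphs are diffeomorphic. A Legendrian graph germ is stable if the analogous property holds for germs: for every tangential deformation $F_\lambda$ of (a representative of) the generating tangential family germ and every sufficiently small $\lambda$, there is a point near the origin of the source plane, tending to the origin as $\lambda\to0$, at which the germ of the Legendrian graph of $F_\lambda$ is diffeomorphic to the initial germ. *)

theory Defs
  imports "HOL-Analysis.Analysis"
begin

section \<open>Smooth maps\<close>

primrec Ck_on :: "nat \<Rightarrow> ('a::real_normed_vector \<Rightarrow> 'b::real_normed_vector) \<Rightarrow> 'a set \<Rightarrow> bool" where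
  "Ck_on 0 f S \<longleftrightarrow> continuous_on S f"
| "Ck_on (Suc k) f S \<longleftrightarrow>
     (\<forall>x\<in>S. f differentiable (at x)) \<and> (\<forall>v. Ck_on k (\<lambda>x. frechet_derivative f (at x) v) S)"

text \<open>Intended for open \<open>S\<close> only, since the derivatives are unrestricted ones.\<close>

definition smooth_on :: "('a::real_normed_vector \<Rightarrow> 'b::real_normed_vector) \<Rightarrow> 'a set \<Rightarrow> bool" where
  "smooth_on f S \<longleftrightarrow> (\<forall>k. Ck_on k f S)"

text \<open>Deformations have an arbitrary finite number \<open>p\<close> of parameters, and this number is
  quantified over inside a definition. The parameter space is therefore the library's
  \<open>Euclidean_space p\<close>: sequences of reals vanishing from index \<open>p\<close> on. Smoothness of a
  function on \<open>Euclidean_space n\<close> means that iterated partial derivatives of all orders exist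
  and are continuous.\<close>

definition partial_deriv ::
    "nat \<Rightarrow> ((nat \<Rightarrow> real) \<Rightarrow> 'b::real_normed_vector) \<Rightarrow> (nat \<Rightarrow> real) \<Rightarrow> 'b" where
  "partial_deriv i g x = vector_derivative (\<lambda>s. g (x(i := s))) (at (x i))"

primrec Ck_Euclidean :: "nat \<Rightarrow> nat \<Rightarrow> ((nat \<Rightarrow> real) \<Rightarrow> 'b::real_normed_vector) \<Rightarrow> bool" where
  "Ck_Euclidean n 0 g \<longleftrightarrow> continuous_map (Euclidean_space n) euclidean g"
| "Ck_Euclidean n (Suc k) g \<longleftrightarrow>
     (\<forall>i<n. (\<forall>x\<in>topspace (Euclidean_space n). (\<lambda>s. g (x(i := s))) differentiable (at (x i))) \<and>
            Ck_Euclidean n k (partial_deriv i g))"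

definition smooth_Euclidean :: "nat \<Rightarrow> ((nat \<Rightarrow> real) \<Rightarrow> 'b::real_normed_vector) \<Rightarrow> bool" where
  "smooth_Euclidean n g \<longleftrightarrow> (\<forall>k. Ck_Euclidean n k g)"

section \<open>Tangential families and their deformations\<close>

type_synonym plane = "real \<times> real"

definition d_xi :: "(plane \<Rightarrow> plane) \<Rightarrow> plane \<Rightarrow> plane" where
  "d_xi f z = vector_derivative (\<lambda>s. f (s, snd z)) (at (fst z))"

definition d_t :: "(plane \<Rightarrow> plane) \<Rightarrow> plane \<Rightarrow> plane" where
  "d_t f z = vector_derivative (\<lambda>s. f (fst z, s)) (at (snd z))"

definition tangential_family :: "(plane \<Rightarrow> plane) \<Rightarrow> bool" where
  "tangential_family f \<longleftrightarrow>
     smooth_on f UNIV \<and>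
     (\<forall>z. d_t f z \<noteq> 0) \<and>
     embedding_map euclidean euclidean (\<lambda>\<xi>. f (\<xi>, 0)) \<and>
     (\<forall>\<xi>. d_xi f (\<xi>, 0) \<noteq> 0) \<and>
     (\<forall>\<xi>. span {d_xi f (\<xi>, 0)} = span {d_t f (\<xi>, 0)})"

text \<open>Joint smoothness on \<open>R^2 \<times> R^p\<close> is expressed on \<open>R^(2 + p)\<close>, whose first two coordinates
  are \<open>(\<xi>, t)\<close>. The last condition says that \<open>F\<close> deforms a representative of the germ of
  \<open>f\<close> at the origin.\<close>

definition tangential_deformation ::
    "nat \<Rightarrow> (plane \<Rightarrow> (nat \<Rightarrow> real) \<Rightarrow> plane) \<Rightarrow> (plane \<Rightarrow> plane) \<Rightarrow> bool" where
  "tangential_deformation p F f \<longleftrightarrow>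
     smooth_Euclidean (2 + p) (\<lambda>y. F (y 0, y 1) (\<lambda>i. y (2 + i))) \<and>
     (\<forall>\<mu>\<in>topspace (Euclidean_space p). tangential_family (\<lambda>z. F z \<mu>)) \<and>
     (\<forall>\<^sub>F z in nhds (0, 0). F z (\<lambda>_. 0) = f z)"

section \<open>Legendrian graphs\<close>

text \<open>A contact element of the plane is a point together with a line, through 0, in the tangent
  plane at that point. The manifold structure on contact elements is given by two affine charts,
  according to whether the line is non-vertical or non-horizontal; the maps below are the
  (injective) inverses of these charts.\<close>

type_synonym contact_element = "plane \<times> plane set"

definition inv_chart_x :: "real \<times> real \<times> real \<Rightarrow> contact_element" where
  "inv_chart_x = (\<lambda>(x, y, m). ((x, y), span {(1, m)}))"

definition inv_chart_y :: "real \<times> real \<times> real \<Rightarrow> contact_element" where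
  "inv_chart_y = (\<lambda>(x, y, m). ((x, y), span {(m, 1)}))"

definition legendrian_graph :: "(plane \<Rightarrow> plane) \<Rightarrow> plane \<Rightarrow> contact_element" where
  "legendrian_graph f z = (f z, span {d_t f z})"

definition coordinate_expression ::
    "(plane \<Rightarrow> contact_element) \<Rightarrow> plane \<Rightarrow> (plane \<Rightarrow> real \<times> real \<times> real) \<Rightarrow> bool" where
  "coordinate_expression L a g \<longleftrightarrow>
     (\<forall>\<^sub>F z in nhds a. L z = inv_chart_x (g z)) \<or> (\<forall>\<^sub>F z in nhds a. L z = inv_chart_y (g z))"

section \<open>Left-Right equivalence and singularity types\<close>

definition diffeo_germ :: "('a::real_normed_vector \<Rightarrow> 'a) \<Rightarrow> 'a \<Rightarrow> bool" where
  "diffeo_germ h a \<longleftrightarrow>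
     (\<exists>U h'. open U \<and> a \<in> U \<and> open (h ` U) \<and> smooth_on h U \<and> smooth_on h' (h ` U) \<and>
             (\<forall>x\<in>U. h' (h x) = x))"

definition left_right_equivalent ::
    "('a::real_normed_vector \<Rightarrow> 'b::real_normed_vector) \<Rightarrow> 'a \<Rightarrow> ('a \<Rightarrow> 'b) \<Rightarrow> 'a \<Rightarrow> bool" where
  "left_right_equivalent g a g' b \<longleftrightarrow>
     (\<exists>h k. diffeo_germ h a \<and> h a = b \<and> diffeo_germ k (g a) \<and>
            (\<forall>\<^sub>F z in nhds a. k (g z) = g' (h z)))"

definition graph_germs_diffeomorphic ::
    "(plane \<Rightarrow> plane) \<Rightarrow> plane \<Rightarrow> (plane \<Rightarrow> plane) \<Rightarrow> plane \<Rightarrow> bool" where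
  "graph_germs_diffeomorphic f a f' b \<longleftrightarrow>
     (\<exists>g g'. coordinate_expression (legendrian_graph f) a g \<and>
             coordinate_expression (legendrian_graph f') b g' \<and>
             left_right_equivalent g a g' b)"

text \<open>A parameterized surface germ is smooth (nonsingular) if it is an immersion germ.\<close>

definition smooth_graph_germ :: "(plane \<Rightarrow> plane) \<Rightarrow> bool" where
  "smooth_graph_germ f \<longleftrightarrow>
     (\<exists>g g'. coordinate_expression (legendrian_graph f) (0, 0) g \<and>
             (g has_derivative g') (at (0, 0)) \<and> inj g')"

definition A1_plus :: "plane \<Rightarrow> real \<times> real \<times> real" where
  "A1_plus = (\<lambda>(\<xi>, t). (\<xi>, t^2, t^3 + t * \<xi>^2))"

definition A1_minus :: "plane \<Rightarrow> real \<times> real \<times> real" where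
  "A1_minus = (\<lambda>(\<xi>, t). (\<xi>, t^2, t^3 - t * \<xi>^2))"

definition graph_germ_of_type ::
    "(plane \<Rightarrow> real \<times> real \<times> real) \<Rightarrow> (plane \<Rightarrow> plane) \<Rightarrow> bool" where
  "graph_germ_of_type N f \<longleftrightarrow>
     (\<exists>g. coordinate_expression (legendrian_graph f) (0, 0) g \<and>
          left_right_equivalent g (0, 0) N (0, 0))"

section \<open>Stability\<close>

definition stable_graph_germ :: "(plane \<Rightarrow> plane) \<Rightarrow> bool" where
  "stable_graph_germ f \<longleftrightarrow>
     (\<forall>p F. tangential_deformation p F f \<longrightarrow>
        (\<exists>q. (q \<longlongrightarrow> (0, 0)) (atin (Euclidean_space p) (\<lambda>_. 0)) \<and>
             (\<forall>\<^sub>F \<mu> in nhdsin (Euclidean_space p) (\<lambda>_. 0).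
                graph_germs_diffeomorphic f (0, 0) (\<lambda>z. F z \<mu>) (q \<mu>))))"

end

theory Submission
  imports Defs
begin

text \<open>In the coordinates \<open>x\<close> and \<open>\<tau> = x - x\<^sub>0\<close>, where \<open>x\<^sub>0\<close> is the abscissa of the tangency point, the
  Legendrian graph of a tangential family is \<open>(x, A, A\<^sub>x + A\<^sub>\<tau>)\<close> with \<open>A\<^sub>\<tau> = \<tau> V\<close>. It is immersed at
  the origin iff \<open>V(0) \<noteq> 0\<close>. If \<open>V(0) = 0\<close>, put \<open>p = V\<^sub>x(0)\<close> and \<open>q = V\<^sub>\<tau>(0)\<close>: when \<open>p + 2 q \<noteq> 0\<close> the graph
  is a fold up to Left-Right equivalence (every smooth even function is a smooth function of the square),
  and it is a Double Whitney Umbrella iff moreover \<open>p\<close>, \<open>q\<close> and \<open>p + q\<close> do not vanish; the sign of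
  \<open>- (p + q) q\<close> distinguishes \<open>A\<^sub>1\<^sup>+\<close> from \<open>A\<^sub>1\<^sup>-\<close>.

  These conditions are open, and since \<open>p \<noteq> 0\<close> the zero of \<open>V\<close> on the support persists, which gives
  stability. Conversely, adding \<open>\<mu>\<^sub>0 \<tau>\<^sup>2 + \<mu>\<^sub>1 \<tau>\<^sup>3\<close> to \<open>A\<close> is a tangential deformation. By Sard's theorem, for
  almost every \<open>\<mu>\<close> all nearby singular points on the support are Double Whitney Umbrellas and the others
  are Whitney umbrellas, which are never equivalent to a singular germ at a point of the support. Hence a
  stable singular graph is a Double Whitney Umbrella.\<close>

section \<open>Calculus of smooth maps\<close>

text \<open>Two features of the definitions shape the proof. Target changes live on a full
  neighbourhood in 3-space, whereas squares fill only a half-plane: the even part of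
  \<open>A\<close> can be subtracted only after it is extended smoothly across the boundary. The
  extension is Seeley's, with explicit coefficients from a theta series. To separate germs, the only
  fact used about the target change is that it is Lipschitz: estimates o(r^n) along curves with a
  velocity at 0 survive, and p + 2 q, p (p + q) and q are each detected by such an estimate.
  Secondly, the base point in the definition of stability is free and may leave the support. One
  parameter must therefore work at all points of a fixed neighbourhood; this is where Sard's theorem
  for maps of the plane enters. Two parameters suffice since the first shifts \<open>V\<close> and
  the second shifts q, while p stays fixed. All this is done for a non-vertical tangent at the
  origin; exchanging the coordinates of the plane gives the other case.\<close>

lemma Ck_on_cong:
  assumes "open S" "\<And>x. x \<in> S \<Longrightarrow> f x = g x"
  shows "Ck_on k f S \<longleftrightarrow> Ck_on k g S"
  using assms
proof (induction k arbitrary: f g)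
  case 0
  then show ?case unfolding Ck_on.simps by (intro continuous_on_cong refl)
next
  case (Suc k)
  have D: "(f has_derivative D) (at x) \<longleftrightarrow> (g has_derivative D) (at x)" if "x \<in> S" for x D
  proof
    show "(f has_derivative D) (at x) \<Longrightarrow> (g has_derivative D) (at x)"
      by (erule has_derivative_transform_within_open[OF _ \<open>open S\<close> that]) (rule Suc.prems)
    show "(g has_derivative D) (at x) \<Longrightarrow> (f has_derivative D) (at x)"
      by (erule has_derivative_transform_within_open[OF _ \<open>open S\<close> that]) (rule Suc.prems(2)[symmetric])
  qed
  have 1: "f differentiable at x \<longleftrightarrow> g differentiable at x" if "x \<in> S" for x
    unfolding differentiable_def D[OF that] ..
  have 2: "frechet_derivative f (at x) = frechet_derivative g (at x)" if "x \<in> S" for x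
    unfolding frechet_derivative_def D[OF that] ..
  have "Ck_on k (\<lambda>x. frechet_derivative f (at x) v) S \<longleftrightarrow> Ck_on k (\<lambda>x. frechet_derivative g (at x) v) S" for v
    by (rule Suc.IH[OF \<open>open S\<close>]) (simp only: 2)
  then show ?case unfolding Ck_on.simps using 1 by blast
qed

lemma Ck_on_subset: "Ck_on k f S \<Longrightarrow> T \<subseteq> S \<Longrightarrow> Ck_on k f T"
  by (induction k arbitrary: f) (auto intro: continuous_on_subset)

lemma Ck_on_Suc_imp: "Ck_on (Suc k) f S \<Longrightarrow> Ck_on k f S"
proof (induction k arbitrary: f)
  case 0
  then show ?case
    by (auto intro!: continuous_at_imp_continuous_on differentiable_imp_continuous_within)
next
  case (Suc k)
  then show ?case
    using Suc.IH unfolding Ck_on.simps(2)[of "Suc k"] Ck_on.simps(2)[of k f] by blast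
qed

lemma Ck_on_imp_continuous: "Ck_on k f S \<Longrightarrow> continuous_on S f"
proof (induction k)
  case (Suc k)
  show ?case by (rule Suc.IH[OF Ck_on_Suc_imp[OF Suc.prems]])
qed simp

lemma Ck_on_SucI:
  assumes "open S" "\<And>x. x \<in> S \<Longrightarrow> (f has_derivative f' x) (at x)"
    and "\<And>v. Ck_on k (\<lambda>x. f' x v) S"
  shows "Ck_on (Suc k) f S"
proof -
  have "Ck_on k (\<lambda>x. frechet_derivative f (at x) v) S" for v
  proof (rule iffD2[OF Ck_on_cong[OF assms(1)] assms(3)])
    show "frechet_derivative f (at x) v = f' x v" if "x \<in> S" for x
      using frechet_derivative_at[OF assms(2)[OF that]] by simp
  qed
  then show ?thesis
    using assms(2) unfolding Ck_on.simps differentiable_def by blast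
qed

lemma Ck_on_Suc_has_derivative:
  "Ck_on (Suc k) f S \<Longrightarrow> x \<in> S \<Longrightarrow> (f has_derivative frechet_derivative f (at x)) (at x)"
  unfolding Ck_on.simps using frechet_derivative_works by blast

lemma Ck_on_const: "open S \<Longrightarrow> Ck_on k (\<lambda>x. c) S"
proof (induction k arbitrary: c)
  case (Suc k)
  show ?case
    by (rule Ck_on_SucI[where f' = "\<lambda>_ _. 0", OF Suc.prems]) (rule has_derivative_const Suc.IH Suc.prems)+
qed simp

lemma Ck_on_linear:
  assumes "bounded_linear L" "open S" "Ck_on k f S"
  shows "Ck_on k (\<lambda>x. L (f x)) S"
  using assms(3)
proof (induction k arbitrary: f)
  case 0
  then show ?case using bounded_linear.continuous_on[OF assms(1)] by simp
next
  case (Suc k)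
  show ?case
  proof (rule Ck_on_SucI[OF \<open>open S\<close>])
    show "((\<lambda>x. L (f x)) has_derivative (\<lambda>v. L (frechet_derivative f (at x) v))) (at x)" if "x \<in> S" for x
      using bounded_linear.has_derivative[OF assms(1) Ck_on_Suc_has_derivative[OF Suc.prems that]] .
    show "Ck_on k (\<lambda>x. L (frechet_derivative f (at x) v)) S" for v
      using Suc.prems by (intro Suc.IH) simp
  qed
qed

lemma Ck_on_add:
  assumes "open S" "Ck_on k f S" "Ck_on k g S"
  shows "Ck_on k (\<lambda>x. f x + g x) S"
  using assms(2,3)
proof (induction k arbitrary: f g)
  case 0
  then show ?case by (auto intro: continuous_on_add)
next
  case (Suc k)
  show ?case
  proof (rule Ck_on_SucI[OF \<open>open S\<close>])
    show "((\<lambda>x. f x + g x) has_derivative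
        (\<lambda>v. frechet_derivative f (at x) v + frechet_derivative g (at x) v)) (at x)" if "x \<in> S" for x
      using Ck_on_Suc_has_derivative[OF Suc.prems(1) that] Ck_on_Suc_has_derivative[OF Suc.prems(2) that]
      by (rule has_derivative_add)
    show "Ck_on k (\<lambda>x. frechet_derivative f (at x) v + frechet_derivative g (at x) v) S" for v
      using Suc.prems by (intro Suc.IH) simp_all
  qed
qed

lemma Ck_on_bilinear:
  assumes "bounded_bilinear P" "open S" "Ck_on k f S" "Ck_on k g S"
  shows "Ck_on k (\<lambda>x. P (f x) (g x)) S"
  using assms(3,4)
proof (induction k arbitrary: f g)
  case 0
  then show ?case using bounded_bilinear.continuous_on[OF assms(1)] by simp
next
  case (Suc k)
  show ?case
  proof (rule Ck_on_SucI[OF \<open>open S\<close>])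
    show "((\<lambda>x. P (f x) (g x)) has_derivative
        (\<lambda>v. P (f x) (frechet_derivative g (at x) v) + P (frechet_derivative f (at x) v) (g x))) (at x)"
      if "x \<in> S" for x
      using bounded_bilinear.FDERIV[OF assms(1) Ck_on_Suc_has_derivative[OF Suc.prems(1) that]
          Ck_on_Suc_has_derivative[OF Suc.prems(2) that]] .
    show "Ck_on k (\<lambda>x. P (f x) (frechet_derivative g (at x) v) + P (frechet_derivative f (at x) v) (g x)) S" for v
      using Suc.prems Ck_on_Suc_imp[OF Suc.prems(1)] Ck_on_Suc_imp[OF Suc.prems(2)]
      by (intro Ck_on_add[OF \<open>open S\<close>] Suc.IH) simp_all
  qed
qed

lemma Ck_on_sum:
  assumes "open S" "\<And>i. i \<in> I \<Longrightarrow> Ck_on k (f i) S"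
  shows "Ck_on k (\<lambda>x. \<Sum>i\<in>I. f i x) S"
  using assms(2) by (induction I rule: infinite_finite_induct) (auto intro: Ck_on_const Ck_on_add assms(1))

text \<open>\<open>Ck_on\<close> controls derivatives in a fixed direction only, whereas the chain
  rule differentiates \<open>g\<close> in a direction that moves with \<open>x\<close>. Expanding
  this direction in \<open>Basis\<close> leaves fixed directions with coefficients of class Ck;
  hence the Euclidean type of the middle space.\<close>

lemma Ck_on_compose:
  fixes g :: "'b::euclidean_space \<Rightarrow> 'c::real_normed_vector"
  assumes "open S" "Ck_on k f S" "Ck_on k g T" "f ` S \<subseteq> T"
  shows "Ck_on k (\<lambda>x. g (f x)) S"
  using assms(2,3)
proof (induction k arbitrary: g)
  case 0
  then show ?case using assms(4) by (auto intro: continuous_on_compose2)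
next
  case (Suc k)
  let ?f' = "\<lambda>x. frechet_derivative f (at x)" and ?g' = "\<lambda>x. frechet_derivative g (at x)"
  show ?case
  proof (rule Ck_on_SucI[OF \<open>open S\<close>])
    fix x assume x: "x \<in> S"
    have g': "(g has_derivative ?g' (f x)) (at (f x))"
      using x assms(4) by (intro Ck_on_Suc_has_derivative[OF Suc.prems(2)]) auto
    then have lin: "linear (?g' (f x))" by (rule has_derivative_linear)
    have "?g' (f x) v = (\<Sum>i\<in>Basis. (v \<bullet> i) *\<^sub>R ?g' (f x) i)" for v
    proof -
      have "?g' (f x) v = ?g' (f x) (\<Sum>i\<in>Basis. (v \<bullet> i) *\<^sub>R i)"
        by (simp only: euclidean_representation)
      also have "\<dots> = (\<Sum>i\<in>Basis. (v \<bullet> i) *\<^sub>R ?g' (f x) i)"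
        by (simp only: linear_sum[OF lin] linear_scale[OF lin])
      finally show ?thesis .
    qed
    then have "?g' (f x) = (\<lambda>v. \<Sum>i\<in>Basis. (v \<bullet> i) *\<^sub>R ?g' (f x) i)" by (rule ext)
    with g' have "(g has_derivative (\<lambda>v. \<Sum>i\<in>Basis. (v \<bullet> i) *\<^sub>R ?g' (f x) i)) (at (f x))"
      by (rule subst[rotated])
    from has_derivative_compose[OF Ck_on_Suc_has_derivative[OF Suc.prems(1) x] this]
    show "((\<lambda>x. g (f x)) has_derivative (\<lambda>v. \<Sum>i\<in>Basis. (?f' x v \<bullet> i) *\<^sub>R ?g' (f x) i)) (at x)" .
  next
    fix v
    have "Ck_on k (\<lambda>x. ?g' (f x) i) S" for i
      using Suc.IH[OF Ck_on_Suc_imp[OF Suc.prems(1)], of "\<lambda>y. ?g' y i"] Suc.prems(2) by simp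
    moreover have "Ck_on k (\<lambda>x. ?f' x v \<bullet> i) S" for i
      using Suc.prems(1) by (intro Ck_on_linear[OF bounded_linear_inner_left \<open>open S\<close>]) simp
    ultimately show "Ck_on k (\<lambda>x. \<Sum>i\<in>Basis. (?f' x v \<bullet> i) *\<^sub>R ?g' (f x) i) S"
      by (intro Ck_on_sum[OF \<open>open S\<close>] Ck_on_bilinear[OF bounded_bilinear_scaleR \<open>open S\<close>])
  qed
qed

lemma Ck_on_id: "open S \<Longrightarrow> Ck_on k (\<lambda>x. x) S"
proof (cases k)
  case (Suc j)
  then show "open S \<Longrightarrow> Ck_on k (\<lambda>x. x) S"
    using Ck_on_SucI[of S "\<lambda>x. x" "\<lambda>_ v. v" j] Ck_on_const[of S j] has_derivative_ident by blast
qed simp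

lemma Ck_on_inverse: "Ck_on k inverse (- {0 :: real})"
proof (induction k)
  case 0
  then show ?case by (auto intro!: continuous_intros)
next
  case (Suc k)
  have o: "open (- {0 :: real})" by (simp add: open_Compl)
  show ?case
  proof (rule Ck_on_SucI[OF o])
    show "(inverse has_derivative (\<lambda>v. (- v) * (inverse x * inverse x))) (at x)" if "x \<in> - {0}" for x :: real
      using that by (auto intro!: derivative_eq_intros)
    show "Ck_on k (\<lambda>x. (- v) * (inverse x * inverse x)) (- {0})" for v :: real
      by (intro Ck_on_bilinear[OF bounded_bilinear_mult o] Ck_on_const[OF o] Suc)
  qed
qed

lemma Ck_on_sqrt: "Ck_on k sqrt {0<..}"
proof (induction k)
  case 0
  then show ?case by (auto intro!: continuous_intros)
next
  case (Suc k)
  have o: "open {0 :: real <..}" by simp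
  show ?case
  proof (rule Ck_on_SucI[OF o])
    show "(sqrt has_derivative (\<lambda>v. (v / 2) * inverse (sqrt x))) (at x)" if "x \<in> {0<..}" for x :: real
      using that by (auto intro!: derivative_eq_intros simp: field_simps)
    show "Ck_on k (\<lambda>x. (v / 2) * inverse (sqrt x)) {0<..}" for v :: real
      by (intro Ck_on_bilinear[OF bounded_bilinear_mult o] Ck_on_const[OF o]
          Ck_on_compose[OF o Suc Ck_on_inverse]) auto
  qed
qed

lemma Ck_on_Pair:
  assumes "open S" "Ck_on k f S" "Ck_on k g S"
  shows "Ck_on k (\<lambda>x. (f x, g x)) S"
proof -
  have "Ck_on k (\<lambda>x. (f x, 0) + (0, g x)) S"
    using assms by (intro Ck_on_add Ck_on_linear[where L="\<lambda>x. (x,0)"] Ck_on_linear[where L="\<lambda>x. (0,x)"])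
      (auto intro: bounded_linear_Pair bounded_linear_zero bounded_linear_ident)
  then show ?thesis by simp
qed

text \<open>Differentiating an integral or a series with parameters yields partial derivatives only.
  Continuity of \<open>fy\<close> is enough to assemble them into the total derivative, so
  regularity of the partial derivatives lifts by one order.\<close>

lemma Ck_on_partialsI:
  fixes f :: "real \<times> real \<Rightarrow> real"
  assumes "open S"
    and x: "\<And>x y. (x, y) \<in> S \<Longrightarrow> ((\<lambda>s. f (s, y)) has_field_derivative fx (x, y)) (at x)"
    and y: "\<And>x y. (x, y) \<in> S \<Longrightarrow> ((\<lambda>s. f (x, s)) has_field_derivative fy (x, y)) (at y)"
    and "Ck_on k fx S" "Ck_on k fy S"
  shows "Ck_on (Suc k) f S"
proof (rule Ck_on_SucI[OF \<open>open S\<close>])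
  show "Ck_on k (\<lambda>z. fst v * fx z + snd v * fy z) S" for v
    using assms by (intro Ck_on_add Ck_on_bilinear[OF bounded_bilinear_mult] Ck_on_const)
  have cont: "continuous_on S fy"
    by (rule Ck_on_imp_continuous) fact
  fix z assume "z \<in> S"
  then obtain a b where z: "z = (a, b)" "(a, b) \<in> S" by (cases z) auto
  obtain U V where UV: "open U" "open V" "a \<in> U" "b \<in> V" "U \<times> V \<subseteq> S"
    using \<open>open S\<close> z(2) by (auto elim!: open_prod_elim)
  obtain e where e: "e > 0" "ball b e \<subseteq> V" using UV by (meson open_contains_ball)
  have "((\<lambda>(x, y). f (x, y)) has_derivative
      (\<lambda>(tx, ty). fx (a, b) * tx + blinfun_apply (blinfun_mult_right (fy (a, b))) ty))
      (at (a, b) within U \<times> ball b e)"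
  proof (rule has_derivative_partialsI[where fy = "\<lambda>x y. blinfun_mult_right (fy (x, y))"])
    show "((\<lambda>x. f (x, b)) has_derivative (*) (fx (a, b))) (at a within U)"
      using x[OF z(2)] by (auto simp: has_field_derivative_def intro: has_derivative_at_withinI)
    show "((\<lambda>y. f (x, y)) has_derivative blinfun_apply (blinfun_mult_right (fy (x, y)))) (at y within ball b e)"
      if "x \<in> U" "y \<in> ball b e" for x y
    proof -
      have "(x, y) \<in> S" using that UV e by auto
      from y[OF this] show ?thesis
        by (auto simp: has_field_derivative_def intro: has_derivative_at_withinI)
    qed
    have "(fy \<longlongrightarrow> fy (a, b)) (at (a, b) within U \<times> ball b e)"
    proof -
      have "isCont fy (a, b)" using cont z(2) \<open>open S\<close> by (simp add: continuous_on_eq_continuous_at)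
      then show ?thesis unfolding isCont_def by (rule tendsto_within_subset) simp
    qed
    then show "continuous (at (a, b) within U \<times> ball b e) (\<lambda>(x, y). blinfun_mult_right (fy (x, y)))"
      unfolding case_prod_beta' prod.collapse continuous_within
      by (rule bounded_linear.tendsto[OF bounded_linear_blinfun_mult_right])
  qed (use e in auto)
  moreover have "open (U \<times> ball b e)" "(a, b) \<in> U \<times> ball b e" using UV e by (auto simp: open_Times)
  ultimately have "((\<lambda>(x, y). f (x, y)) has_derivative
      (\<lambda>(tx, ty). fx (a, b) * tx + blinfun_apply (blinfun_mult_right (fy (a, b))) ty)) (at (a, b))"
    using at_within_open by metis
  then show "(f has_derivative (\<lambda>v. fst v * fx z + snd v * fy z)) (at z)"
    by (simp add: z case_prod_beta' mult.commute)
qed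

section \<open>Germs of smooth maps\<close>

definition smooth_germ :: "('a::real_normed_vector \<Rightarrow> 'b::real_normed_vector) \<Rightarrow> 'a \<Rightarrow> bool" where
  "smooth_germ f a \<longleftrightarrow> (\<exists>U. open U \<and> a \<in> U \<and> smooth_on f U)"

lemma smooth_germI: "open U \<Longrightarrow> a \<in> U \<Longrightarrow> (\<And>k. Ck_on k f U) \<Longrightarrow> smooth_germ f a"
  unfolding smooth_germ_def smooth_on_def by blast

lemma smooth_germE:
  assumes "smooth_germ f a"
  obtains U where "open U" "a \<in> U" "\<And>k. Ck_on k f U"
  using assms unfolding smooth_germ_def smooth_on_def by blast

lemma smooth_germ_UNIV: "smooth_on f UNIV \<Longrightarrow> smooth_germ f a"
  unfolding smooth_germ_def by blast

lemma smooth_germ_combine: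
  assumes "smooth_germ f a" "smooth_germ g a"
    and "\<And>S k. open S \<Longrightarrow> Ck_on k f S \<Longrightarrow> Ck_on k g S \<Longrightarrow> Ck_on k h S"
  shows "smooth_germ h a"
proof -
  obtain U where U: "open U" "a \<in> U" "\<And>k. Ck_on k f U" using assms(1) by (rule smooth_germE) blast
  obtain V where V: "open V" "a \<in> V" "\<And>k. Ck_on k g V" using assms(2) by (rule smooth_germE) blast
  show ?thesis
  proof (rule smooth_germI)
    show "open (U \<inter> V)" "a \<in> U \<inter> V" using U V by auto
    show "Ck_on k h (U \<inter> V)" for k
      by (rule assms(3)) (use U V in \<open>auto intro: Ck_on_subset\<close>)
  qed
qed

lemma smooth_germ_cong:
  assumes "smooth_germ f a" "\<forall>\<^sub>F x in nhds a. f x = g x"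
  shows "smooth_germ g a"
proof -
  obtain U where U: "open U" "a \<in> U" "\<And>k. Ck_on k f U" using assms(1) by (rule smooth_germE) blast
  obtain V where V: "open V" "a \<in> V" "\<And>x. x \<in> V \<Longrightarrow> f x = g x" using assms(2) unfolding eventually_nhds by blast
  show ?thesis
  proof (rule smooth_germI)
    show o: "open (U \<inter> V)" "a \<in> U \<inter> V" using U V by auto
    show "Ck_on k g (U \<inter> V)" for k
      by (rule iffD1[OF Ck_on_cong[OF o(1)] Ck_on_subset[OF U(3)]]) (use V in auto)
  qed
qed

lemma smooth_germ_eventually: "smooth_germ f a \<Longrightarrow> \<forall>\<^sub>F x in nhds a. smooth_germ f x"
  unfolding smooth_germ_def eventually_nhds by blast

lemma smooth_germ_isCont: 
  assumes "smooth_germ f a" shows "isCont f a"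
proof -
  obtain U where U: "open U" "a \<in> U" "\<And>k. Ck_on k f U" using assms(1) by (rule smooth_germE) blast
  then show ?thesis using Ck_on_imp_continuous[OF U(3)] by (simp add: continuous_on_eq_continuous_at)
qed

lemma smooth_germ_derivative:
  assumes "smooth_germ f a" shows "(f has_derivative frechet_derivative f (at a)) (at a)"
proof -
  obtain U where U: "open U" "a \<in> U" "\<And>k. Ck_on k f U" using assms(1) by (rule smooth_germE) blast
  show ?thesis by (rule Ck_on_Suc_has_derivative[OF U(3,2)])
qed

lemma smooth_germ_frechet:
  assumes "smooth_germ f a" shows "smooth_germ (\<lambda>x. frechet_derivative f (at x) v) a"
proof -
  obtain U where U: "open U" "a \<in> U" "\<And>k. Ck_on k f U" using assms(1) by (rule smooth_germE) blast
  have "Ck_on k (\<lambda>x. frechet_derivative f (at x) v) U" for k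
    using U(3)[of "Suc k"] unfolding Ck_on.simps by blast
  then show ?thesis by (rule smooth_germI[OF U(1,2)])
qed

lemma smooth_germ_const: "smooth_germ (\<lambda>x. c) a"
  by (rule smooth_germI[of UNIV]) (auto intro: Ck_on_const)

lemma smooth_germ_id: "smooth_germ (\<lambda>x. x) a"
  by (rule smooth_germI[of UNIV]) (auto intro: Ck_on_id)

lemma smooth_germ_linear: "bounded_linear L \<Longrightarrow> smooth_germ f a \<Longrightarrow> smooth_germ (\<lambda>x. L (f x)) a"
  by (rule smooth_germ_combine[of f a f]) (auto intro: Ck_on_linear)

lemma smooth_germ_add: "smooth_germ f a \<Longrightarrow> smooth_germ g a \<Longrightarrow> smooth_germ (\<lambda>x. f x + g x) a"
  by (rule smooth_germ_combine[of f a g]) (simp_all only: Ck_on_add)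

lemma smooth_germ_Pair: "smooth_germ f a \<Longrightarrow> smooth_germ g a \<Longrightarrow> smooth_germ (\<lambda>x. (f x, g x)) a"
  by (rule smooth_germ_combine[of f a g]) (simp_all only: Ck_on_Pair)

lemma smooth_germ_bilinear:
  "bounded_bilinear P \<Longrightarrow> smooth_germ f a \<Longrightarrow> smooth_germ g a \<Longrightarrow> smooth_germ (\<lambda>x. P (f x) (g x)) a"
  by (rule smooth_germ_combine[of f a g]) (simp_all only: Ck_on_bilinear)

lemma smooth_germ_mult:
  fixes f g :: "_ \<Rightarrow> real"
  shows "smooth_germ f a \<Longrightarrow> smooth_germ g a \<Longrightarrow> smooth_germ (\<lambda>x. f x * g x) a"
  by (rule smooth_germ_bilinear[OF bounded_bilinear_mult])

lemma smooth_germ_minus: "smooth_germ f a \<Longrightarrow> smooth_germ (\<lambda>x. - f x) a"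
  by (rule smooth_germ_linear[OF bounded_linear_minus[OF bounded_linear_ident]])

lemma smooth_germ_diff: "smooth_germ f a \<Longrightarrow> smooth_germ g a \<Longrightarrow> smooth_germ (\<lambda>x. f x - g x) a"
  using smooth_germ_add[OF _ smooth_germ_minus, of f a g] by simp

lemma smooth_germ_fst: "smooth_germ f a \<Longrightarrow> smooth_germ (\<lambda>x. fst (f x)) a"
  by (rule smooth_germ_linear[OF bounded_linear_fst])

lemma smooth_germ_snd: "smooth_germ f a \<Longrightarrow> smooth_germ (\<lambda>x. snd (f x)) a"
  by (rule smooth_germ_linear[OF bounded_linear_snd])

lemma smooth_germ_power:
  fixes f :: "_ \<Rightarrow> real"
  shows "smooth_germ f a \<Longrightarrow> smooth_germ (\<lambda>x. f x ^ n) a"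
  by (induction n) (auto intro: smooth_germ_const smooth_germ_mult)

lemma smooth_germ_compose:
  fixes g :: "'b::euclidean_space \<Rightarrow> 'c::real_normed_vector"
  assumes "smooth_germ g (f a)" "smooth_germ f a"
  shows "smooth_germ (\<lambda>x. g (f x)) a"
proof -
  obtain U where U: "open U" "a \<in> U" "\<And>k. Ck_on k f U" using assms(2) by (rule smooth_germE) blast
  obtain V where V: "open V" "f a \<in> V" "\<And>k. Ck_on k g V" using assms(1) by (rule smooth_germE) blast
  show ?thesis
  proof (rule smooth_germI)
    show o: "open (U \<inter> f -` V)"
      by (rule continuous_open_preimage[OF Ck_on_imp_continuous[OF U(3)] U(1) V(1)])
    show "a \<in> U \<inter> f -` V" using U V by auto
    show "Ck_on k (\<lambda>x. g (f x)) (U \<inter> f -` V)" for k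
      by (rule Ck_on_compose[OF o Ck_on_subset[OF U(3)] V(3)]) auto
  qed
qed

lemma smooth_germ_inverse:
  fixes f :: "_ \<Rightarrow> real"
  assumes "smooth_germ f a" "f a \<noteq> 0"
  shows "smooth_germ (\<lambda>x. inverse (f x)) a"
proof -
  have "smooth_germ inverse (f a)"
    by (rule smooth_germI[OF _ _ Ck_on_inverse]) (auto simp: open_Compl assms(2))
  from smooth_germ_compose[OF this assms(1)] show ?thesis .
qed

lemma smooth_germ_divide:
  fixes f g :: "_ \<Rightarrow> real"
  shows "smooth_germ f a \<Longrightarrow> smooth_germ g a \<Longrightarrow> g a \<noteq> 0 \<Longrightarrow> smooth_germ (\<lambda>x. f x / g x) a"
  unfolding divide_inverse by (intro smooth_germ_mult smooth_germ_inverse)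

lemma smooth_germ_sqrt:
  assumes "smooth_germ f a" "f a > 0"
  shows "smooth_germ (\<lambda>x. sqrt (f x)) a"
proof -
  have "smooth_germ sqrt (f a)"
    by (rule smooth_germI[OF _ _ Ck_on_sqrt]) (auto simp: assms(2))
  from smooth_germ_compose[OF this assms(1)] show ?thesis .
qed

lemma smooth_germ_abs:
  fixes f :: "_ \<Rightarrow> real"
  assumes "smooth_germ f a" "f a \<noteq> 0"
  shows "smooth_germ (\<lambda>x. \<bar>f x\<bar>) a"
proof -
  have c: "(f \<longlongrightarrow> f a) (nhds a)" using smooth_germ_isCont[OF assms(1)] by (simp add: continuous_at tendsto_nhds_iff)
  have "\<forall>\<^sub>F x in nhds a. sgn (f a) * f x = \<bar>f x\<bar>"
  proof (cases "f a > 0")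
    case True
    then show ?thesis using order_tendstoD(1)[OF c True] by (auto elim!: eventually_mono)
  next
    case False
    then have "f a < 0" using assms by simp
    then show ?thesis using order_tendstoD(2)[OF c, of 0] by (auto elim!: eventually_mono)
  qed
  then show ?thesis by (rule smooth_germ_cong[rotated]) (intro smooth_germ_mult smooth_germ_const assms(1))
qed

lemmas smooth_germ_intros = smooth_germ_const smooth_germ_id smooth_germ_add smooth_germ_mult
  smooth_germ_minus smooth_germ_diff smooth_germ_fst smooth_germ_snd smooth_germ_power
  smooth_germ_Pair smooth_germ_divide smooth_germ_sqrt smooth_germ_abs

section \<open>Partial derivatives of maps on the plane\<close>

definition px :: "(real \<times> real \<Rightarrow> 'b::real_normed_vector) \<Rightarrow> real \<times> real \<Rightarrow> 'b" where
  "px F z = frechet_derivative F (at z) (1, 0)"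

definition py :: "(real \<times> real \<Rightarrow> 'b::real_normed_vector) \<Rightarrow> real \<times> real \<Rightarrow> 'b" where
  "py F z = frechet_derivative F (at z) (0, 1)"

lemma smooth_germ_px: "smooth_germ F z \<Longrightarrow> smooth_germ (px F) z"
  unfolding px_def[abs_def] by (rule smooth_germ_frechet)

lemma smooth_germ_py: "smooth_germ F z \<Longrightarrow> smooth_germ (py F) z"
  unfolding py_def[abs_def] by (rule smooth_germ_frechet)

lemma has_derivative_plane:
  assumes "(F has_derivative D) (at (z :: real \<times> real))"
  shows "D = (\<lambda>v. fst v *\<^sub>R px F z + snd v *\<^sub>R py F z)"
proof
  fix v
  have lin: "linear D" using assms by (rule has_derivative_linear)
  have D: "D = frechet_derivative F (at z)" by (rule frechet_derivative_at[OF assms])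
  have "D v = D (fst v *\<^sub>R (1, 0) + snd v *\<^sub>R (0, 1))" by (cases v) simp
  also have "\<dots> = fst v *\<^sub>R D (1, 0) + snd v *\<^sub>R D (0, 1)"
    by (simp only: linear_add[OF lin] linear_scale[OF lin])
  finally show "D v = fst v *\<^sub>R px F z + snd v *\<^sub>R py F z" by (simp only: px_def py_def D)
qed

lemma has_derivative_px_py:
  assumes "(F has_derivative D) (at (z :: real \<times> real))"
  shows "px F z = D (1, 0)" "py F z = D (0, 1)"
  unfolding px_def py_def frechet_derivative_at[OF assms, symmetric] by simp_all

lemma smooth_germ_plane:
  assumes "smooth_germ F z"
  shows "(F has_derivative (\<lambda>v. fst v *\<^sub>R px F z + snd v *\<^sub>R py F z)) (at z)"
  using smooth_germ_derivative[OF assms] has_derivative_plane[OF smooth_germ_derivative[OF assms]] by simp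

lemma has_derivative_along_x:
  assumes "(F has_derivative D) (at (x, y))"
  shows "((\<lambda>s. F (s, y)) has_derivative (\<lambda>s. D (s, 0))) (at x)"
  by (rule has_derivative_compose[of "\<lambda>s. (s, y)" "\<lambda>s. (s, 0)", OF _ assms]) (auto intro!: derivative_eq_intros)

lemma has_derivative_along_y:
  assumes "(F has_derivative D) (at (x, y))"
  shows "((\<lambda>s. F (x, s)) has_derivative (\<lambda>s. D (0, s))) (at y)"
  by (rule has_derivative_compose[of "\<lambda>s. (x, s)" "\<lambda>s. (0, s)", OF _ assms]) (auto intro!: derivative_eq_intros)

lemma smooth_germ_DERIV_x:
  fixes F :: "real \<times> real \<Rightarrow> real"
  assumes "smooth_germ F (x, y)"
  shows "((\<lambda>s. F (s, y)) has_field_derivative px F (x, y)) (at x)"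
proof -
  have "(\<lambda>s. fst (s, 0) *\<^sub>R px F (x, y) + snd (s, 0) *\<^sub>R py F (x, y)) = (*) (px F (x, y))"
    by (rule ext) simp
  from has_derivative_along_x[OF smooth_germ_plane[OF assms], unfolded this]
  show ?thesis unfolding has_field_derivative_def .
qed

lemma smooth_germ_DERIV_y:
  fixes F :: "real \<times> real \<Rightarrow> real"
  assumes "smooth_germ F (x, y)"
  shows "((\<lambda>s. F (x, s)) has_field_derivative py F (x, y)) (at y)"
proof -
  have "(\<lambda>s. fst (0, s) *\<^sub>R px F (x, y) + snd (0, s) *\<^sub>R py F (x, y)) = (*) (py F (x, y))"
    by (rule ext) simp
  from has_derivative_along_y[OF smooth_germ_plane[OF assms], unfolded this]
  show ?thesis unfolding has_field_derivative_def .
qed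

lemma Ck_on_imp_smooth_germ: "(\<And>k. Ck_on k f S) \<Longrightarrow> open S \<Longrightarrow> a \<in> S \<Longrightarrow> smooth_germ f a"
  by (rule smooth_germI[of S])

lemma Ck_on_px: "Ck_on (Suc k) F S \<Longrightarrow> Ck_on k (px F) S"
  and Ck_on_py: "Ck_on (Suc k) F S \<Longrightarrow> Ck_on k (py F) S"
  unfolding px_def[abs_def] py_def[abs_def] Ck_on.simps by blast+

section \<open>Smooth parameter integrals and Hadamard's lemma\<close>

definition box2 :: "real \<Rightarrow> (real \<times> real) set" where
  "box2 r = {-r<..<r} \<times> {-r<..<r}"

lemma open_box2 [simp]: "open (box2 r)"
  unfolding box2_def by (intro open_Times) auto

lemma mem_box2: "(x, y) \<in> box2 r \<longleftrightarrow> \<bar>x\<bar> < r \<and> \<bar>y\<bar> < r"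
  unfolding box2_def by auto

lemma open_contains_box2:
  assumes "open U" "(0, 0) \<in> U"
  obtains r where "r > 0" "box2 r \<subseteq> U"
proof -
  obtain A B where AB: "open A" "open B" "0 \<in> A" "0 \<in> B" "A \<times> B \<subseteq> U"
    using assms by (auto elim!: open_prod_elim)
  obtain a where a: "a > 0" "ball 0 a \<subseteq> A" using AB by (meson open_contains_ball)
  obtain b where b: "b > 0" "ball 0 b \<subseteq> B" using AB by (meson open_contains_ball)
  have "box2 (min a b) \<subseteq> ball 0 a \<times> ball 0 b"
    unfolding box2_def by (auto simp: dist_real_def)
  also have "\<dots> \<subseteq> U" using a b AB by auto
  finally show ?thesis using that[of "min a b"] a b by auto
qed

lemma smooth_germ_box2:
  assumes "smooth_germ f (0 :: real \<times> real)"
  obtains r where "r > 0" "\<And>k. Ck_on k f (box2 r)"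
proof -
  obtain U where U: "open U" "(0,0) \<in> U" "\<And>k. Ck_on k f U"
    using assms unfolding zero_prod_def by (rule smooth_germE) blast
  obtain r where r: "r > 0" "box2 r \<subseteq> U" by (rule open_contains_box2[OF U(1,2)])
  show ?thesis by (rule that[OF r(1) Ck_on_subset[OF U(3) r(2)]])
qed

lemma shrink_box2: "(x, y) \<in> box2 r \<Longrightarrow> 0 \<le> s \<Longrightarrow> s \<le> 1 \<Longrightarrow> (x, s * y) \<in> box2 r"
  unfolding mem_box2 abs_mult
  by (metis abs_ge_zero abs_of_nonneg mult_left_le_one_le order_le_less_trans)

lemma continuous_on_box2_param:
  assumes "continuous_on (box2 r) (H :: _ \<Rightarrow> real)"
  shows "continuous_on (box2 r \<times> {0..1}) (\<lambda>(z, s). s ^ j * H (fst z, s * snd z))"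
  unfolding case_prod_beta
  by (intro continuous_intros continuous_on_compose2[OF assms]) (auto intro: shrink_box2)

text \<open>The weight \<open>s ^ j\<close> is there for the induction: every derivative in the
  second variable brings out one more factor \<open>s\<close>.\<close>

lemma Ck_on_integral_box2:
  fixes H :: "real \<times> real \<Rightarrow> real"
  assumes "\<And>k. Ck_on k H (box2 r)"
  shows "Ck_on k (\<lambda>z. integral {0..1} (\<lambda>s. s ^ j * H (fst z, s * snd z))) (box2 r)"
  using assms
proof (induction k arbitrary: H j)
  case 0
  show ?case
    using integral_continuous_on_param[of "box2 r" 0 1 "\<lambda>z s. s ^ j * H (fst z, s * snd z)"]
      continuous_on_box2_param[OF Ck_on_imp_continuous[OF "0"], of j] by simp
next
  case (Suc k)
  have sm: "smooth_germ H z" if "z \<in> box2 r" for z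
    using Ck_on_imp_smooth_germ[OF Suc.prems] that by simp
  have cH: "continuous_on (box2 r) H" "continuous_on (box2 r) (px H)" "continuous_on (box2 r) (py H)"
    using Ck_on_imp_continuous Suc.prems Ck_on_px Ck_on_py by blast+
  have int: "(\<lambda>s. s ^ j * H (x, s * y)) integrable_on {0..1}" if "(x, y) \<in> box2 r" for x y
    using that by (intro integrable_continuous_real continuous_intros continuous_on_compose2[OF cH(1)])
      (auto intro: shrink_box2)
  show ?case
  proof (rule Ck_on_partialsI[OF open_box2])
    show "Ck_on k (\<lambda>z. integral {0..1} (\<lambda>s. s ^ j * px H (fst z, s * snd z))) (box2 r)"
      by (rule Suc.IH) (rule Ck_on_px[OF Suc.prems])
    show "Ck_on k (\<lambda>z. integral {0..1} (\<lambda>s. s ^ Suc j * py H (fst z, s * snd z))) (box2 r)"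
      by (rule Suc.IH) (rule Ck_on_py[OF Suc.prems])
  next
    fix x y assume xy: "(x, y) \<in> box2 r"
    have "((\<lambda>x. integral (cbox 0 1) (\<lambda>s. s ^ j * H (x, s * y))) has_field_derivative
        integral (cbox 0 1) (\<lambda>s. s ^ j * px H (x, s * y))) (at x within {-r<..<r})"
    proof (rule leibniz_rule_field_derivative)
      fix u t assume ut: "u \<in> {-r<..<r}" "t \<in> cbox 0 (1::real)"
      have "(u, t * y) \<in> box2 r" using xy ut by (intro shrink_box2) (auto simp: box2_def)
      from smooth_germ_DERIV_x[OF sm[OF this]]
      show "((\<lambda>x. t ^ j * H (x, t * y)) has_real_derivative t ^ j * px H (u, t * y)) (at u within {-r<..<r})"
        by (intro DERIV_cmult) (rule has_field_derivative_at_within)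
    next
      show "(\<lambda>s. s ^ j * H (u, s * y)) integrable_on cbox 0 1" if "u \<in> {-r<..<r}" for u
        using int[of u y] that xy by (auto simp: box2_def)
      have "continuous_on ({-r<..<r} \<times> {0..1}) ((\<lambda>(z, s). s ^ j * px H (fst z, s * snd z)) \<circ> (\<lambda>(u, t). ((u, y), t)))"
      proof (rule continuous_on_compose)
        show "continuous_on ({-r<..<r} \<times> {0..1}) (\<lambda>(u, t). ((u, y), t))"
          unfolding case_prod_beta by (intro continuous_intros)
        show "continuous_on ((\<lambda>(u, t). ((u, y), t)) ` ({-r<..<r} \<times> {0..1})) (\<lambda>(z, s). s ^ j * px H (fst z, s * snd z))"
          by (rule continuous_on_subset[OF continuous_on_box2_param[OF cH(2)]]) (use xy in \<open>auto simp: box2_def\<close>)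
      qed
      then show "continuous_on ({-r<..<r} \<times> cbox 0 1) (\<lambda>(u, t). t ^ j * px H (u, t * y))"
        by (simp add: o_def case_prod_beta)
    qed (use xy in \<open>auto simp: box2_def\<close>)
    then show "((\<lambda>s. integral {0..1} (\<lambda>sa. sa ^ j * H (fst (s, y), sa * snd (s, y)))) has_field_derivative
        integral {0..1} (\<lambda>s. s ^ j * px H (fst (x, y), s * snd (x, y)))) (at x)"
      using xy by (simp add: at_within_open[of x "{-r<..<r}"] box2_def)
    have "((\<lambda>y. integral (cbox 0 1) (\<lambda>s. s ^ j * H (x, s * y))) has_field_derivative
        integral (cbox 0 1) (\<lambda>s. s ^ Suc j * py H (x, s * y))) (at y within {-r<..<r})"
    proof (rule leibniz_rule_field_derivative)
      fix u t assume ut: "u \<in> {-r<..<r}" "t \<in> cbox 0 (1::real)"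
      have "(x, t * u) \<in> box2 r" using xy ut by (intro shrink_box2) (auto simp: box2_def)
      have "((\<lambda>y. t ^ j * H (x, t * y)) has_real_derivative t ^ j * (py H (x, t * u) * t)) (at u within {-r<..<r})"
        by (intro DERIV_cmult DERIV_chain2[where f = "\<lambda>s. H (x, s)" and g = "\<lambda>y. t * y"]
            smooth_germ_DERIV_y[OF sm[OF \<open>(x, t * u) \<in> box2 r\<close>]] DERIV_cmult_Id)
      then show "((\<lambda>y. t ^ j * H (x, t * y)) has_real_derivative t ^ Suc j * py H (x, t * u)) (at u within {-r<..<r})"
        by (simp only: power_Suc mult_ac)
    next
      show "(\<lambda>s. s ^ j * H (x, s * u)) integrable_on cbox 0 1" if "u \<in> {-r<..<r}" for u
        using int[of x u] that xy by (auto simp: box2_def)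
      have "continuous_on ({-r<..<r} \<times> {0..1}) ((\<lambda>(z, s). s ^ Suc j * py H (fst z, s * snd z)) \<circ> (\<lambda>(u, t). ((x, u), t)))"
      proof (rule continuous_on_compose)
        show "continuous_on ({-r<..<r} \<times> {0..1}) (\<lambda>(u, t). ((x, u), t))"
          unfolding case_prod_beta by (intro continuous_intros)
        show "continuous_on ((\<lambda>(u, t). ((x, u), t)) ` ({-r<..<r} \<times> {0..1})) (\<lambda>(z, s). s ^ Suc j * py H (fst z, s * snd z))"
          by (rule continuous_on_subset[OF continuous_on_box2_param[OF cH(3)]]) (use xy in \<open>auto simp: box2_def\<close>)
      qed
      then show "continuous_on ({-r<..<r} \<times> cbox 0 1) (\<lambda>(u, t). t ^ Suc j * py H (x, t * u))"
        by (simp add: o_def case_prod_beta)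
    qed (use xy in \<open>auto simp: box2_def\<close>)
    then show "((\<lambda>s. integral {0..1} (\<lambda>sa. sa ^ j * H (fst (x, s), sa * snd (x, s)))) has_field_derivative
        integral {0..1} (\<lambda>s. s ^ Suc j * py H (fst (x, y), s * snd (x, y)))) (at y)"
      using xy by (simp add: at_within_open[of y "{-r<..<r}"] box2_def)
  qed
qed

text \<open>The fundamental theorem of calculus on the segment from \<open>(x, 0)\<close> to
  \<open>(x, y)\<close>: the derivative of \<open>F (x, s * y)\<close> in \<open>s\<close> is
  \<open>y\<close> times the integrand of \<open>G\<close>.\<close>

lemma Hadamard_box2:
  fixes F :: "real \<times> real \<Rightarrow> real"
  assumes F: "\<And>k. Ck_on k F (box2 r)" and 0: "\<And>x. \<bar>x\<bar> < r \<Longrightarrow> F (x, 0) = 0"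
  defines "G \<equiv> \<lambda>z. integral {0..1} (\<lambda>s. py F (fst z, s * snd z))"
  shows "Ck_on k G (box2 r)" "z \<in> box2 r \<Longrightarrow> F z = snd z * G z"
proof -
  have "\<And>k. Ck_on k (py F) (box2 r)" using Ck_on_py[OF F] .
  from Ck_on_integral_box2[OF this, of k 0]
  show "Ck_on k G (box2 r)" by (simp add: G_def)
next
  assume zb: "z \<in> box2 r"
  obtain x y where z: "z = (x, y)" by (cases z)
  have xy: "(x, y) \<in> box2 r" using zb z by simp
  have sm: "smooth_germ F z" if "z \<in> box2 r" for z
    using Ck_on_imp_smooth_germ[OF F] that by simp
  have "((\<lambda>s. py F (x, s * y) * y) has_integral (F (x, 1 * y) - F (x, 0 * y))) {0..1}"
  proof (rule fundamental_theorem_of_calculus)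
    show "((\<lambda>s. F (x, s * y)) has_vector_derivative py F (x, s * y) * y) (at s within {0..1})"
      if "s \<in> {0..1}" for s
    proof -
      have "(x, s * y) \<in> box2 r" using that xy by (intro shrink_box2) auto
      then show ?thesis
        unfolding has_real_derivative_iff_has_vector_derivative[symmetric]
        by (intro DERIV_chain2[where f = "\<lambda>s. F (x, s)" and g = "\<lambda>s. s * y"] smooth_germ_DERIV_y sm)
          (auto intro!: derivative_eq_intros)
    qed
  qed simp
  then have "F (x, y) - F (x, 0) = integral {0..1} (\<lambda>s. py F (x, s * y) * y)"
    by (simp only: integral_unique mult_1 mult_zero_left)
  also have "\<dots> = integral {0..1} (\<lambda>s. py F (x, s * y)) * y"
    by (rule integral_mult_left)
  finally show "F z = snd z * G z" using 0[of x] xy by (simp add: z G_def mem_box2 mult.commute)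
qed

lemma eventually_nhds_box2:
  "r > 0 \<Longrightarrow> (\<And>z. z \<in> box2 r \<Longrightarrow> P z) \<Longrightarrow> \<forall>\<^sub>F z in nhds 0. P z"
  unfolding eventually_nhds by (intro exI[of _ "box2 r"]) (auto simp: zero_prod_def mem_box2)

lemma eventually_nhds_box2E:
  assumes "\<forall>\<^sub>F z in nhds (0 :: real \<times> real). P z"
  obtains r where "r > 0" "\<And>z. z \<in> box2 r \<Longrightarrow> P z"
proof -
  obtain U where U: "open U" "(0,0) \<in> U" "\<forall>z\<in>U. P z"
    using assms unfolding eventually_nhds zero_prod_def by blast
  obtain r where r: "r > 0" "box2 r \<subseteq> U" by (rule open_contains_box2[OF U(1,2)])
  show ?thesis by (rule that[OF r(1)]) (use r U in blast)
qed

lemma Hadamard: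
  fixes F :: "real \<times> real \<Rightarrow> real"
  assumes "smooth_germ F 0" "\<forall>\<^sub>F x in nhds 0. F (x, 0) = 0"
  obtains G where "smooth_germ G 0" "\<forall>\<^sub>F z in nhds 0. F z = snd z * G z"
proof -
  obtain r where r: "r > 0" "\<And>k. Ck_on k F (box2 r)" by (rule smooth_germ_box2[OF assms(1)]) blast
  obtain U where U: "open U" "0 \<in> U" "\<And>x. x \<in> U \<Longrightarrow> F (x, 0) = 0"
    using assms(2) unfolding eventually_nhds by blast
  obtain e where e: "e > 0" "ball 0 e \<subseteq> U" using U by (meson open_contains_ball)
  define d where "d = min r e"
  have d: "d > 0" "\<And>k. Ck_on k F (box2 d)" "\<And>x. \<bar>x\<bar> < d \<Longrightarrow> F (x, 0) = 0"
  proof -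
    show "d > 0" using r e by (simp add: d_def)
    show "Ck_on k F (box2 d)" for k by (rule Ck_on_subset[OF r(2)]) (auto simp: d_def box2_def)
    show "F (x, 0) = 0" if "\<bar>x\<bar> < d" for x using that e by (intro U(3)) (auto simp: d_def dist_real_def)
  qed
  note H = Hadamard_box2[OF d(2,3)]
  show ?thesis
  proof (rule that)
    show "smooth_germ (\<lambda>z. integral {0..1} (\<lambda>s. py F (fst z, s * snd z))) 0"
      by (rule Ck_on_imp_smooth_germ[OF H(1)]) (use d in \<open>auto simp: zero_prod_def mem_box2\<close>)
    show "\<forall>\<^sub>F z in nhds 0. F z = snd z * integral {0..1} (\<lambda>s. py F (fst z, s * snd z))"
      using eventually_nhds_box2[OF d(1) H(2)] .
  qed
qed

section \<open>Smooth inverses of plane germs\<close>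

lemma eventually_nhds_isCont:
  assumes "isCont h a" "\<forall>\<^sub>F y in nhds (h a). P y"
  shows "\<forall>\<^sub>F x in nhds a. P (h x)"
  by (rule eventually_compose_filterlim[OF assms(2)])
    (use assms(1) in \<open>simp add: isCont_def tendsto_at_iff_tendsto_nhds\<close>)

lemma has_derivative_cong_eventually:
  assumes "(f has_derivative D) (at a)" "\<forall>\<^sub>F x in nhds a. f x = g x"
  shows "(g has_derivative D) (at a)"
proof -
  obtain S where "open S" "a \<in> S" "\<And>x. x \<in> S \<Longrightarrow> f x = g x" using assms(2) unfolding eventually_nhds by blast
  then show ?thesis by (intro has_derivative_transform_within_open[OF assms(1)])
qed

text \<open>Cramer's rule in the form needed to write the derivative of an inverse map through the
  partial derivatives of the map.\<close>

lemma cramer_plane: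
  fixes a b c e :: real
  assumes "a * e - b * c \<noteq> 0"
  shows "(e * v - b * w) * inverse (a * e - b * c) * a + (a * w - c * v) * inverse (a * e - b * c) * b = v"
    and "(e * v - b * w) * inverse (a * e - b * c) * c + (a * w - c * v) * inverse (a * e - b * c) * e = w"
proof -
  have "(e * v - b * w) * i * a + (a * w - c * v) * i * b = v * ((a * e - b * c) * i)"
    and "(e * v - b * w) * i * c + (a * w - c * v) * i * e = w * ((a * e - b * c) * i)" for i
    by (simp_all add: algebra_simps)
  note this[of "inverse (a * e - b * c)"]
  then show "(e * v - b * w) * inverse (a * e - b * c) * a + (a * w - c * v) * inverse (a * e - b * c) * b = v"
    and "(e * v - b * w) * inverse (a * e - b * c) * c + (a * w - c * v) * inverse (a * e - b * c) * e = w"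
    by (simp_all only: right_inverse[OF assms] mult_1_right)
qed

text \<open>Bootstrapping: the inverse \<open>g\<close> is differentiable, and by Cramer's rule its
  derivative is a rational expression in the partial derivatives of \<open>f\<close> taken at
  \<open>g y\<close>. If \<open>g\<close> is of class Ck, so is this expression, and
  \<open>g\<close> gains one order.\<close>

lemma inverse_germ_plane:
  fixes f :: "real \<times> real \<Rightarrow> real \<times> real"
  assumes "smooth_germ f a" "(f has_derivative D) (at a)" "inj D"
  obtains g where "smooth_germ g (f a)" "\<forall>\<^sub>F z in nhds a. g (f z) = z" "\<forall>\<^sub>F y in nhds (f a). f (g y) = y"
proof -
  obtain U where U: "open U" "a \<in> U" "\<And>k. Ck_on k f U" using assms(1) by (rule smooth_germE) blast
  have sm: "smooth_germ f z" if "z \<in> U" for z by (rule Ck_on_imp_smooth_germ[OF U(3,1) that])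
  define M where "M z = Blinfun (frechet_derivative f (at z))" for z
  have M: "blinfun_apply (M z) = frechet_derivative f (at z)" if "z \<in> U" for z
    unfolding M_def
    by (rule bounded_linear_Blinfun_apply[OF has_derivative_bounded_linear[OF smooth_germ_derivative[OF sm[OF that]]]])
  have contM: "continuous_on U M"
  proof (rule continuous_on_blinfun_componentwise)
    fix i :: "real \<times> real"
    have "continuous_on U (\<lambda>x. frechet_derivative f (at x) i)"
      using U(3)[of "Suc 0"] unfolding Ck_on.simps by blast
    then show "continuous_on U (\<lambda>x. blinfun_apply (M x) i)"
      by (rule continuous_on_eq) (simp add: M)
  qed
  have DM: "D = blinfun_apply (M a)" unfolding M[OF U(2)] by (rule frechet_derivative_at[OF assms(2)])
  obtain L where L: "linear L" "L \<circ> D = id"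
    using linear_injective_left_inverse[OF has_derivative_linear[OF assms(2)] assms(3)] by blast
  have invL: "Blinfun L o\<^sub>L M a = id_blinfun"
  proof (rule blinfun_eqI)
    show "blinfun_apply (Blinfun L o\<^sub>L M a) i = blinfun_apply id_blinfun i" for i
      using fun_cong[OF L(2), of i] L(1)
      by (simp add: bounded_linear_Blinfun_apply linear_conv_bounded_linear DM)
  qed
  have derM: "(f has_derivative blinfun_apply (M x)) (at x)" if "x \<in> U" for x
    unfolding M[OF that] by (rule smooth_germ_derivative[OF sm[OF that]])
  obtain U' V g g' where V: "open U'" "U' \<subseteq> U" "a \<in> U'" "open V" "f a \<in> V"
    "homeomorphism U' V f g" "\<And>y. y \<in> V \<Longrightarrow> (g has_derivative (g' y)) (at y)"
    "\<And>y. y \<in> V \<Longrightarrow> g' y = inv (blinfun_apply (M (g y)))"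
    "\<And>y. y \<in> V \<Longrightarrow> bij (blinfun_apply (M (g y)))"
    by (rule inverse_function_theorem[OF U(1) derM contM U(2) invL]) (assumption | rule that)+
  have gV: "g ` V \<subseteq> U" using V(2,6) unfolding homeomorphism_def by blast
  define A where "A y = fst (px f (g y))" for y
  define B where "B y = fst (py f (g y))" for y
  define C where "C y = snd (px f (g y))" for y
  define E where "E y = snd (py f (g y))" for y
  have Mapp: "blinfun_apply (M (g y)) v = (fst v * A y + snd v * B y, fst v * C y + snd v * E y)" if "y \<in> V" for y v
  proof -
    have "g y \<in> U" using gV that by blast
    then show ?thesis
      using has_derivative_plane[OF smooth_germ_derivative[OF sm[OF \<open>g y \<in> U\<close>]]]
      by (simp add: M A_def B_def C_def E_def prod_eq_iff)
  qed
  have det: "A y * E y - B y * C y \<noteq> 0" if "y \<in> V" for y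
  proof
    \<comment> \<open>If the determinant vanished, \<open>(B y, - A y)\<close> and
      \<open>(E y, - C y)\<close> would lie in the kernel and hence be 0. All four entries would
      then vanish, and \<open>(1, 0)\<close> would be in the kernel as well.\<close>
    assume d: "A y * E y - B y * C y = 0"
    have inj: "v = 0" if "blinfun_apply (M (g y)) v = 0" for v
      using bij_is_inj[OF V(9)[OF \<open>y \<in> V\<close>]] that by (metis blinfun.zero_right injD)
    have "(B y, - A y) = 0"
      by (rule inj) (use d in \<open>simp add: Mapp[OF that] algebra_simps zero_prod_def\<close>)
    moreover have "(E y, - C y) = 0"
      by (rule inj) (use d in \<open>simp add: Mapp[OF that] algebra_simps zero_prod_def\<close>)
    ultimately have "blinfun_apply (M (g y)) (1, 0) = 0"
      by (simp add: Mapp[OF that] zero_prod_def)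
    from inj[OF this] show False by (simp add: zero_prod_def)
  qed
  have g'eq: "g' y v = ((E y * fst v - B y * snd v) * inverse (A y * E y - B y * C y),
      (A y * snd v - C y * fst v) * inverse (A y * E y - B y * C y))" (is "_ = ?w") if "y \<in> V" for y v
  proof -
    have "blinfun_apply (M (g y)) ?w = v"
      using cramer_plane[OF det[OF that], of "fst v" "snd v"] by (simp add: Mapp[OF that] prod_eq_iff)
    then show ?thesis unfolding V(8)[OF that] using bij_is_inj[OF V(9)[OF that]] by (metis inv_f_eq)
  qed
  have Ckg: "Ck_on k g V" for k
  proof (induction k)
    case 0
    then show ?case using V(6) by (simp add: homeomorphism_def)
  next
    case (Suc k)
    show ?case
    proof (rule Ck_on_SucI[OF V(4) V(7)])
      fix v
      have pxg: "Ck_on k (\<lambda>y. px f (g y)) V" and pyg: "Ck_on k (\<lambda>y. py f (g y)) V"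
        by (rule Ck_on_compose[OF V(4) Suc Ck_on_px[OF U(3)] gV] Ck_on_compose[OF V(4) Suc Ck_on_py[OF U(3)] gV])+
      have ck: "Ck_on k A V" "Ck_on k B V" "Ck_on k C V" "Ck_on k E V"
        unfolding A_def[abs_def] B_def[abs_def] C_def[abs_def] E_def[abs_def]
        by (intro Ck_on_linear[OF bounded_linear_fst V(4)] Ck_on_linear[OF bounded_linear_snd V(4)] pxg pyg)+
      have neg: "Ck_on k (\<lambda>y. F y - G y) V" if "Ck_on k F V" "Ck_on k G V" for F G :: "_ \<Rightarrow> real"
        using Ck_on_add[OF V(4) that(1) Ck_on_linear[OF bounded_linear_minus[OF bounded_linear_ident] V(4) that(2)]] by simp
      have dt: "Ck_on k (\<lambda>y. inverse (A y * E y - B y * C y)) V"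
        by (rule Ck_on_compose[OF V(4) _ Ck_on_inverse])
          (use det in \<open>auto intro!: neg Ck_on_bilinear[OF bounded_bilinear_mult V(4)] ck\<close>)
      have "Ck_on k (\<lambda>y. ((E y * fst v - B y * snd v) * inverse (A y * E y - B y * C y),
          (A y * snd v - C y * fst v) * inverse (A y * E y - B y * C y))) V"
        by (intro Ck_on_Pair[OF V(4)] Ck_on_bilinear[OF bounded_bilinear_mult V(4)] neg dt ck Ck_on_const[OF V(4)])
      then show "Ck_on k (\<lambda>y. g' y v) V"
        by (rule iffD2[OF Ck_on_cong[OF V(4)], rotated]) (rule g'eq)
    qed
  qed
  show ?thesis
  proof (rule that)
    show "smooth_germ g (f a)" by (rule smooth_germI[OF V(4,5) Ckg])
    show "\<forall>\<^sub>F z in nhds a. g (f z) = z"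
      unfolding eventually_nhds using V(1,3,6) unfolding homeomorphism_def by blast
    show "\<forall>\<^sub>F y in nhds (f a). f (g y) = y"
      unfolding eventually_nhds using V(4,5,6) unfolding homeomorphism_def by blast
  qed
qed

section \<open>Germs of diffeomorphisms and Left-Right equivalence\<close>

lemma diffeo_germI:
  assumes h: "smooth_germ h a" and h': "smooth_germ h' (h a)"
    and 1: "\<forall>\<^sub>F z in nhds a. h' (h z) = z" and 2: "\<forall>\<^sub>F y in nhds (h a). h (h' y) = y"
  shows "diffeo_germ h a"
proof -
  obtain U0 where U0: "open U0" "a \<in> U0" "\<And>k. Ck_on k h U0" using h by (rule smooth_germE) blast
  obtain V0 where V0: "open V0" "h a \<in> V0" "\<And>k. Ck_on k h' V0" using h' by (rule smooth_germE) blast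
  obtain U1 where U1: "open U1" "a \<in> U1" "\<And>z. z \<in> U1 \<Longrightarrow> h' (h z) = z"
    using 1 unfolding eventually_nhds by blast
  obtain V1 where V1: "open V1" "h a \<in> V1" "\<And>y. y \<in> V1 \<Longrightarrow> h (h' y) = y"
    using 2 unfolding eventually_nhds by blast
  define V where "V = V0 \<inter> V1"
  define U where "U = (U0 \<inter> h -` V) \<inter> U1"
  have oU: "open U" unfolding U_def V_def
    by (intro open_Int continuous_open_preimage[OF Ck_on_imp_continuous[OF U0(3)]] U0 U1 V0 V1)
  have aU: "a \<in> U" using U0 U1 V0 V1 by (auto simp: U_def V_def)
  \<comment> \<open>This exhibits the image of \<open>U\<close> as a preimage under the continuous
    map \<open>h'\<close>, which is how it is seen to be open.\<close>
  have "h ` U = V \<inter> h' -` U"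
  proof (intro equalityI subsetI)
    fix y assume "y \<in> h ` U"
    then obtain x where x: "x \<in> U" "y = h x" by blast
    then show "y \<in> V \<inter> h' -` U" using U1(3)[of x] by (auto simp: U_def)
  next
    fix y assume y: "y \<in> V \<inter> h' -` U"
    then have "h (h' y) = y" using V1(3) by (auto simp: V_def)
    then show "y \<in> h ` U" using y by (metis IntD2 image_eqI vimageE)
  qed
  moreover have "open (V \<inter> h' -` U)"
    by (rule continuous_open_preimage[OF continuous_on_subset[OF Ck_on_imp_continuous[OF V0(3)]]])
      (use V0 V1 oU in \<open>auto simp: V_def\<close>)
  ultimately have oV: "open (h ` U)" "h ` U \<subseteq> V0" by (auto simp: V_def)
  have "Ck_on k h U" for k by (rule Ck_on_subset[OF U0(3)]) (auto simp: U_def)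
  then have "smooth_on h U" unfolding smooth_on_def ..
  moreover have "smooth_on h' (h ` U)" unfolding smooth_on_def using Ck_on_subset[OF V0(3) oV(2)] ..
  moreover have "\<forall>x\<in>U. h' (h x) = x" using U1(3) by (auto simp: U_def)
  ultimately show ?thesis unfolding diffeo_germ_def using oU aU oV(1) by blast
qed

lemma diffeo_germE:
  assumes "diffeo_germ h a"
  obtains h' where "smooth_germ h a" "smooth_germ h' (h a)" "h' (h a) = a"
    "\<forall>\<^sub>F z in nhds a. h' (h z) = z" "\<forall>\<^sub>F y in nhds (h a). h (h' y) = y"
proof -
  obtain U h' where U: "open U" "a \<in> U" "open (h ` U)" "smooth_on h U" "smooth_on h' (h ` U)"
    "\<And>x. x \<in> U \<Longrightarrow> h' (h x) = x" using assms unfolding diffeo_germ_def by blast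
  show ?thesis
  proof (rule that)
    show "smooth_germ h a" unfolding smooth_germ_def using U by blast
    show "smooth_germ h' (h a)" unfolding smooth_germ_def using U by blast
    show "h' (h a) = a" using U by blast
    show "\<forall>\<^sub>F z in nhds a. h' (h z) = z" unfolding eventually_nhds using U by blast
    show "\<forall>\<^sub>F y in nhds (h a). h (h' y) = y"
      unfolding eventually_nhds by (intro exI[of _ "h ` U"]) (use U in auto)
  qed
qed

lemma diffeo_germ_smooth: "diffeo_germ h a \<Longrightarrow> smooth_germ h a"
  by (erule diffeo_germE)

lemma diffeo_germ_inverse:
  assumes "diffeo_germ h a"
  obtains h' where "diffeo_germ h' (h a)" "h' (h a) = a"
    "\<forall>\<^sub>F z in nhds a. h' (h z) = z" "\<forall>\<^sub>F y in nhds (h a). h (h' y) = y"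
proof -
  obtain h' where h: "smooth_germ h a" "smooth_germ h' (h a)" "h' (h a) = a"
    "\<forall>\<^sub>F z in nhds a. h' (h z) = z" "\<forall>\<^sub>F y in nhds (h a). h (h' y) = y"
    using assms by (rule diffeo_germE)
  show ?thesis by (rule that[OF diffeo_germI[of h' "h a" h] h(3-5)]) (simp_all add: h)
qed

lemma diffeo_germ_plane:
  fixes h :: "real \<times> real \<Rightarrow> real \<times> real"
  assumes "smooth_germ h a" "(h has_derivative D) (at a)" "inj D"
  shows "diffeo_germ h a"
proof -
  obtain g where "smooth_germ g (h a)" "\<forall>\<^sub>F z in nhds a. g (h z) = z" "\<forall>\<^sub>F y in nhds (h a). h (g y) = y"
    by (rule inverse_germ_plane[OF assms])
  then show ?thesis using diffeo_germI assms(1) by blast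
qed

lemma diffeo_germ_compose:
  fixes h k :: "'a::euclidean_space \<Rightarrow> 'a"
  assumes "diffeo_germ h a" "diffeo_germ k (h a)"
  shows "diffeo_germ (\<lambda>x. k (h x)) a"
proof -
  obtain h' where h: "smooth_germ h a" "smooth_germ h' (h a)" "h' (h a) = a"
    "\<forall>\<^sub>F z in nhds a. h' (h z) = z" "\<forall>\<^sub>F y in nhds (h a). h (h' y) = y"
    using assms(1) by (rule diffeo_germE)
  obtain k' where k: "smooth_germ k (h a)" "smooth_germ k' (k (h a))" "k' (k (h a)) = h a"
    "\<forall>\<^sub>F z in nhds (h a). k' (k z) = z" "\<forall>\<^sub>F y in nhds (k (h a)). k (k' y) = y"
    using assms(2) by (rule diffeo_germE)
  show ?thesis
  proof (rule diffeo_germI)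
    show "smooth_germ (\<lambda>x. k (h x)) a" by (rule smooth_germ_compose[OF k(1) h(1)])
    show "smooth_germ (\<lambda>x. h' (k' x)) (k (h a))" by (rule smooth_germ_compose) (simp_all add: h k)
    show "\<forall>\<^sub>F z in nhds a. h' (k' (k (h z))) = z"
      using eventually_nhds_isCont[OF smooth_germ_isCont[OF h(1)] k(4)] h(4) by eventually_elim simp
    have "\<forall>\<^sub>F y in nhds (k (h a)). h (h' (k' y)) = k' y"
      using eventually_nhds_isCont[OF smooth_germ_isCont[OF k(2)], of "\<lambda>y. h (h' y) = y"] h(5) by (simp add: k(3))
    then show "\<forall>\<^sub>F y in nhds (k (h a)). k (h (h' (k' y))) = y"
      using k(5) by eventually_elim simp
  qed
qed

lemma diffeo_germ_inj_derivative:
  fixes h :: "'a::euclidean_space \<Rightarrow> 'a"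
  assumes "diffeo_germ h a"
  shows "inj (frechet_derivative h (at a))"
proof -
  obtain h' where h: "smooth_germ h a" "smooth_germ h' (h a)" "h' (h a) = a"
    "\<forall>\<^sub>F z in nhds a. h' (h z) = z" "\<forall>\<^sub>F y in nhds (h a). h (h' y) = y"
    using assms(1) by (rule diffeo_germE)
  have "((\<lambda>z. h' (h z)) has_derivative (\<lambda>v. frechet_derivative h' (at (h a)) (frechet_derivative h (at a) v))) (at a)"
    by (rule has_derivative_compose[OF smooth_germ_derivative[OF h(1)] smooth_germ_derivative[OF h(2)]])
  then have "((\<lambda>z. z) has_derivative (\<lambda>v. frechet_derivative h' (at (h a)) (frechet_derivative h (at a) v))) (at a)"
    using h(4) by (rule has_derivative_cong_eventually)
  then have "(\<lambda>v. frechet_derivative h' (at (h a)) (frechet_derivative h (at a) v)) = (\<lambda>v. v)"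
    by (rule has_derivative_unique) (rule has_derivative_ident)
  then have "frechet_derivative h' (at (h a)) (frechet_derivative h (at a) v) = v" for v by (rule fun_cong)
  then show ?thesis by (rule inj_on_inverseI)
qed

lemma left_right_equivalentI:
  "diffeo_germ h a \<Longrightarrow> h a = b \<Longrightarrow> diffeo_germ k (g a) \<Longrightarrow> \<forall>\<^sub>F z in nhds a. k (g z) = g' (h z) \<Longrightarrow>
   left_right_equivalent g a g' b"
  unfolding left_right_equivalent_def by blast

lemma left_right_equivalentE:
  assumes "left_right_equivalent g a g' b"
  obtains h k where "diffeo_germ h a" "h a = b" "diffeo_germ k (g a)" "\<forall>\<^sub>F z in nhds a. k (g z) = g' (h z)"
  using assms unfolding left_right_equivalent_def by blast

text \<open>Continuity of \<open>g\<close> brings \<open>g z\<close> into the neighbourhood of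
  \<open>g a\<close> where the inverse of the target change cancels it.\<close>

lemma left_right_equivalent_sym:
  assumes "left_right_equivalent g a g' b" "isCont g a"
  shows "left_right_equivalent g' b g a"
proof -
  obtain h k where hk: "diffeo_germ h a" "h a = b" "diffeo_germ k (g a)" "\<forall>\<^sub>F z in nhds a. k (g z) = g' (h z)"
    using assms(1) by (rule left_right_equivalentE)
  obtain h' where h': "diffeo_germ h' (h a)" "h' (h a) = a" "\<forall>\<^sub>F y in nhds (h a). h (h' y) = y"
    using hk(1) by (rule diffeo_germ_inverse)
  obtain k' where k': "diffeo_germ k' (k (g a))" "\<forall>\<^sub>F y in nhds (g a). k' (k y) = y"
    using hk(3) by (rule diffeo_germ_inverse)
  have kg: "k (g a) = g' b" using eventually_nhds_x_imp_x[OF hk(4)] hk(2) by simp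
  have ch': "isCont h' (h a)" by (rule smooth_germ_isCont[OF diffeo_germ_smooth[OF h'(1)]])
  have "\<forall>\<^sub>F z in nhds a. k' (k (g z)) = g z" by (rule eventually_nhds_isCont[OF assms(2) k'(2)])
  with hk(4) have "\<forall>\<^sub>F z in nhds a. k' (g' (h z)) = g z" by eventually_elim simp
  then have "\<forall>\<^sub>F y in nhds (h a). k' (g' (h (h' y))) = g (h' y)"
    using eventually_nhds_isCont[OF ch', of "\<lambda>z. k' (g' (h z)) = g z"] h'(2) by simp
  then have "\<forall>\<^sub>F y in nhds b. k' (g' y) = g (h' y)"
    using h'(3) unfolding hk(2) by eventually_elim simp
  then show ?thesis
    using h' k' hk(2) kg by (intro left_right_equivalentI[of h' b a k']) auto
qed

lemma left_right_equivalent_trans: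
  fixes g :: "'a::euclidean_space \<Rightarrow> 'b::euclidean_space"
  assumes "left_right_equivalent g a g' b" "left_right_equivalent g' b g'' c"
  shows "left_right_equivalent g a g'' c"
proof -
  obtain h k where hk: "diffeo_germ h a" "h a = b" "diffeo_germ k (g a)" "\<forall>\<^sub>F z in nhds a. k (g z) = g' (h z)"
    using assms(1) by (rule left_right_equivalentE)
  obtain h' k' where hk': "diffeo_germ h' b" "h' b = c" "diffeo_germ k' (g' b)" "\<forall>\<^sub>F z in nhds b. k' (g' z) = g'' (h' z)"
    using assms(2) by (rule left_right_equivalentE)
  have kg: "k (g a) = g' b" using eventually_nhds_x_imp_x[OF hk(4)] hk(2) by simp
  show ?thesis
  proof (rule left_right_equivalentI)
    show "diffeo_germ (\<lambda>x. h' (h x)) a" by (rule diffeo_germ_compose) (simp_all add: hk hk')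
    show "h' (h a) = c" by (simp add: hk hk')
    show "diffeo_germ (\<lambda>x. k' (k x)) (g a)" by (rule diffeo_germ_compose) (simp_all add: hk hk' kg)
    have "\<forall>\<^sub>F z in nhds a. k' (g' (h z)) = g'' (h' (h z))"
      using eventually_nhds_isCont[OF smooth_germ_isCont[OF diffeo_germ_smooth[OF hk(1)]], of "\<lambda>z. k' (g' z) = g'' (h' z)"]
        hk'(4) hk(2) by simp
    then show "\<forall>\<^sub>F z in nhds a. k' (k (g z)) = g'' (h' (h z))"
      using hk(4) by eventually_elim simp
  qed
qed

lemma left_right_equivalent_cong:
  assumes "left_right_equivalent g a g' b" "\<forall>\<^sub>F z in nhds a. f z = g z"
  shows "left_right_equivalent f a g' b"
proof -
  obtain h k where hk: "diffeo_germ h a" "h a = b" "diffeo_germ k (g a)" "\<forall>\<^sub>F z in nhds a. k (g z) = g' (h z)"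
    using assms(1) by (rule left_right_equivalentE)
  have "f a = g a" using eventually_nhds_x_imp_x[OF assms(2)] .
  moreover have "\<forall>\<^sub>F z in nhds a. k (f z) = g' (h z)" using assms(2) hk(4) by eventually_elim simp
  ultimately show ?thesis using hk by (intro left_right_equivalentI[of h a b k f]) auto
qed

section \<open>Smooth even functions\<close>

text \<open>Coefficients of the bilateral theta series
  \<open>\<Sum>k. (-1)^k 2^(-k(k+1)) z^k\<close>. It vanishes at \<open>z = 4^j\<close> for every
  natural number j, and this yields explicit coefficients for Seeley's extension.\<close>

definition theta_coeff :: "int \<Rightarrow> real" where
  "theta_coeff k = (-1) powi k * 2 powi (- (k * (k + 1)))"

lemma theta_term: "theta_coeff k * (4 powi k) ^ j = (-1) powi k * 2 powi (2 * int j * k - k * (k + 1))"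
proof -
  have "(4 powi k :: real) ^ j = 2 powi (2 * int j * k)"
  proof -
    have "(4 :: real) powi k = 2 powi (2 * k)" by (simp add: power_int_mult)
    then have "(4 powi k :: real) ^ j = (2 powi (2 * k)) powi int j" by simp
    also have "\<dots> = 2 powi (2 * k * int j)" by (simp only: power_int_mult)
    finally show ?thesis by (simp add: mult_ac)
  qed
  moreover have "2 powi (2 * int j * k - k * (k + 1)) = 2 powi (- (k * (k + 1))) * (2 :: real) powi (2 * int j * k)"
    by (simp add: power_int_add[symmetric])
  ultimately show ?thesis by (simp add: theta_coeff_def)
qed

lemma summable_on_int_geometric: "(\<lambda>k :: int. (1 / 2 :: real) ^ nat \<bar>k\<bar>) summable_on UNIV"
proof -
  let ?f = "\<lambda>k :: int. (1 / 2 :: real) ^ nat \<bar>k\<bar>"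
  have g: "(\<lambda>n. (1 / 2 :: real) ^ n) summable_on UNIV"
    by (subst summable_on_UNIV_nonneg_real_iff) (auto intro: summable_geometric)
  have "?f summable_on (range int)"
    by (subst summable_on_reindex) (simp_all add: o_def g)
  moreover have "?f summable_on (range (\<lambda>n. - 1 - int n))"
  proof (subst summable_on_reindex)
    show "inj (\<lambda>n. - 1 - int n)" by (auto simp: inj_on_def)
    have "nat (int n + 1) = Suc n" for n by simp
    then have "?f \<circ> (\<lambda>n. - 1 - int n) = (\<lambda>n. (1/2) * (1 / 2) ^ n)" by (auto simp: fun_eq_iff abs_if)
    then show "?f \<circ> (\<lambda>n. - 1 - int n) summable_on UNIV" using summable_on_cmult_right[OF g, of "1/2"] by simp
  qed
  moreover have "range int \<inter> range (\<lambda>n. - 1 - int n) = {}" by auto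
  moreover have "range int \<union> range (\<lambda>n. - 1 - int n) = UNIV"
  proof -
    have "k \<in> range int \<union> range (\<lambda>n. - 1 - int n)" for k
    proof (cases "k \<ge> 0")
      case True
      then show ?thesis by (intro UnI1 image_eqI[of _ _ "nat k"]) auto
    next
      case False
      then show ?thesis by (intro UnI2 image_eqI[of _ _ "nat (- 1 - k)"]) auto
    qed
    then show ?thesis by blast
  qed
  ultimately show ?thesis using summable_on_Un_disjoint by metis
qed

text \<open>Completing the square: the exponent of 2 plus the absolute value of \<open>k\<close> is
  at most \<open>(2 j + 2) |k| - k^2\<close>, hence at most \<open>(j + 1)^2\<close>. The geometric
  factor left over gives summability over the integers.\<close>

lemma theta_term_bound: "\<bar>theta_coeff k * (4 powi k) ^ j\<bar> \<le> 2 ^ ((j + 1)\<^sup>2) * (1 / 2) ^ nat \<bar>k\<bar>"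
proof -
  have "\<bar>theta_coeff k * (4 powi k) ^ j\<bar> = 2 powi (2 * int j * k - k * (k + 1))"
    unfolding theta_term abs_mult by (simp add: power_int_abs)
  also have "\<dots> \<le> 2 powi (int ((j + 1)\<^sup>2) - \<bar>k\<bar>)"
  proof (rule power_int_increasing)
    have "2 * int j * k - k * (k + 1) + \<bar>k\<bar> \<le> (2 * int j + 2) * \<bar>k\<bar> - k * k"
    proof -
      have "2 * int j * k \<le> 2 * int j * \<bar>k\<bar>" by (intro mult_left_mono) auto
      moreover have "\<bar>k\<bar> - k \<le> 2 * \<bar>k\<bar>" by simp
      ultimately show ?thesis by (simp add: algebra_simps)
    qed
    also have "\<dots> \<le> (int j + 1)\<^sup>2"
    proof -
      have "0 \<le> (int j + 1 - \<bar>k\<bar>)\<^sup>2" by simp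
      then show ?thesis by (simp add: power2_eq_square algebra_simps)
    qed
    finally show "2 * int j * k - k * (k + 1) \<le> int ((j + 1)\<^sup>2) - \<bar>k\<bar>" by (simp add: add.commute)
  qed simp
  also have "\<dots> = 2 ^ ((j + 1)\<^sup>2) * (1 / 2) ^ nat \<bar>k\<bar>"
  proof -
    have "(2::real) powi (int ((j + 1)\<^sup>2) - \<bar>k\<bar>) = 2 powi int ((j + 1)\<^sup>2) / 2 powi \<bar>k\<bar>"
      by (rule power_int_diff) simp
    moreover have "(2::real) powi \<bar>k\<bar> = 2 ^ nat \<bar>k\<bar>" by (simp add: power_int_def)
    ultimately show ?thesis by (simp add: power_int_of_nat power_one_over divide_simps del: of_nat_power)
  qed
  finally show ?thesis .
qed

lemma theta_abs_summable: "(\<lambda>k. norm (theta_coeff k * (4 powi k) ^ j)) summable_on UNIV"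
  by (rule Infinite_Sum.abs_summable_on_comparison_test'[OF summable_on_cmult_right[OF summable_on_int_geometric, of "2 ^ ((j + 1)\<^sup>2)"]])
    (simp only: real_norm_def theta_term_bound)

text \<open>The reflection \<open>k \<mapsto> 2 j - 1 - k\<close> preserves the exponent of 2 and flips the sign.\<close>

lemma theta_null: "(\<Sum>\<^sub>\<infinity>k. theta_coeff k * (4 powi k) ^ j) = 0"
proof -
  let ?t = "\<lambda>k. theta_coeff k * (4 powi k) ^ j"
  have "bij (\<lambda>k. 2 * int j - 1 - k)"
    by (rule bij_betw_byWitness[of _ "\<lambda>k. 2 * int j - 1 - k"]) auto
  then have "(\<Sum>\<^sub>\<infinity>k. ?t k) = (\<Sum>\<^sub>\<infinity>k. ?t (2 * int j - 1 - k))"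
    by (rule infsum_reindex_bij_betw[symmetric])
  also have "\<dots> = (\<Sum>\<^sub>\<infinity>k. - ?t k)"
  proof (rule infsum_cong)
    fix k
    have "(-1 :: real) powi (2 * int j - 1 - k) = - ((-1) powi k)"
      by (cases "even k") (auto simp: power_int_minus_left)
    moreover have "2 * int j * (2 * int j - 1 - k) - (2 * int j - 1 - k) * (2 * int j - 1 - k + 1) = 2 * int j * k - k * (k + 1)"
      by (simp add: algebra_simps)
    ultimately show "?t (2 * int j - 1 - k) = - ?t k" unfolding theta_term by simp
  qed
  also have "\<dots> = - (\<Sum>\<^sub>\<infinity>k. ?t k)" by (rule infsum_uminus)
  finally show ?thesis by simp
qed

text \<open>With the divisor \<open>4 powi k + 1\<close> two consecutive moments add up to a null
  theta sum. The moments thus alternate in sign, and become constant once the nodes are replaced by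
  \<open>- (4 powi k)\<close>.\<close>

definition theta_moment :: "nat \<Rightarrow> real" where
  "theta_moment j = (\<Sum>\<^sub>\<infinity>k. theta_coeff k / (4 powi k + 1) * (4 powi k) ^ j)"

lemma divide_add_1_le: "0 \<le> c \<Longrightarrow> 0 < x \<Longrightarrow> c / (x + 1) \<le> (c :: real)"
  by (simp add: divide_le_eq algebra_simps)

lemma theta_div_abs_summable: "(\<lambda>k. norm (theta_coeff k / (4 powi k + 1) * (4 powi k) ^ j)) summable_on UNIV"
proof (rule Infinite_Sum.abs_summable_on_comparison_test'[OF theta_abs_summable[of j]])
  fix k :: int
  have p: "(4::real) powi k > 0" by simp
  have "\<bar>theta_coeff k * (4 powi k) ^ j\<bar> / (4 powi k + 1) \<le> \<bar>theta_coeff k * (4 powi k) ^ j\<bar>"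
    by (rule divide_add_1_le) simp_all
  then show "norm (theta_coeff k / (4 powi k + 1) * (4 powi k) ^ j) \<le> norm (theta_coeff k * (4 powi k) ^ j)"
    using p by (simp add: abs_mult)
qed

lemma theta_moment_Suc: "theta_moment (Suc j) = - theta_moment j"
proof -
  have s: "(\<lambda>k. theta_coeff k / (4 powi k + 1) * (4 powi k) ^ j) summable_on UNIV" for j
    by (rule abs_summable_summable[OF theta_div_abs_summable])
  have "theta_moment (Suc j) + theta_moment j
      = (\<Sum>\<^sub>\<infinity>k. theta_coeff k / (4 powi k + 1) * (4 powi k) ^ Suc j + theta_coeff k / (4 powi k + 1) * (4 powi k) ^ j)"
    unfolding theta_moment_def by (rule infsum_add[OF s s, symmetric])
  also have "\<dots> = (\<Sum>\<^sub>\<infinity>k. theta_coeff k * (4 powi k) ^ j)"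
  proof (rule infsum_cong)
    fix k :: int
    have "(4::real) powi k + 1 \<noteq> 0" using zero_less_power_int[of "4::real" k] by linarith
    then show "theta_coeff k / (4 powi k + 1) * (4 powi k) ^ Suc j + theta_coeff k / (4 powi k + 1) * (4 powi k) ^ j
        = theta_coeff k * (4 powi k) ^ j"
    proof -
      have d: "d * x ^ Suc j + d * x ^ j = d * (x + 1) * x ^ j" for d x :: real by (simp add: algebra_simps)
      have "theta_coeff k / (4 powi k + 1) * (4 powi k + 1) = theta_coeff k"
        using \<open>(4::real) powi k + 1 \<noteq> 0\<close> by simp
      then show ?thesis unfolding d by (simp only:)
    qed
  qed
  also have "\<dots> = 0" by (rule theta_null)
  finally show ?thesis by simp
qed

lemma theta_moment_eq: "theta_moment j = (-1) ^ j * theta_moment 0"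
  by (induction j) (simp_all add: theta_moment_Suc)

text \<open>The moment is wanted nonzero, to be divided by. The indices \<open>n\<close> and
  \<open>- 1 - n\<close> share the exponent \<open>k * (k + 1)\<close> and are paired: the first
  pair contributes -3/10, the second at most 1/5, all the others together at most 1/24.\<close>

lemma theta_moment_neg: "theta_moment 0 < 0"
proof -
  let ?t = "\<lambda>k. theta_coeff k / (4 powi k + 1)"
  have s: "?t summable_on A" for A
    using summable_on_subset_banach[OF abs_summable_summable[OF theta_div_abs_summable[of 0]], of A] by simp
  define w where "w n = ?t (int n) + ?t (- 1 - int n)" for n :: nat
  have un: "UNIV = range int \<union> range (\<lambda>n. - 1 - int n)"
  proof -
    have "k \<in> range int \<union> range (\<lambda>n. - 1 - int n)" for k
    proof (cases "k \<ge> 0")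
      case True
      then show ?thesis by (intro UnI1 image_eqI[of _ _ "nat k"]) auto
    next
      case False
      then show ?thesis by (intro UnI2 image_eqI[of _ _ "nat (- 1 - k)"]) auto
    qed
    then show ?thesis by blast
  qed
  have i: "inj int" "inj (\<lambda>n. - 1 - int n)" by (auto simp: inj_on_def)
  have sw: "(\<lambda>n. ?t (int n)) summable_on UNIV" "(\<lambda>n. ?t (- 1 - int n)) summable_on UNIV"
    using s[of "range int"] s[of "range (\<lambda>n. - 1 - int n)"]
    by (simp_all add: summable_on_reindex[OF i(1)] summable_on_reindex[OF i(2)] o_def)
  have "theta_moment 0 = infsum ?t (range int \<union> range (\<lambda>n. - 1 - int n))"
    by (simp add: theta_moment_def un[symmetric])
  also have "\<dots> = infsum ?t (range int) + infsum ?t (range (\<lambda>n. - 1 - int n))"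
    by (rule infsum_Un_disjoint[OF s s]) auto
  also have "\<dots> = infsum w UNIV"
    unfolding w_def infsum_reindex[OF i(1)] infsum_reindex[OF i(2)] o_def
    by (rule infsum_add[OF sw, symmetric])
  finally have m: "theta_moment 0 = infsum w UNIV" .
  have "w summable_on UNIV" unfolding w_def[abs_def] by (rule summable_on_add[OF sw])
  then have sums: "w sums theta_moment 0" unfolding m by (intro has_sum_imp_sums has_sum_infsum)
  have w0: "w 0 = - 3 / 10" by (simp add: w_def theta_coeff_def power_int_minus)
  have w1: "w 1 \<le> 1 / 5" by (simp add: w_def theta_coeff_def power_int_minus)
  have wn: "w (n + 2) \<le> 1 / 32 * (1 / 4) ^ n" for n
  proof -
    define k where "k = int n + 2"
    have c: "\<bar>theta_coeff k\<bar> \<le> 1 / 64 * (1 / 4) ^ n" if "k = int n + 2 \<or> k = - 1 - (int n + 2)" for k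
    proof -
      have "k * (k + 1) = (int n + 2) * (int n + 3)" using that
      proof
        assume k: "k = int n + 2"
        show ?thesis unfolding k by (simp add: algebra_simps)
      next
        assume k: "k = - 1 - (int n + 2)"
        show ?thesis unfolding k by (simp add: algebra_simps)
      qed
      then have "\<bar>theta_coeff k\<bar> = 2 powi (- ((int n + 2) * (int n + 3)))"
        by (simp add: theta_coeff_def abs_mult power_int_abs)
      also have "\<dots> \<le> 2 powi (- (6 + 2 * int n))"
        by (rule power_int_increasing) (simp_all add: algebra_simps)
      also have "\<dots> = 1 / 64 * (1 / 4) ^ n"
      proof -
        have "(2::real) powi (6 + 2 * int n) = 2 ^ (6 + 2 * n)"
          by (metis of_nat_add of_nat_mult of_nat_numeral power_int_of_nat)
        moreover have "(2::real) ^ (6 + 2 * n) = 64 * 4 ^ n" by (simp add: power_add power_mult)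
        ultimately have "(2::real) powi (- (6 + 2 * int n)) = inverse (64 * 4 ^ n)"
          by (simp only: power_int_minus)
        then show ?thesis by (simp add: field_simps)
      qed
      finally show ?thesis .
    qed
    have t: "?t k \<le> \<bar>theta_coeff k\<bar>" for k
    proof -
      have p: "(4::real) powi k > 0" by simp
      have "?t k \<le> \<bar>theta_coeff k\<bar> / (4 powi k + 1)" using p by (intro divide_right_mono) auto
      also have "\<dots> \<le> \<bar>theta_coeff k\<bar>" by (rule divide_add_1_le) simp_all
      finally show ?thesis .
    qed
    have "?t (int n + 2) \<le> 1 / 64 * (1 / 4) ^ n" "?t (- 1 - (int n + 2)) \<le> 1 / 64 * (1 / 4) ^ n"
      using order_trans[OF t c] by blast+
    moreover have "w (n + 2) = ?t (int n + 2) + ?t (- 1 - (int n + 2))"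
      unfolding w_def of_nat_add of_nat_numeral ..
    ultimately show ?thesis by linarith
  qed
  have "(\<lambda>n. w (n + 2)) sums (theta_moment 0 - (w 0 + w 1))"
    using sums_iff_shift[of w 2 "theta_moment 0 - (w 0 + w 1)"] sums by (simp add: numeral_2_eq_2)
  moreover have "(\<lambda>n. 1 / 32 * (1 / 4 :: real) ^ n) sums (1 / 32 * (1 / (1 - 1 / 4)))"
    by (intro sums_mult geometric_sums) simp
  ultimately have "theta_moment 0 - (w 0 + w 1) \<le> 1 / 32 * (1 / (1 - 1 / 4))"
    by (rule sums_le[rotated]) (rule wn)
  then show ?thesis using w0 w1 by simp
qed

text \<open>Seeley's moment conditions. At the boundary, the j-th derivative of the reflected sum
  carries the factor \<open>\<Sum>k. a k * (- b k) ^ j\<close>, which has to be 1 for all j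
  simultaneously. The nodes are the powers of 4 with integer exponents, enumerated by
  \<open>int_decode\<close>, and the weights are theta coefficients divided by
  \<open>4 powi k + 1\<close> and normalized.\<close>

lemma seeley_coefficients:
  obtains a b :: "nat \<Rightarrow> real" where "\<And>k. b k > 0" "\<And>j. summable (\<lambda>k. \<bar>a k\<bar> * b k ^ j)"
    "\<And>j. (\<lambda>k. a k * (- b k) ^ j) sums 1"
proof -
  define A where "A k = theta_coeff k / (4 powi k + 1) / theta_moment 0" for k
  have m: "theta_moment 0 \<noteq> 0" using theta_moment_neg by simp
  have abs: "(\<lambda>k. norm (A k * (4 powi k) ^ j)) summable_on UNIV" for j
    using summable_on_cmult_right[OF theta_div_abs_summable[of j], of "inverse \<bar>theta_moment 0\<bar>"]
    by (simp add: A_def abs_mult divide_inverse mult_ac)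
  have "(\<lambda>k. A k * (4 powi k) ^ j) = (\<lambda>k. inverse (theta_moment 0) * (theta_coeff k / (4 powi k + 1) * (4 powi k) ^ j))" for j
    by (simp add: A_def field_simps)
  then have "(\<Sum>\<^sub>\<infinity>k. A k * (4 powi k) ^ j) = inverse (theta_moment 0) * theta_moment j" for j
    unfolding theta_moment_def by (simp only: infsum_cmult_right')
  then have inf: "(\<Sum>\<^sub>\<infinity>k. A k * (4 powi k) ^ j) = (-1) ^ j" for j
    using m theta_moment_eq[of j] by simp
  have hs: "((\<lambda>k. A k * (4 powi k) ^ j) has_sum (-1) ^ j) UNIV" for j
    using has_sum_infsum[OF abs_summable_summable[OF abs[of j]]] unfolding inf .
  note bij = bij_int_decode
  show ?thesis
  proof (rule that[of "\<lambda>k. 4 powi int_decode k" "\<lambda>k. A (int_decode k)"])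
    fix j
    have "(\<lambda>k. norm (A (int_decode k) * (4 powi int_decode k) ^ j)) summable_on UNIV"
      using abs[of j] summable_on_reindex_bij_betw[OF bij, of "\<lambda>k. norm (A k * (4 powi k) ^ j)"] by simp
    then have "summable (\<lambda>k. norm (A (int_decode k) * (4 powi int_decode k) ^ j))"
      by (rule summable_on_imp_summable)
    then show "summable (\<lambda>k. \<bar>A (int_decode k)\<bar> * (4 powi int_decode k) ^ j)"
      by (simp add: abs_mult)
    have "((\<lambda>k. A (int_decode k) * (4 powi int_decode k) ^ j) has_sum (-1) ^ j) UNIV"
      using hs[of j] has_sum_reindex_bij_betw[OF bij, of "\<lambda>k. A k * (4 powi k) ^ j"] by simp
    then have "(\<lambda>k. (-1) ^ j * (A (int_decode k) * (4 powi int_decode k) ^ j)) sums ((-1) ^ j * (-1) ^ j)"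
      by (intro sums_mult has_sum_imp_sums)
    moreover have "(-1) ^ j * (A (int_decode k) * (4 powi int_decode k) ^ j) = A (int_decode k) * (- (4 powi int_decode k)) ^ j" for k
      by (subst power_minus[of "4 powi int_decode k"]) simp
    ultimately show "(\<lambda>k. A (int_decode k) * (- (4 powi int_decode k)) ^ j) sums 1"
      by (simp add: power_mult_distrib[symmetric])
  qed simp
qed

text \<open>By the mean value theorem the difference quotient at 0 is a value of \<open>D\<close> at
  an intermediate point. This joins derivative formulas known on the two open half-lines.\<close>

lemma DERIV_removable:
  fixes f D :: "real \<Rightarrow> real"
  assumes der: "\<And>y. y \<noteq> 0 \<Longrightarrow> (f has_field_derivative D y) (at y)" and "isCont f 0" "isCont D 0"
  shows "(f has_field_derivative D 0) (at 0)"
proof -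
  have cont: "continuous_on A f" for A
  proof (rule continuous_at_imp_continuous_on, rule ballI)
    show "isCont f y" for y using DERIV_isCont[OF der[of y]] assms(2) by (cases "y = 0") auto
  qed
  have "\<exists>c. \<bar>c\<bar> < \<bar>h\<bar> \<and> (f h - f 0) / h = D c" if "h \<noteq> 0" for h
  proof (cases "h > 0")
    case True
    obtain l z where z: "0 < z" "z < h" "(f has_field_derivative l) (at z)" "f h - f 0 = (h - 0) * l"
      using MVT[OF True cont] der by (metis real_differentiable_def less_irrefl)
    then have "l = D z" using DERIV_unique der by (metis less_irrefl)
    then show ?thesis using z True by (intro exI[of _ z]) auto
  next
    case False
    then have "h < 0" using that by simp
    obtain l z where z: "h < z" "z < 0" "(f has_field_derivative l) (at z)" "f 0 - f h = (0 - h) * l"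
      using MVT[OF \<open>h < 0\<close> cont] der by (metis real_differentiable_def less_irrefl)
    then have "l = D z" using DERIV_unique der by (metis less_irrefl)
    then show ?thesis using z \<open>h < 0\<close> by (intro exI[of _ z]) (auto simp: field_simps)
  qed
  then obtain c where c: "\<And>h. h \<noteq> 0 \<Longrightarrow> \<bar>c h\<bar> < \<bar>h\<bar>" "\<And>h. h \<noteq> 0 \<Longrightarrow> (f h - f 0) / h = D (c h)"
    by metis
  have "(c \<longlongrightarrow> 0) (at 0)"
  proof (rule Lim_null_comparison)
    show "\<forall>\<^sub>F h in at 0. norm (c h) \<le> \<bar>h\<bar>"
      using c(1) by (auto simp: eventually_at_filter intro!: always_eventually less_imp_le)
    show "((\<lambda>h :: real. \<bar>h\<bar>) \<longlongrightarrow> 0) (at 0)" by (auto intro!: tendsto_eq_intros)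
  qed
  then have "((\<lambda>h. D (c h)) \<longlongrightarrow> D 0) (at 0)" by (rule isCont_tendsto_compose[OF assms(3)])
  then have "((\<lambda>h. (f h - f 0) / h) \<longlongrightarrow> D 0) (at 0)"
    by (rule Lim_transform_eventually) (auto simp: eventually_at_filter c(2))
  then show ?thesis by (simp add: DERIV_def)
qed

text \<open>Replaces the square root: it maps the whole half-line into [0, 1). The dilated arguments
  \<open>b k * - y\<close> of the extension are unbounded, and still the function being extended is
  evaluated inside a fixed box only.\<close>

definition fold_param :: "real \<Rightarrow> real" where
  "fold_param y = sqrt (y / (1 + y))"

lemma fold_param_bounds: "0 \<le> y \<Longrightarrow> 0 \<le> fold_param y \<and> fold_param y < 1"
  unfolding fold_param_def by (simp add: divide_less_eq)

lemma fold_param_0 [simp]: "fold_param 0 = 0"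
  by (simp add: fold_param_def)

lemma fold_param_box2: "\<bar>x\<bar> < 2 \<Longrightarrow> 0 \<le> y \<Longrightarrow> (x, fold_param y) \<in> box2 2"
  using fold_param_bounds[of y] by (simp add: mem_box2)

lemma fold_param_eq: "0 \<le> u \<Longrightarrow> u < 1 \<Longrightarrow> fold_param (u / (1 - u)) = sqrt u"
  unfolding fold_param_def by (simp add: divide_simps)

text \<open>If \<open>s = fold_param y\<close> then \<open>y = s^2 / (1 - s^2)\<close>, so the
  derivative is a function of \<open>s\<close> alone. This keeps derivatives within the functions of
  \<open>x\<close> and \<open>fold_param y\<close>.\<close>

lemma DERIV_fold_param:
  assumes "0 < y"
  shows "fold_param y > 0" 
    "(fold_param has_field_derivative (1 - (fold_param y)\<^sup>2)\<^sup>2 / (2 * fold_param y)) (at y)"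
proof -
  have sq: "(fold_param y)\<^sup>2 = y / (1 + y)" using assms by (simp add: fold_param_def)
  show p: "fold_param y > 0" using assms by (simp add: fold_param_def)
  have "(fold_param has_field_derivative (1 / (1 + y)\<^sup>2) * (inverse (sqrt (y / (1 + y))) / 2)) (at y)"
    unfolding fold_param_def[abs_def] using assms
    by (auto intro!: derivative_eq_intros simp: power2_eq_square divide_simps)
  moreover have "1 - (fold_param y)\<^sup>2 = 1 / (1 + y)" unfolding sq using assms by (simp add: field_simps)
  then have "(1 - (fold_param y)\<^sup>2)\<^sup>2 / (2 * fold_param y) = (1 / (1 + y)\<^sup>2) * (inverse (sqrt (y / (1 + y))) / 2)"
    by (simp only: fold_param_def[of y] power_divide one_power2 divide_inverse inverse_mult_distrib power_inverse mult_1_left mult_ac)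
  ultimately show "(fold_param has_field_derivative (1 - (fold_param y)\<^sup>2)\<^sup>2 / (2 * fold_param y)) (at y)"
    by (simp only:)
qed

text \<open>Radius 2 leaves room around the compact square of radius 1, on which the functions are
  bounded uniformly.\<close>

definition even_box :: "(real \<times> real \<Rightarrow> real) \<Rightarrow> bool" where
  "even_box w \<longleftrightarrow> (\<forall>k. Ck_on k w (box2 2)) \<and> (\<forall>x y. (x, y) \<in> box2 2 \<longrightarrow> w (x, - y) = w (x, y))"

lemma even_box_smooth_germ: "even_box w \<Longrightarrow> z \<in> box2 2 \<Longrightarrow> smooth_germ w z"
  unfolding even_box_def by (blast intro: Ck_on_imp_smooth_germ open_box2)

lemma neg_box2: "(x, - y) \<in> box2 r \<longleftrightarrow> (x, y) \<in> box2 r"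
  by (simp add: mem_box2)

lemma even_box_px:
  assumes "even_box w"
  shows "even_box (px w)"
  unfolding even_box_def
proof (intro conjI allI impI)
  show "Ck_on k (px w) (box2 2)" for k using assms unfolding even_box_def by (blast intro: Ck_on_px)
  fix x y :: real assume xy: "(x, y) \<in> box2 2"
  have "((\<lambda>s. w (s, - y)) has_field_derivative px w (x, - y)) (at x)"
    by (rule smooth_germ_DERIV_x) (use xy assms even_box_smooth_germ neg_box2 in blast)
  moreover have "((\<lambda>s. w (s, y)) has_field_derivative px w (x, y)) (at x)"
    by (rule smooth_germ_DERIV_x) (use xy assms even_box_smooth_germ in blast)
  then have "((\<lambda>s. w (s, - y)) has_field_derivative px w (x, y)) (at x)"
    by (rule has_field_derivative_transform_within_open[of _ _ _ "{-2<..<2}"])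
      (use xy assms in \<open>auto simp: even_box_def box2_def\<close>)
  ultimately show "px w (x, - y) = px w (x, y)" by (rule DERIV_unique)
qed

lemma even_box_py_odd:
  assumes "even_box w" "(x, y) \<in> box2 2"
  shows "py w (x, - y) = - py w (x, y)"
proof -
  have "((\<lambda>s. w (x, s)) has_field_derivative py w (x, - y)) (at (- y))"
    by (rule smooth_germ_DERIV_y) (use assms even_box_smooth_germ neg_box2 in blast)
  then have "((\<lambda>s. w (x, - s)) has_field_derivative - py w (x, - y)) (at y)"
    by (simp add: DERIV_mirror)
  moreover have "((\<lambda>s. w (x, s)) has_field_derivative py w (x, y)) (at y)"
    by (rule smooth_germ_DERIV_y) (use assms even_box_smooth_germ in blast)
  then have "((\<lambda>s. w (x, - s)) has_field_derivative py w (x, y)) (at y)"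
    by (rule has_field_derivative_transform_within_open[of _ _ _ "{-2<..<2}"])
      (use assms in \<open>auto simp: even_box_def box2_def\<close>)
  ultimately have "- py w (x, - y) = py w (x, y)" by (rule DERIV_unique)
  then show ?thesis by simp
qed

text \<open>\<open>fold_deriv w\<close> is the derivative of \<open>w (x, fold_param y)\<close> in \<open>y\<close>, as a function of \<open>x\<close> and
  \<open>fold_param y\<close>; it is even and smooth because \<open>py w\<close> is odd.\<close>

lemma fold_deriv_exists:
  assumes "even_box w"
  obtains v where "even_box v"
    "\<And>x y. (x, y) \<in> box2 2 \<Longrightarrow> py w (x, y) * (1 - y\<^sup>2)\<^sup>2 = 2 * y * v (x, y)"
proof -
  have ck: "Ck_on k (py w) (box2 2)" for k using assms unfolding even_box_def by (blast intro: Ck_on_py)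
  have z: "py w (x, 0) = 0" if "\<bar>x\<bar> < 2" for x
    using even_box_py_odd[OF assms, of x 0] that by (simp add: mem_box2)
  note H = Hadamard_box2[where r = 2 and F = "py w", OF ck z]
  define v1 where "v1 = (\<lambda>z. integral {0..1} (\<lambda>s. py (py w) (fst z, s * snd z)))"
  have ck1: "Ck_on k v1 (box2 2)" for k unfolding v1_def by (rule H(1))
  have v1: "py w (x, y) = y * v1 (x, y)" if "(x, y) \<in> box2 2" for x y
    using H(2)[of "(x, y)"] that by (simp add: v1_def)
  define v where "v z = v1 z * ((1 / 2) * ((1 - snd z * snd z) * (1 - snd z * snd z)))" for z
  show ?thesis
  proof (rule that[of v])
    show "even_box v"
      unfolding even_box_def
    proof (intro conjI allI impI)
      have s: "Ck_on k (\<lambda>z. snd z * snd z) (box2 2)" for k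
        by (intro Ck_on_bilinear[OF bounded_bilinear_mult] Ck_on_linear[OF bounded_linear_snd] Ck_on_id open_box2)
      have "Ck_on k (\<lambda>z. 1 + - (snd z * snd z)) (box2 2)" for k
        by (intro Ck_on_add[OF open_box2] Ck_on_const[OF open_box2]
            Ck_on_linear[OF bounded_linear_minus[OF bounded_linear_ident] open_box2] s)
      then have "Ck_on k (\<lambda>z. 1 - snd z * snd z) (box2 2)" for k by simp
      then show "Ck_on k v (box2 2)" for k
        unfolding v_def[abs_def]
        by (intro Ck_on_bilinear[OF bounded_bilinear_mult open_box2] Ck_on_const[OF open_box2] ck1)
      fix x y :: real assume xy: "(x, y) \<in> box2 2"
      show "v (x, - y) = v (x, y)"
      proof (cases "y = 0")
        case False
        have "- y * v1 (x, - y) = - (y * v1 (x, y))"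
          using even_box_py_odd[OF assms xy] v1[OF xy] v1[of x "- y"] xy by (simp add: neg_box2)
        then show ?thesis using False by (simp add: v_def)
      qed simp
    qed
    show "py w (x, y) * (1 - y\<^sup>2)\<^sup>2 = 2 * y * v (x, y)" if "(x, y) \<in> box2 2" for x y
      unfolding v1[OF that] v_def by (simp add: power2_eq_square)
  qed
qed

section \<open>Seeley's extension of an even function read through \<open>fold_param\<close>\<close>

context
  fixes a b :: "nat \<Rightarrow> real"
  assumes b_pos: "\<And>k. b k > 0" and ab_summable: "\<And>j. summable (\<lambda>k. \<bar>a k\<bar> * b k ^ j)"
    and ab_sums: "\<And>j. (\<lambda>k. a k * (- b k) ^ j) sums 1"
begin

text \<open>Below the axis, a weighted sum of dilated reflections of the values above it. The index
  \<open>j\<close> counts derivatives in the second variable: each brings out a factor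
  \<open>- b k\<close>, and the same family of operators describes all derivatives.\<close>

definition seeley :: "nat \<Rightarrow> (real \<times> real \<Rightarrow> real) \<Rightarrow> real \<times> real \<Rightarrow> real" where
  "seeley j w z = (if snd z \<ge> 0 then w (fst z, fold_param (snd z))
     else \<Sum>k. a k * (- b k) ^ j * w (fst z, fold_param (b k * - snd z)))"

lemma even_box_bounded:
  assumes "even_box w"
  obtains C where "C \<ge> 0" "\<And>x y. \<bar>x\<bar> \<le> 1 \<Longrightarrow> \<bar>y\<bar> \<le> 1 \<Longrightarrow> \<bar>w (x, y)\<bar> \<le> C"
proof -
  have "continuous_on (box2 2) w" using assms Ck_on_imp_continuous unfolding even_box_def by blast
  then have "continuous_on ({-1..1} \<times> {-1..1}) w"
    by (rule continuous_on_subset) (auto simp: box2_def)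
  then have "bounded (w ` ({-1..1} \<times> {-1..1}))"
    by (intro compact_imp_bounded compact_continuous_image compact_Times) auto
  then obtain C where C: "\<forall>z\<in>{-1..1} \<times> {-1..1}. norm (w z) \<le> C"
    unfolding bounded_iff by blast
  show ?thesis
  proof (rule that[of "max C 0"])
    show "\<bar>w (x, y)\<bar> \<le> max C 0" if "\<bar>x\<bar> \<le> 1" "\<bar>y\<bar> \<le> 1" for x y
      using C[rule_format, of "(x, y)"] that by (auto simp: abs_le_iff)
  qed simp
qed

lemma seeley_term_bound:
  assumes "even_box w"
  obtains C where "C \<ge> 0"
    "\<And>k x y. \<bar>x\<bar> \<le> 1 \<Longrightarrow> 0 \<le> y \<Longrightarrow> norm (a k * (- b k) ^ j * w (x, fold_param y)) \<le> C * (\<bar>a k\<bar> * b k ^ j)"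
proof -
  obtain C where C: "C \<ge> 0" "\<And>x y. \<bar>x\<bar> \<le> 1 \<Longrightarrow> \<bar>y\<bar> \<le> 1 \<Longrightarrow> \<bar>w (x, y)\<bar> \<le> C"
    using assms by (rule even_box_bounded) blast
  show ?thesis
  proof (rule that[OF C(1)])
    fix k and x y :: real assume "\<bar>x\<bar> \<le> 1" "0 \<le> y"
    then have "\<bar>w (x, fold_param y)\<bar> \<le> C" using fold_param_bounds[of y] by (intro C(2)) auto
    moreover have "\<bar>a k * (- b k) ^ j\<bar> = \<bar>a k\<bar> * b k ^ j"
      using b_pos[of k] by (simp add: abs_mult power_abs)
    ultimately show "norm (a k * (- b k) ^ j * w (x, fold_param y)) \<le> C * (\<bar>a k\<bar> * b k ^ j)"
      using b_pos[of k] unfolding real_norm_def abs_mult[of _ "w _"]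
      by (subst mult.commute) (simp add: mult_right_mono)
  qed
qed

lemma seeley_continuous:
  assumes "even_box w"
  shows "continuous_on ({-1<..<1} \<times> UNIV) (seeley j w)"
proof -
  let ?A = "{-1<..<1 :: real} \<times> (UNIV :: real set)"
  have cw: "continuous_on (box2 2) w" using assms Ck_on_imp_continuous unfolding even_box_def by blast
  have ct: "continuous_on ?A (\<lambda>z. w (fst z, fold_param (c * max (s * snd z) 0)))" if "c \<ge> 0" for c s
  proof (rule continuous_on_compose2[OF cw])
    have nn: "0 \<le> c * max (s * y) 0" for y using that by simp
    then show "(\<lambda>z. (fst z, fold_param (c * max (s * snd z) 0))) ` ?A \<subseteq> box2 2"
      by (auto intro!: fold_param_box2)
    have "1 + c * max (s * y) 0 \<noteq> 0" for y using nn[of y] by linarith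
    then show "continuous_on ?A (\<lambda>z. (fst z, fold_param (c * max (s * snd z) 0)))"
      unfolding fold_param_def by (intro continuous_intros) auto
  qed
  obtain C where C: "C \<ge> 0"
    "\<And>k x y. \<bar>x\<bar> \<le> 1 \<Longrightarrow> 0 \<le> y \<Longrightarrow> norm (a k * (- b k) ^ j * w (x, fold_param y)) \<le> C * (\<bar>a k\<bar> * b k ^ j)"
    using assms by (rule seeley_term_bound) blast
  let ?f = "\<lambda>k z. a k * (- b k) ^ j * w (fst z, fold_param (b k * max ((-1) * snd z) 0))"
  have "uniform_limit ?A (\<lambda>n z. \<Sum>k<n. ?f k z) (\<lambda>z. \<Sum>k. ?f k z) sequentially"
  proof (rule Weierstrass_m_test)
    show "norm (?f k z) \<le> C * (\<bar>a k\<bar> * b k ^ j)" if "z \<in> ?A" for k z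
      using that b_pos[of k] by (intro C(2)) auto
    show "summable (\<lambda>k. C * (\<bar>a k\<bar> * b k ^ j))" by (intro summable_mult ab_summable)
  qed
  moreover have "continuous_on ?A (?f k)" for k
    by (intro continuous_on_mult_left ct less_imp_le[OF b_pos])
  then have "\<forall>\<^sub>F n in sequentially. continuous_on ?A (\<lambda>z. \<Sum>k<n. ?f k z)"
    by (intro always_eventually allI continuous_on_sum)
  ultimately have "continuous_on ?A (\<lambda>z. \<Sum>k. ?f k z)"
    by (rule uniform_limit_theorem[OF _ _ trivial_limit_sequentially, rotated])
  \<comment> \<open>One formula for both half-planes. Above the axis all arguments in the series are
    clamped to 0, so by the moment condition the series equals \<open>w (x, 0)\<close>, which the
    last term removes; below the axis the first and last terms cancel.\<close>
  then have "continuous_on ?A (\<lambda>z. w (fst z, fold_param (1 * max (1 * snd z) 0)) + (\<Sum>k. ?f k z)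
      - w (fst z, fold_param (0 * max (1 * snd z) 0)))"
    by (intro continuous_on_add continuous_on_diff ct) auto
  then show ?thesis
  proof (rule continuous_on_eq)
    fix z assume "z \<in> ?A"
    show "w (fst z, fold_param (1 * max (1 * snd z) 0)) + (\<Sum>k. ?f k z)
      - w (fst z, fold_param (0 * max (1 * snd z) 0)) = seeley j w z"
    proof (cases "snd z \<ge> 0")
      case True
      then have "(\<lambda>k. ?f k z) = (\<lambda>k. a k * (- b k) ^ j * w (fst z, 0))" by (simp add: max_def)
      also have "\<dots> sums (1 * w (fst z, 0))" by (intro sums_mult2 ab_sums)
      finally have "(\<Sum>k. ?f k z) = w (fst z, 0)" by (simp add: sums_iff)
      then show ?thesis using True by (simp add: seeley_def max_def)
    next
      case False
      then show ?thesis by (simp add: seeley_def max_def)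
    qed
  qed
qed

lemma seeley_DERIV_x:
  assumes "even_box w" "\<bar>x\<bar> < 1"
  shows "((\<lambda>s. seeley j w (s, y)) has_field_derivative seeley j (px w) (x, y)) (at x)"
proof -
  have d: "((\<lambda>s. w (s, fold_param u)) has_field_derivative px w (t, fold_param u)) (at t)"
    if "\<bar>t\<bar> < 2" "0 \<le> u" for t u
    by (rule smooth_germ_DERIV_x, rule even_box_smooth_germ[OF assms(1)], rule fold_param_box2) (use that in auto)
  show ?thesis
  proof (cases "y \<ge> 0")
    case True
    then show ?thesis using d[of x y] assms(2) by (simp add: seeley_def)
  next
    case False
    obtain C where C: "C \<ge> 0"
      "\<And>k x y. \<bar>x\<bar> \<le> 1 \<Longrightarrow> 0 \<le> y \<Longrightarrow> norm (a k * (- b k) ^ j * w (x, fold_param y)) \<le> C * (\<bar>a k\<bar> * b k ^ j)"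
      using assms(1) by (rule seeley_term_bound) blast
    obtain C' where C': "C' \<ge> 0"
      "\<And>k x y. \<bar>x\<bar> \<le> 1 \<Longrightarrow> 0 \<le> y \<Longrightarrow> norm (a k * (- b k) ^ j * px w (x, fold_param y)) \<le> C' * (\<bar>a k\<bar> * b k ^ j)"
      using even_box_px[OF assms(1)] by (rule seeley_term_bound) blast
    have nn: "0 \<le> b k * - y" for k using False b_pos[of k] by (simp add: mult_nonneg_nonpos less_imp_le)
    have "((\<lambda>s. \<Sum>k. a k * (- b k) ^ j * w (s, fold_param (b k * - y))) has_field_derivative
        (\<Sum>k. a k * (- b k) ^ j * px w (x, fold_param (b k * - y)))) (at x)"
    proof (rule has_field_derivative_series'(2)[where S = "{-1<..<1}" and x0 = x and x = x
          and f' = "\<lambda>k s. a k * (- b k) ^ j * px w (s, fold_param (b k * - y))"])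
      show "((\<lambda>s. a n * (- b n) ^ j * w (s, fold_param (b n * - y))) has_real_derivative
          a n * (- b n) ^ j * px w (t, fold_param (b n * - y))) (at t within {- 1<..<1})"
        if "t \<in> {- 1<..<1}" for n t
        by (rule has_field_derivative_at_within[OF DERIV_cmult[OF d[OF _ nn]]]) (use that in auto)
      show "uniformly_convergent_on {- 1<..<1} (\<lambda>n x. \<Sum>k<n. a k * (- b k) ^ j * px w (x, fold_param (b k * - y)))"
        by (rule Weierstrass_m_test'[OF _ summable_mult[OF ab_summable[of j], of C']]) (intro C'(2) nn, auto)
      show "summable (\<lambda>k. a k * (- b k) ^ j * w (x, fold_param (b k * - y)))"
        by (rule summable_comparison_test'[OF summable_mult[OF ab_summable[of j], of C], of 0]) (intro C(2) nn, use assms in auto)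
    qed (use assms in \<open>auto simp: interior_open\<close>)
    then show ?thesis using False by (simp add: seeley_def)
  qed
qed

text \<open>Off the axis this is the chain rule, termwise below it. On the axis the two one-sided
  formulas are joined by \<open>DERIV_removable\<close>, whose continuity hypotheses hold because
  the moment conditions hold for \<open>j\<close> and for \<open>Suc j\<close>.\<close>

lemma seeley_DERIV_y:
  assumes w: "even_box w" and v: "even_box v"
    and wv: "\<And>x y. (x, y) \<in> box2 2 \<Longrightarrow> py w (x, y) * (1 - y\<^sup>2)\<^sup>2 = 2 * y * v (x, y)"
    and x: "\<bar>x\<bar> < 1"
  shows "((\<lambda>s. seeley j w (x, s)) has_field_derivative seeley (Suc j) v (x, y)) (at y)"
proof -
  have d: "((\<lambda>s. w (x, fold_param s)) has_field_derivative v (x, fold_param u)) (at u)" if "0 < u" for u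
  proof -
    have bx: "(x, fold_param u) \<in> box2 2" using x that by (intro fold_param_box2) auto
    have "((\<lambda>s. w (x, fold_param s)) has_field_derivative
        py w (x, fold_param u) * ((1 - (fold_param u)\<^sup>2)\<^sup>2 / (2 * fold_param u))) (at u)"
      by (rule DERIV_chain2[where f = "\<lambda>s. w (x, s)" and g = fold_param])
        (auto intro!: smooth_germ_DERIV_y even_box_smooth_germ[OF w] bx DERIV_fold_param that)
    moreover have "py w (x, fold_param u) * ((1 - (fold_param u)\<^sup>2)\<^sup>2 / (2 * fold_param u)) = v (x, fold_param u)"
      using wv[OF bx] DERIV_fold_param(1)[OF that] by (simp add: divide_simps mult_ac)
    ultimately show ?thesis by simp
  qed
  have nz: "((\<lambda>s. seeley j w (x, s)) has_field_derivative seeley (Suc j) v (x, y)) (at y)" if "y \<noteq> 0" for y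
  proof (cases "y > 0")
    case True
    have "((\<lambda>s. seeley j w (x, s)) has_field_derivative v (x, fold_param y)) (at y)"
      by (rule has_field_derivative_transform_within_open[OF d[OF True], of "{0<..}"])
        (use True in \<open>auto simp: seeley_def\<close>)
    then show ?thesis using True by (simp add: seeley_def)
  next
    case False
    then have y: "y < 0" using that by simp
    obtain C where C: "C \<ge> 0"
      "\<And>k x y. \<bar>x\<bar> \<le> 1 \<Longrightarrow> 0 \<le> y \<Longrightarrow> norm (a k * (- b k) ^ j * w (x, fold_param y)) \<le> C * (\<bar>a k\<bar> * b k ^ j)"
      using w by (rule seeley_term_bound) blast
    obtain C' where C': "C' \<ge> 0"
      "\<And>k x y. \<bar>x\<bar> \<le> 1 \<Longrightarrow> 0 \<le> y \<Longrightarrow> norm (a k * (- b k) ^ Suc j * v (x, fold_param y)) \<le> C' * (\<bar>a k\<bar> * b k ^ Suc j)"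
      using v by (rule seeley_term_bound) blast
    have pos: "0 < b k * - u" if "u < 0" for k u using that b_pos[of k] by (simp add: mult_pos_neg)
    have "((\<lambda>s. \<Sum>k. a k * (- b k) ^ j * w (x, fold_param (b k * - s))) has_field_derivative
        (\<Sum>k. a k * (- b k) ^ Suc j * v (x, fold_param (b k * - y)))) (at y)"
    proof (rule has_field_derivative_series'(2)[where S = "{..<0}" and x0 = y and x = y
          and f' = "\<lambda>k s. a k * (- b k) ^ Suc j * v (x, fold_param (b k * - s))"])
      show "((\<lambda>s. a n * (- b n) ^ j * w (x, fold_param (b n * - s))) has_real_derivative
          a n * (- b n) ^ Suc j * v (x, fold_param (b n * - t))) (at t within {..<0})"
        if "t \<in> {..<0}" for n t
      proof -
        have "((\<lambda>s. w (x, fold_param (b n * - s))) has_real_derivative v (x, fold_param (b n * - t)) * - b n) (at t)"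
          by (rule DERIV_chain2[where f = "\<lambda>u. w (x, fold_param u)" and g = "\<lambda>s. b n * - s"])
            (use that in \<open>auto intro!: derivative_eq_intros d mult_pos_neg b_pos\<close>)
        from has_field_derivative_at_within[OF DERIV_cmult[OF this, of "a n * (- b n) ^ j"]]
        show ?thesis by (simp only: power_Suc mult_ac)
      qed
      show "uniformly_convergent_on {..<0} (\<lambda>n s. \<Sum>k<n. a k * (- b k) ^ Suc j * v (x, fold_param (b k * - s)))"
        by (rule Weierstrass_m_test'[OF _ summable_mult[OF ab_summable[of "Suc j"], of C']])
          (intro C'(2) less_imp_le[OF pos], use x in auto)
      show "summable (\<lambda>k. a k * (- b k) ^ j * w (x, fold_param (b k * - y)))"
        by (rule summable_comparison_test'[OF summable_mult[OF ab_summable[of j], of C], of 0])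
          (intro C(2) less_imp_le[OF pos], use x y in auto)
    qed (use y in \<open>auto simp: interior_open\<close>)
    then have "((\<lambda>s. seeley j w (x, s)) has_field_derivative
        (\<Sum>k. a k * (- b k) ^ Suc j * v (x, fold_param (b k * - y)))) (at y)"
      by (rule has_field_derivative_transform_within_open[of _ _ _ "{..<0}"]) (use y in \<open>auto simp: seeley_def\<close>)
    then show ?thesis using y by (simp add: seeley_def)
  qed
  have c: "isCont (\<lambda>s. seeley i u (x, s)) 0" if "even_box u" for i u
  proof -
    have "continuous_on UNIV (\<lambda>s. seeley i u (x, s))"
      by (rule continuous_on_compose2[OF seeley_continuous[OF that]]) (use x in \<open>auto intro!: continuous_intros\<close>)
    then show ?thesis by (simp add: continuous_on_eq_continuous_at)
  qed
  show ?thesis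
  proof (cases "y = 0")
    case True
    show ?thesis unfolding True by (rule DERIV_removable[OF nz c[OF w] c[OF v]])
  qed (rule nz)
qed

text \<open>Both partial derivatives of an extension are again extensions, of the even functions
  \<open>px w\<close> and \<open>v\<close>; hence the induction on \<open>k\<close> with
  \<open>w\<close> and \<open>j\<close> arbitrary.\<close>

lemma Ck_on_seeley:
  assumes "even_box w"
  shows "Ck_on k (seeley j w) ({-1<..<1} \<times> UNIV)"
  using assms
proof (induction k arbitrary: w j)
  case 0
  then show ?case by (simp add: seeley_continuous)
next
  case (Suc k)
  obtain v where v: "even_box v" "\<And>x y. (x, y) \<in> box2 2 \<Longrightarrow> py w (x, y) * (1 - y\<^sup>2)\<^sup>2 = 2 * y * v (x, y)"
    using Suc.prems by (rule fold_deriv_exists) blast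
  show ?case
  proof (rule Ck_on_partialsI)
    show "open ({-1<..<1 :: real} \<times> (UNIV :: real set))"
      by (intro open_Times open_greaterThanLessThan open_UNIV)
    show "((\<lambda>s. seeley j w (s, y)) has_field_derivative seeley j (px w) (x, y)) (at x)"
      if "(x, y) \<in> {-1<..<1} \<times> UNIV" for x y
      by (rule seeley_DERIV_x[OF Suc.prems]) (use that in auto)
    show "((\<lambda>s. seeley j w (x, s)) has_field_derivative seeley (Suc j) v (x, y)) (at y)"
      if "(x, y) \<in> {-1<..<1} \<times> UNIV" for x y
      by (rule seeley_DERIV_y[OF Suc.prems v]) (use that in auto)
    show "Ck_on k (seeley j (px w)) ({-1<..<1} \<times> UNIV)"
      by (rule Suc.IH[OF even_box_px[OF Suc.prems]])
    show "Ck_on k (seeley (Suc j) v) ({-1<..<1} \<times> UNIV)"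
      by (rule Suc.IH[OF v(1)])
  qed
qed

end

text \<open>Whitney's theorem on even functions, with a parameter. After rescaling to a large box,
  Seeley's extension supplies values for negative squares.\<close>

lemma even_germ_factors_square:
  assumes "smooth_germ w (0 :: real \<times> real)" "\<forall>\<^sub>F z in nhds 0. w (fst z, - snd z) = (w z :: real)"
  obtains h where "smooth_germ h 0" "\<forall>\<^sub>F z in nhds 0. w z = h (fst z, (snd z)\<^sup>2)"
proof -
  obtain a b :: "nat \<Rightarrow> real" where ab: "\<And>k. b k > 0" "\<And>j. summable (\<lambda>k. \<bar>a k\<bar> * b k ^ j)"
    "\<And>j. (\<lambda>k. a k * (- b k) ^ j) sums 1" by (rule seeley_coefficients) blast
  obtain r1 where r1: "r1 > 0" "\<And>k. Ck_on k w (box2 r1)" by (rule smooth_germ_box2[OF assms(1)]) blast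
  obtain r2 where r2: "r2 > 0" "\<And>z. z \<in> box2 r2 \<Longrightarrow> w (fst z, - snd z) = w z"
    using assms(2) by (rule eventually_nhds_box2E) blast
  \<comment> \<open>Halved so that the dilation by \<open>d\<close> sends the box of radius 2 into
    both neighbourhoods.\<close>
  define d where "d = min r1 r2 / 2"
  have d: "d > 0" using r1 r2 by (simp add: d_def)
  have scale: "d *\<^sub>R z \<in> box2 r1 \<inter> box2 r2" if "z \<in> box2 2" for z
  proof -
    obtain x y where z: "z = (x, y)" by (cases z)
    have "\<bar>x\<bar> < 2" "\<bar>y\<bar> < 2" using that by (simp_all add: z mem_box2)
    then have "d * \<bar>x\<bar> < d * 2" "d * \<bar>y\<bar> < d * 2" using d by simp_all
    then show ?thesis using d by (simp add: z mem_box2 abs_mult d_def)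
  qed
  define W where "W z = w (d *\<^sub>R z)" for z
  have W: "even_box W"
    unfolding even_box_def
  proof (intro conjI allI impI)
    show "Ck_on k W (box2 2)" for k
      unfolding W_def
      by (rule Ck_on_compose[OF open_box2 Ck_on_linear[OF bounded_linear_scaleR_right open_box2 Ck_on_id[OF open_box2]] r1(2)])
        (use scale in blast)
    show "W (x, - y) = W (x, y)" if "(x, y) \<in> box2 2" for x y
      using r2(2)[of "d *\<^sub>R (x, y)"] scale[OF that] by (simp add: W_def)
  qed
  note ck = Ck_on_seeley[OF ab W, of _ 0]
  define H where "H = seeley a b 0 W"
  \<comment> \<open>The substitution \<open>u / (1 - u)\<close> undoes \<open>fold_param\<close> up
    to the square root: \<open>fold_param (u / (1 - u)) = sqrt u\<close>.\<close>
  define h where "h z = H (fst z / d, snd z / d\<^sup>2 / (1 - snd z / d\<^sup>2))" for z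
  have sH: "smooth_germ H (0, 0)" unfolding H_def
    by (rule Ck_on_imp_smooth_germ[OF ck]) (simp_all add: open_Times)
  have "smooth_germ h 0"
    unfolding h_def[abs_def]
  proof (rule smooth_germ_compose[where g = H])
    show "smooth_germ H (fst 0 / d, snd 0 / d\<^sup>2 / (1 - snd 0 / d\<^sup>2))" using sH by simp
    show "smooth_germ (\<lambda>z. (fst z / d, snd z / d\<^sup>2 / (1 - snd z / d\<^sup>2))) 0"
      by (intro smooth_germ_intros) (use d in simp_all)
  qed
  moreover have "\<forall>\<^sub>F z in nhds 0. w z = h (fst z, (snd z)\<^sup>2)"
  proof (rule eventually_nhds_box2[OF d])
    fix z assume "z \<in> box2 d"
    then obtain x y where z: "z = (x, y)" "\<bar>x\<bar> < d" "\<bar>y\<bar> < d" by (cases z) (auto simp: mem_box2)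
    have "\<bar>y / d\<bar> < 1" using z d by (simp add: abs_divide)
    then have u: "0 \<le> (y / d)\<^sup>2" "(y / d)\<^sup>2 < 1" by (simp_all only: abs_square_less_1 zero_le_power2)
    have "h (x, y\<^sup>2) = H (x / d, (y / d)\<^sup>2 / (1 - (y / d)\<^sup>2))" by (simp add: h_def power_divide)
    also have "\<dots> = W (x / d, sqrt ((y / d)\<^sup>2))"
      using u fold_param_eq[OF u] by (simp add: H_def seeley_def[OF ab])
    also have "\<dots> = w (x, \<bar>y\<bar>)" using d by (simp add: W_def abs_divide)
    also have "\<dots> = w (x, y)"
      using r2(2)[of "(x, y)"] z by (cases "y \<ge> 0") (auto simp: d_def mem_box2)
    finally show "w z = h (fst z, (snd z)\<^sup>2)" by (simp add: z)
  qed
  ultimately show ?thesis by (rule that)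
qed

section \<open>Partial derivatives of germs in the plane\<close>

lemma eventually_nhds_curve:
  "isCont c a \<Longrightarrow> c a = b \<Longrightarrow> \<forall>\<^sub>F z in nhds b. P z \<Longrightarrow> \<forall>\<^sub>F x in nhds a. P (c x)"
  using eventually_nhds_isCont by blast

lemma has_derivative_planeI:
  assumes "(F has_derivative (\<lambda>v. fst v * p + snd v * q)) (at (z :: real \<times> real))"
  shows "px F z = p" "py F z = q"
  using has_derivative_px_py[OF assms] by simp_all

lemma smooth_germ_plane_real:
  fixes F :: "real \<times> real \<Rightarrow> real"
  assumes "smooth_germ F z"
  shows "(F has_derivative (\<lambda>v. fst v * px F z + snd v * py F z)) (at z)"
  using smooth_germ_plane[OF assms] by simp

lemma px_py_cong:
  assumes "\<forall>\<^sub>F z in nhds (a :: real \<times> real). F z = G z"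
  shows "px F a = px G a" "py F a = py G a"
proof -
  have "(F has_derivative D) (at a) \<longleftrightarrow> (G has_derivative D) (at a)" for D
    using has_derivative_cong_eventually[OF _ assms]
      has_derivative_cong_eventually[OF _ eventually_mono[OF assms], of G D F] by (metis (full_types))
  then have "frechet_derivative F (at a) = frechet_derivative G (at a)"
    unfolding frechet_derivative_def by simp
  then show "px F a = px G a" "py F a = py G a" unfolding px_def py_def by simp_all
qed

lemma px_py_cong_eventually:
  assumes "\<forall>\<^sub>F z in nhds (a :: real \<times> real). F z = G z"
  shows "\<forall>\<^sub>F z in nhds a. px F z = px G z" "\<forall>\<^sub>F z in nhds a. py F z = py G z"
proof -
  have "\<forall>\<^sub>F z in nhds a. \<forall>\<^sub>F z' in nhds z. F z' = G z'"
    using assms by (simp add: eventually_eventually)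
  then show "\<forall>\<^sub>F z in nhds a. px F z = px G z" "\<forall>\<^sub>F z in nhds a. py F z = py G z"
    by (auto elim!: eventually_mono intro: px_py_cong)
qed

context
  fixes f g :: "real \<times> real \<Rightarrow> real" and z :: "real \<times> real"
  assumes fg: "smooth_germ f z" "smooth_germ g z"
begin

lemma px_py_add: "px (\<lambda>z. f z + g z) z = px f z + px g z" "py (\<lambda>z. f z + g z) z = py f z + py g z"
  using has_derivative_px_py[OF has_derivative_add[OF fg[THEN smooth_germ_plane_real]]] by simp_all

lemma px_py_diff: "px (\<lambda>z. f z - g z) z = px f z - px g z" "py (\<lambda>z. f z - g z) z = py f z - py g z"
  using has_derivative_px_py[OF has_derivative_diff[OF fg[THEN smooth_germ_plane_real]]] by simp_all

lemma px_py_mult: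
  "px (\<lambda>z. f z * g z) z = px f z * g z + f z * px g z"
  "py (\<lambda>z. f z * g z) z = py f z * g z + f z * py g z"
  using has_derivative_px_py[OF has_derivative_mult[OF fg[THEN smooth_germ_plane_real]]] by simp_all

lemma px_py_compose:
  fixes F :: "real \<times> real \<Rightarrow> real"
  assumes F: "smooth_germ F (f z, g z)"
  shows "px (\<lambda>z. F (f z, g z)) z = px F (f z, g z) * px f z + py F (f z, g z) * px g z"
    "py (\<lambda>z. F (f z, g z)) z = px F (f z, g z) * py f z + py F (f z, g z) * py g z"
proof -
  have "((\<lambda>z. (f z, g z)) has_derivative (\<lambda>v. (fst v * px f z + snd v * py f z, fst v * px g z + snd v * py g z))) (at z)"
    by (intro has_derivative_Pair fg[THEN smooth_germ_plane_real])
  from has_derivative_compose[OF this smooth_germ_plane_real[OF F]]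
  have "((\<lambda>z. F (f z, g z)) has_derivative (\<lambda>v. fst v * (px F (f z, g z) * px f z + py F (f z, g z) * px g z)
      + snd v * (px F (f z, g z) * py f z + py F (f z, g z) * py g z))) (at z)"
    by (rule has_derivative_eq_rhs) (simp add: algebra_simps)
  from has_derivative_planeI[OF this]
  show "px (\<lambda>z. F (f z, g z)) z = px F (f z, g z) * px f z + py F (f z, g z) * px g z"
    "py (\<lambda>z. F (f z, g z)) z = px F (f z, g z) * py f z + py F (f z, g z) * py g z" .
qed

end

lemma px_py_coordinates [simp]:
  "px fst z = 1" "py fst z = 0" "px snd z = 0" "py snd z = 1" "px (\<lambda>z. c) z = 0" "py (\<lambda>z. c) z = 0"
  by (rule has_derivative_px_py[THEN trans], (rule derivative_intros)+, simp)+

lemma smooth_germ_coordinates: "smooth_germ fst z" "smooth_germ snd z"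
  using smooth_germ_fst[OF smooth_germ_id[of z]] smooth_germ_snd[OF smooth_germ_id[of z]] by simp_all

lemma smooth_germ_graph:
  fixes F :: "real \<times> real \<Rightarrow> 'a::real_normed_vector" and \<theta> :: "real \<Rightarrow> real"
  assumes "smooth_germ F (x, \<theta> x)" "smooth_germ \<theta> x"
  shows "smooth_germ (\<lambda>s. F (s, \<theta> s)) x"
  by (rule smooth_germ_compose[where g = F and f = "\<lambda>s. (s, \<theta> s)"])
    (intro assms smooth_germ_Pair smooth_germ_id)+

lemma DERIV_graph:
  fixes F :: "real \<times> real \<Rightarrow> real"
  assumes "smooth_germ F (x, \<theta> x)" "(\<theta> has_field_derivative d) (at x)"
  shows "((\<lambda>s. F (s, \<theta> s)) has_field_derivative px F (x, \<theta> x) + py F (x, \<theta> x) * d) (at x)"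
proof -
  have "((\<lambda>s. (s, \<theta> s)) has_derivative (\<lambda>s. (s, d * s))) (at x)"
    using assms(2) by (intro has_derivative_Pair has_derivative_ident) (simp add: has_field_derivative_def)
  from has_derivative_compose[OF this smooth_germ_plane_real[OF assms(1)]]
  show ?thesis unfolding has_field_derivative_def
    by (rule has_derivative_eq_rhs) (auto simp: algebra_simps)
qed

lemma smooth_germ_DERIV:
  fixes \<theta> :: "real \<Rightarrow> real"
  assumes "smooth_germ \<theta> x"
  obtains d where "(\<theta> has_field_derivative d) (at x)"
  using smooth_germ_derivative[OF assms] differentiableI real_differentiable_def by blast

lemma smooth_germ_of_fst: "smooth_germ \<theta> (fst z) \<Longrightarrow> smooth_germ (\<lambda>z. \<theta> (fst z)) z" for \<theta> :: "real \<Rightarrow> real"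
  by (rule smooth_germ_compose[OF _ smooth_germ_coordinates(1)])

text \<open>Source changes that keep the first coordinate. Their inverses keep it too and are given
  by a single function \<open>\<eta>\<close>, which is what the later formulas use.\<close>

lemma fibered_diffeo:
  fixes \<phi> :: "real \<times> real \<Rightarrow> real"
  assumes \<phi>: "smooth_germ \<phi> 0" "\<phi> 0 = 0" "py \<phi> 0 \<noteq> 0"
  shows "diffeo_germ (\<lambda>z. (fst z, \<phi> z)) 0"
    and "\<exists>\<eta>. smooth_germ \<eta> 0 \<and> \<eta> 0 = 0 \<and> py \<eta> 0 = 1 / py \<phi> 0 \<and>
      (\<forall>\<^sub>F y in nhds 0. \<phi> (fst y, \<eta> y) = snd y) \<and> (\<forall>\<^sub>F z in nhds 0. \<eta> (fst z, \<phi> z) = snd z)"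
proof -
  let ?H = "\<lambda>z. (fst z, \<phi> z)"
  have H: "smooth_germ ?H 0" by (intro smooth_germ_Pair smooth_germ_coordinates \<phi>)
  have D: "(?H has_derivative (\<lambda>v. (fst v, fst v * px \<phi> 0 + snd v * py \<phi> 0))) (at 0)"
    by (intro has_derivative_Pair smooth_germ_plane_real[OF \<phi>(1)]) (rule derivative_intros)+
  have inj: "inj (\<lambda>v. (fst v, fst v * px \<phi> 0 + snd v * py \<phi> 0))"
    using \<phi>(3) by (auto simp: inj_def)
  show "diffeo_germ ?H 0" by (rule diffeo_germ_plane[OF H D inj])
  have H0: "?H 0 = 0" by (simp add: \<phi>(2) prod_eq_iff)
  obtain g where "smooth_germ g (?H 0)" "\<forall>\<^sub>F z in nhds 0. g (?H z) = z" "\<forall>\<^sub>F y in nhds (?H 0). ?H (g y) = y"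
    by (rule inverse_germ_plane[OF H D inj])
  then have g: "smooth_germ g 0" "\<forall>\<^sub>F z in nhds 0. g (?H z) = z" "\<forall>\<^sub>F y in nhds 0. ?H (g y) = y"
    unfolding H0 .
  have g0: "g 0 = 0" using eventually_nhds_x_imp_x[OF g(2)] H0 by simp
  define \<eta> where "\<eta> y = snd (g y)" for y
  have \<eta>0: "\<eta> 0 = 0" by (simp add: \<eta>_def g0)
  have s: "smooth_germ \<eta> 0" unfolding \<eta>_def[abs_def] by (rule smooth_germ_snd[OF g(1)])
  have e1: "\<forall>\<^sub>F y in nhds 0. \<phi> (fst y, \<eta> y) = snd y"
    using g(3)
  proof eventually_elim
    case (elim y)
    then have "fst (g y) = fst y" "\<phi> (g y) = snd y" by (simp_all add: prod_eq_iff)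
    then show ?case unfolding \<eta>_def by (metis prod.collapse)
  qed
  have e2: "\<forall>\<^sub>F z in nhds 0. \<eta> (fst z, \<phi> z) = snd z"
    using g(2) by eventually_elim (simp add: \<eta>_def)
  have "py (\<lambda>y. \<phi> (fst y, \<eta> y)) 0 = py snd 0" by (rule px_py_cong(2)[OF e1])
  moreover have "smooth_germ \<phi> (fst (0 :: real \<times> real), \<eta> 0)"
    using \<phi>(1) by (simp add: \<eta>0 flip: zero_prod_def)
  note px_py_compose(2)[OF smooth_germ_coordinates(1) s this]
  ultimately have "py \<phi> 0 * py \<eta> 0 = 1" by (simp add: \<eta>0 flip: zero_prod_def)
  then have "py \<eta> 0 = 1 / py \<phi> 0" using \<phi>(3) by (simp add: field_simps)
  then show "\<exists>\<eta>. smooth_germ \<eta> 0 \<and> \<eta> 0 = 0 \<and> py \<eta> 0 = 1 / py \<phi> 0 \<and>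
      (\<forall>\<^sub>F y in nhds 0. \<phi> (fst y, \<eta> y) = snd y) \<and> (\<forall>\<^sub>F z in nhds 0. \<eta> (fst z, \<phi> z) = snd z)"
    using s e1 e2 \<eta>0 by (intro exI[of _ \<eta>]) simp
qed

text \<open>The zero level of \<open>C\<close> becomes the horizontal axis in the coordinates
  \<open>(x, C)\<close>; the slope comes from differentiating the identity along it.\<close>

lemma implicit_function_germ:
  fixes C :: "real \<times> real \<Rightarrow> real"
  assumes C: "smooth_germ C 0" "C 0 = 0" "py C 0 \<noteq> 0"
  obtains \<theta> where "smooth_germ \<theta> 0" "\<theta> 0 = 0" "\<forall>\<^sub>F x in nhds 0. C (x, \<theta> x) = 0"
    "(\<theta> has_field_derivative - px C 0 / py C 0) (at 0)"
proof -
  obtain \<eta> where \<eta>: "smooth_germ \<eta> 0" "\<eta> 0 = 0" "\<forall>\<^sub>F y in nhds 0. C (fst y, \<eta> y) = snd y"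
    using fibered_diffeo(2)[OF C] by blast
  define \<theta> where "\<theta> x = \<eta> (x, 0)" for x
  have s: "smooth_germ \<theta> 0" unfolding \<theta>_def[abs_def]
    by (rule smooth_germ_graph) (simp_all add: \<eta>(1) smooth_germ_const flip: zero_prod_def)
  have 0: "\<theta> 0 = 0" by (simp add: \<theta>_def \<eta>(2) flip: zero_prod_def)
  have e: "\<forall>\<^sub>F x in nhds 0. C (x, \<theta> x) = 0"
    using eventually_nhds_curve[where c = "\<lambda>x. (x, 0)" and a = 0, OF _ _ \<eta>(3)] by (simp add: \<theta>_def zero_prod_def)
  obtain d where d: "(\<theta> has_field_derivative d) (at 0)" using s by (rule smooth_germ_DERIV)
  have "((\<lambda>s. C (s, \<theta> s)) has_field_derivative px C (0, \<theta> 0) + py C (0, \<theta> 0) * d) (at 0)"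
    by (rule DERIV_graph[OF _ d]) (simp add: 0 C(1) flip: zero_prod_def)
  moreover have "((\<lambda>s. C (s, \<theta> s)) has_field_derivative 0) (at 0)"
    using has_derivative_cong_eventually[of "\<lambda>_. 0" "\<lambda>_. 0" 0 "\<lambda>x. C (x, \<theta> x)"] e
    by (simp add: has_field_derivative_def eq_commute[of 0] mult_zero_left[abs_def])
  ultimately have "px C 0 + py C 0 * d = 0"
    using DERIV_unique by (simp add: 0 flip: zero_prod_def)
  then have "d = - px C 0 / py C 0" using C(3) by (simp add: field_simps)
  then show ?thesis using that s 0 e d by simp
qed

lemma Hadamard_py:
  fixes F G :: "real \<times> real \<Rightarrow> real"
  assumes "smooth_germ G 0" "\<forall>\<^sub>F z in nhds 0. F z = snd z * G z"
  shows "\<forall>\<^sub>F z in nhds 0. py F z = G z + snd z * py G z"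
  using px_py_cong_eventually(2)[OF assms(2)] smooth_germ_eventually[OF assms(1)]
proof eventually_elim
  case (elim z)
  have "py (\<lambda>z. snd z * G z) z = py snd z * G z + snd z * py G z"
    by (rule px_py_mult(2)[OF smooth_germ_coordinates(2) elim(2)])
  then show ?case using elim(1) by simp
qed

section \<open>The fold normal form\<close>

lemma px_py_of_fst:
  fixes \<theta> :: "real \<Rightarrow> real"
  assumes "smooth_germ \<theta> (fst z)"
  shows "py (\<lambda>z. \<theta> (fst z)) z = 0"
proof -
  have "((\<lambda>z. \<theta> (fst z)) has_derivative (\<lambda>v. frechet_derivative \<theta> (at (fst z)) (fst v))) (at z)"
    by (rule has_derivative_compose[where f = fst and g = \<theta>, OF _ smooth_germ_derivative[OF assms]])
      (rule derivative_intros)+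
  from has_derivative_px_py(2)[OF this] show ?thesis
    using linear_0[OF has_derivative_linear[OF smooth_germ_derivative[OF assms]]] by simp
qed

lemma tendsto_nhds_smooth_germ: "smooth_germ f a \<Longrightarrow> (f \<longlongrightarrow> f a) (nhds a)"
  using smooth_germ_isCont by (simp add: isCont_def tendsto_at_iff_tendsto_nhds)

lemma eventually_nhds_imp_at: "\<forall>\<^sub>F x in nhds a. P x \<Longrightarrow> \<forall>\<^sub>F x in at a. P x"
  by (simp add: eventually_at_filter eventually_mono)

lemma zero_in_plane: "(0 :: real, 0 :: real) = 0"
  by (simp add: zero_prod_def)

text \<open>The Morse lemma with parameter \<open>x\<close>. \<open>\<theta>\<close> is the critical
  curve of \<open>B\<close> in the second variable; two applications of Hadamard's lemma divide
  \<open>B - B (x, \<theta> x)\<close> by the square of the distance to that curve, and the root of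
  the quotient is absorbed into \<open>\<phi>\<close>.\<close>

lemma fold_coordinate:
  fixes B :: "real \<times> real \<Rightarrow> real"
  assumes B: "smooth_germ B 0" "py B 0 = 0" "py (py B) 0 \<noteq> 0"
  obtains \<theta> \<phi> where "smooth_germ \<theta> 0" "\<theta> 0 = 0"
    "(\<theta> has_field_derivative - px (py B) 0 / py (py B) 0) (at 0)"
    "smooth_germ \<phi> 0" "\<phi> 0 = 0" "py \<phi> 0 > 0" "\<And>x. \<phi> (x, \<theta> x) = 0"
    "\<forall>\<^sub>F z in nhds 0. B z = B (fst z, \<theta> (fst z)) + sgn (py (py B) 0) * (\<phi> z)\<^sup>2"
proof -
  let ?C = "py B"
  have sC: "smooth_germ ?C 0" by (rule smooth_germ_py[OF B(1)])
  obtain \<theta> where \<theta>: "smooth_germ \<theta> 0" "\<theta> 0 = 0" "\<forall>\<^sub>F x in nhds 0. ?C (x, \<theta> x) = 0"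
    "(\<theta> has_field_derivative - px ?C 0 / py ?C 0) (at 0)"
    by (rule implicit_function_germ[OF sC B(2,3)])
  define u where "u z = \<theta> (fst z)" for z :: "real \<times> real"
  have su: "smooth_germ u 0" unfolding u_def[abs_def] by (rule smooth_germ_of_fst) (simp add: \<theta>)
  have u0: "u 0 = 0" by (simp add: u_def \<theta>)
  have pyu: "\<forall>\<^sub>F z in nhds 0. py u z = 0"
    using eventually_nhds_isCont[OF smooth_germ_isCont[OF smooth_germ_coordinates(1)], of "\<lambda>x. smooth_germ \<theta> x" 0]
      smooth_germ_eventually[OF \<theta>(1)]
    unfolding u_def[abs_def] by (auto elim!: eventually_mono intro!: px_py_of_fst)
  \<comment> \<open>The shift sends the horizontal axis to the critical curve, where Hadamard's
    lemma can be applied; \<open>s\<close> below is the inverse shift.\<close>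
  define a where "a z = u z + snd z" for z
  have sa: "smooth_germ a 0" unfolding a_def[abs_def] by (intro smooth_germ_intros smooth_germ_coordinates su)
  have a0: "(fst 0, a 0) = (0 :: real \<times> real)" by (simp add: a_def u0 zero_in_plane)
  have pya: "\<forall>\<^sub>F z in nhds 0. py a z = 1"
    using pyu smooth_germ_eventually[OF su]
    by eventually_elim (simp add: a_def[abs_def] px_py_add smooth_germ_coordinates)
  have sBa: "smooth_germ (\<lambda>z. B (fst z, a z)) 0"
    by (rule smooth_germ_compose[where g = B and f = "\<lambda>z. (fst z, a z)"])
      (simp_all only: a0 B smooth_germ_Pair smooth_germ_coordinates sa)
  have sBu: "smooth_germ (\<lambda>z. B (fst z, u z)) 0"
    by (rule smooth_germ_compose[where g = B and f = "\<lambda>z. (fst z, u z)"])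
      (simp_all add: u0 zero_in_plane B smooth_germ_Pair smooth_germ_coordinates su)
  have u0': "(fst 0, u 0) = (0 :: real \<times> real)" by (simp add: u0 zero_in_plane)
  define B1 where "B1 z = B (fst z, a z) - B (fst z, u z)" for z
  have sB1: "smooth_germ B1 0" unfolding B1_def[abs_def] by (rule smooth_germ_diff[OF sBa sBu])
  have ca: "isCont (\<lambda>z. (fst z, a z)) 0" "isCont (\<lambda>z. (fst z, u z)) 0"
    by (intro smooth_germ_isCont smooth_germ_Pair smooth_germ_coordinates sa su)+
  have pyB1: "\<forall>\<^sub>F z in nhds 0. py B1 z = ?C (fst z, a z)"
    using eventually_nhds_curve[OF ca(1) a0 smooth_germ_eventually[OF B(1)]]
      eventually_nhds_curve[OF ca(2) u0' smooth_germ_eventually[OF B(1)]] smooth_germ_eventually[OF sa] smooth_germ_eventually[OF su]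
      smooth_germ_eventually[OF sBa] smooth_germ_eventually[OF sBu] pya pyu
  proof eventually_elim
    case (elim z)
    have "py (\<lambda>z. B (fst z, a z)) z = px B (fst z, a z) * py fst z + ?C (fst z, a z) * py a z"
      by (rule px_py_compose(2)[OF smooth_germ_coordinates(1) elim(3,1)])
    moreover have "py (\<lambda>z. B (fst z, u z)) z = px B (fst z, u z) * py fst z + ?C (fst z, u z) * py u z"
      by (rule px_py_compose(2)[OF smooth_germ_coordinates(1) elim(4,2)])
    ultimately show ?case
      unfolding B1_def[abs_def] using px_py_diff(2)[OF elim(5,6)] elim(7,8) by simp
  qed
  have "\<forall>\<^sub>F x in nhds 0. B1 (x, 0) = 0" by (simp add: B1_def a_def)
  then obtain B2 where B2: "smooth_germ B2 0" "\<forall>\<^sub>F z in nhds 0. B1 z = snd z * B2 z"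
    using Hadamard[OF sB1] by blast
  have e2: "\<forall>\<^sub>F z in nhds 0. ?C (fst z, a z) = B2 z + snd z * py B2 z"
    using pyB1 Hadamard_py[OF B2] by eventually_elim simp
  have "\<forall>\<^sub>F x in nhds 0. ?C (x, \<theta> x) = B2 (x, 0)"
    using eventually_nhds_curve[where c = "\<lambda>x. (x, 0)" and a = 0, OF _ _ e2] by (simp add: a_def u_def zero_in_plane)
  with \<theta>(3) have "\<forall>\<^sub>F x in nhds 0. B2 (x, 0) = 0" by eventually_elim simp
  then obtain B3 where B3: "smooth_germ B3 0" "\<forall>\<^sub>F z in nhds 0. B2 z = snd z * B3 z"
    using Hadamard[OF B2(1)] by blast
  have "\<forall>\<^sub>F z in nhds 0. ?C (fst z, a z) = snd z * (2 * B3 z + snd z * py B3 z)"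
    using e2 B3(2) Hadamard_py[OF B3] by eventually_elim (simp add: algebra_simps)
  moreover have "smooth_germ (\<lambda>z. 2 * B3 z + snd z * py B3 z) 0"
    by (intro smooth_germ_intros smooth_germ_coordinates smooth_germ_py B3)
  ultimately have "\<forall>\<^sub>F z in nhds 0. py (\<lambda>z. ?C (fst z, a z)) z
      = 2 * B3 z + snd z * py B3 z + snd z * py (\<lambda>z. 2 * B3 z + snd z * py B3 z) z"
    by (rule Hadamard_py[rotated])
  from eventually_nhds_x_imp_x[OF this] have "py (\<lambda>z. ?C (fst z, a z)) 0 = 2 * B3 0" by simp
  moreover have "py (\<lambda>z. ?C (fst z, a z)) 0 = py ?C 0"
    using px_py_compose(2)[OF smooth_germ_coordinates(1) sa, of ?C] eventually_nhds_x_imp_x[OF pya]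
    unfolding a0 by (simp add: sC)
  \<comment> \<open>The quotient after two divisions is half of the second derivative at 0. It is
    therefore nonzero, and its absolute value has a smooth square root.\<close>
  ultimately have B30: "B3 0 = py ?C 0 / 2" by simp
  then have B3nz: "B3 0 \<noteq> 0" using B(3) by simp
  define s where "s z = snd z - u z" for z
  have ss: "smooth_germ s 0" unfolding s_def[abs_def] by (intro smooth_germ_intros smooth_germ_coordinates su)
  have s0: "(fst 0, s 0) = (0 :: real \<times> real)" by (simp add: s_def u0 zero_in_plane)
  have cs: "isCont (\<lambda>z. (fst z, s z)) 0"
    by (intro smooth_germ_isCont smooth_germ_Pair smooth_germ_coordinates ss)
  have sB3: "smooth_germ (\<lambda>z. B3 (fst z, s z)) 0"
    by (rule smooth_germ_compose[where g = B3 and f = "\<lambda>z. (fst z, s z)"])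
      (simp_all only: s0 B3 smooth_germ_Pair smooth_germ_coordinates ss)
  define R where "R z = sqrt \<bar>B3 (fst z, s z)\<bar>" for z
  have sR: "smooth_germ R 0" unfolding R_def[abs_def]
    by (intro smooth_germ_sqrt smooth_germ_abs sB3) (simp_all only: s0 B3nz zero_less_abs_iff not_False_eq_True)
  define \<phi> where "\<phi> z = s z * R z" for z
  show ?thesis
  proof (rule that[OF \<theta>(1,2,4)])
    show "smooth_germ \<phi> 0" unfolding \<phi>_def[abs_def] by (rule smooth_germ_mult[OF ss sR])
    show "\<phi> 0 = 0" by (simp add: \<phi>_def s_def u0)
    have "py s 0 = 1" unfolding s_def[abs_def]
      using px_py_diff(2)[OF smooth_germ_coordinates(2) su] eventually_nhds_x_imp_x[OF pyu] by simp
    then have "py \<phi> 0 = R 0" unfolding \<phi>_def[abs_def]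
      using px_py_mult(2)[OF ss sR] by (simp add: s_def u0)
    then show "py \<phi> 0 > 0" using B3nz by (simp only: R_def s0 real_sqrt_gt_0_iff zero_less_abs_iff not_False_eq_True)
    show "\<phi> (x, \<theta> x) = 0" for x by (simp add: \<phi>_def s_def u_def)
    have "((\<lambda>w. sgn (B3 0) * B3 w) \<longlongrightarrow> sgn (B3 0) * B3 0) (nhds 0)"
      by (intro tendsto_intros tendsto_nhds_smooth_germ B3)
    moreover have "sgn (B3 0) * B3 0 > 0" using B3nz by (simp add: sgn_if)
    ultimately have "\<forall>\<^sub>F w in nhds 0. sgn (B3 0) * B3 w > 0" by (rule order_tendstoD(1))
    then have "\<forall>\<^sub>F w in nhds 0. B1 w = (snd w)\<^sup>2 * (sgn (B3 0) * \<bar>B3 w\<bar>)"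
      using B2(2) B3(2)
    proof eventually_elim
      case (elim w)
      then have "sgn (B3 0) * \<bar>B3 w\<bar> = B3 w" by (auto simp: sgn_if zero_less_mult_iff split: if_splits)
      then show ?case using elim by (simp add: power2_eq_square)
    qed
    from eventually_nhds_curve[OF cs s0 this]
    have "\<forall>\<^sub>F z in nhds 0. B1 (fst z, s z) = sgn (B3 0) * (\<phi> z)\<^sup>2"
      by eventually_elim (simp add: \<phi>_def R_def power_mult_distrib)
    moreover have "B1 (fst z, s z) = B z - B (fst z, \<theta> (fst z))" for z
      by (simp add: B1_def a_def s_def u_def)
    moreover have "sgn (B3 0) = sgn (py ?C 0)" by (simp add: B30 sgn_divide)
    ultimately show "\<forall>\<^sub>F z in nhds 0. B z = B (fst z, \<theta> (fst z)) + sgn (py ?C 0) * (\<phi> z)\<^sup>2"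
      by (auto elim!: eventually_mono simp: algebra_simps)
  qed
qed

text \<open>The odd part divided by the second variable is even, so both parts pass to functions of
  the square. The last two conclusions determine \<open>h\<close> on the two axes, from which its
  leading coefficients are computed.\<close>

lemma even_odd_decomposition:
  fixes E :: "real \<times> real \<Rightarrow> real"
  assumes E: "smooth_germ E 0"
  obtains e h where "smooth_germ e 0" "smooth_germ h 0"
    "\<forall>\<^sub>F z in nhds 0. E z = e (fst z, (snd z)\<^sup>2) + snd z * h (fst z, (snd z)\<^sup>2)"
    "\<forall>\<^sub>F x in nhds 0. h (x, 0) = py E (x, 0)"
    "\<forall>\<^sub>F y in nhds 0. E (0, y) - E (0, - y) = 2 * y * h (0, y\<^sup>2)"
proof -
  have sn: "smooth_germ (\<lambda>z :: real \<times> real. (fst z, - snd z)) 0"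
    by (intro smooth_germ_intros smooth_germ_coordinates)
  have n0: "(fst (0 :: real \<times> real), - snd (0 :: real \<times> real)) = 0" by (simp add: zero_in_plane)
  have cn: "isCont (\<lambda>z :: real \<times> real. (fst z, - snd z)) 0" by (rule smooth_germ_isCont[OF sn])
  have sEn: "smooth_germ (\<lambda>z. E (fst z, - snd z)) 0"
    by (rule smooth_germ_compose[where g = E, OF _ sn]) (simp only: n0 E)
  define D where "D z = E z - E (fst z, - snd z)" for z
  have "smooth_germ D 0" unfolding D_def[abs_def] by (rule smooth_germ_diff[OF E sEn])
  moreover have "\<forall>\<^sub>F x in nhds 0. D (x, 0) = 0" by (simp add: D_def)
  ultimately obtain w where w: "smooth_germ w 0" "\<forall>\<^sub>F z in nhds 0. D z = snd z * w z"
    by (rule Hadamard)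
  have "\<forall>\<^sub>F z in nhds 0. w (fst z, - snd z) = w z"
    using w(2) eventually_nhds_curve[OF cn n0 w(2)]
  proof eventually_elim
    case (elim z)
    show ?case
    proof (cases "snd z = 0")
      case True
      then show ?thesis by (metis minus_zero prod.collapse)
    next
      case False
      have "D (fst z, - snd z) = - D z" by (simp add: D_def)
      then show ?thesis using elim False by simp
    qed
  qed
  then have "\<forall>\<^sub>F z in nhds 0. w (fst z, - snd z) / 2 = w z / 2" by eventually_elim simp
  moreover have "smooth_germ (\<lambda>z. w z / 2) 0" by (intro smooth_germ_intros w) simp
  ultimately obtain h where h: "smooth_germ h 0" "\<forall>\<^sub>F z in nhds 0. w z / 2 = h (fst z, (snd z)\<^sup>2)"
    using even_germ_factors_square[of "\<lambda>z. w z / 2"] by auto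
  have "smooth_germ (\<lambda>z. (E z + E (fst z, - snd z)) / 2) 0" by (intro smooth_germ_intros E sEn) simp
  then obtain e where e: "smooth_germ e 0" "\<forall>\<^sub>F z in nhds 0. (E z + E (fst z, - snd z)) / 2 = e (fst z, (snd z)\<^sup>2)"
    using even_germ_factors_square[of "\<lambda>z. (E z + E (fst z, - snd z)) / 2"] by (auto simp: add.commute)
  have dec: "\<forall>\<^sub>F z in nhds 0. E z = e (fst z, (snd z)\<^sup>2) + snd z * h (fst z, (snd z)\<^sup>2)"
    using w(2) h(2) e(2)
  proof eventually_elim
    case (elim z)
    have "E z = (E z + E (fst z, - snd z)) / 2 + D z / 2" by (simp add: D_def field_simps)
    then show ?case using elim by simp
  qed
  have ssq: "smooth_germ (\<lambda>z :: real \<times> real. (snd z)\<^sup>2) z" for z by (intro smooth_germ_intros smooth_germ_coordinates)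
  have csq: "isCont (\<lambda>z :: real \<times> real. (fst z, (snd z)\<^sup>2)) 0"
    by (intro smooth_germ_isCont smooth_germ_Pair smooth_germ_coordinates ssq)
  have sq0: "(fst (0 :: real \<times> real), (snd (0 :: real \<times> real))\<^sup>2) = 0" by (simp add: zero_in_plane)
  have pysq: "py (\<lambda>z :: real \<times> real. (snd z)\<^sup>2) z = 2 * snd z" for z
    unfolding power2_eq_square using px_py_mult(2)[OF smooth_germ_coordinates(2) smooth_germ_coordinates(2)] by simp
  have "\<forall>\<^sub>F z in nhds 0. snd z = 0 \<longrightarrow> h (fst z, (snd z)\<^sup>2) = py E z"
    using eventually_nhds_curve[OF csq sq0 smooth_germ_eventually[OF h(1)]]
      eventually_nhds_curve[OF csq sq0 smooth_germ_eventually[OF e(1)]] px_py_cong_eventually(2)[OF dec]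
  proof eventually_elim
    case (elim z)
    have sh: "smooth_germ (\<lambda>z. h (fst z, (snd z)\<^sup>2)) z" and se: "smooth_germ (\<lambda>z. e (fst z, (snd z)\<^sup>2)) z"
      by (rule smooth_germ_compose[where f = "\<lambda>z. (fst z, (snd z)\<^sup>2)"];
          intro elim smooth_germ_Pair smooth_germ_coordinates ssq)+
    have "py (\<lambda>z. e (fst z, (snd z)\<^sup>2)) z = py e (fst z, (snd z)\<^sup>2) * (2 * snd z)"
      using px_py_compose(2)[OF smooth_germ_coordinates(1) ssq elim(2)] by (simp add: pysq)
    moreover have "py (\<lambda>z. snd z * h (fst z, (snd z)\<^sup>2)) z
        = h (fst z, (snd z)\<^sup>2) + snd z * py (\<lambda>z. h (fst z, (snd z)\<^sup>2)) z"
      using px_py_mult(2)[OF smooth_germ_coordinates(2) sh] by simp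
    ultimately show ?case
      unfolding elim(3) using px_py_add(2)[OF se smooth_germ_mult[OF smooth_germ_coordinates(2) sh]] by simp
  qed
  from eventually_nhds_curve[where c = "\<lambda>x. (x, 0)" and a = 0, OF _ _ this]
  have hx: "\<forall>\<^sub>F x in nhds 0. h (x, 0) = py E (x, 0)" by (simp add: zero_in_plane)
  have "\<forall>\<^sub>F z in nhds 0. D z = 2 * snd z * h (fst z, (snd z)\<^sup>2)"
    using w(2) h(2) by eventually_elim (simp add: field_simps)
  from eventually_nhds_curve[where c = "\<lambda>y. (0, y)" and a = 0, OF _ _ this]
  have "\<forall>\<^sub>F y in nhds 0. E (0, y) - E (0, - y) = 2 * y * h (0, y\<^sup>2)" by (simp add: zero_in_plane D_def)
  then show ?thesis using that e(1) h(1) dec hx by blast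
qed

definition fold_form :: "(real \<times> real \<Rightarrow> real) \<Rightarrow> real \<times> real \<Rightarrow> real \<times> real \<times> real" where
  "fold_form h = (\<lambda>z. (fst z, (snd z)\<^sup>2, snd z * h (fst z, (snd z)\<^sup>2)))"

text \<open>The third coordinate determines \<open>(\<phi> z)\<^sup>2\<close> as
  \<open>\<sigma> * (m - B0 x)\<close>. A target change can therefore subtract the even part
  \<open>e (x, \<phi>\<^sup>2)\<close> from \<open>A\<close>, and it exchanges the last two
  coordinates.\<close>

lemma fold_left_right:
  fixes A B \<phi> e h :: "real \<times> real \<Rightarrow> real" and B0 :: "real \<Rightarrow> real"
  assumes \<phi>: "smooth_germ \<phi> 0" "\<phi> 0 = 0" "py \<phi> 0 \<noteq> 0" and B0: "smooth_germ B0 0" and e: "smooth_germ e 0"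
    and \<sigma>: "\<sigma> * \<sigma> = 1"
    and A: "\<forall>\<^sub>F z in nhds 0. A z = e (fst z, (\<phi> z)\<^sup>2) + \<phi> z * h (fst z, (\<phi> z)\<^sup>2)"
    and B: "\<forall>\<^sub>F z in nhds 0. B z = B0 (fst z) + \<sigma> * (\<phi> z)\<^sup>2"
  shows "left_right_equivalent (\<lambda>z. (fst z, A z, B z)) 0 (fold_form h) 0"
proof (rule left_right_equivalentI)
  let ?D = "\<lambda>z. (fst z, \<phi> z)"
  define K where "K = (\<lambda>(x, y, m). (x, \<sigma> * (m - B0 x), y - e (x, \<sigma> * (m - B0 x))))"
  define K' where "K' = (\<lambda>(x, y, m). (x, e (x, y) + m, B0 x + \<sigma> * y))"
  have \<sigma>': "\<sigma> * (\<sigma> * t) = t" for t using \<sigma> by (simp flip: mult.assoc)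
  show "diffeo_germ ?D 0" by (rule fibered_diffeo(1)[OF \<phi>])
  show "?D 0 = 0" by (simp add: \<phi>(2) prod_eq_iff)
  show "\<forall>\<^sub>F z in nhds 0. K (fst z, A z, B z) = fold_form h (?D z)"
    using A B by eventually_elim (simp add: K_def fold_form_def \<sigma>')
  let ?p = "(0 :: real, A 0, B 0)"
  have B00: "B 0 = B0 0" using eventually_nhds_x_imp_x[OF B] by (simp add: \<phi>(2))
  have Kp: "K ?p = (0, 0, A 0 - e (0, 0))" by (simp add: K_def B00)
  have 1: "smooth_germ (\<lambda>q :: real \<times> real \<times> real. B0 (fst q)) q" if "fst q = 0" for q
    by (rule smooth_germ_compose[where g = B0 and f = fst]) (simp_all add: that B0 smooth_germ_fst[OF smooth_germ_id])
  have "diffeo_germ K ?p"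
  proof (rule diffeo_germI)
    have s: "smooth_germ (\<lambda>q :: real \<times> real \<times> real. \<sigma> * (snd (snd q) - B0 (fst q))) ?p"
      by (intro smooth_germ_intros 1) simp
    have "smooth_germ (\<lambda>q. e (fst q, \<sigma> * (snd (snd q) - B0 (fst q)))) ?p"
      by (rule smooth_germ_compose[where g = e and f = "\<lambda>q. (fst q, \<sigma> * (snd (snd q) - B0 (fst q)))"])
        (simp_all add: B00 e zero_in_plane, intro smooth_germ_intros s[simplified B00, simplified])
    then show "smooth_germ K ?p"
      unfolding K_def case_prod_beta by (intro smooth_germ_Pair smooth_germ_diff s) (intro smooth_germ_intros)+
    have "smooth_germ (\<lambda>q :: real \<times> real \<times> real. e (fst q, fst (snd q))) (K ?p)"
      by (rule smooth_germ_compose[where g = e and f = "\<lambda>q. (fst q, fst (snd q))"])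
        (simp add: Kp e zero_in_plane, intro smooth_germ_intros)
    then show "smooth_germ K' (K ?p)"
      unfolding K'_def case_prod_beta
      by (intro smooth_germ_Pair smooth_germ_add smooth_germ_mult 1) (simp add: Kp | intro smooth_germ_intros)+
  qed (simp_all add: K_def K'_def case_prod_beta \<sigma>')
  then show "diffeo_germ K (fst (0 :: real \<times> real), A 0, B 0)" by simp
qed

lemma DERIV_0_quotient:
  fixes f :: "real \<Rightarrow> real"
  assumes "(f has_field_derivative d) (at 0)" "f 0 = 0"
  shows "((\<lambda>x. f x / x) \<longlongrightarrow> d) (at 0)"
  using assms by (simp add: DERIV_def)

lemma smooth_germ_isCont_x_axis:
  fixes F :: "real \<times> real \<Rightarrow> real"
  assumes "smooth_germ F 0"
  shows "((\<lambda>x. F (x, 0)) \<longlongrightarrow> F 0) (at 0)" "((\<lambda>y. F (0, y)) \<longlongrightarrow> F 0) (at 0)"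
proof -
  have "smooth_germ (\<lambda>x. F (x, 0)) 0" "smooth_germ (\<lambda>y. F (0, y)) 0"
    by (rule smooth_germ_compose[where g = F and f = "\<lambda>x. (x, 0)"] smooth_germ_compose[where g = F and f = "\<lambda>x. (0, x)"];
        simp add: assms zero_in_plane smooth_germ_Pair smooth_germ_id smooth_germ_const)+
  from this[THEN smooth_germ_isCont]
  show "((\<lambda>x. F (x, 0)) \<longlongrightarrow> F 0) (at 0)" "((\<lambda>y. F (0, y)) \<longlongrightarrow> F 0) (at 0)"
    by (simp_all add: isCont_def zero_in_plane)
qed

text \<open>L'Hopital's rule for the odd part of \<open>f\<close>; it turns the known y-derivative
  of the graph function into the second coefficient of the fold form.\<close>

lemma cubic_limit:
  fixes f f' :: "real \<Rightarrow> real"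
  assumes "\<forall>\<^sub>F y in nhds 0. (f has_field_derivative f' y) (at y)" "((\<lambda>y. f' y / y\<^sup>2) \<longlongrightarrow> c) (at 0)"
  shows "((\<lambda>y. (f y - f (- y)) / (2 * y ^ 3)) \<longlongrightarrow> c / 3) (at_right 0)"
proof (rule lhopital_right_0)
  have cont: "isCont f 0" using eventually_nhds_x_imp_x[OF assms(1)] by (rule DERIV_isCont)
  have "isCont (\<lambda>y. f y - f (- y)) 0"
    by (intro continuous_intros cont isCont_o2[where f = uminus]) (simp_all add: cont)
  then show "((\<lambda>y. f y - f (- y)) \<longlongrightarrow> 0) (at_right 0)"
    by (auto simp: isCont_def intro: tendsto_within_subset)
  show "((\<lambda>y :: real. 2 * y ^ 3) \<longlongrightarrow> 0) (at_right 0)" by (auto intro!: tendsto_eq_intros)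
  show "\<forall>\<^sub>F y :: real in at_right 0. 2 * y ^ 3 \<noteq> 0" "\<forall>\<^sub>F y :: real in at_right 0. 6 * y\<^sup>2 \<noteq> 0"
    by (auto simp: eventually_at_filter)
  show "\<forall>\<^sub>F y :: real in at_right 0. ((\<lambda>y. 2 * y ^ 3) has_real_derivative 6 * y\<^sup>2) (at y)"
    by (intro always_eventually allI) (auto intro!: derivative_eq_intros)
  have m: "isCont uminus (0 :: real)" by (intro continuous_intros)
  have "\<forall>\<^sub>F y in nhds 0. ((\<lambda>y. f y - f (- y)) has_real_derivative f' y + f' (- y)) (at y)"
    using assms(1) eventually_nhds_curve[OF m minus_zero assms(1)]
  proof eventually_elim
    case (elim y)
    have "((\<lambda>y. f (- y)) has_real_derivative f' (- y) * - 1) (at y)"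
      by (rule DERIV_chain2[where f = f and g = uminus, OF elim(2)]) (auto intro!: derivative_eq_intros)
    from DERIV_diff[OF elim(1) this] show ?case by simp
  qed
  then show "\<forall>\<^sub>F y in at_right 0. ((\<lambda>y. f y - f (- y)) has_real_derivative f' y + f' (- y)) (at y)"
    by (auto simp: eventually_at_filter elim!: eventually_mono)
  have f: "filterlim uminus (at 0) (at (0 :: real))" by (auto simp: filterlim_at eventually_at_filter intro!: tendsto_eq_intros)
  have "((\<lambda>y. (f' y / y\<^sup>2 + f' (- y) / (- y)\<^sup>2) / 6) \<longlongrightarrow> (c + c) / 6) (at 0)"
    by (intro tendsto_intros assms(2) filterlim_compose[OF assms(2) f]) simp
  moreover have "(f' y / y\<^sup>2 + f' (- y) / (- y)\<^sup>2) / 6 = (f' y + f' (- y)) / (6 * y\<^sup>2)" for y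
    by (simp add: add_divide_distrib mult.commute)
  ultimately have "((\<lambda>y. (f' y + f' (- y)) / (6 * y\<^sup>2)) \<longlongrightarrow> c / 3) (at 0)"
    by (simp only:) simp
  then show "((\<lambda>y. (f' y + f' (- y)) / (6 * y\<^sup>2)) \<longlongrightarrow> c / 3) (at_right 0)"
    by (rule tendsto_within_subset) simp
qed

text \<open>With \<kappa> = p + 2 q the critical curve has slope -p / \<kappa>, and along it
  \<open>V\<close> grows like p (p + q) x / \<kappa>. The product of the two rates gives
  \<open>h (x, 0)\<close> to second order. On the other axis the rate is \<omega>^3 q, where
  \<omega> > 0 is the derivative of \<open>\<eta>\<close>; integration contributes the factor
  1/3.\<close>

lemma fold_normal_form:
  fixes A B V :: "real \<times> real \<Rightarrow> real"
  assumes A: "smooth_germ A 0" and B: "smooth_germ B 0" and V: "smooth_germ V 0" "V 0 = 0"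
    and Ay: "\<forall>\<^sub>F z in nhds 0. py A z = snd z * V z"
    and By: "\<forall>\<^sub>F z in nhds 0. py B z = V z + snd z * (px V z + py V z)"
    and \<kappa>: "px V 0 + 2 * py V 0 \<noteq> 0"
  obtains h c1 c2 where "c1 > 0" "c2 > 0" "smooth_germ h 0" "h 0 = 0"
    "((\<lambda>x. h (x, 0) / x\<^sup>2) \<longlongrightarrow> - c1 * (px V 0)\<^sup>2 * (px V 0 + py V 0)) (at 0)" "py h 0 = c2 * py V 0"
    "left_right_equivalent (\<lambda>z. (fst z, A z, B z)) 0 (fold_form h) 0"
proof -
  define p q \<kappa> where "p = px V 0" and "q = py V 0" and "\<kappa> = p + 2 * q"
  have \<kappa>nz: "\<kappa> \<noteq> 0" using \<kappa> by (simp add: \<kappa>_def p_def q_def)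
  have sC: "smooth_germ (\<lambda>z. snd z * (px V z + py V z)) 0"
    by (intro smooth_germ_intros smooth_germ_coordinates smooth_germ_px smooth_germ_py V)
  have C: "py B 0 = 0" using eventually_nhds_x_imp_x[OF By] V by simp
  have Cxy: "px (py B) 0 = p" "py (py B) 0 = \<kappa>"
    using px_py_cong[OF By] px_py_add[OF V(1) sC]
      px_py_mult[OF smooth_germ_coordinates(2) smooth_germ_add[OF smooth_germ_px[OF V(1)] smooth_germ_py[OF V(1)]]]
    by (simp_all add: p_def q_def \<kappa>_def)
  obtain \<theta> \<phi> where \<theta>: "smooth_germ \<theta> 0" "\<theta> 0 = 0" "(\<theta> has_field_derivative - p / \<kappa>) (at 0)"
    and \<phi>: "smooth_germ \<phi> 0" "\<phi> 0 = 0" "py \<phi> 0 > 0" "\<And>x. \<phi> (x, \<theta> x) = 0"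
    and Bf: "\<forall>\<^sub>F z in nhds 0. B z = B (fst z, \<theta> (fst z)) + sgn \<kappa> * (\<phi> z)\<^sup>2"
    using fold_coordinate[OF B C] \<kappa>nz unfolding Cxy by blast
  have "py \<phi> 0 \<noteq> 0" using \<phi>(3) by simp
  note fib = fibered_diffeo(2)[OF \<phi>(1,2) this]
  obtain \<eta> where \<eta>: "smooth_germ \<eta> 0" "\<eta> 0 = 0" "py \<eta> 0 = 1 / py \<phi> 0"
    "\<forall>\<^sub>F z in nhds 0. \<eta> (fst z, \<phi> z) = snd z"
    using fib by blast
  define \<omega> where "\<omega> = py \<eta> 0"
  have \<omega>: "\<omega> > 0" using \<phi>(3) by (simp add: \<omega>_def \<eta>)
  have s\<eta>: "smooth_germ (\<lambda>z. (fst z, \<eta> z)) 0" by (intro smooth_germ_Pair smooth_germ_coordinates \<eta>)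
  have \<eta>0: "(fst 0, \<eta> 0) = (0 :: real \<times> real)" by (simp add: \<eta> zero_in_plane)
  have c\<eta>: "isCont (\<lambda>z. (fst z, \<eta> z)) 0" by (rule smooth_germ_isCont[OF s\<eta>])
  define E where "E z = A (fst z, \<eta> z)" for z
  have sE: "smooth_germ E 0" unfolding E_def[abs_def]
    by (rule smooth_germ_compose[where g = A, OF _ s\<eta>]) (simp only: \<eta>0 A)
  have Ey: "\<forall>\<^sub>F z in nhds 0. py E z = \<eta> z * V (fst z, \<eta> z) * py \<eta> z"
    using eventually_nhds_curve[OF c\<eta> \<eta>0 smooth_germ_eventually[OF A]] eventually_nhds_curve[OF c\<eta> \<eta>0 Ay]
      smooth_germ_eventually[OF \<eta>(1)]
  proof eventually_elim
    case (elim z)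
    show ?case unfolding E_def[abs_def]
      using px_py_compose(2)[OF smooth_germ_coordinates(1) elim(3,1)] elim(2) by simp
  qed
  obtain e h where eh: "smooth_germ e 0" "smooth_germ h 0"
    "\<forall>\<^sub>F z in nhds 0. E z = e (fst z, (snd z)\<^sup>2) + snd z * h (fst z, (snd z)\<^sup>2)"
    "\<forall>\<^sub>F x in nhds 0. h (x, 0) = py E (x, 0)"
    "\<forall>\<^sub>F y in nhds 0. E (0, y) - E (0, - y) = 2 * y * h (0, y\<^sup>2)"
    using sE by (rule even_odd_decomposition) blast
  have x0: "isCont (\<lambda>x. (x, 0)) 0" "isCont (\<lambda>y. (0, y)) 0" for z :: real by (intro continuous_intros)+
  have \<eta>\<theta>: "\<forall>\<^sub>F x in nhds 0. \<eta> (x, 0) = \<theta> x"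
  proof -
    have "isCont (\<lambda>x. (x, \<theta> x)) 0" by (intro smooth_germ_isCont smooth_germ_Pair smooth_germ_id \<theta>)
    from eventually_nhds_curve[OF this _ \<eta>(4)] show ?thesis by (simp add: \<theta> \<phi> zero_in_plane)
  qed
  \<comment> \<open>Restricting the odd part to \<open>y = 0\<close> means evaluating
    \<open>py E\<close> on the critical curve, where
    \<open>\<eta> (x, 0) = \<theta> x\<close>.\<close>
  have hx: "\<forall>\<^sub>F x in nhds 0. h (x, 0) = \<theta> x * V (x, \<theta> x) * py \<eta> (x, 0)"
    using eh(4) \<eta>\<theta> eventually_nhds_curve[OF x0(1) _ Ey, unfolded zero_in_plane, OF refl]
    by eventually_elim simp
  have h0: "h 0 = 0" using eventually_nhds_x_imp_x[OF hx] by (simp add: \<theta> zero_in_plane)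
  have sp\<eta>: "smooth_germ (py \<eta>) 0" by (rule smooth_germ_py[OF \<eta>(1)])
  have V\<theta>: "((\<lambda>x. V (x, \<theta> x)) has_field_derivative p + q * (- p / \<kappa>)) (at 0)"
    using DERIV_graph[OF _ \<theta>(3), of V] V by (simp add: \<theta> zero_in_plane p_def q_def)
  have "((\<lambda>x. (\<theta> x / x) * (V (x, \<theta> x) / x) * py \<eta> (x, 0)) \<longlongrightarrow> (- p / \<kappa>) * (p + q * (- p / \<kappa>)) * \<omega>) (at 0)"
    unfolding \<omega>_def
    by (intro tendsto_mult DERIV_0_quotient \<theta> V\<theta> smooth_germ_isCont_x_axis(1)[OF sp\<eta>]) (simp add: \<theta> V zero_in_plane)
  moreover have "\<forall>\<^sub>F x in at 0. (\<theta> x / x) * (V (x, \<theta> x) / x) * py \<eta> (x, 0) = h (x, 0) / x\<^sup>2"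
    using eventually_nhds_imp_at[OF hx] by eventually_elim (simp add: power2_eq_square)
  ultimately have lim1: "((\<lambda>x. h (x, 0) / x\<^sup>2) \<longlongrightarrow> (- p / \<kappa>) * (p + q * (- p / \<kappa>)) * \<omega>) (at 0)"
    by (rule Lim_transform_eventually)
  have gam: "(- p / \<kappa>) * (p + q * (- p / \<kappa>)) * \<omega> = - (\<omega> / \<kappa>\<^sup>2) * p\<^sup>2 * (p + q)"
  proof -
    have "p + q * (- p / \<kappa>) = p * (p + q) / \<kappa>" using \<kappa>nz by (simp add: field_simps) (simp add: \<kappa>_def algebra_simps)
    then show ?thesis by (simp add: power2_eq_square)
  qed
  \<comment> \<open>Second coefficient: on the y-axis both \<open>\<eta>\<close> and
    \<open>V (0, \<eta>)\<close> vanish to first order, so \<open>py E\<close> is \<omega>^3 q y^2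
    up to o(y^2).\<close>
  have Ey0: "\<forall>\<^sub>F y in nhds 0. py E (0, y) = \<eta> (0, y) * V (0, \<eta> (0, y)) * py \<eta> (0, y)"
    using eventually_nhds_curve[OF x0(2) _ Ey] by (simp add: zero_in_plane)
  have DE: "\<forall>\<^sub>F y in nhds 0. ((\<lambda>y. E (0, y)) has_field_derivative py E (0, y)) (at y)"
    using eventually_nhds_curve[OF x0(2) _ smooth_germ_eventually[OF sE]]
    by (auto simp: zero_in_plane elim!: eventually_mono intro: smooth_germ_DERIV_y)
  have D\<eta>: "((\<lambda>y. \<eta> (0, y)) has_field_derivative \<omega>) (at 0)"
    using smooth_germ_DERIV_y[of \<eta> 0 0] \<eta> by (simp add: zero_in_plane \<omega>_def)
  have "((\<lambda>s. V (0, s)) has_field_derivative q) (at (\<eta> (0, 0)))"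
    using smooth_germ_DERIV_y[of V 0 0] V by (simp add: zero_in_plane q_def \<eta>)
  from DERIV_chain2[where f = "\<lambda>s. V (0, s)" and g = "\<lambda>y. \<eta> (0, y)", OF this D\<eta>]
  have DV: "((\<lambda>y. V (0, \<eta> (0, y))) has_field_derivative q * \<omega>) (at 0)" .
  have "((\<lambda>y. (\<eta> (0, y) / y) * (V (0, \<eta> (0, y)) / y) * py \<eta> (0, y)) \<longlongrightarrow> \<omega> * (q * \<omega>) * \<omega>) (at 0)"
    by (intro tendsto_mult DERIV_0_quotient D\<eta> DV smooth_germ_isCont_x_axis(2)[OF sp\<eta>, folded \<omega>_def])
      (simp_all add: \<eta> V zero_in_plane)
  moreover have "\<forall>\<^sub>F y in at 0. (\<eta> (0, y) / y) * (V (0, \<eta> (0, y)) / y) * py \<eta> (0, y) = py E (0, y) / y\<^sup>2"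
    using eventually_nhds_imp_at[OF Ey0] by eventually_elim (simp add: power2_eq_square)
  ultimately have "((\<lambda>y. py E (0, y) / y\<^sup>2) \<longlongrightarrow> \<omega> * (q * \<omega>) * \<omega>) (at 0)"
    by (rule Lim_transform_eventually)
  from cubic_limit[OF DE this]
  have "((\<lambda>y. (E (0, y) - E (0, - y)) / (2 * y ^ 3)) \<longlongrightarrow> \<omega> * (q * \<omega>) * \<omega> / 3) (at_right 0)" .
  moreover have "\<forall>\<^sub>F y in at_right 0. (E (0, y) - E (0, - y)) / (2 * y ^ 3) = h (0, y\<^sup>2) / y\<^sup>2"
    using eh(5) unfolding eventually_at_filter
    by (auto elim!: eventually_mono simp: power2_eq_square power3_eq_cube)
  ultimately have lim2: "((\<lambda>y. h (0, y\<^sup>2) / y\<^sup>2) \<longlongrightarrow> \<omega> * (q * \<omega>) * \<omega> / 3) (at_right 0)"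
    by (rule Lim_transform_eventually)
  have "((\<lambda>y. h (0, y)) has_field_derivative py h 0) (at 0)"
    using smooth_germ_DERIV_y[of h 0 0] eh by (simp add: zero_in_plane)
  then have "((\<lambda>y. h (0, y) / y) \<longlongrightarrow> py h 0) (at 0)"
    by (rule DERIV_0_quotient) (simp add: h0 zero_in_plane)
  moreover have "filterlim (\<lambda>y :: real. y\<^sup>2) (at 0) (at_right 0)"
    by (auto simp: filterlim_at eventually_at_filter intro!: tendsto_eq_intros)
  ultimately have "((\<lambda>y. h (0, y\<^sup>2) / y\<^sup>2) \<longlongrightarrow> py h 0) (at_right 0)"
    by (rule filterlim_compose)
  then have hy: "py h 0 = \<omega> * (q * \<omega>) * \<omega> / 3"
    using lim2 by (intro tendsto_unique[OF trivial_limit_at_right_real])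
  have sB0: "smooth_germ (\<lambda>x. B (x, \<theta> x)) 0"
    by (rule smooth_germ_graph) (simp_all add: \<theta> B zero_in_plane)
  have Ae: "\<forall>\<^sub>F z in nhds 0. A z = e (fst z, (\<phi> z)\<^sup>2) + \<phi> z * h (fst z, (\<phi> z)\<^sup>2)"
  proof -
    have "isCont (\<lambda>z. (fst z, \<phi> z)) 0" by (intro smooth_germ_isCont smooth_germ_Pair smooth_germ_coordinates \<phi>)
    from eventually_nhds_curve[OF this _ eh(3)] \<eta>(4)
    show ?thesis by (auto simp: \<phi> zero_in_plane E_def elim: eventually_elim2)
  qed
  have sg: "sgn \<kappa> * sgn \<kappa> = 1" using \<kappa>nz by (simp add: sgn_if)
  have "left_right_equivalent (\<lambda>z. (fst z, A z, B z)) 0 (fold_form h) 0"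
    by (rule fold_left_right[OF \<phi>(1,2) \<open>py \<phi> 0 \<noteq> 0\<close> sB0 eh(1) sg Ae Bf])
  moreover have "\<omega> / \<kappa>\<^sup>2 > 0" "\<omega> ^ 3 / 3 > 0" using \<omega> \<kappa>nz by simp_all
  moreover have "py h 0 = \<omega> ^ 3 / 3 * q" unfolding hy by (simp add: power3_eq_cube)
  moreover have "((\<lambda>x. h (x, 0) / x\<^sup>2) \<longlongrightarrow> - (\<omega> / \<kappa>\<^sup>2) * p\<^sup>2 * (p + q)) (at 0)" using lim1 unfolding gam .
  ultimately show ?thesis using that[of "\<omega> / \<kappa>\<^sup>2" "\<omega> ^ 3 / 3" h] eh(2) h0 unfolding p_def q_def by blast
qed

section \<open>Recognizing Double Whitney Umbrellas\<close>

text \<open>Both umbrella normal forms in one family, so that the sign is a real number that can be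
  compared with a \<open>sgn\<close>.\<close>

definition A1_form :: "real \<Rightarrow> real \<times> real \<Rightarrow> real \<times> real \<times> real" where
  "A1_form \<epsilon> = (\<lambda>z. (fst z, (snd z)\<^sup>2, snd z ^ 3 + \<epsilon> * (snd z * (fst z)\<^sup>2)))"

lemma A1_form_eq: "A1_plus = A1_form 1" "A1_minus = A1_form (-1)"
  by (auto simp: A1_plus_def A1_minus_def A1_form_def fun_eq_iff)

lemma Hadamard_real:
  fixes f :: "real \<Rightarrow> real"
  assumes f: "smooth_germ f 0" "f 0 = 0"
  obtains g where "smooth_germ g 0" "\<forall>\<^sub>F x in nhds 0. f x = x * g x"
proof -
  have s: "smooth_germ (\<lambda>z :: real \<times> real. f (snd z)) 0"
    by (rule smooth_germ_compose[where g = f and f = snd]) (simp_all add: f smooth_germ_coordinates)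
  have "\<forall>\<^sub>F x :: real in nhds 0. f (snd (x, 0)) = 0" by (simp add: f)
  then obtain G where G: "smooth_germ G 0" "\<forall>\<^sub>F z :: real \<times> real in nhds 0. f (snd z) = snd z * G z"
    using Hadamard[OF s] by blast
  show ?thesis
  proof (rule that)
    show "smooth_germ (\<lambda>x. G (0, x)) 0"
      by (rule smooth_germ_compose[where g = G and f = "\<lambda>x. (0, x)"])
        (simp_all add: zero_in_plane G smooth_germ_Pair smooth_germ_id smooth_germ_const)
    have "isCont (\<lambda>x :: real. (0 :: real, x)) 0" by (intro continuous_intros)
    from eventually_nhds_curve[OF this zero_in_plane G(2)]
    show "\<forall>\<^sub>F x in nhds 0. f x = x * G (0, x)" by simp
  qed
qed

text \<open>The existence of the limit forces the first Hadamard quotient to vanish at 0, which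
  permits a second division.\<close>

lemma Hadamard_real_square:
  fixes f :: "real \<Rightarrow> real"
  assumes f: "smooth_germ f 0" "f 0 = 0" "((\<lambda>x. f x / x\<^sup>2) \<longlongrightarrow> \<gamma>) (at 0)"
  obtains c where "smooth_germ c 0" "c 0 = \<gamma>" "\<forall>\<^sub>F x in nhds 0. f x = x\<^sup>2 * c x"
proof -
  obtain g where g: "smooth_germ g 0" "\<forall>\<^sub>F x in nhds 0. f x = x * g x"
    using f(1,2) by (rule Hadamard_real) blast
  have lim: "(c \<longlongrightarrow> c 0) (at 0)" if "smooth_germ c 0" for c :: "real \<Rightarrow> real"
    using smooth_germ_isCont[OF that] by (simp add: isCont_def)
  have "((\<lambda>x. x * (f x / x\<^sup>2)) \<longlongrightarrow> 0 * \<gamma>) (at 0)" by (intro tendsto_mult f tendsto_ident_at)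
  moreover have "\<forall>\<^sub>F x in at 0. x * (f x / x\<^sup>2) = g x"
    using g(2) by (auto simp: eventually_at_filter power2_eq_square elim!: eventually_mono)
  ultimately have "(g \<longlongrightarrow> 0) (at 0)" using Lim_transform_eventually by fastforce
  then have "g 0 = 0" by (rule tendsto_unique[OF at_neq_bot lim[OF g(1)]])
  obtain c where c: "smooth_germ c 0" "\<forall>\<^sub>F x in nhds 0. g x = x * c x"
    using g(1) \<open>g 0 = 0\<close> by (rule Hadamard_real) blast
  have e: "\<forall>\<^sub>F x in nhds 0. f x = x\<^sup>2 * c x"
    using g(2) c(2) by eventually_elim (simp add: power2_eq_square)
  then have "\<forall>\<^sub>F x in at 0. f x / x\<^sup>2 = c x"
    by (auto simp: eventually_at_filter elim!: eventually_mono)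
  from Lim_transform_eventually[OF f(3) this] have "c 0 = \<gamma>"
    by (rule tendsto_unique[OF at_neq_bot lim[OF c(1)]])
  with c(1) e show ?thesis using that by blast
qed

text \<open>Write \<open>h (x, y) = x\<^sup>2 * c x + y * k (x, y)\<close>. Dividing the third
  target coordinate by \<open>k\<close> leaves \<open>y + x\<^sup>2 * c / k\<close>, and rescaling
  \<open>x\<close> by the root of the absolute value of \<open>c / k\<close> leaves only its sign.
  On the source, \<open>y\<close> stands for the square of the second coordinate.\<close>

lemma fold_form_A1:
  assumes h: "smooth_germ h 0" "h 0 = 0" and \<gamma>: "((\<lambda>x. h (x, 0) / x\<^sup>2) \<longlongrightarrow> \<gamma>) (at 0)"
    and nz: "\<gamma> \<noteq> 0" "py h 0 \<noteq> 0"
  shows "left_right_equivalent (fold_form h) 0 (A1_form (sgn (\<gamma> * py h 0))) 0"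
proof -
  have sh0: "smooth_germ (\<lambda>x. h (x, 0)) 0"
    by (rule smooth_germ_compose[where g = h and f = "\<lambda>x. (x, 0)"])
      (simp_all add: zero_in_plane h smooth_germ_Pair smooth_germ_id smooth_germ_const)
  have "h (0, 0) = 0" by (simp add: zero_in_plane h)
  then obtain c where c: "smooth_germ c 0" "c 0 = \<gamma>" "\<forall>\<^sub>F x in nhds 0. h (x, 0) = x\<^sup>2 * c x"
    using Hadamard_real_square[OF sh0 _ \<gamma>] by blast
  have sh0f: "smooth_germ (\<lambda>z. h (fst z, 0)) 0"
    by (rule smooth_germ_of_fst[where \<theta> = "\<lambda>x. h (x, 0)"]) (simp add: sh0)
  have "smooth_germ (\<lambda>z. h z - h (fst z, 0)) 0" by (intro smooth_germ_diff h sh0f)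
  then obtain k where k: "smooth_germ k 0" "\<forall>\<^sub>F z in nhds 0. h z - h (fst z, 0) = snd z * k z"
    using Hadamard[of "\<lambda>z. h z - h (fst z, 0)"] by auto
  have k0: "k 0 = py h 0"
    using eventually_nhds_x_imp_x[OF Hadamard_py[OF k]] px_py_diff(2)[OF h(1) sh0f]
      px_py_of_fst[of "\<lambda>x. h (x, 0)" 0] sh0 by simp
  define c3 where "c3 z = c (fst z) / k z" for z
  have sc3: "smooth_germ c3 0" unfolding c3_def[abs_def]
    by (intro smooth_germ_divide k smooth_germ_of_fst) (simp_all add: c k0 nz)
  have c30: "c3 0 = \<gamma> / py h 0" by (simp add: c3_def c k0)
  then have c3nz: "c3 0 \<noteq> 0" using nz by simp
  define R where "R z = sqrt \<bar>c3 z\<bar>" for z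
  have sR: "smooth_germ R 0" unfolding R_def[abs_def]
    by (intro smooth_germ_sqrt smooth_germ_abs sc3) (simp_all add: c3nz)
  have R0: "R 0 > 0" using c3nz by (simp add: R_def)
  define \<epsilon> where "\<epsilon> = sgn (c3 0)"
  have eps: "\<epsilon> = sgn (\<gamma> * py h 0)" unfolding \<epsilon>_def c30 using nz by (auto simp: sgn_if zero_less_divide_iff zero_less_mult_iff)
  have "((\<lambda>w. \<epsilon> * c3 w) \<longlongrightarrow> \<epsilon> * c3 0) (nhds 0)"
    by (intro tendsto_intros tendsto_nhds_smooth_germ sc3)
  moreover have "\<epsilon> * c3 0 > 0" using c3nz by (simp add: sgn_if \<epsilon>_def)
  ultimately have "\<forall>\<^sub>F w in nhds 0. \<epsilon> * c3 w > 0" by (rule order_tendstoD(1))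
  then have c3R: "\<forall>\<^sub>F w in nhds 0. c3 w = \<epsilon> * (R w)\<^sup>2"
    by eventually_elim (auto simp: R_def \<epsilon>_def sgn_if zero_less_mult_iff split: if_splits)
  have Rf: "((\<lambda>z. (fst z * F z, snd z)) has_derivative (\<lambda>v. (fst v * F 0, snd v))) (at 0)"
    if "smooth_germ F 0" for F :: "real \<times> real \<Rightarrow> real"
  proof -
    have "smooth_germ (\<lambda>z. fst z * F z) 0" by (intro smooth_germ_mult smooth_germ_coordinates that)
    from smooth_germ_plane_real[OF this]
    have "((\<lambda>z. fst z * F z) has_derivative (\<lambda>v. fst v * F 0)) (at 0)"
      using px_py_mult[OF smooth_germ_coordinates(1) that] by simp
    then show ?thesis by (rule has_derivative_Pair) (rule derivative_intros)+
  qed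
  have inj: "inj (\<lambda>v :: real \<times> real. (fst v * r, snd v))" if "r > 0" for r :: real
    using that by (auto simp: inj_def)
  let ?D = "\<lambda>z. (fst z * R z, snd z)"
  have sD: "smooth_germ ?D 0" by (intro smooth_germ_Pair smooth_germ_mult smooth_germ_coordinates sR)
  have D0: "?D 0 = 0" by (simp add: zero_in_plane)
  obtain g where "smooth_germ g (?D 0)" "\<forall>\<^sub>F z in nhds 0. g (?D z) = z" "\<forall>\<^sub>F y in nhds (?D 0). ?D (g y) = y"
    by (rule inverse_germ_plane[OF sD Rf[OF sR] inj[OF R0]])
  then have g: "smooth_germ g 0" "\<forall>\<^sub>F z in nhds 0. g (?D z) = z" "\<forall>\<^sub>F y in nhds 0. ?D (g y) = y" unfolding D0 .
  have g0: "g 0 = 0" using eventually_nhds_x_imp_x[OF g(2)] D0 by simp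
  let ?sq = "\<lambda>z :: real \<times> real. (fst z, (snd z)\<^sup>2)"
  have ssq: "smooth_germ ?sq 0" by (intro smooth_germ_intros smooth_germ_coordinates)
  have sq0: "?sq 0 = 0" by (simp add: zero_in_plane)
  note csq = smooth_germ_isCont[OF ssq]
  \<comment> \<open>The source rescales \<open>x\<close> by \<open>R\<close> at
    \<open>(x, y\<^sup>2)\<close>, and \<open>K\<close> below rescales by \<open>R\<close> at its
    first two coordinates. On the image of the fold form these are the same number.\<close>
  define S where "S z = (fst z * R (?sq z), snd z)" for z
  have sRs: "smooth_germ (\<lambda>z. R (?sq z)) 0"
    by (rule smooth_germ_compose[OF _ ssq]) (simp only: sq0 sR)
  have dS: "diffeo_germ S 0"
  proof (rule diffeo_germ_plane)
    show "smooth_germ S 0" unfolding S_def[abs_def]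
      by (intro smooth_germ_Pair smooth_germ_mult smooth_germ_coordinates sRs)
    show "(S has_derivative (\<lambda>v. (fst v * R (?sq 0), snd v))) (at 0)"
      unfolding S_def[abs_def] by (rule Rf[OF sRs])
    show "inj (\<lambda>v :: real \<times> real. (fst v * R (?sq 0), snd v))" by (rule inj) (simp only: sq0 R0)
  qed
  let ?pr = "\<lambda>q :: real \<times> real \<times> real. (fst q, fst (snd q))"
  define K where "K q = (fst q * R (?pr q), fst (snd q), snd (snd q) / k (?pr q))" for q
  define K' where "K' q = (fst (g (?pr q)), fst (snd q), snd (snd q) * k (g (?pr q)))" for q
  have spr: "smooth_germ ?pr q" for q by (intro smooth_germ_intros)
  have pr0: "?pr 0 = 0" by (simp add: zero_in_plane)
  have on_pr: "smooth_germ (\<lambda>q. F (?pr q)) 0" if "smooth_germ F 0" for F :: "real \<times> real \<Rightarrow> 'z::real_normed_vector"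
    by (rule smooth_germ_compose[OF _ spr]) (simp only: pr0 that)
  have K0: "K 0 = 0" by (simp add: K_def prod_eq_iff)
  have dK: "diffeo_germ K 0"
  proof (rule diffeo_germI)
    show "smooth_germ K 0" unfolding K_def[abs_def]
      by (intro smooth_germ_Pair smooth_germ_mult smooth_germ_divide on_pr sR k(1) smooth_germ_fst smooth_germ_snd smooth_germ_id)
        (simp add: zero_in_plane k0 nz)
    have "smooth_germ (\<lambda>y. k (g y)) 0" by (rule smooth_germ_compose[OF _ g(1)]) (simp add: g0 k(1))
    from on_pr[OF this] on_pr[OF g(1)] show "smooth_germ K' (K 0)" unfolding K0 unfolding K'_def[abs_def]
      by (intro smooth_germ_Pair smooth_germ_mult smooth_germ_fst smooth_germ_snd smooth_germ_id)
    have knz: "\<forall>\<^sub>F z in nhds 0. k z \<noteq> 0"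
      using tendsto_imp_eventually_ne[OF tendsto_nhds_smooth_germ[OF k(1)], of 0] by (simp add: k0 nz)
    show "\<forall>\<^sub>F q in nhds 0. K' (K q) = q"
      using eventually_nhds_curve[OF smooth_germ_isCont[OF spr] pr0 g(2)] eventually_nhds_curve[OF smooth_germ_isCont[OF spr] pr0 knz]
      by eventually_elim (simp add: K_def K'_def)
    have "\<forall>\<^sub>F y in nhds 0. k (g y) \<noteq> 0" by (rule eventually_nhds_curve[OF smooth_germ_isCont[OF g(1)] g0 knz])
    with g(3) have "\<forall>\<^sub>F y in nhds 0. k (g y) \<noteq> 0 \<and> ?D (g y) = y" by eventually_elim simp
    from eventually_nhds_curve[OF smooth_germ_isCont[OF spr] pr0 this]
    show "\<forall>\<^sub>F q in nhds (K 0). K (K' q) = q" unfolding K0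
    proof eventually_elim
      case (elim q)
      obtain a b m where q: "q = (a, b, m)" by (cases q)
      obtain u y where uy: "g (a, b) = (u, y)" by (cases "g (a, b)")
      have e: "k (u, y) \<noteq> 0" "(u * R (u, y), y) = (a, b)"
        using elim unfolding q fst_conv snd_conv uy by blast+
      have y: "y = b" using e(2) by blast
      have a: "u * R (u, b) = a" using e(2) unfolding y by blast
      show ?case
        using e(1) unfolding q K_def K'_def fst_conv snd_conv uy unfolding y fst_conv snd_conv a by simp
    qed
  qed
  have f0: "fold_form h 0 = 0" by (simp add: fold_form_def prod_eq_iff)
  have "\<forall>\<^sub>F z in nhds 0. k z \<noteq> 0"
    using tendsto_imp_eventually_ne[OF tendsto_nhds_smooth_germ[OF k(1)], of 0] by (simp add: k0 nz)
  moreover have "\<forall>\<^sub>F z :: real \<times> real in nhds 0. h (fst z, 0) = (fst z)\<^sup>2 * c (fst z)"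
    by (rule eventually_nhds_curve[OF smooth_germ_isCont[OF smooth_germ_coordinates(1)] _ c(3)]) simp
  ultimately have "\<forall>\<^sub>F w in nhds 0. h w / k w = snd w + \<epsilon> * (fst w * R w)\<^sup>2"
    using k(2) c3R
  proof eventually_elim
    case (elim w)
    have "h w = snd w * k w + (fst w)\<^sup>2 * c (fst w)" using elim(2,3) by simp
    then have "h w / k w = snd w + (fst w)\<^sup>2 * c3 w" using elim(1) by (simp add: c3_def field_simps)
    then show ?case using elim(4) by (simp add: power_mult_distrib)
  qed
  from eventually_nhds_curve[OF csq sq0 this]
  have "\<forall>\<^sub>F z in nhds 0. K (fold_form h z) = A1_form \<epsilon> (S z)"
  proof eventually_elim
    case (elim z)
    have "snd z * h (?sq z) / k (?sq z) = snd z * (h (?sq z) / k (?sq z))" by simp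
    also have "\<dots> = snd z ^ 3 + \<epsilon> * (snd z * (fst z * R (?sq z))\<^sup>2)"
      unfolding elim by (simp add: algebra_simps power2_eq_square power3_eq_cube)
    finally show ?case by (simp add: K_def fold_form_def A1_form_def S_def)
  qed
  then show ?thesis
    unfolding eps[symmetric]
    by (intro left_right_equivalentI[of S 0 0 K]) (simp_all add: dS f0 dK S_def zero_in_plane)
qed

section \<open>Asymptotic invariants of Left-Right equivalence\<close>

lemma curve_tendsto:
  fixes z :: "real \<Rightarrow> 'a::real_normed_vector"
  assumes "((\<lambda>r. (z r - a) /\<^sub>R r) \<longlongrightarrow> e) (at_right 0)"
  shows "(z \<longlongrightarrow> a) (at_right 0)"
proof -
  have "((\<lambda>r. a + r *\<^sub>R ((z r - a) /\<^sub>R r)) \<longlongrightarrow> a + 0 *\<^sub>R e) (at_right 0)"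
    by (intro tendsto_intros assms)
  moreover have "\<forall>\<^sub>F r in at_right (0::real). a + r *\<^sub>R ((z r - a) /\<^sub>R r) = z r"
    by (auto simp: eventually_at_filter)
  ultimately show ?thesis using Lim_transform_eventually by fastforce
qed

text \<open>A curve is only required to have a one-sided velocity at 0. This weak notion is
  preserved by every differentiable map, hence by changes of source.\<close>

lemma curve_derivative:
  fixes h :: "'a::real_normed_vector \<Rightarrow> 'b::real_normed_vector"
  assumes D: "(h has_derivative D) (at a)" and z: "((\<lambda>r. (z r - a) /\<^sub>R r) \<longlongrightarrow> e) (at_right 0)"
  shows "((\<lambda>r. (h (z r) - h a) /\<^sub>R r) \<longlongrightarrow> D e) (at_right 0)"
proof -
  have lin: "bounded_linear D" using D by (rule has_derivative_bounded_linear)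
  note za = curve_tendsto[OF z]
  have "((\<lambda>r. (h (z r) - h a) /\<^sub>R r - D ((z r - a) /\<^sub>R r)) \<longlongrightarrow> 0) (at_right 0)"
  proof (rule tendstoI)
    fix \<epsilon> :: real assume \<epsilon>: "\<epsilon> > 0"
    define M where "M = norm e + 1"
    have M: "M > 0" by (simp add: M_def add_nonneg_pos)
    have "((\<lambda>r. norm ((z r - a) /\<^sub>R r)) \<longlongrightarrow> norm e) (at_right 0)" by (intro tendsto_norm z)
    then have 1: "\<forall>\<^sub>F r in at_right 0. norm ((z r - a) /\<^sub>R r) < M"
      by (rule order_tendstoD(2)) (simp add: M_def)
    have "\<epsilon> / (2 * M) > 0" using \<epsilon> M by simp
    then obtain d where d: "d > 0" "\<And>y. norm (y - a) < d \<Longrightarrow> norm (h y - h a - D (y - a)) \<le> \<epsilon> / (2 * M) * norm (y - a)"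
      using D unfolding has_derivative_at_alt by blast
    have 2: "\<forall>\<^sub>F r in at_right 0. norm (z r - a) < d"
      using tendstoD[OF za d(1)] by (simp add: dist_norm)
    have 3: "\<forall>\<^sub>F r in at_right (0::real). r > 0" by (auto simp: eventually_at_filter)
    show "\<forall>\<^sub>F r in at_right 0. dist ((h (z r) - h a) /\<^sub>R r - D ((z r - a) /\<^sub>R r)) 0 < \<epsilon>"
      using 1 2 3
    proof eventually_elim
      case (elim r)
      have "(h (z r) - h a) /\<^sub>R r - D ((z r - a) /\<^sub>R r) = (h (z r) - h a - D (z r - a)) /\<^sub>R r"
        by (simp only: linear_scale[OF bounded_linear.linear[OF lin]] flip: scaleR_diff_right)
      then have "norm ((h (z r) - h a) /\<^sub>R r - D ((z r - a) /\<^sub>R r)) = norm (h (z r) - h a - D (z r - a)) / r"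
        using elim(3) by (simp add: divide_inverse mult.commute)
      also have "\<dots> \<le> \<epsilon> / (2 * M) * norm (z r - a) / r"
        using elim(3) d(2)[OF elim(2)] by (intro divide_right_mono) auto
      also have "\<dots> = \<epsilon> / (2 * M) * norm ((z r - a) /\<^sub>R r)"
      proof -
        have "norm ((z r - a) /\<^sub>R r) = norm (z r - a) / r"
          using elim(3) unfolding norm_scaleR by (simp add: field_simps)
        then show ?thesis by (simp only: times_divide_eq_right)
      qed
      also have "\<dots> \<le> \<epsilon> / (2 * M) * M"
        using elim(1) \<epsilon> M by (intro mult_left_mono) auto
      also have "\<dots> < \<epsilon>" using \<epsilon> M by simp
      finally show ?case by simp
    qed
  qed
  from tendsto_add[OF this bounded_linear.tendsto[OF lin z]] show ?thesis by simp
qed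

lemma smooth_germ_lipschitz:
  fixes k :: "'a::euclidean_space \<Rightarrow> 'b::euclidean_space"
  assumes "smooth_germ k b"
  obtains d C where "d > 0" "\<And>x y. x \<in> ball b d \<Longrightarrow> y \<in> ball b d \<Longrightarrow> norm (k x - k y) \<le> C * norm (x - y)"
    "\<And>x v. x \<in> ball b d \<Longrightarrow> norm (frechet_derivative k (at x) v) \<le> C * norm v"
proof -
  let ?K = "\<lambda>x. frechet_derivative k (at x)"
  define C where "C = (\<Sum>i\<in>Basis. norm (?K b i) + 1)"
  have C: "C \<ge> 0" unfolding C_def by (intro sum_nonneg) simp
  have "\<forall>\<^sub>F x in nhds b. norm (?K x i) < norm (?K b i) + 1" for i
    by (rule order_tendstoD(2)[OF tendsto_norm[OF tendsto_nhds_smooth_germ[OF smooth_germ_frechet[OF assms]]]]) simp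
  then have "\<forall>\<^sub>F x in nhds b. \<forall>i\<in>Basis. norm (?K x i) < norm (?K b i) + 1"
    by (simp add: eventually_ball_finite)
  with smooth_germ_eventually[OF assms]
  have "\<forall>\<^sub>F x in nhds b. smooth_germ k x \<and> (\<forall>i\<in>Basis. norm (?K x i) < norm (?K b i) + 1)"
    by eventually_elim simp
  then obtain d where d: "d > 0" "\<And>x. x \<in> ball b d \<Longrightarrow> smooth_germ k x \<and> (\<forall>i\<in>Basis. norm (?K x i) < norm (?K b i) + 1)"
    unfolding eventually_nhds_metric by (auto simp: dist_commute)
  have bound: "norm (?K x v) \<le> C * norm v" if "x \<in> ball b d" for x v
  proof -
    have lin: "linear (?K x)" by (rule has_derivative_linear[OF smooth_germ_derivative]) (use d(2)[OF that] in blast)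
    have "?K x v = ?K x (\<Sum>i\<in>Basis. (v \<bullet> i) *\<^sub>R i)" by (simp only: euclidean_representation)
    also have "\<dots> = (\<Sum>i\<in>Basis. (v \<bullet> i) *\<^sub>R ?K x i)"
      by (simp only: linear_sum[OF lin] linear_scale[OF lin])
    also have "norm \<dots> \<le> (\<Sum>i\<in>Basis. norm v * (norm (?K b i) + 1))"
    proof (rule sum_norm_le)
      fix i :: 'a assume i: "i \<in> Basis"
      have "norm ((v \<bullet> i) *\<^sub>R ?K x i) = \<bar>v \<bullet> i\<bar> * norm (?K x i)" by simp
      also have "\<dots> \<le> norm v * (norm (?K b i) + 1)"
        using Basis_le_norm[OF i] d(2)[OF that] i by (intro mult_mono) (auto simp: less_imp_le)
      finally show "norm ((v \<bullet> i) *\<^sub>R ?K x i) \<le> norm v * (norm (?K b i) + 1)" .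
    qed
    also have "\<dots> = C * norm v" by (simp add: C_def sum_distrib_left[symmetric] mult.commute)
    finally show ?thesis .
  qed
  have "C-lipschitz_on (ball b d) k"
  proof (rule bounded_derivative_imp_lipschitz)
    show "(k has_derivative ?K x) (at x within ball b d)" if "x \<in> ball b d" for x
      by (rule has_derivative_at_withinI, rule smooth_germ_derivative) (use d(2)[OF that] in blast)
    show "onorm (?K x) \<le> C" if "x \<in> ball b d" for x
      by (rule onorm_le) (rule bound[OF that])
  qed (simp_all add: C)
  then show ?thesis using that[OF d(1) _ bound] by (auto simp: lipschitz_on_def dist_norm)
qed

lemma scaled_bound_tendsto_0:
  fixes f :: "real \<Rightarrow> 'a::real_normed_vector" and g :: "real \<Rightarrow> 'b::real_normed_vector"
  assumes "((\<lambda>r. f r /\<^sub>R s r) \<longlongrightarrow> 0) F" "\<forall>\<^sub>F r in F. norm (g r) \<le> C * norm (f r)"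
  shows "((\<lambda>r. g r /\<^sub>R s r) \<longlongrightarrow> 0) F"
proof (rule Lim_null_comparison)
  show "\<forall>\<^sub>F r in F. norm (g r /\<^sub>R s r) \<le> C * norm (f r /\<^sub>R s r)"
    using assms(2)
  proof eventually_elim
    case (elim r)
    have "\<bar>inverse (s r)\<bar> * norm (g r) \<le> \<bar>inverse (s r)\<bar> * (C * norm (f r))"
      by (intro mult_left_mono elim) simp
    then show ?case by (simp add: mult_ac)
  qed
  have "((\<lambda>r. C * norm (f r /\<^sub>R s r)) \<longlongrightarrow> C * norm (0 :: 'a)) F" by (intro tendsto_intros assms(1))
  then show "((\<lambda>r. C * norm (f r /\<^sub>R s r)) \<longlongrightarrow> 0) F" by simp
qed

text \<open>Near \<open>g a\<close> the target change is Lipschitz with bounded derivative.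
  Estimates o(r^n) for differences of values, and for the differential along a vector, therefore
  pass from \<open>g\<close> to \<open>g'\<close> composed with the source change.\<close>

lemma left_right_transfer:
  fixes g :: "'a::euclidean_space \<Rightarrow> 'b::euclidean_space"
  assumes "left_right_equivalent g a g' b" "smooth_germ g a" "smooth_germ g' b"
  obtains h where "diffeo_germ h a" "h a = b"
    "\<And>z1 z2 n. (z1 \<longlongrightarrow> a) (at_right 0) \<Longrightarrow> (z2 \<longlongrightarrow> a) (at_right 0) \<Longrightarrow>
      ((\<lambda>r. (g (z1 r) - g (z2 r)) /\<^sub>R r ^ n) \<longlongrightarrow> 0) (at_right (0 :: real)) \<Longrightarrow>
      ((\<lambda>r. (g' (h (z1 r)) - g' (h (z2 r))) /\<^sub>R r ^ n) \<longlongrightarrow> 0) (at_right 0)"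
    "\<And>z v n. (z \<longlongrightarrow> a) (at_right 0) \<Longrightarrow>
      ((\<lambda>r. frechet_derivative g (at (z r)) v /\<^sub>R r ^ n) \<longlongrightarrow> 0) (at_right (0 :: real)) \<Longrightarrow>
      ((\<lambda>r. frechet_derivative g' (at (h (z r))) (frechet_derivative h (at (z r)) v) /\<^sub>R r ^ n) \<longlongrightarrow> 0) (at_right 0)"
proof -
  obtain h k where hk: "diffeo_germ h a" "h a = b" "diffeo_germ k (g a)" "\<forall>\<^sub>F z in nhds a. k (g z) = g' (h z)"
    using assms(1) by (rule left_right_equivalentE)
  have sh: "smooth_germ h a" and sk: "smooth_germ k (g a)" using hk by (simp_all add: diffeo_germ_smooth)
  obtain d C where d: "d > 0" "\<And>x y. x \<in> ball (g a) d \<Longrightarrow> y \<in> ball (g a) d \<Longrightarrow> norm (k x - k y) \<le> C * norm (x - y)"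
    "\<And>x v. x \<in> ball (g a) d \<Longrightarrow> norm (frechet_derivative k (at x) v) \<le> C * norm v"
    using sk by (rule smooth_germ_lipschitz) blast
  have gb: "\<forall>\<^sub>F z in nhds a. g z \<in> ball (g a) d"
    by (rule eventually_nhds_isCont[OF smooth_germ_isCont[OF assms(2)]])
      (use d(1) in \<open>auto simp: eventually_nhds_metric dist_commute\<close>)
  have ch: "isCont h a" by (rule smooth_germ_isCont[OF sh])
  have D: "\<forall>\<^sub>F z in nhds a. \<forall>v. frechet_derivative k (at (g z)) (frechet_derivative g (at z) v)
      = frechet_derivative g' (at (h z)) (frechet_derivative h (at z) v)"
    using iffD2[OF eventually_eventually hk(4)] smooth_germ_eventually[OF assms(2)] smooth_germ_eventually[OF sh]
      eventually_nhds_curve[OF smooth_germ_isCont[OF assms(2)] refl smooth_germ_eventually[OF sk]]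
      eventually_nhds_curve[OF ch hk(2) smooth_germ_eventually[OF assms(3)]]
  proof eventually_elim
    case (elim z)
    have "((\<lambda>z. k (g z)) has_derivative (\<lambda>v. frechet_derivative k (at (g z)) (frechet_derivative g (at z) v))) (at z)"
      by (rule has_derivative_compose[OF smooth_germ_derivative[OF elim(2)] smooth_germ_derivative[OF elim(4)]])
    from has_derivative_cong_eventually[OF this elim(1)]
    have "((\<lambda>z. g' (h z)) has_derivative (\<lambda>v. frechet_derivative k (at (g z)) (frechet_derivative g (at z) v))) (at z)" .
    moreover have "((\<lambda>z. g' (h z)) has_derivative (\<lambda>v. frechet_derivative g' (at (h z)) (frechet_derivative h (at z) v))) (at z)"
      by (rule has_derivative_compose[OF smooth_germ_derivative[OF elim(3)] smooth_germ_derivative[OF elim(5)]])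
    ultimately have "(\<lambda>v. frechet_derivative k (at (g z)) (frechet_derivative g (at z) v))
        = (\<lambda>v. frechet_derivative g' (at (h z)) (frechet_derivative h (at z) v))"
      by (rule has_derivative_unique)
    from fun_cong[OF this] show ?case by blast
  qed
  show ?thesis
  proof (rule that[OF hk(1,2)])
    fix z1 z2 :: "real \<Rightarrow> 'a" and n
    assume z: "(z1 \<longlongrightarrow> a) (at_right 0)" "(z2 \<longlongrightarrow> a) (at_right 0)"
      and l: "((\<lambda>r. (g (z1 r) - g (z2 r)) /\<^sub>R r ^ n) \<longlongrightarrow> 0) (at_right 0)"
    show "((\<lambda>r. (g' (h (z1 r)) - g' (h (z2 r))) /\<^sub>R r ^ n) \<longlongrightarrow> 0) (at_right 0)"
    proof (rule scaled_bound_tendsto_0[OF l])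
      show "\<forall>\<^sub>F r in at_right 0. norm (g' (h (z1 r)) - g' (h (z2 r))) \<le> C * norm (g (z1 r) - g (z2 r))"
        using eventually_compose_filterlim[OF gb z(1)] eventually_compose_filterlim[OF gb z(2)]
          eventually_compose_filterlim[OF hk(4) z(1)] eventually_compose_filterlim[OF hk(4) z(2)]
        by eventually_elim (use d(2) in metis)
    qed
  next
    fix z :: "real \<Rightarrow> 'a" and v n
    assume z: "(z \<longlongrightarrow> a) (at_right 0)"
      and l: "((\<lambda>r. frechet_derivative g (at (z r)) v /\<^sub>R r ^ n) \<longlongrightarrow> 0) (at_right 0)"
    show "((\<lambda>r. frechet_derivative g' (at (h (z r))) (frechet_derivative h (at (z r)) v) /\<^sub>R r ^ n) \<longlongrightarrow> 0) (at_right 0)"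
    proof (rule scaled_bound_tendsto_0[OF l])
      show "\<forall>\<^sub>F r in at_right 0. norm (frechet_derivative g' (at (h (z r))) (frechet_derivative h (at (z r)) v))
          \<le> C * norm (frechet_derivative g (at (z r)) v)"
        using eventually_compose_filterlim[OF gb z] eventually_compose_filterlim[OF D z]
        by eventually_elim (use d(3) in metis)
    qed
  qed
qed

lemma smooth_germ_A1_form: "smooth_germ (A1_form \<epsilon>) z"
  unfolding A1_form_def by (intro smooth_germ_intros smooth_germ_coordinates)

lemma A1_form_derivative:
  "frechet_derivative (A1_form \<epsilon>) (at z) v =
    (fst v, 2 * snd z * snd v, 3 * (snd z)\<^sup>2 * snd v + \<epsilon> * (snd v * (fst z)\<^sup>2 + snd z * (2 * fst z * fst v)))"
proof -
  have "(A1_form \<epsilon> has_derivative (\<lambda>v. (fst v, 2 * snd z * snd v,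
      3 * (snd z)\<^sup>2 * snd v + \<epsilon> * (snd v * (fst z)\<^sup>2 + snd z * (2 * fst z * fst v))))) (at z)"
    unfolding A1_form_def
    by (auto intro!: derivative_eq_intros simp: algebra_simps power2_eq_square fun_eq_iff)
  from frechet_derivative_at[OF this, symmetric] show ?thesis by simp
qed

lemma A1_form_0: "A1_form \<epsilon> 0 = 0"
  by (simp add: A1_form_def prod_eq_iff)

lemma tendsto_0_times_id:
  fixes f :: "real \<Rightarrow> real"
  assumes "((\<lambda>r. f r / r ^ Suc n) \<longlongrightarrow> 0) (at_right 0)"
  shows "((\<lambda>r. f r / r ^ n) \<longlongrightarrow> 0) (at_right 0)"
proof -
  have "((\<lambda>r. r * (f r / r ^ Suc n)) \<longlongrightarrow> 0 * 0) (at_right 0)" by (intro tendsto_intros assms)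
  moreover have "\<forall>\<^sub>F r in at_right 0. r * (f r / r ^ Suc n) = f r / r ^ n" by (auto simp: eventually_at_filter)
  ultimately show ?thesis using Lim_transform_eventually by fastforce
qed

lemma diffeo_germ_derivative_nonzero:
  fixes h :: "'a::euclidean_space \<Rightarrow> 'a"
  assumes "diffeo_germ h a" "e \<noteq> 0"
  shows "frechet_derivative h (at a) e \<noteq> 0"
proof
  assume z: "frechet_derivative h (at a) e = 0"
  have "frechet_derivative h (at a) 0 = 0"
    by (rule linear_0[OF has_derivative_linear[OF smooth_germ_derivative[OF diffeo_germ_smooth[OF assms(1)]]]])
  with z show False using injD[OF diffeo_germ_inj_derivative[OF assms(1)], of e 0] assms(2) by simp
qed

context
  fixes g :: "real \<times> real \<Rightarrow> real \<times> real \<times> real" and \<epsilon> :: real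
  assumes lr: "left_right_equivalent g 0 (A1_form \<epsilon>) 0" and g: "smooth_germ g 0"
begin

text \<open>The first two coordinates of \<open>A1_form\<close> are x and y^2. Both being o(r^2)
  makes the velocity of the transported curve vanish. Used to exclude p + 2 q = 0.\<close>

lemma A1_growth:
  assumes z: "((\<lambda>r. (z r - 0) /\<^sub>R r) \<longlongrightarrow> e) (at_right 0)" "e \<noteq> 0"
    and l: "((\<lambda>r. (g (z r) - g 0) /\<^sub>R r ^ 2) \<longlongrightarrow> 0) (at_right 0)"
  shows False
proof -
  obtain h where h: "diffeo_germ h 0" "h 0 = 0"
    "\<And>z1 z2 n. (z1 \<longlongrightarrow> 0) (at_right 0) \<Longrightarrow> (z2 \<longlongrightarrow> 0) (at_right 0) \<Longrightarrow>
      ((\<lambda>r. (g (z1 r) - g (z2 r)) /\<^sub>R r ^ n) \<longlongrightarrow> 0) (at_right (0 :: real)) \<Longrightarrow>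
      ((\<lambda>r. (A1_form \<epsilon> (h (z1 r)) - A1_form \<epsilon> (h (z2 r))) /\<^sub>R r ^ n) \<longlongrightarrow> 0) (at_right 0)"
    by (rule left_right_transfer[OF lr g smooth_germ_A1_form]) blast
  define w where "w = frechet_derivative h (at 0) e"
  have w: "w \<noteq> 0" unfolding w_def by (rule diffeo_germ_derivative_nonzero[OF h(1) z(2)])
  have hz: "((\<lambda>r. (h (z r) - h 0) /\<^sub>R r) \<longlongrightarrow> w) (at_right 0)"
    unfolding w_def by (rule curve_derivative[OF smooth_germ_derivative[OF diffeo_germ_smooth[OF h(1)]] z(1)])
  have N: "((\<lambda>r. A1_form \<epsilon> (h (z r)) /\<^sub>R r ^ 2) \<longlongrightarrow> 0) (at_right 0)"
    using h(3)[OF curve_tendsto[OF z(1)] tendsto_const l] by (simp add: h(2) A1_form_0)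
  have "((\<lambda>r. fst (h (z r)) / r ^ Suc 1) \<longlongrightarrow> 0) (at_right 0)"
    using tendsto_fst[OF N] by (simp add: A1_form_def divide_inverse mult.commute numeral_2_eq_2)
  from tendsto_0_times_id[OF this] have "((\<lambda>r. fst (h (z r)) / r) \<longlongrightarrow> 0) (at_right 0)" by simp
  moreover have "((\<lambda>r. fst (h (z r)) / r) \<longlongrightarrow> fst w) (at_right 0)"
    using tendsto_fst[OF hz] by (simp add: h(2) divide_inverse mult.commute)
  ultimately have f: "fst w = 0" using tendsto_unique[OF trivial_limit_at_right_real] by blast
  have "((\<lambda>r. (snd (h (z r)) / r)\<^sup>2) \<longlongrightarrow> 0) (at_right 0)"
    using tendsto_fst[OF tendsto_snd[OF N]] by (simp add: A1_form_def divide_inverse mult.commute power_mult_distrib power_inverse)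
  moreover have "((\<lambda>r. (snd (h (z r)) / r)\<^sup>2) \<longlongrightarrow> (snd w)\<^sup>2) (at_right 0)"
    using tendsto_power[OF tendsto_snd[OF hz], of 2] by (simp add: h(2) divide_inverse mult.commute)
  ultimately have "(snd w)\<^sup>2 = 0" using tendsto_unique[OF trivial_limit_at_right_real] by blast
  then show False using f w by (simp add: prod_eq_iff)
qed

text \<open>The kernel direction is transported to the y-axis, where the odd cubic term separates
  opposite points at order r^3. Used to exclude q = 0.\<close>

lemma A1_opposite_points:
  assumes z1: "((\<lambda>r. (z1 r - 0) /\<^sub>R r) \<longlongrightarrow> e) (at_right 0)" and z2: "((\<lambda>r. (z2 r - 0) /\<^sub>R r) \<longlongrightarrow> - e) (at_right 0)"
    and e: "e \<noteq> 0" "frechet_derivative g (at 0) e = 0"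
    and l: "((\<lambda>r. (g (z1 r) - g (z2 r)) /\<^sub>R r ^ 3) \<longlongrightarrow> 0) (at_right 0)"
  shows False
proof -
  obtain h where h: "diffeo_germ h 0" "h 0 = 0"
    "\<And>z1 z2 n. (z1 \<longlongrightarrow> 0) (at_right 0) \<Longrightarrow> (z2 \<longlongrightarrow> 0) (at_right 0) \<Longrightarrow>
      ((\<lambda>r. (g (z1 r) - g (z2 r)) /\<^sub>R r ^ n) \<longlongrightarrow> 0) (at_right (0 :: real)) \<Longrightarrow>
      ((\<lambda>r. (A1_form \<epsilon> (h (z1 r)) - A1_form \<epsilon> (h (z2 r))) /\<^sub>R r ^ n) \<longlongrightarrow> 0) (at_right 0)"
    "\<And>z v n. (z \<longlongrightarrow> 0) (at_right 0) \<Longrightarrow>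
      ((\<lambda>r. frechet_derivative g (at (z r)) v /\<^sub>R r ^ n) \<longlongrightarrow> 0) (at_right (0 :: real)) \<Longrightarrow>
      ((\<lambda>r. frechet_derivative (A1_form \<epsilon>) (at (h (z r))) (frechet_derivative h (at (z r)) v) /\<^sub>R r ^ n) \<longlongrightarrow> 0) (at_right 0)"
    by (rule left_right_transfer[OF lr g smooth_germ_A1_form]) blast
  define D where "D = frechet_derivative h (at 0)"
  have D: "(h has_derivative D) (at 0)" unfolding D_def by (rule smooth_germ_derivative[OF diffeo_germ_smooth[OF h(1)]])
  have w: "D e \<noteq> 0" unfolding D_def by (rule diffeo_germ_derivative_nonzero[OF h(1) e(1)])
  have "((\<lambda>r :: real. frechet_derivative (A1_form \<epsilon>) (at (h 0)) (frechet_derivative h (at 0) e) /\<^sub>R r ^ 0) \<longlongrightarrow> 0) (at_right 0)"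
    by (rule h(4)[OF tendsto_const]) (simp add: e(2))
  then have "frechet_derivative (A1_form \<epsilon>) (at 0) (D e) = 0"
    by (simp add: h(2) D_def tendsto_const_iff)
  then have f: "fst (D e) = 0" by (simp add: A1_form_derivative prod_eq_iff)
  let ?P = "\<lambda>u :: real \<times> real. snd u ^ 3 + \<epsilon> * (snd u * (fst u)\<^sup>2)"
  have hz: "((\<lambda>r. h (z1 r) /\<^sub>R r) \<longlongrightarrow> D e) (at_right 0)" "((\<lambda>r. h (z2 r) /\<^sub>R r) \<longlongrightarrow> D (- e)) (at_right 0)"
    using curve_derivative[OF D z1] curve_derivative[OF D z2] by (simp_all add: h(2))
  have "D (- e) = - D e" by (rule linear_neg[OF has_derivative_linear[OF D]])
  then have "((\<lambda>r. ?P (h (z1 r) /\<^sub>R r) - ?P (h (z2 r) /\<^sub>R r)) \<longlongrightarrow> ?P (D e) - ?P (- D e)) (at_right 0)"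
    using hz by (intro tendsto_intros) simp_all
  moreover have "((\<lambda>r. (A1_form \<epsilon> (h (z1 r)) - A1_form \<epsilon> (h (z2 r))) /\<^sub>R r ^ 3) \<longlongrightarrow> 0) (at_right 0)"
    by (rule h(3)[OF curve_tendsto[OF z1] curve_tendsto[OF z2] l])
  from tendsto_snd[OF tendsto_snd[OF this]]
  have "((\<lambda>r. (?P (h (z1 r)) - ?P (h (z2 r))) / r ^ 3) \<longlongrightarrow> 0) (at_right 0)"
    by (simp add: A1_form_def divide_inverse mult.commute)
  moreover have "?P (u /\<^sub>R r) = ?P u / r ^ 3" for u r
    by (cases "r = 0") (simp_all add: field_simps power2_eq_square power3_eq_cube)
  ultimately have "?P (D e) - ?P (- D e) = 0"
    using tendsto_unique[OF trivial_limit_at_right_real] by (simp add: diff_divide_distrib) blast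
  then have "snd (D e) ^ 3 = 0" by (simp add: f)
  then show False using w f by (simp add: prod_eq_iff)
qed

text \<open>The three coordinates of the differential are read in turn: the first makes the limit of
  the transported vector vertical, the second then makes the y-velocity 0, and the third, 3 y^2 +
  \<epsilon> x^2 to leading order, makes the x-velocity 0. Used to exclude p (p + q) = 0.\<close>

lemma A1_derivative_growth:
  assumes z: "((\<lambda>r. (z r - 0) /\<^sub>R r) \<longlongrightarrow> e) (at_right 0)" "e \<noteq> 0" and v: "v \<noteq> 0" and \<epsilon>: "\<epsilon> \<noteq> 0"
    and l: "((\<lambda>r. frechet_derivative g (at (z r)) v /\<^sub>R r ^ 2) \<longlongrightarrow> 0) (at_right 0)"
  shows False
proof -
  obtain h where h: "diffeo_germ h 0" "h 0 = 0"
    "\<And>z v n. (z \<longlongrightarrow> 0) (at_right 0) \<Longrightarrow>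
      ((\<lambda>r. frechet_derivative g (at (z r)) v /\<^sub>R r ^ n) \<longlongrightarrow> 0) (at_right (0 :: real)) \<Longrightarrow>
      ((\<lambda>r. frechet_derivative (A1_form \<epsilon>) (at (h (z r))) (frechet_derivative h (at (z r)) v) /\<^sub>R r ^ n) \<longlongrightarrow> 0) (at_right 0)"
    by (rule left_right_transfer[OF lr g smooth_germ_A1_form]) blast
  note sh = diffeo_germ_smooth[OF h(1)]
  note z0 = curve_tendsto[OF z(1)]
  define e' where "e' = frechet_derivative h (at 0) e"
  have e': "e' \<noteq> 0" unfolding e'_def by (rule diffeo_germ_derivative_nonzero[OF h(1) z(2)])
  have hz: "((\<lambda>r. h (z r) /\<^sub>R r) \<longlongrightarrow> e') (at_right 0)"
    using curve_derivative[OF smooth_germ_derivative[OF sh] z(1)] by (simp add: h(2) e'_def)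
  define x where "x r = fst (h (z r)) / r" for r
  define y where "y r = snd (h (z r)) / r" for r
  have xl: "(x \<longlongrightarrow> fst e') (at_right 0)" and yl: "(y \<longlongrightarrow> snd e') (at_right 0)"
    unfolding x_def[abs_def] y_def[abs_def] using tendsto_fst[OF hz] tendsto_snd[OF hz]
    by (simp_all add: divide_inverse mult.commute)
  define w where "w r = frechet_derivative h (at (z r)) v" for r
  define w0 where "w0 = frechet_derivative h (at 0) v"
  have w0: "w0 \<noteq> 0" unfolding w0_def by (rule diffeo_germ_derivative_nonzero[OF h(1) v])
  have wl: "(w \<longlongrightarrow> w0) (at_right 0)"
    unfolding w_def[abs_def] w0_def
    by (rule isCont_tendsto_compose[OF smooth_germ_isCont[OF smooth_germ_frechet[OF sh]] z0])
  have N: "((\<lambda>r. frechet_derivative (A1_form \<epsilon>) (at (h (z r))) (w r) /\<^sub>R r ^ 2) \<longlongrightarrow> 0) (at_right 0)"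
    unfolding w_def by (rule h(3)[OF z0 l])
  have n1: "((\<lambda>r. fst (w r) / r ^ Suc 1) \<longlongrightarrow> 0) (at_right 0)"
    using tendsto_fst[OF N] by (simp add: A1_form_derivative divide_inverse mult.commute numeral_2_eq_2)
  have n1': "((\<lambda>r. fst (w r) / r ^ Suc 0) \<longlongrightarrow> 0) (at_right 0)" by (rule tendsto_0_times_id[of _ "Suc 0"]) (use n1 in simp)
  have "((\<lambda>r. fst (w r) / r ^ 0) \<longlongrightarrow> 0) (at_right 0)" by (rule tendsto_0_times_id[OF n1'])
  then have "fst w0 = 0"
    using tendsto_fst[OF wl] by (intro tendsto_unique[OF trivial_limit_at_right_real]) simp_all
  then have s0: "snd w0 \<noteq> 0" using w0 by (simp add: prod_eq_iff)
  have "((\<lambda>r. (2 * snd (h (z r)) * snd (w r)) / r ^ Suc 1) \<longlongrightarrow> 0) (at_right 0)"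
    using tendsto_fst[OF tendsto_snd[OF N]] by (simp add: A1_form_derivative divide_inverse mult.commute numeral_2_eq_2)
  from tendsto_0_times_id[OF this]
  have "((\<lambda>r. 2 * y r * snd (w r)) \<longlongrightarrow> 0) (at_right 0)" by (simp add: y_def)
  moreover have "((\<lambda>r. 2 * y r * snd (w r)) \<longlongrightarrow> 2 * snd e' * snd w0) (at_right 0)"
    by (intro tendsto_intros yl wl)
  ultimately have "2 * snd e' * snd w0 = 0" using tendsto_unique[OF trivial_limit_at_right_real] by blast
  then have ye: "snd e' = 0" using s0 by simp
  have "((\<lambda>r. 3 * (y r)\<^sup>2 * snd (w r) + \<epsilon> * (snd (w r) * (x r)\<^sup>2 + y r * (2 * x r * fst (w r))))
      \<longlongrightarrow> 3 * (snd e')\<^sup>2 * snd w0 + \<epsilon> * (snd w0 * (fst e')\<^sup>2 + snd e' * (2 * fst e' * fst w0))) (at_right 0)"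
    by (intro tendsto_intros xl yl wl)
  moreover have "((\<lambda>r. 3 * (y r)\<^sup>2 * snd (w r) + \<epsilon> * (snd (w r) * (x r)\<^sup>2 + y r * (2 * x r * fst (w r)))) \<longlongrightarrow> 0) (at_right 0)"
  proof (rule Lim_transform_eventually)
    show "((\<lambda>r. snd (snd (frechet_derivative (A1_form \<epsilon>) (at (h (z r))) (w r) /\<^sub>R r ^ 2))) \<longlongrightarrow> 0) (at_right 0)"
      using tendsto_snd[OF tendsto_snd[OF N]] by simp
    show "\<forall>\<^sub>F r in at_right 0. snd (snd (frechet_derivative (A1_form \<epsilon>) (at (h (z r))) (w r) /\<^sub>R r ^ 2))
        = 3 * (y r)\<^sup>2 * snd (w r) + \<epsilon> * (snd (w r) * (x r)\<^sup>2 + y r * (2 * x r * fst (w r)))"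
      unfolding eventually_at_filter
      by (intro always_eventually allI impI)
        (simp add: A1_form_derivative x_def y_def divide_inverse power_mult_distrib power_inverse algebra_simps power2_eq_square)
  qed
  ultimately have "3 * (snd e')\<^sup>2 * snd w0 + \<epsilon> * (snd w0 * (fst e')\<^sup>2 + snd e' * (2 * fst e' * fst w0)) = 0"
    by (rule tendsto_unique[OF trivial_limit_at_right_real])
  then have "fst e' = 0" using ye s0 \<epsilon> by simp
  then show False using ye e' by (simp add: prod_eq_iff)
qed

end

text \<open>\<open>A1_form (- 1)\<close> has double points arbitrarily close to the origin, \<open>A1_form 1\<close> is injective.\<close>

lemma A1_forms_not_equivalent: "\<not> left_right_equivalent (A1_form (- 1)) 0 (A1_form 1) 0"
proof
  assume "left_right_equivalent (A1_form (- 1)) 0 (A1_form 1) 0"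
  then obtain h k where hk: "diffeo_germ h 0" "\<forall>\<^sub>F z in nhds 0. k (A1_form (- 1) z) = A1_form 1 (h z)"
    by (rule left_right_equivalentE) blast
  obtain h' where "\<forall>\<^sub>F z in nhds 0. h' (h z) = z" using hk(1) by (rule diffeo_germ_inverse) blast
  with hk(2) have "\<forall>\<^sub>F z in nhds 0. k (A1_form (- 1) z) = A1_form 1 (h z) \<and> h' (h z) = z"
    by eventually_elim simp
  then obtain r where r: "r > 0" "\<And>z. z \<in> box2 r \<Longrightarrow> k (A1_form (- 1) z) = A1_form 1 (h z) \<and> h' (h z) = z"
    by (rule eventually_nhds_box2E) blast
  \<comment> \<open>Double points come from x^2 = y^2: there y^3 - y x^2 vanishes for both signs of
    y.\<close>
  have b: "(r / 2, r / 2) \<in> box2 r" "(r / 2, - r / 2) \<in> box2 r" using r(1) by (simp_all add: mem_box2)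
  have "A1_form (- 1) (r / 2, r / 2) = A1_form (- 1) (r / 2, - r / 2)"
    by (simp add: A1_form_def power2_eq_square power3_eq_cube)
  then have "A1_form 1 (h (r / 2, r / 2)) = A1_form 1 (h (r / 2, - r / 2))"
    using r(2)[OF b(1)] r(2)[OF b(2)] by metis
  moreover have "u = u'" if "A1_form 1 u = A1_form 1 u'" for u u'
  proof -
    have f: "fst u = fst u'" "(snd u)\<^sup>2 = (snd u')\<^sup>2" and c: "snd u ^ 3 + snd u * (fst u)\<^sup>2 = snd u' ^ 3 + snd u' * (fst u')\<^sup>2"
      using that unfolding A1_form_def prod.inject mult_1 by blast+
    have e: "y ^ 3 + y * x\<^sup>2 = y * (y\<^sup>2 + x\<^sup>2)" for x y :: real by (simp add: algebra_simps power2_eq_square power3_eq_cube)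
    have "snd u * ((snd u)\<^sup>2 + (fst u)\<^sup>2) = snd u' * ((snd u)\<^sup>2 + (fst u)\<^sup>2)"
      using c unfolding e f[symmetric] .
    then have "(snd u - snd u') * ((snd u)\<^sup>2 + (fst u)\<^sup>2) = 0" by (simp only: left_diff_distrib diff_self)
    then have "snd u = snd u'" using f(2) by (auto simp: sum_power2_eq_zero_iff)
    with f(1) show ?thesis by (simp add: prod_eq_iff)
  qed
  ultimately have "h (r / 2, r / 2) = h (r / 2, - r / 2)" by blast
  then have "(r / 2, r / 2) = (r / 2, - r / 2)" using r(2)[OF b(1)] r(2)[OF b(2)] by metis
  then show False using r(1) by simp
qed

lemma A1_form_sign_unique:
  assumes "left_right_equivalent g 0 (A1_form \<epsilon>) 0" "left_right_equivalent g 0 (A1_form \<epsilon>') 0" "smooth_germ g 0"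
    and "\<epsilon> = 1 \<or> \<epsilon> = - 1" "\<epsilon>' = 1 \<or> \<epsilon>' = - 1"
  shows "\<epsilon> = \<epsilon>'"
proof -
  note c = smooth_germ_isCont[OF assms(3)]
  have "left_right_equivalent (A1_form \<epsilon>) 0 (A1_form \<epsilon>') 0" "left_right_equivalent (A1_form \<epsilon>') 0 (A1_form \<epsilon>) 0"
    using left_right_equivalent_trans[OF left_right_equivalent_sym[OF assms(1) c] assms(2)]
      left_right_equivalent_trans[OF left_right_equivalent_sym[OF assms(2) c] assms(1)] .
  then show ?thesis using A1_forms_not_equivalent assms(4,5) by auto
qed

lemma smooth_germ_fold_form: "smooth_germ h 0 \<Longrightarrow> smooth_germ (fold_form h) 0"
  unfolding fold_form_def
  by (intro smooth_germ_Pair smooth_germ_mult smooth_germ_power smooth_germ_coordinates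
      smooth_germ_compose[where g = h and f = "\<lambda>z. (fst z, (snd z)\<^sup>2)"]) (simp add: zero_in_plane)

text \<open>If \<open>\<gamma> = 0\<close>, the differential in the direction \<open>(0, 1)\<close>
  is o(r^2) along the x-axis; if \<open>py h 0 = 0\<close>, the points \<open>(0, r)\<close> and
  \<open>(0, - r)\<close> have images differing by o(r^3). Umbrellas admit neither. The sign then
  follows from \<open>fold_form_A1\<close> and the inequivalence of the two forms.\<close>

lemma fold_form_A1_converse:
  assumes lr: "left_right_equivalent (fold_form h) 0 (A1_form \<epsilon>) 0" and h: "smooth_germ h 0" "h 0 = 0"
    and \<gamma>: "((\<lambda>x. h (x, 0) / x\<^sup>2) \<longlongrightarrow> \<gamma>) (at 0)" and \<epsilon>: "\<epsilon> = 1 \<or> \<epsilon> = - 1"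
  shows "\<gamma> * py h 0 \<noteq> 0" "\<epsilon> = sgn (\<gamma> * py h 0)"
proof -
  note sf = smooth_germ_fold_form[OF h(1)]
  let ?sq = "\<lambda>z :: real \<times> real. (fst z, (snd z)\<^sup>2)"
  have ssq: "smooth_germ ?sq z" for z by (intro smooth_germ_intros smooth_germ_coordinates)
  have "\<forall>\<^sub>F z in nhds 0. smooth_germ h (?sq z)"
    by (rule eventually_nhds_curve[OF smooth_germ_isCont[OF ssq] _ smooth_germ_eventually[OF h(1)]]) (simp add: zero_in_plane)
  then have D: "\<forall>\<^sub>F z in nhds 0. snd z = 0 \<longrightarrow> frechet_derivative (fold_form h) (at z) (0, 1) = (0, 0, h (fst z, 0))"
  proof eventually_elim
    case (elim z)
    have sh: "smooth_germ (\<lambda>z. h (?sq z)) z" by (rule smooth_germ_compose[OF elim ssq])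
    have "((\<lambda>z. snd z * h (?sq z)) has_derivative (\<lambda>v. snd z * frechet_derivative (\<lambda>z. h (?sq z)) (at z) v + snd v * h (?sq z))) (at z)"
      by (rule has_derivative_mult[OF _ smooth_germ_derivative[OF sh]]) (rule derivative_intros)+
    then have "(fold_form h has_derivative (\<lambda>v. (fst v, 2 * snd z * snd v,
        snd z * frechet_derivative (\<lambda>z. h (?sq z)) (at z) v + snd v * h (?sq z)))) (at z)"
      unfolding fold_form_def by (intro has_derivative_Pair) (auto intro!: derivative_eq_intros)
    from frechet_derivative_at[OF this, symmetric] show ?case by simp
  qed
  have g0: "\<gamma> \<noteq> 0"
  proof
    assume "\<gamma> = 0"
    have z: "((\<lambda>r :: real. ((r, 0) - 0) /\<^sub>R r) \<longlongrightarrow> (1, 0 :: real)) (at_right 0)"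
    proof (rule Lim_transform_eventually[OF tendsto_const])
      show "\<forall>\<^sub>F r :: real in at_right 0. (1, 0) = ((r, 0) - 0) /\<^sub>R r" by (auto simp: eventually_at_filter)
    qed
    have "((\<lambda>x. h (x, 0) / x\<^sup>2) \<longlongrightarrow> 0) (at_right 0)"
      using \<gamma> unfolding \<open>\<gamma> = 0\<close> by (rule tendsto_within_subset) simp
    then have "((\<lambda>x. (0 :: real, 0 :: real, h (x, 0) / x\<^sup>2)) \<longlongrightarrow> (0, 0, 0)) (at_right 0)" by (intro tendsto_intros)
    moreover have "isCont (\<lambda>x :: real. (x, 0 :: real)) 0" by (intro continuous_intros)
    from eventually_nhds_imp_at[OF eventually_nhds_curve[OF this zero_in_plane D]]
    have "\<forall>\<^sub>F r in at_right 0. (0, 0, h (r, 0) / r\<^sup>2) = frechet_derivative (fold_form h) (at (r, 0)) (0, 1) /\<^sub>R r ^ 2"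
      unfolding eventually_at_filter by (auto elim!: eventually_mono simp: divide_inverse mult.commute)
    ultimately have "((\<lambda>r. frechet_derivative (fold_form h) (at (r, 0)) (0, 1) /\<^sub>R r ^ 2) \<longlongrightarrow> (0, 0, 0)) (at_right 0)"
      by (rule Lim_transform_eventually)
    then have l: "((\<lambda>r. frechet_derivative (fold_form h) (at (r, 0)) (0, 1) /\<^sub>R r ^ 2) \<longlongrightarrow> 0) (at_right 0)"
      by (simp add: zero_prod_def)
    show False by (rule A1_derivative_growth[OF lr sf z _ _ _ l]) (use \<epsilon> in \<open>auto simp: zero_prod_def\<close>)
  qed
  moreover have d0: "py h 0 \<noteq> 0"
  proof
    assume py0: "py h 0 = 0"
    have z: "((\<lambda>r :: real. ((0, s * r) - 0) /\<^sub>R r) \<longlongrightarrow> (0 :: real, s)) (at_right 0)" for s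
    proof (rule Lim_transform_eventually[OF tendsto_const])
      show "\<forall>\<^sub>F r :: real in at_right 0. (0, s) = ((0, s * r) - 0) /\<^sub>R r" by (auto simp: eventually_at_filter)
    qed
    have "((\<lambda>y. h (0, y)) has_field_derivative 0) (at 0)"
      using smooth_germ_DERIV_y[of h 0 0] h py0 by (simp add: zero_in_plane)
    then have "((\<lambda>y. h (0, y) / y) \<longlongrightarrow> 0) (at 0)"
      by (rule DERIV_0_quotient) (simp add: h zero_in_plane)
    moreover have "filterlim (\<lambda>y :: real. y\<^sup>2) (at 0) (at_right 0)"
      by (auto simp: filterlim_at eventually_at_filter intro!: tendsto_eq_intros)
    ultimately have "((\<lambda>y. h (0, y\<^sup>2) / y\<^sup>2) \<longlongrightarrow> 0) (at_right 0)" by (rule filterlim_compose)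
    then have "((\<lambda>y. (0 :: real, 0 :: real, 2 * (h (0, y\<^sup>2) / y\<^sup>2))) \<longlongrightarrow> (0, 0, 2 * 0)) (at_right 0)" by (intro tendsto_intros)
    moreover have "\<forall>\<^sub>F r in at_right 0. (0, 0, 2 * (h (0, r\<^sup>2) / r\<^sup>2)) = (fold_form h (0, 1 * r) - fold_form h (0, (- 1) * r)) /\<^sub>R r ^ 3"
      by (auto simp: eventually_at_filter fold_form_def divide_inverse power2_eq_square power3_eq_cube)
    ultimately have "((\<lambda>r. (fold_form h (0, 1 * r) - fold_form h (0, (- 1) * r)) /\<^sub>R r ^ 3) \<longlongrightarrow> (0, 0, 2 * 0)) (at_right 0)"
      by (rule Lim_transform_eventually)
    then have l: "((\<lambda>r. (fold_form h (0, 1 * r) - fold_form h (0, (- 1) * r)) /\<^sub>R r ^ 3) \<longlongrightarrow> 0) (at_right 0)"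
      by (simp add: zero_prod_def)
    have "frechet_derivative (fold_form h) (at 0) (0, 1) = 0"
      using eventually_nhds_x_imp_x[OF D] h by (simp add: zero_in_plane prod_eq_iff)
    moreover have "((\<lambda>r :: real. ((0, (- 1) * r) - 0) /\<^sub>R r) \<longlongrightarrow> - (0 :: real, 1)) (at_right 0)" using z[of "- 1"] by simp
    ultimately show False
      using A1_opposite_points[OF lr sf z[of 1] _ _ _ l] by (simp add: zero_prod_def)
  qed
  ultimately show nz: "\<gamma> * py h 0 \<noteq> 0" by simp
  have "left_right_equivalent (fold_form h) 0 (A1_form (sgn (\<gamma> * py h 0))) 0"
    by (rule fold_form_A1[OF h \<gamma> g0 d0])
  from A1_form_sign_unique[OF lr this sf \<epsilon>] show "\<epsilon> = sgn (\<gamma> * py h 0)"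
    using nz by (simp add: sgn_if)
qed

text \<open>Schwarz's theorem: the second difference over a small square is a mean value of either
  mixed derivative, and both are continuous.\<close>

lemma px_py_commute:
  fixes F :: "real \<times> real \<Rightarrow> real"
  assumes F: "smooth_germ F z"
  shows "py (px F) z = px (py F) z"
proof (rule ccontr)
  assume ne: "py (px F) z \<noteq> px (py F) z"
  define \<delta> where "\<delta> = \<bar>py (px F) z - px (py F) z\<bar> / 2"
  have \<delta>: "\<delta> > 0" using ne by (simp add: \<delta>_def)
  obtain a b where z: "z = (a, b)" by (cases z)
  have sx: "smooth_germ (px F) z" and sy: "smooth_germ (py F) z"
    by (rule smooth_germ_px[OF F] smooth_germ_py[OF F])+
  have "\<forall>\<^sub>F w in nhds z. dist (py (px F) w) (py (px F) z) < \<delta>" "\<forall>\<^sub>F w in nhds z. dist (px (py F) w) (px (py F) z) < \<delta>"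
    by (rule tendstoD[OF tendsto_nhds_smooth_germ \<delta>], rule smooth_germ_py[OF sx] smooth_germ_px[OF sy])+
  with smooth_germ_eventually[OF F]
  have "\<forall>\<^sub>F w in nhds z. smooth_germ F w \<and> dist (py (px F) w) (py (px F) z) < \<delta> \<and> dist (px (py F) w) (px (py F) z) < \<delta>"
    by eventually_elim simp
  then obtain U where U: "open U" "(a, b) \<in> U" "\<And>w. w \<in> U \<Longrightarrow> smooth_germ F w \<and> dist (py (px F) w) (py (px F) z) < \<delta> \<and> dist (px (py F) w) (px (py F) z) < \<delta>"
    unfolding eventually_nhds z by blast
  obtain S T where ST: "open S" "open T" "a \<in> S" "b \<in> T" "S \<times> T \<subseteq> U"
    using open_prod_elim[OF U(1,2)] by (metis mem_Sigma_iff)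
  obtain e1 where e1: "e1 > 0" "ball a e1 \<subseteq> S" using ST by (meson open_contains_ball)
  obtain e2 where e2: "e2 > 0" "ball b e2 \<subseteq> T" using ST by (meson open_contains_ball)
  define h where "h = min e1 e2 / 2"
  have h: "h > 0" using e1 e2 by (simp add: h_def)
  have inU: "(x, y) \<in> U" if "a \<le> x" "x \<le> a + h" "b \<le> y" "y \<le> b + h" for x y
  proof -
    have "x \<in> ball a e1" "y \<in> ball b e2" using that e1 e2 by (auto simp: dist_real_def h_def)
    then show ?thesis using e1 e2 ST by blast
  qed
  have sm: "smooth_germ F (x, y)" if "a \<le> x" "x \<le> a + h" "b \<le> y" "y \<le> b + h" for x y
    using U(3)[OF inU[OF that]] by blast
  have "\<exists>c>a. c < a + h \<and> (F (a + h, b + h) - F (a + h, b)) - (F (a, b + h) - F (a, b)) = (a + h - a) * (px F (c, b + h) - px F (c, b))"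
    by (rule MVT2) (use h in \<open>auto intro!: DERIV_diff smooth_germ_DERIV_x sm\<close>)
  then obtain c where c: "a < c" "c < a + h" "(F (a + h, b + h) - F (a + h, b)) - (F (a, b + h) - F (a, b)) = h * (px F (c, b + h) - px F (c, b))"
    by auto
  have "\<exists>d>b. d < b + h \<and> px F (c, b + h) - px F (c, b) = (b + h - b) * py (px F) (c, d)"
    by (rule MVT2) (use h c in \<open>auto intro!: smooth_germ_DERIV_y smooth_germ_px sm\<close>)
  then obtain d where d: "b < d" "d < b + h" "px F (c, b + h) - px F (c, b) = h * py (px F) (c, d)" by auto
  have "\<exists>d>b. d < b + h \<and> (F (a + h, b + h) - F (a, b + h)) - (F (a + h, b) - F (a, b)) = (b + h - b) * (py F (a + h, d) - py F (a, d))"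
    by (rule MVT2) (use h in \<open>auto intro!: DERIV_diff smooth_germ_DERIV_y sm\<close>)
  then obtain d' where d': "b < d'" "d' < b + h" "(F (a + h, b + h) - F (a, b + h)) - (F (a + h, b) - F (a, b)) = h * (py F (a + h, d') - py F (a, d'))"
    by auto
  have "\<exists>c>a. c < a + h \<and> py F (a + h, d') - py F (a, d') = (a + h - a) * px (py F) (c, d')"
    by (rule MVT2) (use h d' in \<open>auto intro!: smooth_germ_DERIV_x smooth_germ_py sm\<close>)
  then obtain c' where c': "a < c'" "c' < a + h" "py F (a + h, d') - py F (a, d') = h * px (py F) (c', d')" by auto
  have "h * (h * py (px F) (c, d)) = h * (h * px (py F) (c', d'))"
    using c(3) d'(3) unfolding d(3) c'(3) by linarith
  then have "py (px F) (c, d) = px (py F) (c', d')" using h by simp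
  moreover have "dist (py (px F) (c, d)) (py (px F) z) < \<delta>" "dist (px (py F) (c', d')) (px (py F) z) < \<delta>"
    using U(3)[OF inU[of c d]] U(3)[OF inU[of c' d']] c d c' d' by auto
  ultimately have "\<bar>py (px F) z - px (py F) z\<bar> < 2 * \<delta>" unfolding dist_real_def by linarith
  then show False by (simp add: \<delta>_def)
qed

lemma quadratic_limit:
  fixes f f' :: "real \<Rightarrow> real"
  assumes "\<forall>\<^sub>F y in nhds 0. (f has_field_derivative f' y) (at y)" "((\<lambda>y. f' y / y) \<longlongrightarrow> c) (at 0)"
  shows "((\<lambda>y. (f y - f 0) / y\<^sup>2) \<longlongrightarrow> c / 2) (at_right 0)"
proof (rule lhopital_right_0)
  have "isCont f 0" using eventually_nhds_x_imp_x[OF assms(1)] by (rule DERIV_isCont)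
  then have "((\<lambda>y. f y - f 0) \<longlongrightarrow> f 0 - f 0) (at 0)" unfolding isCont_def by (intro tendsto_intros)
  then show "((\<lambda>y. f y - f 0) \<longlongrightarrow> 0) (at_right 0)" by (auto intro: tendsto_within_subset)
  show "((\<lambda>y :: real. y\<^sup>2) \<longlongrightarrow> 0) (at_right 0)" by (auto intro!: tendsto_eq_intros)
  show "\<forall>\<^sub>F y :: real in at_right 0. y\<^sup>2 \<noteq> 0" "\<forall>\<^sub>F y :: real in at_right 0. 2 * y \<noteq> 0"
    by (auto simp: eventually_at_filter)
  show "\<forall>\<^sub>F y :: real in at_right 0. ((\<lambda>y. y\<^sup>2) has_real_derivative 2 * y) (at y)"
    by (intro always_eventually allI) (auto intro!: derivative_eq_intros)
  show "\<forall>\<^sub>F y in at_right 0. ((\<lambda>y. f y - f 0) has_real_derivative f' y) (at y)"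
    using assms(1) unfolding eventually_at_filter
    by (auto elim!: eventually_mono intro!: derivative_eq_intros)
  have "((\<lambda>y. (f' y / y) / 2) \<longlongrightarrow> c / 2) (at 0)" by (intro tendsto_intros assms(2)) simp
  moreover have "(f' y / y) / 2 = f' y / (2 * y)" for y by simp
  ultimately have "((\<lambda>y. f' y / (2 * y)) \<longlongrightarrow> c / 2) (at 0)" by (simp only:)
  then show "((\<lambda>y. f' y / (2 * y)) \<longlongrightarrow> c / 2) (at_right 0)" by (rule tendsto_within_subset) simp
qed

section \<open>Legendrian graphs in adapted coordinates\<close>

text \<open>In the coordinates \<open>x\<close> and \<open>\<tau> = x - x\<^sub>0\<close>, where \<open>x\<^sub>0\<close> is the abscissa of the tangency point, a
  tangential family reads \<open>y = A (x, \<tau>)\<close> with \<open>A\<^sub>\<tau>(x, 0) = 0\<close>, that is \<open>A\<^sub>\<tau> = \<tau> V\<close>, and its slope is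
  \<open>B = A\<^sub>x + A\<^sub>\<tau>\<close>.\<close>

definition tangential_germ :: "(real \<times> real \<Rightarrow> real) \<Rightarrow> (real \<times> real \<Rightarrow> real) \<Rightarrow> (real \<times> real \<Rightarrow> real) \<Rightarrow> bool" where
  "tangential_germ A B V \<longleftrightarrow> smooth_germ A 0 \<and> smooth_germ B 0 \<and> smooth_germ V 0 \<and>
    (\<forall>\<^sub>F z in nhds 0. py A z = snd z * V z) \<and>
    (\<forall>\<^sub>F z in nhds 0. py B z = V z + snd z * (px V z + py V z))"

definition graph_form :: "(real \<times> real \<Rightarrow> real) \<Rightarrow> (real \<times> real \<Rightarrow> real) \<Rightarrow> real \<times> real \<Rightarrow> real \<times> real \<times> real" where
  "graph_form A B = (\<lambda>z. (fst z, A z, B z))"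

lemma smooth_germ_graph_form:
  "smooth_germ A z \<Longrightarrow> smooth_germ B z \<Longrightarrow> smooth_germ (graph_form A B) z"
  unfolding graph_form_def by (intro smooth_germ_Pair smooth_germ_coordinates)

lemma graph_form_has_derivative:
  assumes "smooth_germ A z" "smooth_germ B z"
  shows "(graph_form A B has_derivative
    (\<lambda>v. (fst v, fst v * px A z + snd v * py A z, fst v * px B z + snd v * py B z))) (at z)"
  unfolding graph_form_def
  by (intro has_derivative_Pair smooth_germ_plane_real assms) (rule derivative_intros)+

lemma graph_form_derivative:
  assumes "smooth_germ A z" "smooth_germ B z"
  shows "frechet_derivative (graph_form A B) (at z) v
    = (fst v, fst v * px A z + snd v * py A z, fst v * px B z + snd v * py B z)"
  using frechet_derivative_at[OF graph_form_has_derivative[OF assms], symmetric] by simp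

text \<open>The transfer principle with a constant curve and exponent 0, where a limit of constants
  is an equality.\<close>

lemma kernel_transfer:
  fixes g :: "'a::euclidean_space \<Rightarrow> 'b::euclidean_space"
  assumes "left_right_equivalent g a g' b" "smooth_germ g a" "smooth_germ g' b"
    and v: "v \<noteq> 0" "frechet_derivative g (at a) v = 0"
  obtains w where "w \<noteq> 0" "frechet_derivative g' (at b) w = 0"
proof -
  obtain h where h: "diffeo_germ h a" "h a = b"
    "\<And>z v n. (z \<longlongrightarrow> a) (at_right 0) \<Longrightarrow>
      ((\<lambda>r. frechet_derivative g (at (z r)) v /\<^sub>R r ^ n) \<longlongrightarrow> 0) (at_right (0 :: real)) \<Longrightarrow>
      ((\<lambda>r. frechet_derivative g' (at (h (z r))) (frechet_derivative h (at (z r)) v) /\<^sub>R r ^ n) \<longlongrightarrow> 0) (at_right 0)"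
    by (rule left_right_transfer[OF assms(1-3)]) blast
  have "((\<lambda>r :: real. frechet_derivative g' (at (h a)) (frechet_derivative h (at a) v) /\<^sub>R r ^ 0) \<longlongrightarrow> 0) (at_right 0)"
    by (rule h(3)[OF tendsto_const]) (simp add: v(2))
  then have "frechet_derivative g' (at b) (frechet_derivative h (at a) v) = 0"
    by (simp add: h(2) tendsto_const_iff)
  then show ?thesis using that diffeo_germ_derivative_nonzero[OF h(1) v(1)] by blast
qed

context
  fixes A B V :: "real \<times> real \<Rightarrow> real"
  assumes tg: "tangential_germ A B V"
begin

lemma tangential_germ_smooth: "smooth_germ A 0" "smooth_germ B 0" "smooth_germ V 0" "smooth_germ (graph_form A B) 0"
  using tg smooth_germ_graph_form unfolding tangential_germ_def by blast+

lemma tangential_germ_py: "\<forall>\<^sub>F z in nhds 0. py A z = snd z * V z"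
    "\<forall>\<^sub>F z in nhds 0. py B z = V z + snd z * (px V z + py V z)"
  using tg unfolding tangential_germ_def by blast+

lemma tangential_germ_at_0: "py A 0 = 0" "py B 0 = V 0"
  using eventually_nhds_x_imp_x[OF tangential_germ_py(1)] eventually_nhds_x_imp_x[OF tangential_germ_py(2)] by simp_all

lemma graph_form_kernel_iff:
  "frechet_derivative (graph_form A B) (at 0) w = 0 \<longleftrightarrow> fst w = 0 \<and> V 0 * snd w = 0"
proof -
  have eq: "frechet_derivative (graph_form A B) (at 0) w = (fst w, fst w * px A 0, fst w * px B 0 + snd w * V 0)"
    using graph_form_derivative[OF tangential_germ_smooth(1,2), of w] by (simp add: tangential_germ_at_0)
  show ?thesis unfolding eq by (auto simp: prod_eq_iff)
qed

lemma tangential_germ_py_B: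
  "px (py B) 0 = px V 0" "py (py B) 0 = px V 0 + 2 * py V 0"
  using px_py_cong[OF tangential_germ_py(2)] px_py_add[OF tangential_germ_smooth(3)
      smooth_germ_mult[OF smooth_germ_coordinates(2) smooth_germ_add[OF smooth_germ_px[OF tangential_germ_smooth(3)] smooth_germ_py[OF tangential_germ_smooth(3)]]]]
    px_py_mult[OF smooth_germ_coordinates(2) smooth_germ_add[OF smooth_germ_px[OF tangential_germ_smooth(3)] smooth_germ_py[OF tangential_germ_smooth(3)]]]
  by simp_all

lemma A1_singular:
  assumes "left_right_equivalent (graph_form A B) 0 (A1_form \<epsilon>) 0"
  shows "V 0 = 0"
proof -
  have "frechet_derivative (A1_form \<epsilon>) (at 0) (0, 1) = 0" by (simp add: A1_form_derivative prod_eq_iff)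
  moreover have "(0 :: real, 1 :: real) \<noteq> 0" by (simp add: zero_prod_def)
  ultimately obtain w where w: "w \<noteq> 0" "frechet_derivative (graph_form A B) (at 0) w = 0"
    using kernel_transfer[OF left_right_equivalent_sym[OF assms smooth_germ_isCont[OF tangential_germ_smooth(4)]]
        smooth_germ_A1_form tangential_germ_smooth(4), of "(0, 1)"] by blast
  from w(1) w(2)[unfolded graph_form_kernel_iff] show ?thesis by (auto simp: prod_eq_iff)
qed

text \<open>On the \<tau>-axis, A_\<tau> = \<tau> V is o(\<tau>) because V vanishes at 0, and
  B_\<tau> is o(\<tau>) as soon as p + 2 q = 0, its \<tau>-derivative at 0. The graph then moves by
  o(\<tau>^2) only, against \<open>A1_growth\<close>.\<close>

lemma A1_fold:
  assumes "left_right_equivalent (graph_form A B) 0 (A1_form \<epsilon>) 0"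
  shows "px V 0 + 2 * py V 0 \<noteq> 0"
proof
  assume 0: "px V 0 + 2 * py V 0 = 0"
  have V0: "V 0 = 0" by (rule A1_singular[OF assms])
  have c: "isCont (\<lambda>y :: real. (0 :: real, y)) 0" by (intro continuous_intros)
  have D: "\<forall>\<^sub>F y in nhds 0. ((\<lambda>y. F (0, y)) has_field_derivative py F (0, y)) (at y)" if "smooth_germ F 0" for F :: "real \<times> real \<Rightarrow> real"
    using eventually_nhds_curve[OF c zero_in_plane smooth_germ_eventually[OF that]]
    by (auto elim!: eventually_mono intro: smooth_germ_DERIV_y)
  have "\<forall>\<^sub>F y in at 0. V (0, y) = py A (0, y) / y"
    using eventually_nhds_imp_at[OF eventually_nhds_curve[OF c zero_in_plane tangential_germ_py(1)]]
    by (auto simp: eventually_at_filter elim!: eventually_mono)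
  from Lim_transform_eventually[OF smooth_germ_isCont_x_axis(2)[OF tangential_germ_smooth(3)] this]
  have "((\<lambda>y. py A (0, y) / y) \<longlongrightarrow> 0) (at 0)" by (simp add: V0)
  from quadratic_limit[OF D[OF tangential_germ_smooth(1)] this]
  have lA: "((\<lambda>y. (A (0, y) - A 0) / y\<^sup>2) \<longlongrightarrow> 0) (at_right 0)" by (simp add: zero_in_plane)
  have "((\<lambda>y. py B (0, y)) has_field_derivative py (py B) (0, 0)) (at 0)"
    by (rule smooth_germ_DERIV_y) (simp add: zero_in_plane smooth_germ_py tangential_germ_smooth)
  then have "((\<lambda>y. py B (0, y)) has_field_derivative 0) (at 0)"
    using 0 by (simp add: zero_in_plane tangential_germ_py_B)
  then have "((\<lambda>y. py B (0, y) / y) \<longlongrightarrow> 0) (at 0)"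
    by (rule DERIV_0_quotient) (simp add: zero_in_plane tangential_germ_at_0 V0)
  from quadratic_limit[OF D[OF tangential_germ_smooth(2)] this]
  have lB: "((\<lambda>y. (B (0, y) - B 0) / y\<^sup>2) \<longlongrightarrow> 0) (at_right 0)" by (simp add: zero_in_plane)
  have "((\<lambda>y. (0 :: real, (A (0, y) - A 0) / y\<^sup>2, (B (0, y) - B 0) / y\<^sup>2)) \<longlongrightarrow> (0, 0, 0)) (at_right 0)"
    by (intro tendsto_intros lA lB)
  moreover have "(0, (A (0, y) - A 0) / y\<^sup>2, (B (0, y) - B 0) / y\<^sup>2) = (graph_form A B (0, y) - graph_form A B 0) /\<^sub>R y ^ 2" for y
    by (simp add: graph_form_def divide_inverse mult.commute)
  ultimately have l: "((\<lambda>y. (graph_form A B (0, y) - graph_form A B 0) /\<^sub>R y ^ 2) \<longlongrightarrow> 0) (at_right 0)"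
    by (simp add: zero_prod_def)
  have z: "((\<lambda>r :: real. ((0, r) - 0) /\<^sub>R r) \<longlongrightarrow> (0 :: real, 1)) (at_right 0)"
  proof (rule Lim_transform_eventually[OF tendsto_const])
    show "\<forall>\<^sub>F r :: real in at_right 0. (0, 1) = ((0, r) - 0) /\<^sub>R r" by (auto simp: eventually_at_filter)
  qed
  show False by (rule A1_growth[OF assms tangential_germ_smooth(4) z _ l]) (simp add: zero_prod_def)
qed

lemma tangential_germ_fold_form:
  assumes "V 0 = 0" "px V 0 + 2 * py V 0 \<noteq> 0"
  obtains h \<gamma> c where "c > 0" "smooth_germ h 0" "h 0 = 0" "((\<lambda>x. h (x, 0) / x\<^sup>2) \<longlongrightarrow> \<gamma>) (at 0)"
    "\<gamma> * py h 0 = - c * ((px V 0)\<^sup>2 * ((px V 0 + py V 0) * py V 0))"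
    "left_right_equivalent (graph_form A B) 0 (fold_form h) 0"
proof -
  obtain h c1 c2 where h: "c1 > 0" "c2 > 0" "smooth_germ h 0" "h 0 = 0"
    "((\<lambda>x. h (x, 0) / x\<^sup>2) \<longlongrightarrow> - c1 * (px V 0)\<^sup>2 * (px V 0 + py V 0)) (at 0)" "py h 0 = c2 * py V 0"
    "left_right_equivalent (\<lambda>z. (fst z, A z, B z)) 0 (fold_form h) 0"
    by (rule fold_normal_form[OF tangential_germ_smooth(1-3) assms(1) tangential_germ_py assms(2)]) blast
  show ?thesis
    by (rule that[of "c1 * c2", OF _ h(3-5)]) (use h in \<open>simp_all add: graph_form_def\<close>)
qed

lemma A1_if:
  assumes "V 0 = 0" "px V 0 + 2 * py V 0 \<noteq> 0" "px V 0 \<noteq> 0" "(px V 0 + py V 0) * py V 0 \<noteq> 0"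
  shows "left_right_equivalent (graph_form A B) 0 (A1_form (- sgn ((px V 0 + py V 0) * py V 0))) 0"
proof -
  obtain h \<gamma> c where h: "c > 0" "smooth_germ h 0" "h 0 = 0" "((\<lambda>x. h (x, 0) / x\<^sup>2) \<longlongrightarrow> \<gamma>) (at 0)"
    "\<gamma> * py h 0 = - c * ((px V 0)\<^sup>2 * ((px V 0 + py V 0) * py V 0))"
    "left_right_equivalent (graph_form A B) 0 (fold_form h) 0"
    using assms(1,2) by (rule tangential_germ_fold_form)
  have p2: "c * (px V 0)\<^sup>2 > 0" using h(1) assms(3) by simp
  have "\<gamma> * py h 0 = - (c * (px V 0)\<^sup>2) * ((px V 0 + py V 0) * py V 0)" unfolding h(5) by simp
  then have "sgn (\<gamma> * py h 0) = - sgn ((px V 0 + py V 0) * py V 0)"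
  proof -
    have "sgn (- a * x) = - sgn x" if "a > 0" for a x :: real using that by (simp add: sgn_mult)
    then show ?thesis using \<open>\<gamma> * py h 0 = - (c * (px V 0)\<^sup>2) * _\<close> p2 by (simp only:)
  qed
  moreover have "\<gamma> * py h 0 \<noteq> 0" unfolding h(5) using h(1) assms(3,4) by simp
  then have "left_right_equivalent (fold_form h) 0 (A1_form (sgn (\<gamma> * py h 0))) 0"
    by (intro fold_form_A1[OF h(2-4)]) auto
  ultimately show ?thesis using left_right_equivalent_trans[OF h(6)] by simp
qed

text \<open>\<open>A1_fold\<close> makes the fold form available, and the invariants of the fold
  form exclude the remaining degenerate cases.\<close>

lemma A1_only_if:
  assumes lr: "left_right_equivalent (graph_form A B) 0 (A1_form \<epsilon>) 0" and \<epsilon>: "\<epsilon> = 1 \<or> \<epsilon> = - 1"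
  shows "V 0 = 0" "px V 0 + 2 * py V 0 \<noteq> 0" "px V 0 \<noteq> 0" "(px V 0 + py V 0) * py V 0 \<noteq> 0"
    "\<epsilon> = - sgn ((px V 0 + py V 0) * py V 0)"
proof -
  show V0: "V 0 = 0" and \<kappa>: "px V 0 + 2 * py V 0 \<noteq> 0" by (rule A1_singular[OF lr] A1_fold[OF lr])+
  obtain h \<gamma> c where h: "c > 0" "smooth_germ h 0" "h 0 = 0" "((\<lambda>x. h (x, 0) / x\<^sup>2) \<longlongrightarrow> \<gamma>) (at 0)"
    "\<gamma> * py h 0 = - c * ((px V 0)\<^sup>2 * ((px V 0 + py V 0) * py V 0))"
    "left_right_equivalent (graph_form A B) 0 (fold_form h) 0"
    using V0 \<kappa> by (rule tangential_germ_fold_form)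
  note c = smooth_germ_isCont[OF tangential_germ_smooth(4)]
  have "left_right_equivalent (fold_form h) 0 (A1_form \<epsilon>) 0"
    by (rule left_right_equivalent_trans[OF left_right_equivalent_sym[OF h(6) c] lr])
  from fold_form_A1_converse[OF this h(2-4) \<epsilon>]
  have nz: "\<gamma> * py h 0 \<noteq> 0" and "\<epsilon> = sgn (\<gamma> * py h 0)" by blast+
  from nz show p: "px V 0 \<noteq> 0" and pq: "(px V 0 + py V 0) * py V 0 \<noteq> 0" unfolding h(5) by auto
  from A1_form_sign_unique[OF lr A1_if[OF V0 \<kappa> p pq] tangential_germ_smooth(4) \<epsilon>] pq
  show "\<epsilon> = - sgn ((px V 0 + py V 0) * py V 0)" by (simp add: sgn_if)
qed

text \<open>Since B_\<tau> = V is nonzero at 0, \<open>B\<close> serves as second source coordinate,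
  and the graph becomes a surface over the (x, m)-plane that a target shear flattens. All smooth
  graph germs thus share one normal form.\<close>

lemma immersive_normal_form:
  assumes V0: "V 0 \<noteq> 0"
  shows "left_right_equivalent (graph_form A B) 0 (\<lambda>z. (fst z, 0, snd z)) 0"
proof -
  define \<phi> where "\<phi> z = B z - B 0" for z
  have s: "smooth_germ \<phi> 0" unfolding \<phi>_def[abs_def] by (intro smooth_germ_diff tangential_germ_smooth smooth_germ_const)
  have 0: "\<phi> 0 = 0" by (simp add: \<phi>_def)
  have "py \<phi> 0 = V 0"
    unfolding \<phi>_def[abs_def] using px_py_diff(2)[OF tangential_germ_smooth(2) smooth_germ_const] tangential_germ_at_0 by simp
  then have p: "py \<phi> 0 \<noteq> 0" using V0 by simp
  obtain \<eta> where \<eta>: "smooth_germ \<eta> 0" "\<eta> 0 = 0" "\<forall>\<^sub>F z in nhds 0. \<eta> (fst z, \<phi> z) = snd z"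
    using fibered_diffeo(2)[OF s 0 p] by blast
  define E where "E y = A (fst y, \<eta> y)" for y
  have sE: "smooth_germ E 0" unfolding E_def[abs_def]
    by (rule smooth_germ_compose[where g = A and f = "\<lambda>y. (fst y, \<eta> y)"])
      (simp_all add: \<eta> zero_in_plane tangential_germ_smooth smooth_germ_Pair smooth_germ_coordinates)
  define K where "K = (\<lambda>(x, y, m). (x, y - E (x, m - B 0), m - B 0))"
  define K' where "K' = (\<lambda>(x, y, m). (x, y + E (x, m), m + B 0))"
  show ?thesis
  proof (rule left_right_equivalentI)
    show "diffeo_germ (\<lambda>z. (fst z, \<phi> z)) 0" by (rule fibered_diffeo(1)[OF s 0 p])
    show "(fst 0, \<phi> 0) = (0 :: real \<times> real)" by (simp add: 0 zero_in_plane)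
    have "\<forall>\<^sub>F z in nhds 0. A z = E (fst z, \<phi> z)"
      using \<eta>(3) by eventually_elim (simp add: E_def)
    then show "\<forall>\<^sub>F z in nhds 0. K (graph_form A B z) = (fst (fst z, \<phi> z), 0, snd (fst z, \<phi> z))"
      by eventually_elim (simp add: K_def graph_form_def \<phi>_def)
    show "diffeo_germ K (graph_form A B 0)"
    proof (rule diffeo_germI)
      have "smooth_germ (\<lambda>q :: real \<times> real \<times> real. E (fst q, snd (snd q) - B 0)) (graph_form A B 0)"
        by (rule smooth_germ_compose[where g = E and f = "\<lambda>q. (fst q, snd (snd q) - B 0)"])
          (simp add: graph_form_def zero_in_plane sE, intro smooth_germ_intros)
      then show "smooth_germ K (graph_form A B 0)"
        unfolding K_def case_prod_beta
        by (intro smooth_germ_Pair smooth_germ_diff smooth_germ_fst smooth_germ_snd smooth_germ_id smooth_germ_const)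
      have "smooth_germ (\<lambda>q :: real \<times> real \<times> real. E (fst q, snd (snd q))) (K (graph_form A B 0))"
        by (rule smooth_germ_compose[where g = E and f = "\<lambda>q. (fst q, snd (snd q))"])
          (simp add: graph_form_def K_def zero_in_plane sE, intro smooth_germ_intros)
      then show "smooth_germ K' (K (graph_form A B 0))"
        unfolding K'_def case_prod_beta
        by (intro smooth_germ_Pair smooth_germ_add smooth_germ_fst smooth_germ_snd smooth_germ_id smooth_germ_const)
    qed (simp_all add: K_def K'_def case_prod_beta)
  qed
qed

end

section \<open>Local model of a tangential family\<close>

lemma d_t_eq_py:
  assumes "smooth_germ f z"
  shows "d_t f z = py f z"
proof -
  obtain a b where z: "z = (a, b)" by (cases z)
  have "((\<lambda>s. f (a, s)) has_vector_derivative py f (a, b)) (at b)"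
    using has_derivative_along_y[OF smooth_germ_plane[OF assms[unfolded z]]] by (simp add: has_vector_derivative_def)
  then show ?thesis unfolding d_t_def z by (simp add: vector_derivative_at)
qed

lemma d_xi_eq_px:
  assumes "smooth_germ f z"
  shows "d_xi f z = px f z"
proof -
  obtain a b where z: "z = (a, b)" by (cases z)
  have "((\<lambda>s. f (s, b)) has_vector_derivative px f (a, b)) (at a)"
    using has_derivative_along_x[OF smooth_germ_plane[OF assms[unfolded z]]] by (simp add: has_vector_derivative_def)
  then show ?thesis unfolding d_xi_def z by (simp add: vector_derivative_at)
qed

lemma px_py_fst_snd:
  fixes f :: "real \<times> real \<Rightarrow> real \<times> real"
  assumes "smooth_germ f z"
  shows "px (\<lambda>z. fst (f z)) z = fst (px f z)" "py (\<lambda>z. fst (f z)) z = fst (py f z)"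
    "px (\<lambda>z. snd (f z)) z = snd (px f z)" "py (\<lambda>z. snd (f z)) z = snd (py f z)"
  using has_derivative_px_py[OF has_derivative_fst[OF smooth_germ_plane[OF assms]]]
    has_derivative_px_py[OF has_derivative_snd[OF smooth_germ_plane[OF assms]]] by simp_all

text \<open>For a tangential family \<open>(X, Y)\<close> this is \<open>X\<^sub>t\<^sup>2\<close> times the Poisson bracket of \<open>X\<close> and of the
  slope \<open>Y\<^sub>t / X\<^sub>t\<close>; its zeros on the support are the singular points of the graph.\<close>

definition graph_bracket :: "(plane \<Rightarrow> plane) \<Rightarrow> plane \<Rightarrow> real" where
  "graph_bracket f z = fst (d_xi f z) * (snd (d_t (d_t f) z) * fst (d_t f z) - snd (d_t f z) * fst (d_t (d_t f) z))
    - fst (d_t f z) * (snd (d_xi (d_t f) z) * fst (d_t f z) - snd (d_t f z) * fst (d_xi (d_t f) z))"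

definition slope :: "(plane \<Rightarrow> plane) \<Rightarrow> plane \<Rightarrow> real" where
  "slope f z = snd (d_t f z) / fst (d_t f z)"

definition graph_chart :: "(plane \<Rightarrow> plane) \<Rightarrow> plane \<Rightarrow> real \<times> real \<times> real" where
  "graph_chart f z = (fst (f z), snd (f z), slope f z)"

lemma px_py_quotient:
  fixes u v :: "real \<times> real \<Rightarrow> real"
  assumes "smooth_germ u z" "smooth_germ v z" "v z \<noteq> 0"
  shows "px (\<lambda>z. u z / v z) z = (px u z * v z - u z * px v z) / (v z)\<^sup>2"
    "py (\<lambda>z. u z / v z) z = (py u z * v z - u z * py v z) / (v z)\<^sup>2"
  using has_derivative_px_py[OF has_derivative_divide'[OF smooth_germ_plane_real[OF assms(1)] smooth_germ_plane_real[OF assms(2)] assms(3)]]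
  by (simp_all add: power2_eq_square)

lemma span_pair_slope:
  fixes a b m :: real
  shows "span {(a, b)} = span {(1, m)} \<Longrightarrow> b = m * a"
    and "span {(a, b)} = span {(m, 1)} \<Longrightarrow> a = m * b \<and> b \<noteq> 0"
    and "a \<noteq> 0 \<Longrightarrow> span {(a, b)} = span {(1, b / a)}"
    and "span {(c, d)} = span {(a, b)} \<Longrightarrow> c * b = d * a"
proof -
  have mem: "v \<in> span {w} \<longleftrightarrow> (\<exists>k. v = k *\<^sub>R w)" for v w :: "real \<times> real"
    by (auto simp: span_singleton)
  show "b = m * a" if "span {(a, b)} = span {(1, m)}"
  proof -
    have "(a, b) \<in> span {(1, m)}" using that span_base[of "(a, b)" "{(a, b)}"] by simp
    then show ?thesis by (auto simp: mem)
  qed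
  show "a = m * b \<and> b \<noteq> 0" if e: "span {(a, b)} = span {(m, 1)}"
  proof -
    have "(a, b) \<in> span {(m, 1)}" using e span_base[of "(a, b)" "{(a, b)}"] by simp
    moreover have "(m, 1) \<in> span {(a, b)}" using e span_base[of "(m, 1)" "{(m, 1 :: real)}"] by simp
    ultimately show ?thesis by (auto simp: mem)
  qed
  show "span {(a, b)} = span {(1, b / a)}" if "a \<noteq> 0"
  proof -
    have "(a, b) = a *\<^sub>R (1, b / a)" "(1, b / a) = inverse a *\<^sub>R (a, b)" using that by (simp_all add: field_simps)
    then show ?thesis unfolding span_eq by (auto simp: mem)
  qed
  show "c * b = d * a" if "span {(c, d)} = span {(a, b)}"
  proof -
    have "(c, d) \<in> span {(a, b)}" using that span_base[of "(c, d)" "{(c, d)}"] by simp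
    then show ?thesis by (auto simp: mem)
  qed
qed

context
  fixes f :: "plane \<Rightarrow> plane"
  assumes sm: "\<And>z. smooth_germ f z"
begin

lemma d_t_py: "d_t f = py f" and d_xi_px: "d_xi f = px f"
  by (rule ext, rule d_t_eq_py[OF sm] d_xi_eq_px[OF sm])+

lemma smooth_germ_d_t: "smooth_germ (d_t f) z" and smooth_germ_d_xi: "smooth_germ (d_xi f) z"
  unfolding d_t_py d_xi_px by (rule smooth_germ_py[OF sm] smooth_germ_px[OF sm])+

lemma smooth_germ_slope: "fst (d_t f z) \<noteq> 0 \<Longrightarrow> smooth_germ (slope f) z"
  unfolding slope_def[abs_def] by (intro smooth_germ_divide smooth_germ_fst smooth_germ_snd smooth_germ_d_t)

lemma smooth_germ_graph_chart: "fst (d_t f z) \<noteq> 0 \<Longrightarrow> smooth_germ (graph_chart f) z"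
  unfolding graph_chart_def[abs_def] by (intro smooth_germ_Pair smooth_germ_fst smooth_germ_snd sm smooth_germ_slope)

lemma eventually_d_t_nonzero:
  assumes "fst (d_t f a) \<noteq> 0"
  shows "\<forall>\<^sub>F z in nhds a. fst (d_t f z) \<noteq> 0"
  by (rule tendsto_imp_eventually_ne[OF tendsto_nhds_smooth_germ[OF smooth_germ_fst[OF smooth_germ_d_t]] assms])

lemma graph_chart_expression:
  assumes "fst (d_t f a) \<noteq> 0"
  shows "coordinate_expression (legendrian_graph f) a (graph_chart f)"
  unfolding coordinate_expression_def
proof (rule disjI1)
  show "\<forall>\<^sub>F z in nhds a. legendrian_graph f z = inv_chart_x (graph_chart f z)"
    using eventually_d_t_nonzero[OF assms]
  proof eventually_elim
    case (elim z)
    then show ?case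
      using span_pair_slope(3)[of "fst (d_t f z)" "snd (d_t f z)"]
      by (simp add: legendrian_graph_def inv_chart_x_def graph_chart_def slope_def)
  qed
qed

text \<open>Equivalence of graph germs allows either affine chart. Where both apply they differ by
  \<open>m \<mapsto> 1 / m\<close>, a local diffeomorphism of the target, so every question reduces
  to \<open>graph_chart\<close>.\<close>

lemma coordinate_expression_unique:
  assumes nz: "fst (d_t f a) \<noteq> 0" and g: "coordinate_expression (legendrian_graph f) a g"
  shows "smooth_germ g a" "left_right_equivalent g a (graph_chart f) a"
proof -
  note sc = smooth_germ_graph_chart[OF nz]
  have "smooth_germ g a \<and> left_right_equivalent g a (graph_chart f) a"
    using g unfolding coordinate_expression_def
  proof
    assume "\<forall>\<^sub>F z in nhds a. legendrian_graph f z = inv_chart_x (g z)"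
    then have e: "\<forall>\<^sub>F z in nhds a. graph_chart f z = g z"
      using eventually_d_t_nonzero[OF nz]
    proof eventually_elim
      case (elim z)
      obtain x y m where gz: "g z = (x, y, m)" by (cases "g z")
      have "f z = (x, y)" "span {d_t f z} = span {(1, m)}"
        using elim(1) by (simp_all add: gz legendrian_graph_def inv_chart_x_def)
      moreover from this(2) have "snd (d_t f z) = m * fst (d_t f z)"
        using span_pair_slope(1)[of "fst (d_t f z)" "snd (d_t f z)" m] by simp
      ultimately show ?case using elim(2) by (simp add: graph_chart_def slope_def gz)
    qed
    have "left_right_equivalent g a g a"
    proof (rule left_right_equivalentI)
      show "diffeo_germ (\<lambda>z. z) a" "diffeo_germ (\<lambda>z. z) (g a)"
        by (rule diffeo_germI[where h' = "\<lambda>z. z"]; simp add: smooth_germ_id)+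
    qed simp_all
    then have l: "left_right_equivalent (graph_chart f) a g a" by (rule left_right_equivalent_cong) (rule e)
    show ?thesis
      using smooth_germ_cong[OF sc e] left_right_equivalent_sym[OF l smooth_germ_isCont[OF sc]] by blast
  next
    assume "\<forall>\<^sub>F z in nhds a. legendrian_graph f z = inv_chart_y (g z)"
    define K where "K = (\<lambda>(x :: real, y :: real, m :: real). (x, y, 1 / m))"
    have e: "\<forall>\<^sub>F z in nhds a. slope f z \<noteq> 0 \<and> K (graph_chart f z) = g z"
      using \<open>\<forall>\<^sub>F z in nhds a. legendrian_graph f z = inv_chart_y (g z)\<close> eventually_d_t_nonzero[OF nz]
    proof eventually_elim
      case (elim z)
      obtain x y m where gz: "g z = (x, y, m)" by (cases "g z")
      have "f z = (x, y)" "span {d_t f z} = span {(m, 1)}"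
        using elim(1) by (simp_all add: gz legendrian_graph_def inv_chart_y_def)
      moreover from this(2) have "fst (d_t f z) = m * snd (d_t f z)" "snd (d_t f z) \<noteq> 0"
        using span_pair_slope(2)[of "fst (d_t f z)" "snd (d_t f z)" m] by simp_all
      ultimately show ?case using elim(2) by (simp add: graph_chart_def slope_def gz K_def)
    qed
    have sK: "smooth_germ K q" if "snd (snd q) \<noteq> 0" for q
      unfolding K_def case_prod_beta
      by (intro smooth_germ_Pair smooth_germ_divide smooth_germ_fst smooth_germ_snd smooth_germ_id smooth_germ_const that)
    have m: "slope f a \<noteq> 0" using eventually_nhds_x_imp_x[OF e] by blast
    have nzq: "\<forall>\<^sub>F q in nhds q0. snd (snd q) \<noteq> 0" if "snd (snd q0) \<noteq> 0" for q0 :: "real \<times> real \<times> real"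
      by (rule tendsto_imp_eventually_ne[OF tendsto_nhds_smooth_germ[OF smooth_germ_snd[OF smooth_germ_snd[OF smooth_germ_id]]] that])
    have KK: "K (K q) = q" for q by (cases q) (simp add: K_def)
    have dK: "diffeo_germ K (graph_chart f a)"
    proof (rule diffeo_germI[where h' = K])
      show "smooth_germ K (graph_chart f a)" by (rule sK) (simp add: graph_chart_def m)
      show "smooth_germ K (K (graph_chart f a))" by (rule sK) (simp add: graph_chart_def K_def m)
    qed (simp_all add: KK)
    have "smooth_germ (\<lambda>z. K (graph_chart f z)) a"
      by (rule smooth_germ_compose[OF sK sc]) (simp add: graph_chart_def m)
    moreover have e': "\<forall>\<^sub>F z in nhds a. K (graph_chart f z) = g z" using e by eventually_elim simp
    ultimately have sg: "smooth_germ g a" by (rule smooth_germ_cong)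
    have "left_right_equivalent (graph_chart f) a g a"
      by (rule left_right_equivalentI[of "\<lambda>z. z", OF _ _ dK e'])
        (rule diffeo_germI[where h' = "\<lambda>z. z"]; simp add: smooth_germ_id | simp)+
    then show ?thesis using sg left_right_equivalent_sym smooth_germ_isCont[OF sc] by blast
  qed
  then show "smooth_germ g a" "left_right_equivalent g a (graph_chart f) a" by blast+
qed

end

lemma tangential_family_smooth: "tangential_family f \<Longrightarrow> smooth_germ f z"
  unfolding tangential_family_def using smooth_germ_UNIV by blast

text \<open>The pair (x, \<tau>) as a map of the source, with x measured from the abscissa of the
  base point \<open>(\<xi>, 0)\<close> so that this point goes to the origin.\<close>

definition adapted_coordinates :: "(plane \<Rightarrow> plane) \<Rightarrow> real \<Rightarrow> plane \<Rightarrow> plane" where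
  "adapted_coordinates f \<xi> z = (fst (f z) - fst (f (\<xi>, 0)), fst (f z) - fst (f (fst z, 0)))"

text \<open>At the base point the Jacobian of \<open>\<Phi>\<close> is triangular with diagonal
  X_\<xi> and X_t. Expressing Y as \<open>A\<close> of the new coordinates, the chain rule gives Y_t
  = (A_x + A_\<tau>) X_t, so the slope is \<open>B\<close>; on the support also Y_\<xi> = A_x
  X_\<xi>, and tangency forces A_\<tau> = 0 there.\<close>

lemma local_model:
  assumes tf: "tangential_family f" and nz: "fst (d_t f (\<xi>, 0)) \<noteq> 0"
  defines "\<Phi> \<equiv> adapted_coordinates f \<xi>"
  obtains A B V where "diffeo_germ \<Phi> (\<xi>, 0)" "tangential_germ A B V" "fst (d_xi f (\<xi>, 0)) \<noteq> 0"
    "\<forall>\<^sub>F z in nhds (\<xi>, 0). snd (f z) = A (\<Phi> z) \<and> slope f z = B (\<Phi> z)"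
    "\<forall>\<^sub>F z in nhds 0. B z = px A z + py A z"
    "\<forall>\<^sub>F z in nhds (\<xi>, 0). graph_bracket f z = fst (d_t f z) ^ 3 * fst (d_xi f (fst z, 0)) * py B (\<Phi> z)"
    "px (\<lambda>z. py B (\<Phi> z)) (\<xi>, 0) = px (py B) 0 * fst (d_xi f (\<xi>, 0))"
    "py (\<lambda>z. py B (\<Phi> z)) (\<xi>, 0) = (px (py B) 0 + py (py B) 0) * fst (d_t f (\<xi>, 0))"
proof -
  let ?a = "(\<xi>, 0 :: real)"
  note sm = tangential_family_smooth[OF tf]
  note dt = d_t_py[OF sm] and dxi = d_xi_px[OF sm]
  define X where "X z = fst (f z)" for z
  define Y where "Y z = snd (f z)" for z
  have sX: "smooth_germ X z" and sY: "smooth_germ Y z" for z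
    unfolding X_def[abs_def] Y_def[abs_def] by (intro smooth_germ_fst smooth_germ_snd sm)+
  have XY: "px X z = fst (d_xi f z)" "py X z = fst (d_t f z)" "px Y z = snd (d_xi f z)" "py Y z = snd (d_t f z)" for z
    unfolding X_def[abs_def] Y_def[abs_def] by (simp_all add: px_py_fst_snd[OF sm] dt dxi)
  have tang: "px X (x, 0) * py Y (x, 0) = px Y (x, 0) * py X (x, 0)" for x
    using tf span_pair_slope(4)[of "px X (x, 0)" "px Y (x, 0)" "py X (x, 0)" "py Y (x, 0)"]
    by (simp add: XY tangential_family_def)
  \<comment> \<open>Were X_\<xi> zero with X_t nonzero, tangency would make Y_\<xi> zero too,
    although the support is immersed.\<close>
  have pxX: "px X (x, 0) \<noteq> 0" if "py X (x, 0) \<noteq> 0" for x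
  proof
    assume 0: "px X (x, 0) = 0"
    with tang[of x] that have "px Y (x, 0) = 0" by simp
    with 0 have "d_xi f (x, 0) = 0" by (simp add: XY prod_eq_iff)
    then show False using tf by (simp add: tangential_family_def)
  qed
  have nzX: "py X ?a \<noteq> 0" using nz by (simp add: XY)
  define b where "b z = X (fst z, 0)" for z :: plane
  have sb: "smooth_germ b z" for z unfolding b_def[abs_def]
    by (rule smooth_germ_of_fst[where \<theta> = "\<lambda>x. X (x, 0)"]) (rule smooth_germ_graph; simp add: sX smooth_germ_const)
  have bd: "px b z = px X (fst z, 0)" "py b z = 0" for z
  proof -
    have "smooth_germ (\<lambda>z :: plane. 0 :: real) z" by (rule smooth_germ_const)
    from px_py_compose[OF smooth_germ_coordinates(1) this, of X] sX
    show "px b z = px X (fst z, 0)" "py b z = 0" by (simp_all add: b_def[abs_def])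
  qed
  have \<Phi>: "\<Phi> z = (X z - X ?a, X z - b z)" for z
    by (simp add: \<Phi>_def adapted_coordinates_def X_def b_def)
  have s\<Phi>1: "smooth_germ (\<lambda>z. X z - X ?a) z" and s\<Phi>2: "smooth_germ (\<lambda>z. X z - b z) z" for z
    by (intro smooth_germ_diff sX sb smooth_germ_const)+
  have d\<Phi>1: "px (\<lambda>z. X z - X ?a) z = px X z" "py (\<lambda>z. X z - X ?a) z = py X z" for z
    using px_py_diff[OF sX smooth_germ_const] by simp_all
  have d\<Phi>2: "px (\<lambda>z. X z - b z) z = px X z - px X (fst z, 0)" "py (\<lambda>z. X z - b z) z = py X z" for z
    using px_py_diff[OF sX sb] by (simp_all add: bd)
  have s\<Phi>: "smooth_germ \<Phi> z" for z unfolding \<Phi>[abs_def] by (intro smooth_germ_Pair s\<Phi>1 s\<Phi>2)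
  have \<Phi>a: "\<Phi> ?a = 0" by (simp add: \<Phi> b_def zero_in_plane)
  have D: "(\<Phi> has_derivative (\<lambda>v. (fst v * px X ?a + snd v * py X ?a, snd v * py X ?a))) (at ?a)"
    unfolding \<Phi>[abs_def]
    using has_derivative_Pair[OF smooth_germ_plane_real[OF s\<Phi>1[of ?a]] smooth_germ_plane_real[OF s\<Phi>2[of ?a]]] by (simp add: d\<Phi>1 d\<Phi>2)
  have inj: "inj (\<lambda>v. (fst v * px X ?a + snd v * py X ?a, snd v * py X ?a))"
    using nzX pxX by (auto simp: inj_def)
  have d\<Phi>: "diffeo_germ \<Phi> ?a" by (rule diffeo_germ_plane[OF s\<Phi> D inj])
  obtain \<Psi> where "smooth_germ \<Psi> (\<Phi> ?a)" "\<forall>\<^sub>F z in nhds ?a. \<Psi> (\<Phi> z) = z" "\<forall>\<^sub>F y in nhds (\<Phi> ?a). \<Phi> (\<Psi> y) = y"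
    by (rule inverse_germ_plane[OF s\<Phi> D inj])
  then have \<Psi>: "smooth_germ \<Psi> 0" "\<forall>\<^sub>F z in nhds ?a. \<Psi> (\<Phi> z) = z" "\<forall>\<^sub>F y in nhds 0. \<Phi> (\<Psi> y) = y" unfolding \<Phi>a .
  have \<Psi>0: "\<Psi> 0 = ?a" using eventually_nhds_x_imp_x[OF \<Psi>(2)] by (simp add: \<Phi>a)
  have c\<Phi>: "isCont \<Phi> ?a" and c\<Psi>: "isCont \<Psi> 0" by (rule smooth_germ_isCont[OF s\<Phi>] smooth_germ_isCont[OF \<Psi>(1)])+
  define A where "A y = Y (\<Psi> y)" for y
  have sA: "smooth_germ A 0" unfolding A_def[abs_def] by (rule smooth_germ_compose[OF sY \<Psi>(1)])
  define B where "B z = px A z + py A z" for z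
  have sB: "smooth_germ B 0" unfolding B_def[abs_def] by (intro smooth_germ_add smooth_germ_px smooth_germ_py sA)
  have YA: "\<forall>\<^sub>F z in nhds ?a. Y z = A (\<Phi> z)" using \<Psi>(2) by eventually_elim (simp add: A_def)
  have comp: "\<forall>\<^sub>F z in nhds ?a. px (\<lambda>z. F (\<Phi> z)) z = px F (\<Phi> z) * px X z + py F (\<Phi> z) * (px X z - px X (fst z, 0)) \<and>
      py (\<lambda>z. F (\<Phi> z)) z = (px F (\<Phi> z) + py F (\<Phi> z)) * py X z" if "smooth_germ F 0" for F :: "plane \<Rightarrow> real"
    using eventually_nhds_curve[OF c\<Phi> \<Phi>a smooth_germ_eventually[OF that]]
  proof eventually_elim
    case (elim z)
    from px_py_compose[OF s\<Phi>1 s\<Phi>2, OF elim[unfolded \<Phi>]]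
    show ?case by (simp add: \<Phi>[abs_def] d\<Phi>1 d\<Phi>2 algebra_simps)
  qed
  have evX: "\<forall>\<^sub>F z in nhds ?a. py X z \<noteq> 0"
    by (rule tendsto_imp_eventually_ne[OF tendsto_nhds_smooth_germ[OF smooth_germ_py[OF sX]] nzX])
  have Yd: "\<forall>\<^sub>F z in nhds ?a. px Y z = px A (\<Phi> z) * px X z + py A (\<Phi> z) * (px X z - px X (fst z, 0)) \<and>
      py Y z = (px A (\<Phi> z) + py A (\<Phi> z)) * py X z"
    using px_py_cong_eventually[OF YA] comp[OF sA] by eventually_elim simp
  have sl: "\<forall>\<^sub>F z in nhds ?a. slope f z = B (\<Phi> z)"
    using Yd evX
  proof eventually_elim
    case (elim z)
    have "slope f z = py Y z / py X z" by (simp add: slope_def XY)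
    then show ?case using elim by (simp add: B_def)
  qed
  have "\<forall>\<^sub>F x in nhds 0. py A (x, 0) = 0"
  proof -
    obtain W where W: "open W" "?a \<in> W" "\<forall>z\<in>W. py X z \<noteq> 0" using evX unfolding eventually_nhds by blast
    obtain S T where ST0: "open S" "open T" "?a \<in> S \<times> T" "S \<times> T \<subseteq> W" by (rule open_prod_elim[OF W(1,2)])
    have ST: "open S" "open T" "\<xi> \<in> S" "0 \<in> T" "\<And>x y. x \<in> S \<Longrightarrow> y \<in> T \<Longrightarrow> py X (x, y) \<noteq> 0"
      using ST0 W(3) by auto
    obtain e where e: "e > 0" "ball 0 e \<subseteq> T" using ST by (meson open_contains_ball)
    \<comment> \<open>The support corresponds to \<tau> = 0 only if \<tau> has no other zeros
      nearby: by the mean value theorem a second zero on the same curve would give a zero of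
      X_t.\<close>
    have rolle: "y = 0" if x: "x \<in> S" and y: "\<bar>y\<bar> < e" and eq: "X (x, y) = X (x, 0)" for x y
    proof (rule ccontr)
      assume "y \<noteq> 0"
      have sub: "u \<in> T" if "\<bar>u\<bar> \<le> \<bar>y\<bar>" for u using that e y by (auto simp: dist_real_def)
      have der: "((\<lambda>u. X (x, u)) has_field_derivative py X (x, u)) (at u)" for u by (rule smooth_germ_DERIV_y[OF sX])
      have "\<exists>u. \<bar>u\<bar> \<le> \<bar>y\<bar> \<and> py X (x, u) = 0"
      proof (cases "y > 0")
        case True
        obtain u where "0 < u" "u < y" "X (x, y) - X (x, 0) = (y - 0) * py X (x, u)"
          using MVT2[OF True der] by blast
        then show ?thesis using eq True by (intro exI[of _ u]) auto
      next
        case False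
        with \<open>y \<noteq> 0\<close> have "y < 0" by simp
        obtain u where "y < u" "u < 0" "X (x, 0) - X (x, y) = (0 - y) * py X (x, u)"
          using MVT2[OF \<open>y < 0\<close> der] by blast
        then show ?thesis using eq \<open>y < 0\<close> by (intro exI[of _ u]) auto
      qed
      then show False using ST(5)[OF x] sub by blast
    qed
    have "\<forall>\<^sub>F z in nhds ?a. fst z \<in> S \<and> \<bar>snd z\<bar> < e"
      unfolding eventually_nhds by (intro exI[of _ "S \<times> ball 0 e"]) (use ST e in \<open>auto intro: open_Times simp: dist_real_def\<close>)
    with Yd evX have "\<forall>\<^sub>F z in nhds ?a. (fst z \<in> S \<and> \<bar>snd z\<bar> < e) \<and> py X z \<noteq> 0 \<and>
        px Y z = px A (\<Phi> z) * px X z + py A (\<Phi> z) * (px X z - px X (fst z, 0)) \<and>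
        py Y z = (px A (\<Phi> z) + py A (\<Phi> z)) * py X z" by eventually_elim blast
    from eventually_nhds_curve[OF c\<Psi> \<Psi>0 this] \<Psi>(3)
    have "\<forall>\<^sub>F y in nhds 0. snd y = 0 \<longrightarrow> py A y = 0"
    proof eventually_elim
      case (elim w)
      obtain x y where xy: "\<Psi> w = (x, y)" by (cases "\<Psi> w")
      show ?case
      proof
        assume w0: "snd w = 0"
        have "snd (\<Phi> (x, y)) = 0" using elim(2) w0 by (simp add: xy)
        then have "X (x, y) = X (x, 0)" by (simp add: \<Phi> b_def)
        then have "y = 0" using rolle[of x y] elim(1) unfolding xy fst_conv snd_conv by blast
        with elim have e: "py X (x, 0) \<noteq> 0" "px Y (x, 0) = px A w * px X (x, 0)" "py Y (x, 0) = (px A w + py A w) * py X (x, 0)"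
          by (simp_all add: xy)
        \<comment> \<open>Tangency in the new coordinates: after cancelling A_x X_\<xi> X_t what
          remains is X_\<xi> X_t A_\<tau> = 0.\<close>
        have "px X (x, 0) * ((px A w + py A w) * py X (x, 0)) = px A w * px X (x, 0) * py X (x, 0)"
          using tang[of x] unfolding e(2,3) .
        then have "px X (x, 0) * py X (x, 0) * py A w = 0" by (simp add: algebra_simps)
        then show "py A w = 0" using e(1) pxX[OF e(1)] by simp
      qed
    qed
    from eventually_nhds_curve[where c = "\<lambda>x. (x, 0)" and a = 0, OF _ _ this]
    show ?thesis by (simp add: zero_in_plane)
  qed
  then obtain V where V: "smooth_germ V 0" "\<forall>\<^sub>F z in nhds 0. py A z = snd z * V z"
    using Hadamard[OF smooth_germ_py[OF sA]] by blast
  have "\<forall>\<^sub>F z in nhds 0. py B z = V z + snd z * (px V z + py V z)"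
    using px_py_cong_eventually[OF V(2)] smooth_germ_eventually[OF V(1)] smooth_germ_eventually[OF sA]
  proof eventually_elim
    case (elim z)
    have "py B z = py (px A) z + py (py A) z"
      unfolding B_def[abs_def] by (rule px_py_add(2)[OF smooth_germ_px[OF elim(4)] smooth_germ_py[OF elim(4)]])
    then show ?case
      using elim px_py_commute[OF elim(4)] px_py_mult[OF smooth_germ_coordinates(2) elim(3)] by (simp add: algebra_simps)
  qed
  then have tg: "tangential_germ A B V" unfolding tangential_germ_def using sA sB V by blast
  \<comment> \<open>The bracket is X_t^2 times X_\<xi> slope_t - X_t slope_\<xi>. In the new
    coordinates the B_x terms cancel, and B_\<tau> is left with the factor X_t times X_\<xi> on the
    support.\<close>
  have br: "\<forall>\<^sub>F z in nhds ?a. graph_bracket f z = fst (d_t f z) ^ 3 * fst (d_xi f (fst z, 0)) * py B (\<Phi> z)"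
    using px_py_cong_eventually[OF sl] comp[OF sB] evX
  proof eventually_elim
    case (elim z)
    have sdt: "smooth_germ (d_t f) z" by (rule smooth_germ_d_t[OF sm])
    have nzt: "fst (d_t f z) \<noteq> 0" using elim(4) by (simp add: XY)
    have q: "px (slope f) z = (snd (d_xi (d_t f) z) * fst (d_t f z) - snd (d_t f z) * fst (d_xi (d_t f) z)) / (fst (d_t f z))\<^sup>2"
      "py (slope f) z = (snd (d_t (d_t f) z) * fst (d_t f z) - snd (d_t f z) * fst (d_t (d_t f) z)) / (fst (d_t f z))\<^sup>2"
      using px_py_quotient[OF smooth_germ_snd[OF sdt] smooth_germ_fst[OF sdt] nzt]
      by (simp_all add: slope_def[abs_def] px_py_fst_snd[OF sdt] d_t_eq_py[OF sdt] d_xi_eq_px[OF sdt])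
    have "graph_bracket f z = (fst (d_t f z))\<^sup>2 * (px X z * py (slope f) z - py X z * px (slope f) z)"
    proof -
      have "a * u - c * w = t\<^sup>2 * (a * (u / t\<^sup>2) - c * (w / t\<^sup>2))" if "t \<noteq> 0" for a c u w t :: real
        using that by (simp add: field_simps)
      then show ?thesis unfolding graph_bracket_def q XY using nzt by blast
    qed
    also have "px X z * py (slope f) z - py X z * px (slope f) z = py X z * px X (fst z, 0) * py B (\<Phi> z)"
    proof -
      have e: "px (slope f) z = px B (\<Phi> z) * px X z + py B (\<Phi> z) * (px X z - px X (fst z, 0))"
        "py (slope f) z = (px B (\<Phi> z) + py B (\<Phi> z)) * py X z"
        using elim(1-3) by simp_all
      show ?thesis unfolding e by (simp add: algebra_simps)
    qed
    finally show ?case by (simp add: XY power2_eq_square power3_eq_cube)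
  qed
  show ?thesis
  proof (rule that[OF d\<Phi> tg _ _ _ br])
    show "fst (d_xi f ?a) \<noteq> 0" using pxX[OF nzX] by (simp add: XY)
    show "\<forall>\<^sub>F z in nhds ?a. snd (f z) = A (\<Phi> z) \<and> slope f z = B (\<Phi> z)"
      using YA sl by eventually_elim (simp add: Y_def)
    show "\<forall>\<^sub>F z in nhds 0. B z = px A z + py A z" by (simp add: B_def)
    show "px (\<lambda>z. py B (\<Phi> z)) ?a = px (py B) 0 * fst (d_xi f ?a)"
      "py (\<lambda>z. py B (\<Phi> z)) ?a = (px (py B) 0 + py (py B) 0) * fst (d_t f ?a)"
      using eventually_nhds_x_imp_x[OF comp[OF smooth_germ_py[OF sB]]] by (simp_all add: \<Phi>a XY)
  qed
qed

lemma graph_chart_local_model: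
  assumes "diffeo_germ (adapted_coordinates f \<xi>) (\<xi>, 0)"
    and "\<forall>\<^sub>F z in nhds (\<xi>, 0). snd (f z) = A (adapted_coordinates f \<xi> z) \<and> slope f z = B (adapted_coordinates f \<xi> z)"
  shows "left_right_equivalent (graph_chart f) (\<xi>, 0) (graph_form A B) 0"
proof (rule left_right_equivalentI[OF assms(1)])
  let ?K = "\<lambda>q :: real \<times> real \<times> real. (fst q - fst (f (\<xi>, 0)), snd q)"
  let ?K' = "\<lambda>q :: real \<times> real \<times> real. (fst q + fst (f (\<xi>, 0)), snd q)"
  show "adapted_coordinates f \<xi> (\<xi>, 0) = 0" by (simp add: adapted_coordinates_def zero_in_plane)
  show "diffeo_germ ?K (graph_chart f (\<xi>, 0))"
  proof (rule diffeo_germI)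
    show "smooth_germ ?K (graph_chart f (\<xi>, 0))" "smooth_germ ?K' (?K (graph_chart f (\<xi>, 0)))"
      by (intro smooth_germ_intros)+
  qed simp_all
  show "\<forall>\<^sub>F z in nhds (\<xi>, 0). ?K (graph_chart f z) = graph_form A B (adapted_coordinates f \<xi> z)"
    using assms(2) by eventually_elim (simp add: graph_chart_def graph_form_def adapted_coordinates_def)
qed

text \<open>At a singular point, \<open>p = V\<^sub>x\<close> and \<open>q = V\<^sub>\<tau>\<close> are, up to nonzero squares and powers of \<open>X\<^sub>t\<close>, the
  numbers \<open>\<partial>\<^sub>\<xi>\<beta>\<close> and \<open>(X\<^sub>\<xi> \<partial>\<^sub>t\<beta> - 2 X\<^sub>t \<partial>\<^sub>\<xi>\<beta>) / 2\<close>, where \<open>\<beta>\<close> is the bracket.\<close>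

lemma support_point_classification:
  assumes tf: "tangential_family f" and nz: "fst (d_t f (\<xi>, 0)) \<noteq> 0"
  defines "T \<equiv> fst (d_t f (\<xi>, 0))" and "S \<equiv> fst (d_xi f (\<xi>, 0))"
    and "b1 \<equiv> px (graph_bracket f) (\<xi>, 0)" and "b2 \<equiv> py (graph_bracket f) (\<xi>, 0)"
  shows "\<epsilon> = 1 \<or> \<epsilon> = - 1 \<Longrightarrow> left_right_equivalent (graph_chart f) (\<xi>, 0) (A1_form \<epsilon>) 0 \<longleftrightarrow>
      graph_bracket f (\<xi>, 0) = 0 \<and> b1 \<noteq> 0 \<and> S * b2 - T * b1 \<noteq> 0 \<and>
      S * b2 * (S * b2 - 2 * T * b1) \<noteq> 0 \<and> \<epsilon> = - sgn (S * b2 * (S * b2 - 2 * T * b1))"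
    and "graph_bracket f (\<xi>, 0) \<noteq> 0 \<Longrightarrow> left_right_equivalent (graph_chart f) (\<xi>, 0) (\<lambda>z. (fst z, 0, snd z)) 0"
    and "graph_bracket f (\<xi>, 0) = 0 \<longleftrightarrow> (\<exists>v. v \<noteq> 0 \<and> frechet_derivative (graph_chart f) (at (\<xi>, 0)) v = 0)"
proof -
  let ?\<Phi> = "adapted_coordinates f \<xi>"
  note sm = tangential_family_smooth[OF tf]
  obtain A B V where lm: "diffeo_germ ?\<Phi> (\<xi>, 0)" "tangential_germ A B V" "fst (d_xi f (\<xi>, 0)) \<noteq> 0"
    "\<forall>\<^sub>F z in nhds (\<xi>, 0). snd (f z) = A (?\<Phi> z) \<and> slope f z = B (?\<Phi> z)"
    "\<forall>\<^sub>F z in nhds (\<xi>, 0). graph_bracket f z = fst (d_t f z) ^ 3 * fst (d_xi f (fst z, 0)) * py B (?\<Phi> z)"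
    "px (\<lambda>z. py B (?\<Phi> z)) (\<xi>, 0) = px (py B) 0 * fst (d_xi f (\<xi>, 0))"
    "py (\<lambda>z. py B (?\<Phi> z)) (\<xi>, 0) = (px (py B) 0 + py (py B) 0) * fst (d_t f (\<xi>, 0))"
    by (rule local_model[OF tf nz]) blast
  note tg = lm(2)
  have TS: "T \<noteq> 0" "S \<noteq> 0" using nz lm(3) by (simp_all add: T_def S_def)
  have \<Phi>0: "?\<Phi> (\<xi>, 0) = 0" by (simp add: adapted_coordinates_def zero_in_plane)
  note scg = smooth_germ_graph_chart[OF sm nz] and sgf = tangential_germ_smooth(4)[OF tg]
  have lr: "left_right_equivalent (graph_chart f) (\<xi>, 0) (graph_form A B) 0"
    by (rule graph_chart_local_model[OF lm(1,4)])
  have lr': "left_right_equivalent (graph_form A B) 0 (graph_chart f) (\<xi>, 0)"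
    by (rule left_right_equivalent_sym[OF lr smooth_germ_isCont[OF scg]])
  have b0: "graph_bracket f (\<xi>, 0) = T ^ 3 * S * V 0"
    using eventually_nhds_x_imp_x[OF lm(5)] by (simp add: \<Phi>0 T_def S_def tangential_germ_at_0[OF tg])
  then have b0V: "graph_bracket f (\<xi>, 0) = 0 \<longleftrightarrow> V 0 = 0" using TS by simp
  \<comment> \<open>At a singular point the product rule keeps only the term that differentiates
    B_\<tau>, since B_\<tau> itself vanishes there.\<close>
  have b12: "b1 = T ^ 3 * S\<^sup>2 * px V 0" "b2 = T ^ 4 * S * (2 * (px V 0 + py V 0))" if V0: "V 0 = 0"
  proof -
    have s0: "smooth_germ (\<lambda>z. fst (d_xi f (fst z, 0))) (\<xi>, 0)"
      by (rule smooth_germ_of_fst[where \<theta> = "\<lambda>x. fst (d_xi f (x, 0))"])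
        (rule smooth_germ_graph[where \<theta> = "\<lambda>_. 0" and F = "\<lambda>z. fst (d_xi f z)"];
          simp add: smooth_germ_const smooth_germ_fst smooth_germ_d_xi[OF sm])
    have s1: "smooth_germ (\<lambda>z. fst (d_t f z) ^ 3 * fst (d_xi f (fst z, 0))) (\<xi>, 0)"
      by (rule smooth_germ_mult[OF smooth_germ_power[OF smooth_germ_fst[OF smooth_germ_d_t[OF sm]]] s0])
    have s2: "smooth_germ (\<lambda>z. py B (?\<Phi> z)) (\<xi>, 0)"
      by (rule smooth_germ_compose[OF _ diffeo_germ_smooth[OF lm(1)]])
        (simp add: \<Phi>0 smooth_germ_py tangential_germ_smooth[OF tg])
    have C0: "py B (?\<Phi> (\<xi>, 0)) = 0" by (simp add: \<Phi>0 tangential_germ_at_0[OF tg] V0)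
    show "b1 = T ^ 3 * S\<^sup>2 * px V 0" "b2 = T ^ 4 * S * (2 * (px V 0 + py V 0))"
      unfolding b1_def b2_def px_py_cong[OF lm(5)] px_py_mult[OF s1 s2] C0 lm(6,7) tangential_germ_py_B[OF tg] T_def S_def
      by (simp_all add: algebra_simps power2_eq_square power3_eq_cube power4_eq_xxxx)
  qed
  show "left_right_equivalent (graph_chart f) (\<xi>, 0) (A1_form \<epsilon>) 0 \<longleftrightarrow>
      graph_bracket f (\<xi>, 0) = 0 \<and> b1 \<noteq> 0 \<and> S * b2 - T * b1 \<noteq> 0 \<and>
      S * b2 * (S * b2 - 2 * T * b1) \<noteq> 0 \<and> \<epsilon> = - sgn (S * b2 * (S * b2 - 2 * T * b1))"
    if \<epsilon>: "\<epsilon> = 1 \<or> \<epsilon> = - 1"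
  proof (cases "V 0 = 0")
    case False
    then show ?thesis using A1_singular[OF tg left_right_equivalent_trans[OF lr']] b0V by blast
  next
    case True
    define p q where "p = px V 0" and "q = py V 0"
    have 1: "b1 = T ^ 3 * S\<^sup>2 * p" using b12[OF True] by (simp add: p_def)
    have 2: "S * b2 - T * b1 = T ^ 4 * S\<^sup>2 * (p + 2 * q)"
      using b12[OF True] by (simp add: p_def q_def algebra_simps power2_eq_square power3_eq_cube power4_eq_xxxx)
    have 3: "S * b2 * (S * b2 - 2 * T * b1) = 4 * (T ^ 4 * S\<^sup>2)\<^sup>2 * ((p + q) * q)"
      using b12[OF True] by (simp add: p_def q_def algebra_simps power2_eq_square power3_eq_cube power4_eq_xxxx)
    have pos: "4 * (T ^ 4 * S\<^sup>2)\<^sup>2 > 0" using TS by simp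
    then have 4: "sgn (S * b2 * (S * b2 - 2 * T * b1)) = sgn ((p + q) * q)"
      unfolding 3 by (simp only: sgn_mult[of "4 * (T ^ 4 * S\<^sup>2)\<^sup>2"] sgn_pos mult_1)
    have 5: "b1 \<noteq> 0 \<longleftrightarrow> p \<noteq> 0" unfolding 1 using TS by simp
    have 6: "S * b2 - T * b1 \<noteq> 0 \<longleftrightarrow> p + 2 * q \<noteq> 0" unfolding 2 using TS by simp
    have 7: "S * b2 * (S * b2 - 2 * T * b1) \<noteq> 0 \<longleftrightarrow> (p + q) * q \<noteq> 0" unfolding 3 using TS by simp
    have "left_right_equivalent (graph_form A B) 0 (A1_form \<epsilon>) 0 \<longleftrightarrow>
        p \<noteq> 0 \<and> p + 2 * q \<noteq> 0 \<and> (p + q) * q \<noteq> 0 \<and> \<epsilon> = - sgn ((p + q) * q)"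
      using A1_only_if[OF tg _ \<epsilon>] A1_if[OF tg True] unfolding p_def q_def by blast
    then show ?thesis
      unfolding 4 5 6 7 using b0V True left_right_equivalent_trans[OF lr] left_right_equivalent_trans[OF lr'] by blast
  qed
  show "left_right_equivalent (graph_chart f) (\<xi>, 0) (\<lambda>z. (fst z, 0, snd z)) 0" if "graph_bracket f (\<xi>, 0) \<noteq> 0"
    using left_right_equivalent_trans[OF lr immersive_normal_form[OF tg]] that b0V by blast
  show "graph_bracket f (\<xi>, 0) = 0 \<longleftrightarrow> (\<exists>v. v \<noteq> 0 \<and> frechet_derivative (graph_chart f) (at (\<xi>, 0)) v = 0)"
  proof
    assume "graph_bracket f (\<xi>, 0) = 0"
    then have "frechet_derivative (graph_form A B) (at 0) (0, 1) = 0"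
      unfolding graph_form_kernel_iff[OF tg] b0V by simp
    moreover have "(0 :: real, 1 :: real) \<noteq> 0" by (simp add: zero_prod_def)
    ultimately show "\<exists>v. v \<noteq> 0 \<and> frechet_derivative (graph_chart f) (at (\<xi>, 0)) v = 0"
      using kernel_transfer[OF lr' sgf scg, of "(0, 1)"] by blast
  next
    assume "\<exists>v. v \<noteq> 0 \<and> frechet_derivative (graph_chart f) (at (\<xi>, 0)) v = 0"
    then obtain w where w: "w \<noteq> 0" "frechet_derivative (graph_form A B) (at 0) w = 0"
      using kernel_transfer[OF lr scg sgf] by blast
    from w(1) w(2)[unfolded graph_form_kernel_iff[OF tg]] have "V 0 = 0" by (auto simp: prod_eq_iff)
    then show "graph_bracket f (\<xi>, 0) = 0" using b0V by blast
  qed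
qed

section \<open>Jets of tangential deformations\<close>

lemma smooth_EuclideanD:
  assumes "smooth_Euclidean n g"
  shows "continuous_map (Euclidean_space n) euclidean g"
    and "i < n \<Longrightarrow> smooth_Euclidean n (partial_deriv i g)"
    and "i < n \<Longrightarrow> x \<in> topspace (Euclidean_space n) \<Longrightarrow> (\<lambda>s. g (x(i := s))) differentiable (at (x i))"
proof -
  have 0: "Ck_Euclidean n k g" for k using assms unfolding smooth_Euclidean_def by blast
  show "continuous_map (Euclidean_space n) euclidean g" using 0[of 0] by simp
  show "smooth_Euclidean n (partial_deriv i g)" if "i < n"
    unfolding smooth_Euclidean_def using 0[of "Suc k" for k] that unfolding Ck_Euclidean.simps by blast
  show "(\<lambda>s. g (x(i := s))) differentiable (at (x i))" if "i < n" "x \<in> topspace (Euclidean_space n)"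
    using 0[of "Suc 0"] that unfolding Ck_Euclidean.simps by blast
qed

text \<open>Smoothness in all variables and parameters is available through iterated partial
  derivatives. This notion is stable under products and differences, which is all that is needed to
  form the bracket and to differentiate it once more with joint continuity.\<close>

definition C1_along :: "nat \<Rightarrow> nat \<Rightarrow> ((nat \<Rightarrow> real) \<Rightarrow> real) \<Rightarrow> bool" where
  "C1_along n i g \<longleftrightarrow> continuous_map (Euclidean_space n) euclideanreal g \<and>
    (\<exists>g'. continuous_map (Euclidean_space n) euclideanreal g' \<and>
      (\<forall>x\<in>topspace (Euclidean_space n). ((\<lambda>s. g (x(i := s))) has_field_derivative g' x) (at (x i))))"

lemma C1_along_mult:
  assumes "C1_along n i f" "C1_along n i g"
  shows "C1_along n i (\<lambda>x. f x * g x)"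
proof -
  obtain f' g' where d: "continuous_map (Euclidean_space n) euclideanreal f'" "continuous_map (Euclidean_space n) euclideanreal g'"
    "\<And>x. x \<in> topspace (Euclidean_space n) \<Longrightarrow> ((\<lambda>s. f (x(i := s))) has_field_derivative f' x) (at (x i))"
    "\<And>x. x \<in> topspace (Euclidean_space n) \<Longrightarrow> ((\<lambda>s. g (x(i := s))) has_field_derivative g' x) (at (x i))"
    using assms unfolding C1_along_def by blast
  have c: "continuous_map (Euclidean_space n) euclideanreal f" "continuous_map (Euclidean_space n) euclideanreal g"
    using assms unfolding C1_along_def by blast+
  show ?thesis unfolding C1_along_def
  proof (intro conjI exI ballI)
    show "continuous_map (Euclidean_space n) euclideanreal (\<lambda>x. f x * g x)"
      by (intro continuous_map_real_mult c)
    show "continuous_map (Euclidean_space n) euclideanreal (\<lambda>x. f' x * g x + g' x * f x)"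
      by (intro continuous_map_add continuous_map_real_mult c d)
    fix x assume x: "x \<in> topspace (Euclidean_space n)"
    show "((\<lambda>s. f (x(i := s)) * g (x(i := s))) has_field_derivative f' x * g x + g' x * f x) (at (x i))"
      using DERIV_mult[OF d(3)[OF x] d(4)[OF x]] by simp
  qed
qed

lemma C1_along_diff:
  assumes "C1_along n i f" "C1_along n i g"
  shows "C1_along n i (\<lambda>x. f x - g x)"
proof -
  obtain f' g' where d: "continuous_map (Euclidean_space n) euclideanreal f'" "continuous_map (Euclidean_space n) euclideanreal g'"
    "\<And>x. x \<in> topspace (Euclidean_space n) \<Longrightarrow> ((\<lambda>s. f (x(i := s))) has_field_derivative f' x) (at (x i))"
    "\<And>x. x \<in> topspace (Euclidean_space n) \<Longrightarrow> ((\<lambda>s. g (x(i := s))) has_field_derivative g' x) (at (x i))"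
    using assms unfolding C1_along_def by blast
  have c: "continuous_map (Euclidean_space n) euclideanreal f" "continuous_map (Euclidean_space n) euclideanreal g"
    using assms unfolding C1_along_def by blast+
  show ?thesis unfolding C1_along_def
  proof (intro conjI exI ballI)
    show "continuous_map (Euclidean_space n) euclideanreal (\<lambda>x. f x - g x)"
      by (intro continuous_map_diff c)
    show "continuous_map (Euclidean_space n) euclideanreal (\<lambda>x. f' x - g' x)"
      by (intro continuous_map_diff d)
    fix x assume x: "x \<in> topspace (Euclidean_space n)"
    show "((\<lambda>s. f (x(i := s)) - g (x(i := s))) has_field_derivative f' x - g' x) (at (x i))"
      by (rule DERIV_diff[OF d(3)[OF x] d(4)[OF x]])
  qed
qed

lemma C1_along_linear:
  fixes g :: "(nat \<Rightarrow> real) \<Rightarrow> 'b::real_normed_vector"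
  assumes L: "bounded_linear (L :: 'b \<Rightarrow> real)" and g: "smooth_Euclidean n g" "i < n"
  shows "C1_along n i (\<lambda>x. L (g x))"
proof -
  have comp: "continuous_map (Euclidean_space n) euclideanreal (\<lambda>x. L (h x))"
    if "continuous_map (Euclidean_space n) euclidean h" for h
    using continuous_map_compose[OF that, of euclideanreal L] linear_continuous_on[OF L, of UNIV] by (simp add: o_def)
  show ?thesis unfolding C1_along_def
  proof (intro conjI exI ballI)
    show "continuous_map (Euclidean_space n) euclideanreal (\<lambda>x. L (g x))" by (rule comp[OF smooth_EuclideanD(1)[OF g(1)]])
    show "continuous_map (Euclidean_space n) euclideanreal (\<lambda>x. L (partial_deriv i g x))"
      by (rule comp[OF smooth_EuclideanD(1)[OF smooth_EuclideanD(2)[OF g]]])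
    fix x assume "x \<in> topspace (Euclidean_space n)"
    then have "((\<lambda>s. g (x(i := s))) has_vector_derivative partial_deriv i g x) (at (x i))"
      unfolding partial_deriv_def using smooth_EuclideanD(3)[OF g] vector_derivative_works by blast
    from bounded_linear.has_vector_derivative[OF L this]
    show "((\<lambda>s. L (g (x(i := s)))) has_field_derivative L (partial_deriv i g x)) (at (x i))"
      by (simp add: has_real_derivative_iff_has_vector_derivative)
  qed
qed

lemma smooth_germ_graph_bracket:
  assumes "tangential_family f"
  shows "smooth_germ (graph_bracket f) z"
proof -
  note sm = tangential_family_smooth[OF assms]
  have 2: "smooth_germ (d_t (d_t f)) z" "smooth_germ (d_xi (d_t f)) z" for z
    by (rule smooth_germ_d_t smooth_germ_d_xi; rule smooth_germ_d_t[OF sm])+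
  show ?thesis unfolding graph_bracket_def[abs_def]
    by (intro smooth_germ_diff smooth_germ_mult smooth_germ_fst smooth_germ_snd 2 smooth_germ_d_t[OF sm] smooth_germ_d_xi[OF sm])
qed

text \<open>Places a point of the support and a parameter into R^(2 + p): the second coordinate is t
  = 0, and parameters are shifted by 2.\<close>

definition support_param :: "real \<Rightarrow> (nat \<Rightarrow> real) \<Rightarrow> nat \<Rightarrow> real" where
  "support_param \<xi> \<mu> i = (if i = 0 then \<xi> else if i = 1 then 0 else \<mu> (i - 2))"

lemma support_param_topspace: "\<mu> \<in> topspace (Euclidean_space p) \<Longrightarrow> support_param \<xi> \<mu> \<in> topspace (Euclidean_space (2 + p))"
  by (auto simp: topspace_Euclidean_space support_param_def)

lemma continuous_map_support_param:
  "continuous_map (prod_topology euclideanreal (Euclidean_space p)) (Euclidean_space (2 + p)) (\<lambda>z. support_param (fst z) (snd z))"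
proof -
  let ?X = "prod_topology euclideanreal (Euclidean_space p)"
  have "continuous_map ?X euclideanreal (\<lambda>z. support_param (fst z) (snd z) i)" for i
  proof (cases "i = 0 \<or> i = 1")
    case True
    then show ?thesis by (auto simp: continuous_map_fst support_param_def)
  next
    case False
    have "continuous_map (Euclidean_space p) euclideanreal (\<lambda>\<mu>. \<mu> (i - 2))"
      unfolding Euclidean_space_def by (intro continuous_map_from_subtopology continuous_map_product_projection) simp
    from continuous_map_compose[OF continuous_map_snd this]
    show ?thesis using False by (simp add: support_param_def o_def)
  qed
  moreover have "(\<lambda>z. support_param (fst z) (snd z)) ` topspace ?X \<subseteq> {x. \<forall>i\<ge>2 + p. x i = 0}"
    using support_param_topspace by (force simp: topspace_Euclidean_space)
  ultimately show ?thesis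
    unfolding Euclidean_space_def[of "2 + p"] continuous_map_in_subtopology continuous_map_componentwise_UNIV by blast
qed

text \<open>Keeps signs, not merely nonvanishing: the sign of the last classifying number is the
  type of the umbrella. The interval of abscissas is uniform in the parameter, as is needed to
  follow a zero.\<close>

lemma joint_neighborhood:
  fixes h :: "real \<Rightarrow> real \<Rightarrow> (nat \<Rightarrow> real) \<Rightarrow> real"
  assumes h: "continuous_map (Euclidean_space (2 + p)) euclideanreal (\<lambda>y. h (y 0) (y 1) (\<lambda>i. y (2 + i)))"
    and \<mu>: "\<mu>0 \<in> topspace (Euclidean_space p)" and nz: "h \<xi>0 0 \<mu>0 \<noteq> 0"
  obtains \<delta> N where "\<delta> > 0" "openin (Euclidean_space p) N" "\<mu>0 \<in> N"
    "\<And>\<xi> \<mu>. \<bar>\<xi> - \<xi>0\<bar> < \<delta> \<Longrightarrow> \<mu> \<in> N \<Longrightarrow> sgn (h \<xi> 0 \<mu>) = sgn (h \<xi>0 0 \<mu>0)"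
proof -
  let ?X = "prod_topology euclideanreal (Euclidean_space p)" and ?v = "h \<xi>0 0 \<mu>0"
  have e: "(\<lambda>y. h (y 0) (y 1) (\<lambda>i. y (2 + i))) \<circ> (\<lambda>z. support_param (fst z) (snd z)) = (\<lambda>z. h (fst z) 0 (snd z))"
    by (simp add: fun_eq_iff support_param_def)
  define S where "S = {z \<in> topspace ?X. h (fst z) 0 (snd z) \<in> {y. y * ?v > 0}}"
  have o: "open {y. y * ?v > 0}" by (intro open_Collect_less continuous_intros)
  have S: "openin ?X S" unfolding S_def
    by (rule openin_continuous_map_preimage[OF continuous_map_compose[OF continuous_map_support_param h, unfolded e]]) (simp add: o)
  have "(\<xi>0, \<mu>0) \<in> S" using \<mu> nz by (auto simp: S_def zero_less_mult_iff)
  from iffD1[OF openin_prod_topology_alt S, rule_format, OF this]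
  obtain U N where U: "openin euclideanreal U" "openin (Euclidean_space p) N" "\<xi>0 \<in> U" "\<mu>0 \<in> N" "U \<times> N \<subseteq> S"
    by (elim exE conjE)
  have "open U" using U(1) by simp
  then obtain \<delta> where \<delta>: "\<delta> > 0" "ball \<xi>0 \<delta> \<subseteq> U" using U(3) by (rule openE) blast
  show ?thesis
  proof (rule that[OF \<delta>(1) U(2,4)])
    fix \<xi> \<mu> assume "\<bar>\<xi> - \<xi>0\<bar> < \<delta>" and \<mu>: "\<mu> \<in> N"
    then have "\<xi> \<in> ball \<xi>0 \<delta>" by (simp add: dist_real_def abs_minus_commute)
    then have "(\<xi>, \<mu>) \<in> S" using \<mu> \<delta>(2) U(5) by blast
    then have "h \<xi> 0 \<mu> * ?v > 0" unfolding S_def by simp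
    then show "sgn (h \<xi> 0 \<mu>) = sgn ?v" by (auto simp: sgn_if zero_less_mult_iff)
  qed
qed

context
  fixes p :: nat and F :: "plane \<Rightarrow> (nat \<Rightarrow> real) \<Rightarrow> plane" and f :: "plane \<Rightarrow> plane"
  assumes def: "tangential_deformation p F f"
begin

lemma member_tangential: "\<mu> \<in> topspace (Euclidean_space p) \<Longrightarrow> tangential_family (\<lambda>z. F z \<mu>)"
  using def unfolding tangential_deformation_def by blast

text \<open>The bracket contains second derivatives, so its own derivatives are of third order. They
  are obtained as partial derivatives in the joint variables, and identified with \<open>px\<close>
  and \<open>py\<close> of each member by uniqueness of derivatives.\<close>

lemma deformation_continuous:
  shows "continuous_map (Euclidean_space (2 + p)) euclideanreal (\<lambda>y. fst (d_t (\<lambda>z. F z (\<lambda>i. y (2 + i))) (y 0, y 1)))"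
    and "continuous_map (Euclidean_space (2 + p)) euclideanreal (\<lambda>y. fst (d_xi (\<lambda>z. F z (\<lambda>i. y (2 + i))) (y 0, y 1)))"
    and "continuous_map (Euclidean_space (2 + p)) euclideanreal (\<lambda>y. graph_bracket (\<lambda>z. F z (\<lambda>i. y (2 + i))) (y 0, y 1))"
    and "continuous_map (Euclidean_space (2 + p)) euclideanreal (\<lambda>y. px (graph_bracket (\<lambda>z. F z (\<lambda>i. y (2 + i)))) (y 0, y 1))"
    and "continuous_map (Euclidean_space (2 + p)) euclideanreal (\<lambda>y. py (graph_bracket (\<lambda>z. F z (\<lambda>i. y (2 + i)))) (y 0, y 1))"
proof -
  let ?E = "Euclidean_space (2 + p)" and ?g = "\<lambda>y. F (y 0, y 1) (\<lambda>i. y (2 + i))"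
  have g: "smooth_Euclidean (2 + p) ?g" using def unfolding tangential_deformation_def by blast
  have i: "0 < 2 + p" "1 < 2 + p" by simp_all
  have gx: "partial_deriv 0 ?g = (\<lambda>y. d_xi (\<lambda>z. F z (\<lambda>i. y (2 + i))) (y 0, y 1))"
    and gt: "partial_deriv 1 ?g = (\<lambda>y. d_t (\<lambda>z. F z (\<lambda>i. y (2 + i))) (y 0, y 1))"
    by (simp_all add: fun_eq_iff partial_deriv_def d_xi_def d_t_def)
  have gxt: "partial_deriv 0 (partial_deriv 1 ?g) = (\<lambda>y. d_xi (d_t (\<lambda>z. F z (\<lambda>i. y (2 + i)))) (y 0, y 1))"
    and gtt: "partial_deriv 1 (partial_deriv 1 ?g) = (\<lambda>y. d_t (d_t (\<lambda>z. F z (\<lambda>i. y (2 + i)))) (y 0, y 1))"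
    unfolding gt by (simp_all add: fun_eq_iff partial_deriv_def d_xi_def[of "d_t _"] d_t_def[of "d_t _"])
  note s1 = smooth_EuclideanD(2)[OF g i(1)] smooth_EuclideanD(2)[OF g i(2)]
  note s2 = smooth_EuclideanD(2)[OF s1(2) i(1)] smooth_EuclideanD(2)[OF s1(2) i(2)]
  note sm = s1[unfolded gx gt] s2[unfolded gxt gtt]
  have C1: "C1_along (2 + p) k (\<lambda>y. graph_bracket (\<lambda>z. F z (\<lambda>i. y (2 + i))) (y 0, y 1))" if "k < 2 + p" for k
    unfolding graph_bracket_def
    by (intro C1_along_diff C1_along_mult C1_along_linear[OF bounded_linear_fst _ that] C1_along_linear[OF bounded_linear_snd _ that] sm)
  have c: "continuous_map ?E euclideanreal (\<lambda>y. fst (h y))" if "smooth_Euclidean (2 + p) h" for h :: "_ \<Rightarrow> plane"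
    using C1_along_linear[OF bounded_linear_fst that i(1)] unfolding C1_along_def by blast
  show "continuous_map ?E euclideanreal (\<lambda>y. fst (d_t (\<lambda>z. F z (\<lambda>i. y (2 + i))) (y 0, y 1)))"
    and "continuous_map ?E euclideanreal (\<lambda>y. fst (d_xi (\<lambda>z. F z (\<lambda>i. y (2 + i))) (y 0, y 1)))"
    by (rule c[OF sm(2)] c[OF sm(1)])+
  show "continuous_map ?E euclideanreal (\<lambda>y. graph_bracket (\<lambda>z. F z (\<lambda>i. y (2 + i))) (y 0, y 1))"
    using C1[OF i(1)] unfolding C1_along_def by blast
  have mem: "smooth_germ (graph_bracket (\<lambda>z. F z (\<lambda>i. y (2 + i)))) z" if "y \<in> topspace ?E" for y z
    by (rule smooth_germ_graph_bracket[OF member_tangential]) (use that in \<open>auto simp: topspace_Euclidean_space\<close>)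
  obtain b0 where b0: "continuous_map ?E euclideanreal b0"
    "\<And>y. y \<in> topspace ?E \<Longrightarrow> ((\<lambda>s. graph_bracket (\<lambda>z. F z (\<lambda>i. y (2 + i))) (s, y 1)) has_field_derivative b0 y) (at (y 0))"
    using C1[OF i(1)] unfolding C1_along_def by auto
  have "b0 y = px (graph_bracket (\<lambda>z. F z (\<lambda>i. y (2 + i)))) (y 0, y 1)" if "y \<in> topspace ?E" for y
    by (rule DERIV_unique[OF b0(2)[OF that] smooth_germ_DERIV_x[OF mem[OF that]]])
  with b0(1) show "continuous_map ?E euclideanreal (\<lambda>y. px (graph_bracket (\<lambda>z. F z (\<lambda>i. y (2 + i)))) (y 0, y 1))"
    by (rule continuous_map_eq)
  obtain b1 where b1: "continuous_map ?E euclideanreal b1"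
    "\<And>y. y \<in> topspace ?E \<Longrightarrow> ((\<lambda>s. graph_bracket (\<lambda>z. F z (\<lambda>i. y (2 + i))) (y 0, s)) has_field_derivative b1 y) (at (y 1))"
    using C1[OF i(2)] unfolding C1_along_def by auto
  have "b1 y = py (graph_bracket (\<lambda>z. F z (\<lambda>i. y (2 + i)))) (y 0, y 1)" if "y \<in> topspace ?E" for y
    by (rule DERIV_unique[OF b1(2)[OF that] smooth_germ_DERIV_y[OF mem[OF that]]])
  with b1(1) show "continuous_map ?E euclideanreal (\<lambda>y. py (graph_bracket (\<lambda>z. F z (\<lambda>i. y (2 + i)))) (y 0, y 1))"
    by (rule continuous_map_eq)
qed

text \<open>The member with parameter 0 agrees with \<open>f\<close> near the origin only; what the
  classification at the origin needs is carried over through the germ.\<close>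

lemma member_0:
  assumes f: "\<And>z. smooth_germ f z" and nz: "fst (d_t f (0, 0)) \<noteq> 0"
  shows "(\<lambda>_. 0) \<in> topspace (Euclidean_space p)" "fst (d_t (\<lambda>z. F z (\<lambda>_. 0)) (0, 0)) \<noteq> 0"
    "left_right_equivalent (graph_chart f) (0, 0) N b \<Longrightarrow> left_right_equivalent (graph_chart (\<lambda>z. F z (\<lambda>_. 0))) (0, 0) N b"
proof -
  show 0: "(\<lambda>_. 0) \<in> topspace (Euclidean_space p)" by (simp add: topspace_Euclidean_space)
  have e: "\<forall>\<^sub>F z in nhds (0, 0). F z (\<lambda>_. 0) = f z" using def unfolding tangential_deformation_def by blast
  have d: "\<forall>\<^sub>F z in nhds (0, 0). d_t (\<lambda>z. F z (\<lambda>_. 0)) z = d_t f z"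
    using px_py_cong_eventually(2)[OF e] d_t_eq_py[OF f] d_t_eq_py[OF tangential_family_smooth[OF member_tangential[OF 0]]] by simp
  show "fst (d_t (\<lambda>z. F z (\<lambda>_. 0)) (0, 0)) \<noteq> 0" using eventually_nhds_x_imp_x[OF d] nz by simp
  have "\<forall>\<^sub>F z in nhds (0, 0). graph_chart (\<lambda>z. F z (\<lambda>_. 0)) z = graph_chart f z"
    using e d by eventually_elim (simp add: graph_chart_def slope_def)
  then show "left_right_equivalent (graph_chart f) (0, 0) N b \<Longrightarrow> left_right_equivalent (graph_chart (\<lambda>z. F z (\<lambda>_. 0))) (0, 0) N b"
    by (rule left_right_equivalent_cong[rotated])
qed

end

lemma graph_germs_diffeomorphicI:
  assumes f: "\<And>z. smooth_germ f z" "fst (d_t f a) \<noteq> 0" and f': "\<And>z. smooth_germ f' z" "fst (d_t f' b) \<noteq> 0"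
    and N: "left_right_equivalent (graph_chart f) a N c" "left_right_equivalent (graph_chart f') b N c"
  shows "graph_germs_diffeomorphic f a f' b"
  unfolding graph_germs_diffeomorphic_def
  using graph_chart_expression[OF f] graph_chart_expression[OF f']
    left_right_equivalent_trans[OF N(1) left_right_equivalent_sym[OF N(2) smooth_germ_isCont[OF smooth_germ_graph_chart[OF f']]]]
  by blast

lemma graph_germ_of_type_iff:
  assumes f: "\<And>z. smooth_germ f z" "fst (d_t f (0, 0)) \<noteq> 0"
  shows "graph_germ_of_type N f \<longleftrightarrow> left_right_equivalent (graph_chart f) 0 N 0"
proof
  assume "graph_germ_of_type N f"
  then obtain g where g: "coordinate_expression (legendrian_graph f) (0, 0) g" "left_right_equivalent g (0, 0) N (0, 0)"
    unfolding graph_germ_of_type_def by blast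
  note u = coordinate_expression_unique[OF f g(1)]
  show "left_right_equivalent (graph_chart f) 0 N 0"
    using left_right_equivalent_trans[OF left_right_equivalent_sym[OF u(2) smooth_germ_isCont[OF u(1)]] g(2)]
    by (simp add: zero_in_plane)
next
  assume "left_right_equivalent (graph_chart f) 0 N 0"
  then show "graph_germ_of_type N f"
    unfolding graph_germ_of_type_def using graph_chart_expression[OF f] by (auto simp: zero_in_plane)
qed

lemma smooth_graph_germ_iff:
  assumes tf: "tangential_family f" and nz: "fst (d_t f (0, 0)) \<noteq> 0"
  shows "smooth_graph_germ f \<longleftrightarrow> graph_bracket f (0, 0) \<noteq> 0"
proof -
  note sm = tangential_family_smooth[OF tf]
  note cl = support_point_classification(3)[OF tf nz]
  note sc = smooth_germ_graph_chart[OF sm nz]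
  show ?thesis
  proof
    assume "smooth_graph_germ f"
    then obtain g g' where g: "coordinate_expression (legendrian_graph f) (0, 0) g" "(g has_derivative g') (at (0, 0))" "inj g'"
      unfolding smooth_graph_germ_def by blast
    note u = coordinate_expression_unique[OF sm nz g(1)]
    show "graph_bracket f (0, 0) \<noteq> 0"
    proof
      assume "graph_bracket f (0, 0) = 0"
      then obtain v where v: "v \<noteq> 0" "frechet_derivative (graph_chart f) (at (0, 0)) v = 0" using cl by blast
      obtain w where "w \<noteq> 0" "frechet_derivative g (at (0, 0)) w = 0"
        by (rule kernel_transfer[OF left_right_equivalent_sym[OF u(2) smooth_germ_isCont[OF u(1)]] sc u(1) v])
      then show False
        using injD[OF g(3), of w 0] linear_0[OF has_derivative_linear[OF g(2)]]
        unfolding frechet_derivative_at[OF g(2), symmetric] by simp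
    qed
  next
    assume b: "graph_bracket f (0, 0) \<noteq> 0"
    note D = smooth_germ_derivative[OF sc]
    have "inj (frechet_derivative (graph_chart f) (at (0, 0)))"
      unfolding linear_injective_0[OF has_derivative_linear[OF D]] using cl b by blast
    then show "smooth_graph_germ f"
      unfolding smooth_graph_germ_def using graph_chart_expression[OF sm nz] D by blast
  qed
qed

section \<open>Stability of smooth graphs and of Double Whitney Umbrellas\<close>

text \<open>Nonvanishing of the bracket at the origin is an open condition on the parameter, and all
  immersive germs share a normal form; the base point can stay at the origin.\<close>

lemma smooth_imp_stable:
  assumes tf: "tangential_family f" and nz: "fst (d_t f (0, 0)) \<noteq> 0" and b: "graph_bracket f (0, 0) \<noteq> 0"
  shows "stable_graph_germ f"
  unfolding stable_graph_germ_def
proof (intro allI impI)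
  fix p F assume def: "tangential_deformation p F f"
  note sm = tangential_family_smooth[OF tf]
  let ?N = "\<lambda>z :: plane. (fst z, 0 :: real, snd z)"
  let ?f0 = "\<lambda>z. F z (\<lambda>_. 0)"
  have lr: "left_right_equivalent (graph_chart f) (0, 0) ?N 0" by (rule support_point_classification(2)[OF tf nz b])
  note m0 = member_0[OF def sm nz]
  note tf0 = member_tangential[OF def m0(1)]
  \<comment> \<open>A zero of the bracket would give a kernel vector, which the equivalence with the
    flat normal form rules out.\<close>
  have b0: "graph_bracket ?f0 (0, 0) \<noteq> 0"
  proof
    assume "graph_bracket ?f0 (0, 0) = 0"
    then obtain v where v: "v \<noteq> 0" "frechet_derivative (graph_chart ?f0) (at (0, 0)) v = 0"
      using support_point_classification(3)[OF tf0 m0(2)] by blast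
    have sN: "smooth_germ ?N z" for z by (intro smooth_germ_intros smooth_germ_coordinates)
    obtain w where w: "w \<noteq> 0" "frechet_derivative ?N (at 0) w = 0"
      by (rule kernel_transfer[OF m0(3)[OF lr] smooth_germ_graph_chart[OF tangential_family_smooth[OF tf0] m0(2)] sN v])
    have "(?N has_derivative ?N) (at 0)" by (auto intro!: derivative_eq_intros)
    from w(2)[unfolded frechet_derivative_at[OF this, symmetric]] w(1) show False by (simp add: prod_eq_iff)
  qed
  obtain d1 N1 where N1: "d1 > 0" "openin (Euclidean_space p) N1" "(\<lambda>_. 0) \<in> N1"
    "\<And>\<xi> \<mu>. \<bar>\<xi> - 0\<bar> < d1 \<Longrightarrow> \<mu> \<in> N1 \<Longrightarrow> sgn (fst (d_t (\<lambda>z. F z \<mu>) (\<xi>, 0))) = sgn (fst (d_t ?f0 (0, 0)))"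
    by (rule joint_neighborhood[where h = "\<lambda>\<xi> t \<mu>. fst (d_t (\<lambda>z. F z \<mu>) (\<xi>, t))", OF deformation_continuous(1)[OF def] m0(1,2)]) blast
  obtain d2 N2 where N2: "d2 > 0" "openin (Euclidean_space p) N2" "(\<lambda>_. 0) \<in> N2"
    "\<And>\<xi> \<mu>. \<bar>\<xi> - 0\<bar> < d2 \<Longrightarrow> \<mu> \<in> N2 \<Longrightarrow> sgn (graph_bracket (\<lambda>z. F z \<mu>) (\<xi>, 0)) = sgn (graph_bracket ?f0 (0, 0))"
    by (rule joint_neighborhood[where h = "\<lambda>\<xi> t \<mu>. graph_bracket (\<lambda>z. F z \<mu>) (\<xi>, t)", OF deformation_continuous(3)[OF def] m0(1) b0]) blast
  have ev: "\<forall>\<^sub>F \<mu> in nhdsin (Euclidean_space p) (\<lambda>_. 0). graph_germs_diffeomorphic f (0, 0) (\<lambda>z. F z \<mu>) (0, 0)"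
    unfolding eventually_nhdsin
  proof (intro disjI2 exI conjI ballI)
    show "openin (Euclidean_space p) (N1 \<inter> N2)" "(\<lambda>_. 0) \<in> N1 \<inter> N2" using N1 N2 by auto
    fix \<mu> assume \<mu>: "\<mu> \<in> N1 \<inter> N2"
    then have "\<mu> \<in> topspace (Euclidean_space p)" using openin_subset[OF N1(2)] by blast
    note tfm = member_tangential[OF def this]
    have nzm: "fst (d_t (\<lambda>z. F z \<mu>) (0, 0)) \<noteq> 0" using N1(4)[of 0 \<mu>] N1(1) \<mu> m0(2) by (auto simp: sgn_if split: if_splits)
    have bm: "graph_bracket (\<lambda>z. F z \<mu>) (0, 0) \<noteq> 0" using N2(4)[of 0 \<mu>] N2(1) \<mu> b0 by (auto simp: sgn_if split: if_splits)
    show "graph_germs_diffeomorphic f (0, 0) (\<lambda>z. F z \<mu>) (0, 0)"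
      by (rule graph_germs_diffeomorphicI[OF sm nz tangential_family_smooth[OF tfm] nzm lr support_point_classification(2)[OF tfm nzm bm]])
  qed
  then show "\<exists>q. (q \<longlongrightarrow> (0, 0)) (atin (Euclidean_space p) (\<lambda>_. 0)) \<and>
      (\<forall>\<^sub>F \<mu> in nhdsin (Euclidean_space p) (\<lambda>_. 0). graph_germs_diffeomorphic f (0, 0) (\<lambda>z. F z \<mu>) (q \<mu>))"
    by - (rule exI[of _ "\<lambda>_. (0, 0)"], rule conjI, rule tendsto_const, rule ev)
qed

lemma sgn_increment:
  fixes b b' :: "real \<Rightarrow> real"
  assumes "\<And>x. \<bar>x\<bar> < \<delta> \<Longrightarrow> (b has_field_derivative b' x) (at x)" "\<And>x. \<bar>x\<bar> < \<delta> \<Longrightarrow> sgn (b' x) = s"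
    and x: "\<bar>x\<bar> < \<delta>" "\<bar>y\<bar> < \<delta>" "x < y"
  shows "sgn (b y - b x) = s"
proof -
  have d: "(b has_field_derivative b' z) (at z)" if "x \<le> z" "z \<le> y" for z
    by (rule assms(1)) (use that x in linarith)
  obtain z where z: "x < z" "z < y" "b y - b x = (y - x) * b' z"
    using MVT2[OF x(3) d] by blast
  then have "\<bar>z\<bar> < \<delta>" using x by linarith
  then show ?thesis using z x assms(2) by (simp add: sgn_mult)
qed

text \<open>For small parameters the classifying numbers keep their signs near 0. As the
  \<xi>-derivative of the bracket is one of them, the bracket is strictly monotone along the
  support; it has exactly one zero there, which tends to 0 with the parameter and is an umbrella of
  the same sign.\<close>

lemma A1_imp_stable:
  assumes tf: "tangential_family f" and nz: "fst (d_t f (0, 0)) \<noteq> 0" and \<epsilon>: "\<epsilon> = 1 \<or> \<epsilon> = - 1"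
    and lr: "left_right_equivalent (graph_chart f) (0, 0) (A1_form \<epsilon>) 0"
  shows "stable_graph_germ f"
  unfolding stable_graph_germ_def
proof (intro allI impI)
  fix p F assume def: "tangential_deformation p F f"
  note sm = tangential_family_smooth[OF tf]
  let ?E = "Euclidean_space p" and ?o = "\<lambda>_ :: nat. 0 :: real"
  define T where "T \<xi> t \<mu> = fst (d_t (\<lambda>z. F z \<mu>) (\<xi>, t))" for \<xi> t \<mu>
  define S where "S \<xi> t \<mu> = fst (d_xi (\<lambda>z. F z \<mu>) (\<xi>, t))" for \<xi> t \<mu>
  define b where "b \<xi> t \<mu> = graph_bracket (\<lambda>z. F z \<mu>) (\<xi>, t)" for \<xi> t \<mu>
  define b1 where "b1 \<xi> t \<mu> = px (graph_bracket (\<lambda>z. F z \<mu>)) (\<xi>, t)" for \<xi> t \<mu>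
  define b2 where "b2 \<xi> t \<mu> = py (graph_bracket (\<lambda>z. F z \<mu>)) (\<xi>, t)" for \<xi> t \<mu>
  define c2 where "c2 \<xi> t \<mu> = S \<xi> t \<mu> * b2 \<xi> t \<mu> - T \<xi> t \<mu> * b1 \<xi> t \<mu>" for \<xi> t \<mu>
  define c3 where "c3 \<xi> t \<mu> = S \<xi> t \<mu> * b2 \<xi> t \<mu> * (S \<xi> t \<mu> * b2 \<xi> t \<mu> - 2 * T \<xi> t \<mu> * b1 \<xi> t \<mu>)" for \<xi> t \<mu>
  note cont = deformation_continuous[OF def, folded T_def S_def b_def b1_def b2_def]
  have cont2: "continuous_map (Euclidean_space (2 + p)) euclideanreal (\<lambda>y. c2 (y 0) (y 1) (\<lambda>i. y (2 + i)))"
    unfolding c2_def by (intro continuous_map_diff continuous_map_real_mult cont)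
  have two: "continuous_map (Euclidean_space (2 + p)) euclideanreal (\<lambda>y. 2)" by simp
  have cont3: "continuous_map (Euclidean_space (2 + p)) euclideanreal (\<lambda>y. c3 (y 0) (y 1) (\<lambda>i. y (2 + i)))"
    unfolding c3_def by (intro continuous_map_diff continuous_map_real_mult cont two)
  have cl: "left_right_equivalent (graph_chart (\<lambda>z. F z \<mu>)) (\<xi>, 0) (A1_form \<epsilon>) 0 \<longleftrightarrow>
      b \<xi> 0 \<mu> = 0 \<and> b1 \<xi> 0 \<mu> \<noteq> 0 \<and> c2 \<xi> 0 \<mu> \<noteq> 0 \<and> c3 \<xi> 0 \<mu> \<noteq> 0 \<and> \<epsilon> = - sgn (c3 \<xi> 0 \<mu>)"
    if "\<mu> \<in> topspace ?E" "T \<xi> 0 \<mu> \<noteq> 0" for \<mu> \<xi>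
    using support_point_classification(1)[OF member_tangential[OF def that(1)] that(2)[unfolded T_def] \<epsilon>]
    unfolding c2_def c3_def T_def S_def b_def b1_def b2_def .
  note m0 = member_0[OF def sm nz]
  have T0: "T 0 0 ?o \<noteq> 0" using m0(2) unfolding T_def .
  have 0: "b 0 0 ?o = 0" "b1 0 0 ?o \<noteq> 0" "c2 0 0 ?o \<noteq> 0" "c3 0 0 ?o \<noteq> 0" "\<epsilon> = - sgn (c3 0 0 ?o)"
    using cl[OF m0(1) T0] m0(3)[OF lr] by blast+
  obtain d1 N1 where N1: "d1 > 0" "openin ?E N1" "?o \<in> N1"
    "\<And>\<xi> \<mu>. \<bar>\<xi> - 0\<bar> < d1 \<Longrightarrow> \<mu> \<in> N1 \<Longrightarrow> sgn (T \<xi> 0 \<mu>) = sgn (T 0 0 ?o)"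
    by (rule joint_neighborhood[where h = T, OF cont(1) m0(1) T0]) blast
  obtain d2 N2 where N2: "d2 > 0" "openin ?E N2" "?o \<in> N2"
    "\<And>\<xi> \<mu>. \<bar>\<xi> - 0\<bar> < d2 \<Longrightarrow> \<mu> \<in> N2 \<Longrightarrow> sgn (b1 \<xi> 0 \<mu>) = sgn (b1 0 0 ?o)"
    by (rule joint_neighborhood[where h = b1, OF cont(4) m0(1) 0(2)]) blast
  obtain d3 N3 where N3: "d3 > 0" "openin ?E N3" "?o \<in> N3"
    "\<And>\<xi> \<mu>. \<bar>\<xi> - 0\<bar> < d3 \<Longrightarrow> \<mu> \<in> N3 \<Longrightarrow> sgn (c2 \<xi> 0 \<mu>) = sgn (c2 0 0 ?o)"
    by (rule joint_neighborhood[where h = c2, OF cont2 m0(1) 0(3)]) blast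
  obtain d4 N4 where N4: "d4 > 0" "openin ?E N4" "?o \<in> N4"
    "\<And>\<xi> \<mu>. \<bar>\<xi> - 0\<bar> < d4 \<Longrightarrow> \<mu> \<in> N4 \<Longrightarrow> sgn (c3 \<xi> 0 \<mu>) = sgn (c3 0 0 ?o)"
    by (rule joint_neighborhood[where h = c3, OF cont3 m0(1) 0(4)]) blast
  define \<delta> where "\<delta> = min (min d1 d2) (min d3 d4)"
  define N where "N = N1 \<inter> N2 \<inter> (N3 \<inter> N4)"
  have \<delta>: "\<delta> > 0" and oN: "openin ?E N" "?o \<in> N" unfolding \<delta>_def N_def using N1(1-3) N2(1-3) N3(1-3) N4(1-3) by auto
  have sg: "sgn (T \<xi> 0 \<mu>) = sgn (T 0 0 ?o)" "sgn (b1 \<xi> 0 \<mu>) = sgn (b1 0 0 ?o)" "sgn (c2 \<xi> 0 \<mu>) = sgn (c2 0 0 ?o)" "sgn (c3 \<xi> 0 \<mu>) = sgn (c3 0 0 ?o)"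
    if "\<bar>\<xi>\<bar> < \<delta>" "\<mu> \<in> N" for \<xi> \<mu>
    using that N1(4)[of \<xi> \<mu>] N2(4)[of \<xi> \<mu>] N3(4)[of \<xi> \<mu>] N4(4)[of \<xi> \<mu>] unfolding \<delta>_def N_def by simp_all
  have N_top: "\<mu> \<in> topspace ?E" if "\<mu> \<in> N" for \<mu> using openin_subset[OF oN(1)] that by blast
  define s where "s = sgn (b1 0 0 ?o)"
  have s: "s = 1 \<or> s = - 1" using 0(2) unfolding s_def sgn_if by simp
  have db: "((\<lambda>x. b x 0 \<mu>) has_field_derivative b1 \<xi> 0 \<mu>) (at \<xi>)" if "\<mu> \<in> N" for \<mu> \<xi>
    unfolding b_def b1_def
    by (rule smooth_germ_DERIV_x[OF smooth_germ_graph_bracket[OF member_tangential[OF def N_top[OF that]]]])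
  have incr: "sgn (b y 0 \<mu> - b x 0 \<mu>) = s" if "\<mu> \<in> N" "\<bar>x\<bar> < \<delta>" "\<bar>y\<bar> < \<delta>" "x < y" for x y \<mu>
    by (rule sgn_increment[OF db[OF that(1)] sg(2)[OF _ that(1), folded s_def] that(2-4)])
  have diffeo: "graph_germs_diffeomorphic f (0, 0) (\<lambda>z. F z \<mu>) (\<xi>, 0)" if "\<mu> \<in> N" "\<bar>\<xi>\<bar> < \<delta>" "b \<xi> 0 \<mu> = 0" for \<mu> \<xi>
  proof -
    note g = sg[OF that(2,1)]
    have T: "T \<xi> 0 \<mu> \<noteq> 0" using g(1) T0 by (metis sgn_eq_0_iff)
    have "b1 \<xi> 0 \<mu> \<noteq> 0" "c2 \<xi> 0 \<mu> \<noteq> 0" "c3 \<xi> 0 \<mu> \<noteq> 0"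
      using g(2-4) 0(2-4) by (metis sgn_eq_0_iff)+
    then have lrm: "left_right_equivalent (graph_chart (\<lambda>z. F z \<mu>)) (\<xi>, 0) (A1_form \<epsilon>) 0"
      using cl[OF N_top[OF that(1)] T] that(3) 0(5) g(4) by simp
    show ?thesis
      by (rule graph_germs_diffeomorphicI[OF sm nz tangential_family_smooth[OF member_tangential[OF def N_top[OF that(1)]]] T[unfolded T_def] lr lrm])
  qed
  have uniq: "x = y" if "\<mu> \<in> N" "\<bar>x\<bar> < \<delta>" "\<bar>y\<bar> < \<delta>" "b x 0 \<mu> = 0" "b y 0 \<mu> = 0" for x y \<mu>
    using incr[OF that(1,2,3)] incr[OF that(1,3,2)] that(4,5) s by (cases x y rule: linorder_cases) auto
  \<comment> \<open>For the undeformed member the bracket has opposite signs at \<open>r\<close> and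
    \<open>- r\<close>. These signs persist for small parameters, and the intermediate value theorem
    yields a zero between them.\<close>
  have ex: "\<exists>U. openin ?E U \<and> ?o \<in> U \<and> U \<subseteq> N \<and> (\<forall>\<mu>\<in>U. \<exists>\<xi>. \<bar>\<xi>\<bar> < e \<and> \<bar>\<xi>\<bar> < \<delta> \<and> b \<xi> 0 \<mu> = 0)" if "e > 0" for e
  proof -
    define r where "r = min e \<delta> / 2"
    have r: "0 < r" "r < e" "r < \<delta>" unfolding r_def using \<open>e > 0\<close> \<delta> by auto
    have sr: "sgn (b r 0 ?o) = s" "sgn (b (- r) 0 ?o) = - s"
      using incr[OF oN(2), of 0 r] incr[OF oN(2), of "- r" 0] r \<delta> 0(1) by (auto simp: sgn_minus[symmetric] sgn_if split: if_splits)
    then have nzr: "b r 0 ?o \<noteq> 0" "b (- r) 0 ?o \<noteq> 0" using s by auto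
    obtain d5 N5 where N5: "d5 > 0" "openin ?E N5" "?o \<in> N5"
      "\<And>\<xi> \<mu>. \<bar>\<xi> - r\<bar> < d5 \<Longrightarrow> \<mu> \<in> N5 \<Longrightarrow> sgn (b \<xi> 0 \<mu>) = sgn (b r 0 ?o)"
      by (rule joint_neighborhood[where h = b, OF cont(3) m0(1) nzr(1)]) blast
    obtain d6 N6 where N6: "d6 > 0" "openin ?E N6" "?o \<in> N6"
      "\<And>\<xi> \<mu>. \<bar>\<xi> - (- r)\<bar> < d6 \<Longrightarrow> \<mu> \<in> N6 \<Longrightarrow> sgn (b \<xi> 0 \<mu>) = sgn (b (- r) 0 ?o)"
      by (rule joint_neighborhood[where h = b, OF cont(3) m0(1) nzr(2)]) blast
    have "\<exists>\<xi>. \<bar>\<xi>\<bar> < e \<and> \<bar>\<xi>\<bar> < \<delta> \<and> b \<xi> 0 \<mu> = 0" if \<mu>: "\<mu> \<in> N \<inter> N5 \<inter> N6" for \<mu>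
    proof -
      have "sgn (b r 0 \<mu>) = s" "sgn (b (- r) 0 \<mu>) = - s"
        using N5(4)[of r \<mu>] N6(4)[of "- r" \<mu>] N5(1) N6(1) \<mu> sr by simp_all
      then have "s * b (- r) 0 \<mu> \<le> 0" "0 \<le> s * b r 0 \<mu>" using s by (auto simp: sgn_if split: if_splits)
      moreover have "continuous_on {- r..r} (\<lambda>x. s * b x 0 \<mu>)"
        by (intro continuous_intros continuous_at_imp_continuous_on ballI DERIV_isCont[OF db]) (use \<mu> in simp)
      ultimately obtain x where "- r \<le> x" "x \<le> r" "s * b x 0 \<mu> = 0"
        using IVT'[of "\<lambda>x. s * b x 0 \<mu>" "- r" 0 r] r by auto
      then show ?thesis using r s by (intro exI[of _ x]) auto
    qed
    then show ?thesis using oN N5(2,3) N6(2,3) by (intro exI[of _ "N \<inter> N5 \<inter> N6"]) auto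
  qed
  \<comment> \<open>By uniqueness of the zero within \<delta> this choice does not depend on the
    precision e. It is a default value where no zero exists, which happens only away from 0.\<close>
  define q where "q \<mu> = (SOME \<xi>. \<bar>\<xi>\<bar> < \<delta> \<and> b \<xi> 0 \<mu> = 0, 0 :: real)" for \<mu>
  have q: "q \<mu> = (\<xi>, 0)" if "\<mu> \<in> N" "\<bar>\<xi>\<bar> < \<delta>" "b \<xi> 0 \<mu> = 0" for \<mu> \<xi>
  proof -
    have "(SOME \<xi>. \<bar>\<xi>\<bar> < \<delta> \<and> b \<xi> 0 \<mu> = 0) = \<xi>"
    proof (rule some_equality)
      show "\<bar>\<xi>\<bar> < \<delta> \<and> b \<xi> 0 \<mu> = 0" using that(2,3) by (rule conjI)
      show "x = \<xi>" if "\<bar>x\<bar> < \<delta> \<and> b x 0 \<mu> = 0" for x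
        by (rule uniq[OF \<open>\<mu> \<in> N\<close> conjunct1[OF that] \<open>\<bar>\<xi>\<bar> < \<delta>\<close> conjunct2[OF that] \<open>b \<xi> 0 \<mu> = 0\<close>])
    qed
    then show ?thesis unfolding q_def by (rule arg_cong)
  qed
  show "\<exists>q. (q \<longlongrightarrow> (0, 0)) (atin ?E ?o) \<and>
      (\<forall>\<^sub>F \<mu> in nhdsin ?E ?o. graph_germs_diffeomorphic f (0, 0) (\<lambda>z. F z \<mu>) (q \<mu>))"
  proof (rule exI[of _ q], rule conjI)
    show "(q \<longlongrightarrow> (0, 0)) (atin ?E ?o)"
    proof (rule tendstoI)
      fix e :: real assume "e > 0"
      from ex[OF this] obtain U where U: "openin ?E U" "?o \<in> U" "U \<subseteq> N" "\<And>\<mu>. \<mu> \<in> U \<Longrightarrow> \<exists>\<xi>. \<bar>\<xi>\<bar> < e \<and> \<bar>\<xi>\<bar> < \<delta> \<and> b \<xi> 0 \<mu> = 0"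
        by blast
      have "dist (q \<mu>) (0, 0) < e" if mem: "\<mu> \<in> U" for \<mu>
      proof -
        obtain \<xi> where \<xi>: "\<bar>\<xi>\<bar> < e" "\<bar>\<xi>\<bar> < \<delta>" "b \<xi> 0 \<mu> = 0" using U(4)[OF mem] by blast
        have "q \<mu> = (\<xi>, 0)" using q[of \<mu> \<xi>] \<xi> U(3) mem by blast
        then show ?thesis using \<xi>(1) by (simp add: dist_prod_def dist_real_def)
      qed
      then show "\<forall>\<^sub>F \<mu> in atin ?E ?o. dist (q \<mu>) (0, 0) < e"
        unfolding eventually_atin using U(1,2) by blast
    qed
    from ex[OF zero_less_one] obtain U where U: "openin ?E U" "?o \<in> U" "U \<subseteq> N"
      "\<And>\<mu>. \<mu> \<in> U \<Longrightarrow> \<exists>\<xi>. \<bar>\<xi>\<bar> < 1 \<and> \<bar>\<xi>\<bar> < \<delta> \<and> b \<xi> 0 \<mu> = 0"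
      by blast
    have "graph_germs_diffeomorphic f (0, 0) (\<lambda>z. F z \<mu>) (q \<mu>)" if mem: "\<mu> \<in> U" for \<mu>
    proof -
      obtain \<xi> where \<xi>: "\<bar>\<xi>\<bar> < \<delta>" "b \<xi> 0 \<mu> = 0" using U(4)[OF mem] by blast
      have N: "\<mu> \<in> N" using U(3) mem by blast
      show ?thesis unfolding q[OF N \<xi>] by (rule diffeo[OF N \<xi>])
    qed
    then show "\<forall>\<^sub>F \<mu> in nhdsin ?E ?o. graph_germs_diffeomorphic f (0, 0) (\<lambda>z. F z \<mu>) (q \<mu>)"
      unfolding eventually_nhdsin using U(1,2) by blast
  qed
qed

section \<open>Generic perturbations\<close>

text \<open>Sard's theorem on the set where the differential is singular, transported to
  \<open>real^2\<close> by linear isomorphisms so that singularity becomes a rank deficit of a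
  matrix.\<close>

lemma critical_values_negligible:
  fixes M :: "real \<times> real \<Rightarrow> real \<times> real"
  assumes der: "\<And>z. z \<in> S \<Longrightarrow> (M has_derivative M' z) (at z)"
    and crit: "\<And>z. z \<in> S \<Longrightarrow> \<exists>e. e \<noteq> 0 \<and> M' z e = 0"
  shows "negligible {v :: real^2. (v $ 1, v $ 2) \<in> M ` S}"
proof -
  define J where "J v = (v $ 1, v $ 2)" for v :: "real^2"
  define I :: "real \<times> real \<Rightarrow> real^2" where "I z = vector [fst z, snd z]" for z
  have JI: "J (I z) = z" and IJ: "I (J v) = v" for z v
    by (simp_all add: J_def I_def vec_eq_iff forall_2)
  have "linear J" "linear I" by (auto intro!: linearI simp: J_def I_def vec_eq_iff forall_2)
  then have bl: "bounded_linear J" "bounded_linear I" by (simp_all add: linear_conv_bounded_linear)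
  let ?f = "\<lambda>v. I (M (J v))" and ?f' = "\<lambda>v w. I (M' (J v) (J w))"
  have d: "(?f has_derivative ?f' v) (at v)" if "v \<in> J -` S" for v
    by (rule bounded_linear.has_derivative[OF bl(2)], rule has_derivative_compose[OF bounded_linear_imp_has_derivative[OF bl(1)] der])
      (use that in simp)
  have "negligible (?f ` (J -` S))"
  proof (rule baby_Sard)
    show "CARD(2) \<le> CARD(2)" by simp
    fix v assume v: "v \<in> J -` S"
    show "(?f has_derivative ?f' v) (at v within J -` S)" using d[OF v] by (rule has_derivative_at_withinI)
    obtain e where e: "e \<noteq> 0" "M' (J v) e = 0" using crit v by blast
    have lin: "linear (?f' v)" using d[OF v] by (rule has_derivative_linear)
    have "?f' v (I e) = ?f' v 0" using e(2) linear_0[OF lin] linear_0[OF \<open>linear I\<close>] by (simp add: JI)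
    moreover have "I e \<noteq> 0"
    proof
      assume "I e = 0"
      then have "J (I e) = J 0" by simp
      then show False using e(1) linear_0[OF \<open>linear J\<close>] by (simp add: JI)
    qed
    ultimately have "\<not> inj (?f' v)" unfolding inj_def by blast
    moreover have "(*v) (matrix (?f' v)) = ?f' v" by (rule matrix_vector_mul(2)[OF lin])
    ultimately show "rank (matrix (?f' v)) < CARD(2)" unfolding less_rank_noninjective by simp
  qed
  moreover have "{v. J v \<in> M ` S} = ?f ` (J -` S)"
  proof (intro equalityI subsetI)
    fix v assume "v \<in> {v. J v \<in> M ` S}"
    then obtain z where z: "z \<in> S" "J v = M z" by blast
    then have "v = ?f (I z)" using IJ[of v] by (simp add: JI)
    then show "v \<in> ?f ` (J -` S)" using z(1) by (intro image_eqI[of _ _ "I z"]) (simp_all add: JI)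
  qed (auto simp: JI)
  ultimately show ?thesis by (simp add: J_def)
qed

text \<open>The first coefficient is o(r) and the second tends to a nonzero number, so
  \<open>py C\<close> is o(r) along the curve; hence its derivative in the direction of the velocity
  is 0.\<close>

lemma along_kernel_limit:
  fixes C :: "real \<times> real \<Rightarrow> real" and c :: "real \<Rightarrow> real \<times> real"
  assumes C: "smooth_germ C w" "py C w = 0"
    and c: "((\<lambda>r. (c r - w) /\<^sub>R r) \<longlongrightarrow> e) (at_right 0)"
    and u: "((\<lambda>r. u1 r / r) \<longlongrightarrow> 0) (at_right 0)" "(u2 \<longlongrightarrow> t) (at_right 0)" "t \<noteq> 0"
    and lim: "((\<lambda>r. (u1 r * px C (c r) + u2 r * py C (c r)) / r) \<longlongrightarrow> 0) (at_right 0)"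
  shows "fst e * px (py C) w + snd e * py (py C) w = 0"
proof -
  have "((\<lambda>r. px C (c r)) \<longlongrightarrow> px C w) (at_right 0)"
    by (rule isCont_tendsto_compose[OF smooth_germ_isCont[OF smooth_germ_px[OF C(1)]] curve_tendsto[OF c]])
  from tendsto_divide[OF tendsto_diff[OF lim tendsto_mult[OF u(1) this]] u(2,3)]
  have 1: "((\<lambda>r. ((u1 r * px C (c r) + u2 r * py C (c r)) / r - u1 r / r * px C (c r)) / u2 r) \<longlongrightarrow> 0) (at_right 0)" by simp
  have nz: "\<forall>\<^sub>F r in at_right 0. u2 r \<noteq> 0" using u(2,3) by (rule tendsto_imp_eventually_ne)
  have "\<forall>\<^sub>F r in at_right 0. ((u1 r * px C (c r) + u2 r * py C (c r)) / r - u1 r / r * px C (c r)) / u2 r = (py C (c r) - py C w) /\<^sub>R r"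
    using nz eventually_at_right_less[of 0] by eventually_elim (simp add: C(2) field_simps)
  from Lim_transform_eventually[OF 1 this]
  have "((\<lambda>r. (py C (c r) - py C w) /\<^sub>R r) \<longlongrightarrow> 0) (at_right 0)" .
  moreover have "((\<lambda>r. (py C (c r) - py C w) /\<^sub>R r) \<longlongrightarrow> fst e * px (py C) w + snd e * py (py C) w) (at_right 0)"
    by (rule curve_derivative[OF smooth_germ_plane_real[OF smooth_germ_py[OF C(1)]] c])
  ultimately show ?thesis using tendsto_unique[OF trivial_limit_at_right_real] by blast
qed

text \<open>Along some line \<open>r \<mapsto> r e\<close> through a singular point of \<open>(x, A, B)\<close> the differential maps the
  kernel vector to \<open>o(r)\<close>. This property is invariant under Left-Right equivalence and fails for
  Whitney umbrellas, the singular points that a generic perturbation has off the support.\<close>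

lemma degenerate_kernel:
  assumes tg: "tangential_germ A B V" and V0: "V 0 = 0"
    and s: "smooth_germ A' w" "smooth_germ B' w"
    and lr: "left_right_equivalent (graph_form A B) 0 (graph_form A' B') w"
  shows "py A' w = 0" "py B' w = 0"
    "\<exists>e. e \<noteq> 0 \<and> fst e * px (py A') w + snd e * py (py A') w = 0 \<and> fst e * px (py B') w + snd e * py (py B') w = 0"
proof -
  note sA = tangential_germ_smooth(1)[OF tg] and sB = tangential_germ_smooth(2)[OF tg]
  let ?g = "graph_form A B" and ?g' = "graph_form A' B'" and ?v = "(0 :: real, 1 :: real)"
  obtain h where h: "diffeo_germ h 0" "h 0 = w"
    "\<And>z v n. (z \<longlongrightarrow> 0) (at_right 0) \<Longrightarrow>
      ((\<lambda>r. frechet_derivative ?g (at (z r)) v /\<^sub>R r ^ n) \<longlongrightarrow> 0) (at_right (0 :: real)) \<Longrightarrow>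
      ((\<lambda>r. frechet_derivative ?g' (at (h (z r))) (frechet_derivative h (at (z r)) v) /\<^sub>R r ^ n) \<longlongrightarrow> 0) (at_right 0)"
    by (rule left_right_transfer[OF lr tangential_germ_smooth(4)[OF tg] smooth_germ_graph_form[OF s]]) blast
  note Dh = smooth_germ_derivative[OF diffeo_germ_smooth[OF h(1)]]
  have injh: "frechet_derivative h (at 0) v \<noteq> 0" if "v \<noteq> 0" for v
    using diffeo_germ_inj_derivative[OF h(1)] that unfolding linear_injective_0[OF has_derivative_linear[OF Dh]] by blast
  define u where "u = frechet_derivative h (at 0) ?v"
  have "frechet_derivative ?g (at 0) ?v = 0" unfolding graph_form_kernel_iff[OF tg] by (simp add: V0)
  then have "((\<lambda>r :: real. frechet_derivative ?g' (at w) u) \<longlongrightarrow> 0) (at_right 0)"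
    using h(3)[where z = "\<lambda>_. 0" and v = ?v and n = 0] by (simp add: h(2) u_def)
  then have "frechet_derivative ?g' (at w) u = 0" by (simp add: tendsto_const_iff)
  moreover have "u \<noteq> 0" unfolding u_def by (rule injh) (simp add: zero_prod_def)
  ultimately have u: "fst u = 0" "snd u \<noteq> 0" and py0: "py A' w = 0" "py B' w = 0"
    unfolding graph_form_derivative[OF s] by (auto simp: prod_eq_iff)
  show "py A' w = 0" "py B' w = 0" by (rule py0)+
  define p q where "p = px V 0" and "q = py V 0"
  \<comment> \<open>The gradient of B_\<tau> at 0 is (p, p + 2 q), that of A_\<tau> is 0 since V
    vanishes there. \<open>e\<close> is chosen orthogonal to the former; if that gradient vanishes,
    every direction will do.\<close>
  define e where "e = (if p + 2 * q = 0 \<and> p = 0 then (1, 0) else (p + 2 * q, - p))"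
  have e: "e \<noteq> 0" "fst e * p + snd e * (p + 2 * q) = 0" by (auto simp: e_def prod_eq_iff)
  have z: "((\<lambda>r. (r *\<^sub>R e - 0) /\<^sub>R r) \<longlongrightarrow> e) (at_right 0)"
  proof (rule Lim_transform_eventually[OF tendsto_const[of e]])
    show "\<forall>\<^sub>F r in at_right 0. e = (r *\<^sub>R e - 0) /\<^sub>R r" using eventually_at_right_less[of 0] by eventually_elim simp
  qed
  note z0 = curve_tendsto[OF z]
  have pA: "px (py A) 0 = 0" "py (py A) 0 = 0"
    using px_py_cong[OF tangential_germ_py(1)[OF tg]] px_py_mult[OF smooth_germ_coordinates(2) tangential_germ_smooth(3)[OF tg]] V0
    by simp_all
  have "((\<lambda>z. (0 :: real, py A z, py B z)) has_derivative
      (\<lambda>v. (0, fst v * px (py A) 0 + snd v * py (py A) 0, fst v * px (py B) 0 + snd v * py (py B) 0))) (at 0)"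
    by (intro has_derivative_Pair has_derivative_const smooth_germ_plane_real smooth_germ_py sA sB)
  from curve_derivative[OF this z]
  have "((\<lambda>r. (0 :: real, py A (r *\<^sub>R e), py B (r *\<^sub>R e)) /\<^sub>R r) \<longlongrightarrow> 0) (at_right 0)"
    using e(2) by (simp add: pA tangential_germ_py_B[OF tg] tangential_germ_at_0[OF tg] V0 p_def q_def zero_prod_def[symmetric])
  moreover have "\<forall>\<^sub>F z in nhds 0. frechet_derivative ?g (at z) ?v = (0, py A z, py B z)"
    using smooth_germ_eventually[OF sA] smooth_germ_eventually[OF sB] by eventually_elim (simp add: graph_form_derivative)
  then have "\<forall>\<^sub>F r in at_right 0. (0, py A (r *\<^sub>R e), py B (r *\<^sub>R e)) /\<^sub>R r = frechet_derivative ?g (at (r *\<^sub>R e)) ?v /\<^sub>R r ^ 1"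
    by (rule filterlim_iff[THEN iffD1, rule_format, OF z0, THEN eventually_mono]) simp
  ultimately have "((\<lambda>r. frechet_derivative ?g (at (r *\<^sub>R e)) ?v /\<^sub>R r ^ 1) \<longlongrightarrow> 0) (at_right 0)"
    by (rule Lim_transform_eventually)
  note L = h(3)[OF z0 this]
  define c where "c r = h (r *\<^sub>R e)" for r
  define U where "U r = frechet_derivative h (at (r *\<^sub>R e)) ?v" for r
  define e' where "e' = frechet_derivative h (at 0) e"
  have c: "((\<lambda>r. (c r - w) /\<^sub>R r) \<longlongrightarrow> e') (at_right 0)"
    using curve_derivative[OF Dh z] unfolding c_def e'_def h(2) .
  have U: "(U \<longlongrightarrow> u) (at_right 0)"
    unfolding U_def u_def
    by (rule isCont_tendsto_compose[OF smooth_germ_isCont[OF smooth_germ_frechet[OF diffeo_germ_smooth[OF h(1)]]] z0])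
  have "\<forall>\<^sub>F z in nhds w. \<forall>v. frechet_derivative ?g' (at z) v
      = (fst v, fst v * px A' z + snd v * py A' z, fst v * px B' z + snd v * py B' z)"
    using smooth_germ_eventually[OF s(1)] smooth_germ_eventually[OF s(2)] by eventually_elim (simp add: graph_form_derivative)
  then have "\<forall>\<^sub>F r in at_right 0. frechet_derivative ?g' (at (c r)) (U r) /\<^sub>R r ^ 1 = (fst (U r) / r,
      (fst (U r) * px A' (c r) + snd (U r) * py A' (c r)) / r, (fst (U r) * px B' (c r) + snd (U r) * py B' (c r)) / r)"
    by (rule filterlim_iff[THEN iffD1, rule_format, OF curve_tendsto[OF c], THEN eventually_mono])
      (simp add: divide_inverse mult.commute del: split_paired_All)
  from Lim_transform_eventually[OF L[folded c_def U_def] this]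
  have "((\<lambda>r. (fst (U r) / r, (fst (U r) * px A' (c r) + snd (U r) * py A' (c r)) / r,
      (fst (U r) * px B' (c r) + snd (U r) * py B' (c r)) / r)) \<longlongrightarrow> 0) (at_right 0)" .
  note L1 = tendsto_fst[OF this, simplified] tendsto_fst[OF tendsto_snd[OF this], simplified] tendsto_snd[OF tendsto_snd[OF this], simplified]
  note K = along_kernel_limit[OF _ _ c L1(1) tendsto_snd[OF U] u(2)]
  show "\<exists>e. e \<noteq> 0 \<and> fst e * px (py A') w + snd e * py (py A') w = 0 \<and> fst e * px (py B') w + snd e * py (py B') w = 0"
    using K[OF s(1) py0(1) L1(2)] K[OF s(2) py0(2) L1(3)] injh[OF e(1)] unfolding e'_def by blast
qed


text \<open>The corresponding \<open>V\<close> is \<open>V + 2 * fst m + 3 * snd m * \<tau>\<close>: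
  \<open>fst m\<close> moves the zeros of \<open>V\<close> along the support, \<open>snd m\<close>
  changes q and leaves p alone. \<open>perturb_B\<close> is the matching slope, as the added terms
  do not depend on x.\<close>

definition perturb_A :: "real \<times> real \<Rightarrow> (real \<times> real \<Rightarrow> real) \<Rightarrow> real \<times> real \<Rightarrow> real" where
  "perturb_A m A z = A z + fst m * snd z ^ 2 + snd m * snd z ^ 3"

definition perturb_B :: "real \<times> real \<Rightarrow> (real \<times> real \<Rightarrow> real) \<Rightarrow> real \<times> real \<Rightarrow> real" where
  "perturb_B m B z = B z + 2 * fst m * snd z + 3 * snd m * snd z ^ 2"

lemma smooth_germ_perturb:
  "smooth_germ A w \<Longrightarrow> smooth_germ (perturb_A m A) w" "smooth_germ B w \<Longrightarrow> smooth_germ (perturb_B m B) w"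
  unfolding perturb_A_def[abs_def] perturb_B_def[abs_def]
  by (intro smooth_germ_add smooth_germ_mult smooth_germ_power smooth_germ_const smooth_germ_coordinates; assumption)+

lemma py_perturb:
  "smooth_germ A z \<Longrightarrow> py (perturb_A m A) z = py A z + 2 * fst m * snd z + 3 * snd m * snd z ^ 2"
  "smooth_germ B z \<Longrightarrow> py (perturb_B m B) z = py B z + 2 * fst m + 6 * snd m * snd z"
proof -
  assume A: "smooth_germ A z"
  have "(perturb_A m A has_derivative (\<lambda>v. fst v * px A z + snd v * py A z + fst m * (2 * snd z * snd v) + snd m * (3 * snd z ^ 2 * snd v))) (at z)"
    unfolding perturb_A_def[abs_def] by (rule derivative_eq_intros smooth_germ_plane_real[OF A] refl)+ (simp add: fun_eq_iff algebra_simps power2_eq_square)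
  from has_derivative_px_py(2)[OF this]
  show "py (perturb_A m A) z = py A z + 2 * fst m * snd z + 3 * snd m * snd z ^ 2" by simp
next
  assume B: "smooth_germ B z"
  have "(perturb_B m B has_derivative (\<lambda>v. fst v * px B z + snd v * py B z + 2 * fst m * snd v + 3 * snd m * (2 * snd z * snd v))) (at z)"
    unfolding perturb_B_def[abs_def] by (rule derivative_eq_intros smooth_germ_plane_real[OF B] refl)+ (simp add: fun_eq_iff algebra_simps power2_eq_square)
  from has_derivative_px_py(2)[OF this]
  show "py (perturb_B m B) z = py B z + 2 * fst m + 6 * snd m * snd z" by simp
qed

lemma px_py_shift:
  fixes F :: "real \<times> real \<Rightarrow> real"
  assumes "smooth_germ F (z + w)"
  shows "px (\<lambda>z. F (z + w)) z = px F (z + w)" "py (\<lambda>z. F (z + w)) z = py F (z + w)"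
proof -
  have "((\<lambda>z. F (z + w)) has_derivative (\<lambda>v. fst v * px F (z + w) + snd v * py F (z + w))) (at z)"
    by (rule has_derivative_compose[where f = "\<lambda>z. z + w" and f' = "\<lambda>v. v" and g = F, OF _ smooth_germ_plane_real[OF assms]])
      (auto intro!: derivative_eq_intros)
  from has_derivative_px_py[OF this] show "px (\<lambda>z. F (z + w)) z = px F (z + w)" "py (\<lambda>z. F (z + w)) z = py F (z + w)"
    by simp_all
qed

lemma smooth_germ_shift:
  fixes F :: "real \<times> real \<Rightarrow> real"
  assumes "smooth_germ F w" shows "smooth_germ (\<lambda>z. F (z + w)) 0"
  by (rule smooth_germ_compose[where f = "\<lambda>z. z + w"]) (simp_all add: assms smooth_germ_add smooth_germ_id smooth_germ_const)

lemma eventually_nhds_shift: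
  fixes w :: "real \<times> real"
  assumes "\<forall>\<^sub>F z in nhds w. P z" shows "\<forall>\<^sub>F z in nhds 0. P (z + w)"
  by (rule eventually_nhds_curve[OF _ _ assms]) (auto intro!: continuous_intros)

context
  fixes A B V :: "real \<times> real \<Rightarrow> real" and w m :: "real \<times> real"
  assumes sA: "smooth_germ A w" and sB: "smooth_germ B w" and sV: "smooth_germ V w"
    and pyA: "\<forall>\<^sub>F z in nhds w. py A z = snd z * V z"
    and pyB: "\<forall>\<^sub>F z in nhds w. py B z = V z + snd z * (px V z + py V z)"
begin

lemma eventually_py_perturb:
  "\<forall>\<^sub>F z in nhds w. py (perturb_A m A) z = snd z * (V z + 2 * fst m + 3 * snd m * snd z)"
  "\<forall>\<^sub>F z in nhds w. py (perturb_B m B) z = V z + snd z * (px V z + py V z) + 2 * fst m + 6 * snd m * snd z"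
proof -
  show "\<forall>\<^sub>F z in nhds w. py (perturb_A m A) z = snd z * (V z + 2 * fst m + 3 * snd m * snd z)"
    using smooth_germ_eventually[OF sA] pyA
    by eventually_elim (simp add: py_perturb algebra_simps power2_eq_square)
  show "\<forall>\<^sub>F z in nhds w. py (perturb_B m B) z = V z + snd z * (px V z + py V z) + 2 * fst m + 6 * snd m * snd z"
    using smooth_germ_eventually[OF sB] pyB
    by eventually_elim (simp add: py_perturb)
qed

text \<open>For \<tau> different from 0 the two equations of a singular point are linear in
  \<open>m\<close> and can be solved: \<open>m\<close> is a function of the point. The degeneracy of
  the kernel then says that the differential of this function kills \<open>e\<close>.\<close>

lemma degenerate_off_support:
  assumes \<tau>: "snd w \<noteq> 0" and 0: "py (perturb_A m A) w = 0" "py (perturb_B m B) w = 0"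
    and ex: "\<exists>e. e \<noteq> 0 \<and> fst e * px (py (perturb_A m A)) w + snd e * py (py (perturb_A m A)) w = 0 \<and>
      fst e * px (py (perturb_B m B)) w + snd e * py (py (perturb_B m B)) w = 0"
  defines "K \<equiv> \<lambda>z. px V z + py V z"
  shows "m = ((snd w * K w - V w) / 2, - K w / 3)"
    "\<exists>e. e \<noteq> 0 \<and> fst e * px V w + snd e * py V w = snd e * K w \<and> fst e * px K w + snd e * py K w = 0"
proof -
  obtain e where e: "e \<noteq> 0" "fst e * px (py (perturb_A m A)) w + snd e * py (py (perturb_A m A)) w = 0"
    "fst e * px (py (perturb_B m B)) w + snd e * py (py (perturb_B m B)) w = 0" using ex by blast
  have sK: "smooth_germ K w" unfolding K_def by (intro smooth_germ_add smooth_germ_px smooth_germ_py sV)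
  have "px V z + py V z = K z" for z by (simp add: K_def)
  note ev = eventually_py_perturb[unfolded this]
  define R where "R = V w + 2 * fst m + 3 * snd m * snd w"
  have "((\<lambda>z. snd z * (V z + 2 * fst m + 3 * snd m * snd z)) has_derivative
      (\<lambda>v. snd v * R + snd w * (fst v * px V w + snd v * py V w + 3 * snd m * snd v))) (at w)"
    by (rule derivative_eq_intros smooth_germ_plane_real[OF sV] refl)+ (simp add: fun_eq_iff R_def algebra_simps)
  note dA = has_derivative_px_py[OF this, folded px_py_cong[OF ev(1)]]
  have "((\<lambda>z. V z + snd z * K z + 2 * fst m + 6 * snd m * snd z) has_derivative
      (\<lambda>v. (fst v * px V w + snd v * py V w) + (snd v * K w + snd w * (fst v * px K w + snd v * py K w)) + 6 * snd m * snd v)) (at w)"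
    by (rule derivative_eq_intros smooth_germ_plane_real[OF sV] smooth_germ_plane_real[OF sK] refl)+ (simp add: fun_eq_iff algebra_simps)
  note dB = has_derivative_px_py[OF this, folded px_py_cong[OF ev(2)]]
  have R: "R = 0" using eventually_nhds_x_imp_x[OF ev(1)] 0(1) \<tau> by (simp add: R_def)
  have B0: "V w + snd w * K w + 2 * fst m + 6 * snd m * snd w = 0" using eventually_nhds_x_imp_x[OF ev(2)] 0(2) by simp
  have "snd w * (K w + 3 * snd m) = 0" using R B0 unfolding R_def by (simp add: algebra_simps)
  then have m2: "snd m = - K w / 3" using \<tau> by simp
  then have m1: "fst m = (snd w * K w - V w) / 2" using R unfolding R_def by (simp add: algebra_simps)
  show "m = ((snd w * K w - V w) / 2, - K w / 3)" using m1 m2 by (simp add: prod_eq_iff)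
  have "snd w * (fst e * px V w + snd e * py V w + 3 * snd m * snd e) = 0"
    using e(2) unfolding dA R by (simp add: algebra_simps)
  then have DV: "fst e * px V w + snd e * py V w = snd e * K w" using \<tau> by (simp add: m2)
  have "(fst e * px V w + snd e * py V w) + snd e * K w + snd w * (fst e * px K w + snd e * py K w) + 6 * snd m * snd e = 0"
    using e(3) unfolding dB by (simp add: algebra_simps)
  then have "snd w * (fst e * px K w + snd e * py K w) = 0" unfolding DV m2 by simp
  then have "fst e * px K w + snd e * py K w = 0" using \<tau> by simp
  with e(1) DV show "\<exists>e. e \<noteq> 0 \<and> fst e * px V w + snd e * py V w = snd e * K w \<and> fst e * px K w + snd e * py K w = 0" by blast
qed

text \<open>After translation the point is the origin of a tangential germ with p' = V_x and q' =
  V_\<tau> + 3 \<open>snd m\<close>. The values c = 0, 1/2, 1 correspond to q' = 0, p' + 2 q' = 0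
  and p' + q' = 0, the ways to miss an umbrella when p' is nonzero.\<close>

lemma degenerate_on_support:
  assumes \<tau>: "snd w = 0" and 0: "py (perturb_B m B) w = 0"
    and not_A1: "\<And>\<epsilon>. \<epsilon> = 1 \<or> \<epsilon> = - 1 \<Longrightarrow> \<not> left_right_equivalent (graph_form (perturb_A m A) (perturb_B m B)) w (A1_form \<epsilon>) 0"
  shows "fst m = - V w / 2" "px V w = 0 \<or> (\<exists>c\<in>{0, 1/2, 1}. snd m = - (py V w + c * px V w) / 3)"
proof -
  define A' where "A' z = perturb_A m A (z + w)" for z
  define B' where "B' z = perturb_B m B (z + w)" for z
  \<comment> \<open>Since \<open>w\<close> lies on the axis, the translation changes x only, and the
    factor \<tau> in A_\<tau> = \<tau> V keeps its meaning.\<close>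
  define V' where "V' z = V (z + w) + (2 * fst m + 3 * snd m * snd z)" for z
  have sV': "smooth_germ V' 0"
    unfolding V'_def by (intro smooth_germ_add smooth_germ_shift[OF sV] smooth_germ_mult smooth_germ_const smooth_germ_coordinates)
  have pV': "px V' z = px V (z + w)" "py V' z = py V (z + w) + 3 * snd m" if "smooth_germ V (z + w)" for z
  proof -
    have "(V' has_derivative (\<lambda>v. (fst v * px V (z + w) + snd v * py V (z + w)) + 3 * snd m * snd v)) (at z)"
      unfolding V'_def[abs_def]
      by (rule has_derivative_add[OF has_derivative_compose[where f = "\<lambda>z. z + w" and f' = "\<lambda>v. v" and g = V, OF _ smooth_germ_plane_real[OF that]]])
        (auto intro!: derivative_eq_intros)
    from has_derivative_px_py[OF this] show "px V' z = px V (z + w)" "py V' z = py V (z + w) + 3 * snd m" by simp_all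
  qed
  note sp = smooth_germ_perturb(1)[OF sA, of m] smooth_germ_perturb(2)[OF sB, of m]
  have tg: "tangential_germ A' B' V'"
    unfolding tangential_germ_def
  proof (intro conjI sV')
    show "smooth_germ A' 0" "smooth_germ B' 0" unfolding A'_def B'_def by (rule smooth_germ_shift sp)+
    show "\<forall>\<^sub>F z in nhds 0. py A' z = snd z * V' z"
      using eventually_nhds_shift[OF eventually_py_perturb(1)] eventually_nhds_shift[OF smooth_germ_eventually[OF sp(1)]]
      by eventually_elim (simp add: A'_def[abs_def] px_py_shift V'_def \<tau> algebra_simps)
    show "\<forall>\<^sub>F z in nhds 0. py B' z = V' z + snd z * (px V' z + py V' z)"
      using eventually_nhds_shift[OF eventually_py_perturb(2)] eventually_nhds_shift[OF smooth_germ_eventually[OF sp(2)]]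
        eventually_nhds_shift[OF smooth_germ_eventually[OF sV]]
      by eventually_elim (simp add: B'_def[abs_def] px_py_shift pV' V'_def \<tau> algebra_simps)
  qed
  have p: "px V' 0 = px V w" "py V' 0 = py V w + 3 * snd m" using pV'[of 0] sV by simp_all
  have lr: "left_right_equivalent (graph_form (perturb_A m A) (perturb_B m B)) w (graph_form A' B') 0"
  proof (rule left_right_equivalentI)
    let ?k = "\<lambda>q :: real \<times> real \<times> real. (fst q - fst w, snd q)" and ?k' = "\<lambda>q :: real \<times> real \<times> real. (fst q + fst w, snd q)"
    let ?g = "graph_form (perturb_A m A) (perturb_B m B)"
    show "diffeo_germ (\<lambda>z. z - w) w"
      by (rule diffeo_germI[where h' = "\<lambda>z. z + w"]; (intro smooth_germ_intros)?) simp_all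
    show "diffeo_germ ?k (?g w)"
      by (rule diffeo_germI[where h' = ?k']; (intro smooth_germ_intros)?) simp_all
    show "\<forall>\<^sub>F z in nhds w. ?k (?g z) = graph_form A' B' (z - w)" by (simp add: graph_form_def A'_def B'_def)
  qed simp
  have V'0: "V' 0 = 0"
    using eventually_nhds_x_imp_x[OF eventually_py_perturb(2)] 0 \<tau> by (simp add: V'_def)
  then show "fst m = - V w / 2" by (simp add: V'_def)
  show "px V w = 0 \<or> (\<exists>c\<in>{0, 1/2, 1}. snd m = - (py V w + c * px V w) / 3)"
  proof (rule ccontr)
    assume n: "\<not> ?thesis"
    have p0: "px V w \<noteq> 0" "snd m \<noteq> - py V w / 3" "snd m \<noteq> - (py V w + px V w / 2) / 3" "snd m \<noteq> - (py V w + px V w) / 3"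
      using n by auto
    have "px V w + 2 * (py V w + 3 * snd m) \<noteq> 0" by (rule contrapos_nn[OF p0(3)]) (simp add: field_simps)
    moreover have "py V w + 3 * snd m \<noteq> 0" by (rule contrapos_nn[OF p0(2)]) (simp add: field_simps)
    moreover have "px V w + (py V w + 3 * snd m) \<noteq> 0" by (rule contrapos_nn[OF p0(4)]) (simp add: field_simps)
    ultimately have nz: "px V' 0 + 2 * py V' 0 \<noteq> 0" "px V' 0 \<noteq> 0" "(px V' 0 + py V' 0) * py V' 0 \<noteq> 0"
      unfolding p using p0(1) by simp_all
    have "left_right_equivalent (graph_form (perturb_A m A) (perturb_B m B)) w
        (A1_form (- sgn ((px V' 0 + py V' 0) * py V' 0))) 0"
      by (rule left_right_equivalent_trans[OF lr A1_if[OF tg V'0 nz]])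
    then show False using not_A1[of "- sgn ((px V' 0 + py V' 0) * py V' 0)"] nz(3) by (auto simp: sgn_if split: if_splits)
  qed
qed

end


text \<open>\<open>W\<close> is fixed before \<open>m\<close>, and one \<open>m\<close> serves all
  of \<open>W\<close>, because the base point of a deformed germ is not known in advance. If the
  original is no umbrella, an equivalent germ on the support is none either, so both kinds of
  degenerate points have to be avoided.\<close>

lemma generic_perturbation:
  assumes tg: "tangential_germ A B V" and V0: "V 0 = 0"
    and not_A1: "\<And>\<epsilon>. \<epsilon> = 1 \<or> \<epsilon> = - 1 \<Longrightarrow> \<not> left_right_equivalent (graph_form A B) 0 (A1_form \<epsilon>) 0"
  obtains W where "open W" "0 \<in> W"
    "\<And>r. r > 0 \<Longrightarrow> \<exists>m. m \<noteq> 0 \<and> \<bar>fst m\<bar> < r \<and> \<bar>snd m\<bar> < r \<and>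
      (\<forall>w\<in>W. \<not> left_right_equivalent (graph_form A B) 0 (graph_form (perturb_A m A) (perturb_B m B)) w)"
proof -
  define K where "K z = px V z + py V z" for z
  note s = tangential_germ_smooth(1-3)[OF tg]
  have "\<forall>\<^sub>F w in nhds 0. smooth_germ A w \<and> smooth_germ B w \<and> smooth_germ V w \<and>
      (\<forall>\<^sub>F z in nhds w. py A z = snd z * V z) \<and> (\<forall>\<^sub>F z in nhds w. py B z = V z + snd z * (px V z + py V z))"
    by (intro eventually_conj smooth_germ_eventually s iffD2[OF eventually_eventually] tangential_germ_py[OF tg])
  then obtain W where W: "open W" "0 \<in> W"
    and sm: "\<And>w. w \<in> W \<Longrightarrow> smooth_germ A w" "\<And>w. w \<in> W \<Longrightarrow> smooth_germ B w" "\<And>w. w \<in> W \<Longrightarrow> smooth_germ V w"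
    and ev: "\<And>w. w \<in> W \<Longrightarrow> \<forall>\<^sub>F z in nhds w. py A z = snd z * V z"
      "\<And>w. w \<in> W \<Longrightarrow> \<forall>\<^sub>F z in nhds w. py B z = V z + snd z * (px V z + py V z)"
    unfolding eventually_nhds by blast
  have sK: "smooth_germ K w" if "w \<in> W" for w
    unfolding K_def[abs_def] by (intro smooth_germ_add smooth_germ_px smooth_germ_py sm(3)[OF that])
  have along: "((\<lambda>z. C (fst z, 0)) has_derivative (\<lambda>e. px C (fst z, 0) * fst e)) (at z)"
    if "smooth_germ C (fst z, 0)" for C :: "real \<times> real \<Rightarrow> real" and z
    by (rule has_derivative_compose[where f = fst and g = "\<lambda>x. C (x, 0)",
          OF has_derivative_fst[OF has_derivative_ident] smooth_germ_DERIV_x[OF that, unfolded has_field_derivative_def]])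

  \<comment> \<open>If the perturbed graph has a degenerate singular point, then its parameter \<open>m\<close> is a critical
    value of \<open>M1\<close> (point off the support), of \<open>M2\<close> or of some \<open>M3 c\<close> (point on the support).\<close>
  define M1 where "M1 z = ((snd z * K z - V z) / 2, - K z / 3)" for z
  define M1' where "M1' z e = ((snd z * (fst e * px K z + snd e * py K z) + snd e * K z - (fst e * px V z + snd e * py V z)) / 2,
      - (fst e * px K z + snd e * py K z) / 3)" for z e
  define S1 where "S1 = {z \<in> W. \<exists>e. e \<noteq> 0 \<and> M1' z e = 0}"
  have n1: "negligible {v :: real^2. (v $ 1, v $ 2) \<in> M1 ` S1}"
  proof (rule critical_values_negligible)
    fix z assume "z \<in> S1"
    then have z: "z \<in> W" "\<exists>e. e \<noteq> 0 \<and> M1' z e = 0" unfolding S1_def by blast+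
    show "(M1 has_derivative M1' z) (at z)" unfolding M1_def[abs_def] M1'_def[abs_def]
      by (rule derivative_eq_intros smooth_germ_plane_real[OF sm(3)[OF z(1)]] smooth_germ_plane_real[OF sK[OF z(1)]] numeral_neq_zero refl)+
        (simp add: fun_eq_iff)
    show "\<exists>e. e \<noteq> 0 \<and> M1' z e = 0" by (rule z(2))
  qed

  \<comment> \<open>Points of the support with p = 0. They put no constraint on
    \<open>snd m\<close>, which is therefore the second source coordinate.\<close>
  define M2 where "M2 z = (- V (fst z, 0) / 2, snd z)" for z :: "real \<times> real"
  define S2 where "S2 = {z :: real \<times> real. (fst z, 0) \<in> W \<and> px V (fst z, 0) = 0}"
  have n2: "negligible {v :: real^2. (v $ 1, v $ 2) \<in> M2 ` S2}"
  proof (rule critical_values_negligible[where M' = "\<lambda>z e. (- (px V (fst z, 0) * fst e) / 2, snd e)"])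
    fix z assume z: "z \<in> S2"
    then have sz: "smooth_germ V (fst z, 0)" unfolding S2_def using sm(3) by blast
    show "(M2 has_derivative (\<lambda>e. (- (px V (fst z, 0) * fst e) / 2, snd e))) (at z)"
      unfolding M2_def[abs_def]
      by (rule derivative_eq_intros along[OF sz] numeral_neq_zero refl)+ simp
    show "\<exists>e. e \<noteq> 0 \<and> (- (px V (fst z, 0) * fst e) / 2, snd e) = 0"
      by (rule exI[of _ "(1, 0)"]) (use z in \<open>simp add: S2_def prod_eq_iff\<close>)
  qed

  \<comment> \<open>Here the parameter depends on the abscissa alone; the map ignores its second
    argument and is singular everywhere.\<close>
  define M3 where "M3 c z = (- V (fst z, 0) / 2, - (py V (fst z, 0) + c * px V (fst z, 0)) / 3)" for c :: real and z :: "real \<times> real"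
  define S3 where "S3 = {z :: real \<times> real. (fst z, 0) \<in> W}"
  have n3: "negligible {v :: real^2. (v $ 1, v $ 2) \<in> M3 c ` S3}" for c
  proof (rule critical_values_negligible[where M' = "\<lambda>z e. (- (px V (fst z, 0) * fst e) / 2,
      - (px (py V) (fst z, 0) * fst e + c * (px (px V) (fst z, 0) * fst e)) / 3)"])
    fix z assume z: "z \<in> S3"
    then have sz: "smooth_germ V (fst z, 0)" unfolding S3_def using sm(3) by blast
    show "(M3 c has_derivative (\<lambda>e. (- (px V (fst z, 0) * fst e) / 2,
      - (px (py V) (fst z, 0) * fst e + c * (px (px V) (fst z, 0) * fst e)) / 3))) (at z)"
      unfolding M3_def[abs_def]
      by (rule derivative_eq_intros along[OF sz] along[OF smooth_germ_px[OF sz]] along[OF smooth_germ_py[OF sz]] numeral_neq_zero refl)+ simp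
    show "\<exists>e :: real \<times> real. e \<noteq> 0 \<and> (- (px V (fst z, 0) * fst e) / 2,
      - (px (py V) (fst z, 0) * fst e + c * (px (px V) (fst z, 0) * fst e)) / 3) = 0"
      by (rule exI[of _ "(0, 1)"]) (simp add: prod_eq_iff)
  qed

  show ?thesis
  proof (rule that[OF W])
    fix r :: real assume r: "r > 0"
    let ?bad = "{v :: real^2. (v $ 1, v $ 2) \<in> M1 ` S1} \<union> ({v. (v $ 1, v $ 2) \<in> M2 ` S2} \<union> ({v. (v $ 1, v $ 2) \<in> M3 0 ` S3} \<union>
        ({v. (v $ 1, v $ 2) \<in> M3 (1/2) ` S3} \<union> {v. (v $ 1, v $ 2) \<in> M3 1 ` S3})))"
    have bad: "negligible ?bad" by (intro negligible_Un n1 n2 n3)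
    define D where "D = ball (0 :: real^2) r - {0}"
    have "open D" unfolding D_def by (intro open_Diff open_ball closed_singleton)
    moreover have "D \<noteq> {}"
    proof -
      have "axis 1 (r / 2) \<in> D" using r by (simp add: D_def axis_eq_0_iff norm_eq_sqrt_inner inner_axis_axis real_sqrt_divide)
      then show ?thesis by blast
    qed
    ultimately have "\<not> negligible D" by (rule open_not_negligible)
    then have "\<not> D \<subseteq> ?bad" using bad negligible_subset by blast
    then obtain v where v: "v \<in> D" "v \<notin> ?bad" by blast
    define m where "m = (v $ 1, v $ 2)"
    have m: "m \<noteq> 0" "\<bar>fst m\<bar> < r" "\<bar>snd m\<bar> < r"
      using v(1) component_le_norm_cart[of v 1] component_le_norm_cart[of v 2]
      by (auto simp: D_def m_def vec_eq_iff forall_2 prod_eq_iff)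
    have good: "m \<notin> M1 ` S1" "m \<notin> M2 ` S2" "\<And>c. c \<in> {0, 1/2, 1} \<Longrightarrow> m \<notin> M3 c ` S3"
      using v(2) unfolding m_def by blast+
    have "False" if w: "w \<in> W" and lr: "left_right_equivalent (graph_form A B) 0 (graph_form (perturb_A m A) (perturb_B m B)) w" for w
    proof -
      note sp = smooth_germ_perturb(1)[OF sm(1)[OF w], of m] smooth_germ_perturb(2)[OF sm(2)[OF w], of m]
      note deg = degenerate_kernel[OF tg V0 sp lr]
      show False
      proof (cases "snd w = 0")
        case False
        note off = degenerate_off_support[OF sm(1,2,3)[OF w] ev[OF w] False deg, folded K_def]
        obtain e where e: "e \<noteq> 0" "fst e * px V w + snd e * py V w = snd e * K w" "fst e * px K w + snd e * py K w = 0"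
          using off(2) unfolding K_def[abs_def] by blast
        have "M1' w e = 0" unfolding M1'_def e(2,3) by (simp add: prod_eq_iff)
        then have "w \<in> S1" unfolding S1_def using w e(1) by blast
        moreover have "m = M1 w" unfolding M1_def by (rule off(1))
        ultimately show False using good(1) by blast
      next
        case True
        then have w0: "(fst w, 0) = w" by (simp add: prod_eq_iff)
        have nA: "\<not> left_right_equivalent (graph_form (perturb_A m A) (perturb_B m B)) w (A1_form \<epsilon>) 0" if "\<epsilon> = 1 \<or> \<epsilon> = - 1" for \<epsilon>
          using not_A1[OF that] left_right_equivalent_trans[OF lr] by blast
        note on = degenerate_on_support[OF sm(1,2,3)[OF w] ev[OF w] True deg(2) nA]
        have wS: "(fst w, t) \<in> S3" for t using w w0 unfolding S3_def by simp
        from on(2) show False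
        proof
          assume "px V w = 0"
          then have "(fst w, snd m) \<in> S2" using w w0 unfolding S2_def by simp
          moreover have "m = M2 (fst w, snd m)" using on(1) by (simp add: M2_def w0 prod_eq_iff[of m])
          ultimately show False using good(2) by blast
        next
          assume "\<exists>c\<in>{0, 1/2, 1}. snd m = - (py V w + c * px V w) / 3"
          then obtain c where c: "c \<in> {0, 1/2, 1}" "snd m = - (py V w + c * px V w) / 3" by (rule bexE)
          have "m = M3 c (fst w, 0)" using on(1) c(2) by (simp add: M3_def w0 prod_eq_iff[of m])
          then show False using good(3)[OF c(1)] wS by blast
        qed
      qed
    qed
    with m show "\<exists>m. m \<noteq> 0 \<and> \<bar>fst m\<bar> < r \<and> \<bar>snd m\<bar> < r \<and>
      (\<forall>w\<in>W. \<not> left_right_equivalent (graph_form A B) 0 (graph_form (perturb_A m A) (perturb_B m B)) w)" by blast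
  qed
qed

section \<open>Instability of the other singular graphs\<close>

lemma Ck_on_of_smooth_germ:
  assumes "\<And>z. smooth_germ g z" shows "Ck_on k g UNIV"
  using assms
proof (induction k arbitrary: g)
  case 0
  then show ?case by (auto intro!: continuous_at_imp_continuous_on smooth_germ_isCont)
next
  case (Suc k)
  have "g differentiable at x" for x using smooth_germ_derivative[OF Suc.prems] unfolding differentiable_def by blast
  moreover have "Ck_on k (\<lambda>x. frechet_derivative g (at x) v) UNIV" for v
    by (rule Suc.IH[OF smooth_germ_frechet[OF Suc.prems]])
  ultimately show ?case by simp
qed

text \<open>Each partial derivative of the composite is a derivative of \<open>G\<close> in the
  constant direction \<open>d i\<close>, again composed with \<open>e\<close>. The induction
  therefore never leaves functions of this shape.\<close>

lemma smooth_Euclidean_affine: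
  fixes G :: "'a::real_normed_vector \<Rightarrow> 'b::real_normed_vector"
  assumes G: "\<And>k. Ck_on k G UNIV" and e: "continuous_map (Euclidean_space n) euclidean e"
    and upd: "\<And>i x s. i < n \<Longrightarrow> e (x(i := s)) = e x + (s - x i) *\<^sub>R d i"
  shows "smooth_Euclidean n (\<lambda>y. G (e y))"
proof -
  have "Ck_on k G UNIV \<Longrightarrow> Ck_Euclidean n k (\<lambda>y. G (e y))" for k and G :: "'a \<Rightarrow> 'b"
  proof (induction k arbitrary: G)
    case 0
    then have "continuous_map euclidean euclidean G" by simp
    from continuous_map_compose[OF e this] show ?case by (simp add: o_def)
  next
    case (Suc k)
    have D: "((\<lambda>s. G (e (x(i := s)))) has_vector_derivative frechet_derivative G (at (e x)) (d i)) (at (x i))"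
      if "i < n" for i x
    proof -
      have G': "(G has_derivative frechet_derivative G (at (e x))) (at (e x))"
        using Suc.prems by (simp add: frechet_derivative_works[symmetric])
      have "((\<lambda>s. e x + (s - x i) *\<^sub>R d i) has_derivative (\<lambda>h. h *\<^sub>R d i)) (at (x i))"
        by (auto intro!: derivative_eq_intros)
      from has_derivative_compose[OF this, of G] G'
      have "((\<lambda>s. G (e x + (s - x i) *\<^sub>R d i)) has_derivative (\<lambda>h. frechet_derivative G (at (e x)) (h *\<^sub>R d i))) (at (x i))"
        by simp
      then show ?thesis
        unfolding has_vector_derivative_def upd[OF that] linear_cmul[OF has_derivative_linear[OF G']] .
    qed
    have "partial_deriv i (\<lambda>y. G (e y)) = (\<lambda>y. frechet_derivative G (at (e y)) (d i))" if "i < n" for i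
      unfolding partial_deriv_def by (rule ext) (rule vector_derivative_at[OF D[OF that]])
    moreover have "Ck_Euclidean n k (\<lambda>y. frechet_derivative G (at (e y)) (d i))" for i
      using Suc.IH[of "\<lambda>w. frechet_derivative G (at w) (d i)"] Suc.prems by simp
    moreover have "(\<lambda>s. G (e (x(i := s)))) differentiable (at (x i))" if "i < n" for i x
      by (rule differentiableI_vector[OF D[OF that]])
    ultimately show ?case unfolding Ck_Euclidean.simps by (intro allI impI conjI ballI) simp_all
  qed
  then show ?thesis unfolding smooth_Euclidean_def using G by blast
qed

section \<open>The perturbation as a deformation of the whole family\<close>

definition support_height :: "(plane \<Rightarrow> plane) \<Rightarrow> plane \<Rightarrow> real" where
  "support_height f z = fst (f z) - fst (f (fst z, 0))"

text \<open>\<open>support_height\<close> is the coordinate \<tau>, but defined on the whole plane.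
  The members are thus globally tangential families, whereas the adapted coordinates exist only
  locally. The first component of \<open>f\<close> is left unchanged.\<close>

definition cubic_deformation :: "(plane \<Rightarrow> plane) \<Rightarrow> real \<times> real \<Rightarrow> plane \<Rightarrow> plane" where
  "cubic_deformation f m z = f z + (0, fst m * support_height f z ^ 2 + snd m * support_height f z ^ 3)"

context
  fixes f :: "plane \<Rightarrow> plane"
  assumes tf: "tangential_family f"
begin

lemma smooth_germ_support_height: "smooth_germ (support_height f) z"
proof -
  note sm = tangential_family_smooth[OF tf]
  have "smooth_germ (\<lambda>z. f (fst z, 0)) z"
    by (rule smooth_germ_compose[where f = "\<lambda>z. (fst z, 0)", OF sm])
      (intro smooth_germ_Pair smooth_germ_coordinates smooth_germ_const)
  then show ?thesis unfolding support_height_def[abs_def] by (intro smooth_germ_diff smooth_germ_fst sm)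
qed

lemma support_height_axis [simp]: "support_height f (\<xi>, 0) = 0"
  by (simp add: support_height_def)

lemma py_support_height: "py (support_height f) z = fst (d_t f z)"
proof -
  note sm = tangential_family_smooth[OF tf]
  have 1: "smooth_germ (\<lambda>s. fst (f (s, 0))) x" for x
    by (rule smooth_germ_fst[OF smooth_germ_graph[where F = f and \<theta> = "\<lambda>_. 0", OF sm smooth_germ_const]])
  have 2: "smooth_germ (\<lambda>z. fst (f (fst z, 0))) z"
    by (rule smooth_germ_of_fst[where \<theta> = "\<lambda>s. fst (f (s, 0))", OF 1])
  show ?thesis
    unfolding support_height_def[abs_def] px_py_diff(2)[OF smooth_germ_fst[OF sm] 2]
      px_py_of_fst[where \<theta> = "\<lambda>s. fst (f (s, 0))", OF 1] px_py_fst_snd(2)[OF sm] d_t_eq_py[OF sm] by simp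
qed

lemma smooth_germ_cubic_deformation: "smooth_germ (cubic_deformation f m) z"
  unfolding cubic_deformation_def[abs_def]
  by (intro smooth_germ_add smooth_germ_Pair smooth_germ_mult smooth_germ_power smooth_germ_const
      smooth_germ_support_height tangential_family_smooth[OF tf])

lemma cubic_deformation_derivatives:
  defines "c \<equiv> \<lambda>m z. 2 * fst m * support_height f z + 3 * snd m * support_height f z ^ 2"
  shows "d_t (cubic_deformation f m) z = d_t f z + (0, c m z * fst (d_t f z))"
    and "d_xi (cubic_deformation f m) z = d_xi f z + (0, c m z * px (support_height f) z)"
proof -
  note sm = tangential_family_smooth[OF tf] and sh = smooth_germ_support_height
  have "(cubic_deformation f m has_derivative (\<lambda>v. (fst v *\<^sub>R px f z + snd v *\<^sub>R py f z) +
      (0, c m z * (fst v * px (support_height f) z + snd v * py (support_height f) z)))) (at z)"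
    unfolding cubic_deformation_def[abs_def] c_def
    by (rule derivative_eq_intros smooth_germ_plane[OF sm] smooth_germ_plane_real[OF sh] refl)+
      (simp add: fun_eq_iff algebra_simps power2_eq_square)
  from has_derivative_px_py[OF this]
  show "d_t (cubic_deformation f m) z = d_t f z + (0, c m z * fst (d_t f z))"
    "d_xi (cubic_deformation f m) z = d_xi f z + (0, c m z * px (support_height f) z)"
    unfolding d_t_eq_py[OF smooth_germ_cubic_deformation] d_xi_eq_px[OF smooth_germ_cubic_deformation]
    by (simp_all add: d_t_eq_py[OF sm, symmetric] d_xi_eq_px[OF sm] py_support_height)
qed

text \<open>The added term has a double zero on the support, so the support and the tangents there
  are those of \<open>f\<close>. Where the first component of the t-derivative vanishes, the second
  is unchanged, so the curves stay immersed.\<close>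

lemma tangential_family_cubic_deformation: "tangential_family (cubic_deformation f m)"
proof -
  have 0: "cubic_deformation f m (\<xi>, 0) = f (\<xi>, 0)" "d_t (cubic_deformation f m) (\<xi>, 0) = d_t f (\<xi>, 0)"
    "d_xi (cubic_deformation f m) (\<xi>, 0) = d_xi f (\<xi>, 0)" for \<xi>
    by (simp_all add: cubic_deformation_derivatives cubic_deformation_def zero_in_plane)
  have "d_t (cubic_deformation f m) z \<noteq> 0" for z
  proof
    assume d: "d_t (cubic_deformation f m) z = 0"
    then have "fst (d_t f z) = 0" unfolding cubic_deformation_derivatives by (simp add: prod_eq_iff)
    with d have "d_t f z = 0" unfolding cubic_deformation_derivatives by (simp add: zero_in_plane)
    then show False using tf unfolding tangential_family_def by blast
  qed
  moreover have "smooth_on (cubic_deformation f m) UNIV"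
    unfolding smooth_on_def using Ck_on_of_smooth_germ[OF smooth_germ_cubic_deformation] by blast
  ultimately show ?thesis using tf unfolding tangential_family_def 0 by blast
qed

lemma tangential_deformation_cubic:
  "tangential_deformation 2 (\<lambda>z \<mu>. cubic_deformation f (\<mu> 0, \<mu> 1) z) f"
  unfolding tangential_deformation_def
proof (intro conjI ballI)
  \<comment> \<open>Coordinates 0 and 1 are the source point, 2 and 3 the parameters of the
    deformation.\<close>
  let ?e = "\<lambda>y :: nat \<Rightarrow> real. ((y 0, y 1), (y 2, y 3))"
  let ?G = "\<lambda>w :: plane \<times> plane. cubic_deformation f (snd w) (fst w)"
  have "smooth_germ ?G w" for w
    unfolding cubic_deformation_def
    by (intro smooth_germ_add smooth_germ_Pair smooth_germ_mult smooth_germ_power smooth_germ_const smooth_germ_fst smooth_germ_snd smooth_germ_id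
      smooth_germ_compose[where g = f and f = fst] smooth_germ_compose[where g = "support_height f" and f = fst]
      smooth_germ_support_height tangential_family_smooth[OF tf] smooth_germ_fst[OF smooth_germ_id, simplified])
  then have 1: "Ck_on k ?G UNIV" for k by (rule Ck_on_of_smooth_germ)
  have proj: "continuous_map (Euclidean_space 4) euclideanreal (\<lambda>y. y i)" for i
    unfolding Euclidean_space_def by (intro continuous_map_from_subtopology continuous_map_product_projection) simp
  have 2: "continuous_map (Euclidean_space 4) euclidean ?e"
    using continuous_map_pairedI[OF continuous_map_pairedI[OF proj[of 0] proj[of 1]] continuous_map_pairedI[OF proj[of 2] proj[of 3]]]
    by simp
  have 3: "?e (x(i := s)) = ?e x + (s - x i) *\<^sub>R ?e (\<lambda>j. if j = i then 1 else 0)" for i x s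
    by (auto simp: fun_upd_def)
  have "smooth_Euclidean 4 (\<lambda>y. ?G (?e y))" by (rule smooth_Euclidean_affine[OF 1 2 3])
  then show "smooth_Euclidean (2 + 2) (\<lambda>y. cubic_deformation f (y (2 + 0), y (2 + 1)) (y 0, y 1))"
    by (simp add: numeral_eq_Suc)
  show "tangential_family (\<lambda>z. cubic_deformation f (\<mu> 0, \<mu> 1) z)" for \<mu> :: "nat \<Rightarrow> real"
    by (rule tangential_family_cubic_deformation)
  show "\<forall>\<^sub>F z in nhds (0, 0). cubic_deformation f (0, 0) z = f z"
    by (simp add: cubic_deformation_def zero_in_plane)
qed

end

lemma diffeo_germ_eventually: "diffeo_germ h a \<Longrightarrow> \<forall>\<^sub>F z in nhds a. diffeo_germ h z"
  unfolding diffeo_germ_def eventually_nhds by blast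

text \<open>Adapted coordinates involve the first component of the family only, which the
  deformation keeps. One source change therefore works for every \<open>m\<close> and every base
  point \<open>a\<close> near the origin, also off the support.\<close>

lemma cubic_deformation_local_model:
  assumes tf: "tangential_family f" and \<Phi>: "diffeo_germ (adapted_coordinates f 0) a"
    and e: "\<forall>\<^sub>F z in nhds a. fst (d_t f z) \<noteq> 0"
      "\<forall>\<^sub>F z in nhds a. snd (f z) = A (adapted_coordinates f 0 z) \<and> slope f z = B (adapted_coordinates f 0 z)"
  shows "left_right_equivalent (graph_chart (cubic_deformation f m)) a
    (graph_form (perturb_A m A) (perturb_B m B)) (adapted_coordinates f 0 a)"
proof (rule left_right_equivalentI[OF \<Phi> refl])
  let ?g = "graph_chart (cubic_deformation f m)"
  let ?k = "\<lambda>q :: real \<times> real \<times> real. (fst q - fst (f (0, 0)), snd q)"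
  let ?k' = "\<lambda>q :: real \<times> real \<times> real. (fst q + fst (f (0, 0)), snd q)"
  show "diffeo_germ ?k (?g a)"
    by (rule diffeo_germI[where h' = ?k']; (intro smooth_germ_intros)?) simp_all
  show "\<forall>\<^sub>F z in nhds a. ?k (?g z) = graph_form (perturb_A m A) (perturb_B m B) (adapted_coordinates f 0 z)"
    using e
  proof eventually_elim
    case (elim z)
    have s: "snd (adapted_coordinates f 0 z) = support_height f z" "fst (adapted_coordinates f 0 z) = fst (f z) - fst (f (0, 0))"
      by (simp_all add: adapted_coordinates_def support_height_def)
    have "slope (cubic_deformation f m) z = slope f z + (2 * fst m * support_height f z + 3 * snd m * support_height f z ^ 2)"
      using elim(1) by (simp add: slope_def cubic_deformation_derivatives[OF tf] add_divide_distrib)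
    then show ?case
      using elim(2) by (simp add: graph_chart_def graph_form_def perturb_A_def perturb_B_def s cubic_deformation_def)
  qed
qed


definition plane_params :: "real \<times> real \<Rightarrow> nat \<Rightarrow> real" where
  "plane_params m i = (if i = 0 then fst m else if i = 1 then snd m else 0)"

lemma continuous_map_plane_params: "continuous_map euclidean (Euclidean_space 2) plane_params"
proof -
  have "continuous_map euclidean euclideanreal (\<lambda>m. plane_params m i)" for i
    unfolding plane_params_def by (cases "i = 0"; cases "i = 1") (auto intro!: continuous_intros)
  then show ?thesis
    unfolding Euclidean_space_def continuous_map_in_subtopology continuous_map_componentwise_UNIV
    by (auto simp: plane_params_def)
qed

lemma plane_params_small:
  assumes "openin (Euclidean_space 2) N" "(\<lambda>_. 0) \<in> N"
  obtains r where "r > 0" "\<And>m. \<bar>fst m\<bar> < r \<Longrightarrow> \<bar>snd m\<bar> < r \<Longrightarrow> plane_params m \<in> N"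
proof -
  have "openin euclidean {m \<in> topspace euclidean. plane_params m \<in> N}"
    by (rule openin_continuous_map_preimage[OF continuous_map_plane_params assms(1)])
  then have "open {m. plane_params m \<in> N}" by simp
  moreover have "plane_params 0 = (\<lambda>_. 0)" by (simp add: plane_params_def fun_eq_iff)
  then have "0 \<in> {m. plane_params m \<in> N}" using assms(2) by simp
  ultimately obtain e where e: "e > 0" "ball 0 e \<subseteq> {m. plane_params m \<in> N}" by (rule openE) blast
  show ?thesis
  proof (rule that[of "e / 2"])
    fix m :: "real \<times> real" assume "\<bar>fst m\<bar> < e / 2" "\<bar>snd m\<bar> < e / 2"
    then have "norm m < e" using norm_Pair_le[of "fst m" "snd m"] by simp
    then show "plane_params m \<in> N" using e(2) by (auto simp del: split_paired_All)
  qed (use e(1) in simp)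
qed

text \<open>By contradiction: stability applied to the cubic deformation provides equivalent germs
  at points that approach the origin and so enter \<open>W\<close> for small parameters. A generic
  small \<open>m\<close> has no equivalent germ anywhere in \<open>W\<close>.\<close>

lemma stable_imp_A1:
  assumes tf: "tangential_family f" and nz: "fst (d_t f (0, 0)) \<noteq> 0" and st: "stable_graph_germ f"
    and b: "graph_bracket f (0, 0) = 0"
  obtains \<epsilon> where "\<epsilon> = 1 \<or> \<epsilon> = - 1" "left_right_equivalent (graph_chart f) (0, 0) (A1_form \<epsilon>) 0"
proof (rule ccontr)
  assume "\<not> thesis"
  then have not_A1: "\<not> left_right_equivalent (graph_chart f) (0, 0) (A1_form \<epsilon>) 0" if "\<epsilon> = 1 \<or> \<epsilon> = - 1" for \<epsilon>
    using \<open>\<And>\<epsilon>. \<epsilon> = 1 \<or> \<epsilon> = - 1 \<Longrightarrow> left_right_equivalent (graph_chart f) (0, 0) (A1_form \<epsilon>) 0 \<Longrightarrow> thesis\<close> that by blast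
  note sm = tangential_family_smooth[OF tf]
  let ?\<Phi> = "adapted_coordinates f 0" and ?E = "Euclidean_space 2" and ?o = "\<lambda>_ :: nat. 0 :: real"
  obtain A B V where lm: "diffeo_germ ?\<Phi> (0, 0)" "tangential_germ A B V"
    "\<forall>\<^sub>F z in nhds (0, 0). snd (f z) = A (?\<Phi> z) \<and> slope f z = B (?\<Phi> z)"
    using tf nz by (rule local_model) blast
  note scg = smooth_germ_graph_chart[OF sm nz]
  have lr: "left_right_equivalent (graph_chart f) (0, 0) (graph_form A B) 0"
    by (rule graph_chart_local_model[OF lm(1,3)])
  have lr': "left_right_equivalent (graph_form A B) 0 (graph_chart f) (0, 0)"
    by (rule left_right_equivalent_sym[OF lr smooth_germ_isCont[OF scg]])
  have V0: "V 0 = 0"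
  proof -
    obtain v where v: "v \<noteq> 0" "frechet_derivative (graph_chart f) (at (0, 0)) v = 0"
      using support_point_classification(3)[OF tf nz] b by blast
    obtain w where w: "w \<noteq> 0" "frechet_derivative (graph_form A B) (at 0) w = 0"
      by (rule kernel_transfer[OF lr scg tangential_germ_smooth(4)[OF lm(2)] v])
    from w(1) w(2)[unfolded graph_form_kernel_iff[OF lm(2)]] show ?thesis by (auto simp: prod_eq_iff)
  qed
  have nA: "\<not> left_right_equivalent (graph_form A B) 0 (A1_form \<epsilon>) 0" if "\<epsilon> = 1 \<or> \<epsilon> = - 1" for \<epsilon>
    using not_A1[OF that] left_right_equivalent_trans[OF lr] by blast
  obtain W where W: "open W" "0 \<in> W"
    "\<And>r. r > 0 \<Longrightarrow> \<exists>m. m \<noteq> 0 \<and> \<bar>fst m\<bar> < r \<and> \<bar>snd m\<bar> < r \<and>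
      (\<forall>w\<in>W. \<not> left_right_equivalent (graph_form A B) 0 (graph_form (perturb_A m A) (perturb_B m B)) w)"
    by (rule generic_perturbation[OF lm(2) V0 nA]) (assumption, rule that)
  have "(?\<Phi> \<longlongrightarrow> 0) (nhds (0, 0))"
    using tendsto_nhds_smooth_germ[OF diffeo_germ_smooth[OF lm(1)]] by (simp add: adapted_coordinates_def zero_in_plane)
  then have "\<forall>\<^sub>F z in nhds (0, 0). ?\<Phi> z \<in> W" using W(1,2) by (rule topological_tendstoD)
  then have "\<forall>\<^sub>F a in nhds (0, 0). diffeo_germ ?\<Phi> a \<and> ?\<Phi> a \<in> W \<and> (\<forall>\<^sub>F z in nhds a. fst (d_t f z) \<noteq> 0) \<and>
      (\<forall>\<^sub>F z in nhds a. snd (f z) = A (?\<Phi> z) \<and> slope f z = B (?\<Phi> z))"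
    by (intro eventually_conj diffeo_germ_eventually lm(1) iffD2[OF eventually_eventually] lm(3) eventually_d_t_nonzero[OF sm nz])
  then obtain U where U: "open U" "(0, 0) \<in> U" and Q: "\<And>a. a \<in> U \<Longrightarrow> diffeo_germ ?\<Phi> a" "\<And>a. a \<in> U \<Longrightarrow> ?\<Phi> a \<in> W"
      "\<And>a. a \<in> U \<Longrightarrow> \<forall>\<^sub>F z in nhds a. fst (d_t f z) \<noteq> 0"
      "\<And>a. a \<in> U \<Longrightarrow> \<forall>\<^sub>F z in nhds a. snd (f z) = A (?\<Phi> z) \<and> slope f z = B (?\<Phi> z)"
    unfolding eventually_nhds by blast
  obtain q where q: "(q \<longlongrightarrow> (0, 0)) (atin ?E ?o)"
    "\<forall>\<^sub>F \<mu> in nhdsin ?E ?o. graph_germs_diffeomorphic f (0, 0) (cubic_deformation f (\<mu> 0, \<mu> 1)) (q \<mu>)"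
    using st[unfolded stable_graph_germ_def, rule_format, OF tangential_deformation_cubic[OF tf]] by blast
  have oE: "?o \<in> topspace ?E" by (simp add: topspace_Euclidean_space)
  have "\<forall>\<^sub>F \<mu> in atin ?E ?o. q \<mu> \<in> U" using q(1) U by (rule topological_tendstoD)
  then obtain N1 where N1: "openin ?E N1" "?o \<in> N1" "\<And>\<mu>. \<mu> \<in> N1 \<Longrightarrow> \<mu> \<noteq> ?o \<Longrightarrow> q \<mu> \<in> U"
    unfolding eventually_atin using oE by blast
  obtain N2 where N2: "openin ?E N2" "?o \<in> N2"
    "\<And>\<mu>. \<mu> \<in> N2 \<Longrightarrow> graph_germs_diffeomorphic f (0, 0) (cubic_deformation f (\<mu> 0, \<mu> 1)) (q \<mu>)"
    using q(2) oE unfolding eventually_nhdsin by blast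
  have "openin ?E (N1 \<inter> N2)" "?o \<in> N1 \<inter> N2" using N1(1,2) N2(1,2) by auto
  then obtain r where r: "r > 0" "\<And>m. \<bar>fst m\<bar> < r \<Longrightarrow> \<bar>snd m\<bar> < r \<Longrightarrow> plane_params m \<in> N1 \<inter> N2"
    by (rule plane_params_small) blast
  from W(3)[OF r(1)] obtain m where m: "m \<noteq> 0" "\<bar>fst m\<bar> < r" "\<bar>snd m\<bar> < r"
    "\<And>w. w \<in> W \<Longrightarrow> \<not> left_right_equivalent (graph_form A B) 0 (graph_form (perturb_A m A) (perturb_B m B)) w" by blast
  define F where "F = cubic_deformation f m"
  define a where "a = q (plane_params m)"
  have pm: "plane_params m 0 = fst m" "plane_params m 1 = snd m" by (simp_all add: plane_params_def)
  \<comment> \<open>The limit of \<open>q\<close> is taken over \<open>atin\<close>, which says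
    nothing about its value at the parameter 0.\<close>
  have "plane_params m \<noteq> ?o"
  proof
    assume "plane_params m = ?o"
    then have "fst m = 0" "snd m = 0" using pm by simp_all
    then show False using m(1) by (simp add: prod_eq_iff)
  qed
  then have aU: "a \<in> U" unfolding a_def using N1(3) r(2)[OF m(2,3)] by blast
  have "graph_germs_diffeomorphic f (0, 0) F a"
    using N2(3)[of "plane_params m"] r(2)[OF m(2,3)] unfolding F_def a_def pm by simp
  then obtain g g' where g: "coordinate_expression (legendrian_graph f) (0, 0) g"
    "coordinate_expression (legendrian_graph F) a g'" "left_right_equivalent g (0, 0) g' a"
    unfolding graph_germs_diffeomorphic_def by blast
  have nzF: "fst (d_t F a) \<noteq> 0"
    using eventually_nhds_x_imp_x[OF Q(3)[OF aU]] by (simp add: F_def cubic_deformation_derivatives[OF tf])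
  note u = coordinate_expression_unique[OF sm nz g(1)]
  note u' = coordinate_expression_unique[OF tangential_family_smooth[OF tangential_family_cubic_deformation[OF tf]] nzF[unfolded F_def] g(2)[unfolded F_def], folded F_def]
  have "left_right_equivalent (graph_form A B) 0 g (0, 0)"
    by (rule left_right_equivalent_trans[OF lr' left_right_equivalent_sym[OF u(2) smooth_germ_isCont[OF u(1)]]])
  then have "left_right_equivalent (graph_form A B) 0 (graph_chart F) a"
    by (rule left_right_equivalent_trans[OF left_right_equivalent_trans[OF _ g(3)] u'(2)])
  moreover have "left_right_equivalent (graph_chart F) a (graph_form (perturb_A m A) (perturb_B m B)) (?\<Phi> a)"
    unfolding F_def by (rule cubic_deformation_local_model[OF tf Q(1,3,4)[OF aU]])
  ultimately have "left_right_equivalent (graph_form A B) 0 (graph_form (perturb_A m A) (perturb_B m B)) (?\<Phi> a)"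
    by (rule left_right_equivalent_trans)
  then show False using m(4)[OF Q(2)[OF aU]] by blast
qed

section \<open>Exchanging the coordinates of the plane\<close>

text \<open>Updating an index below \<open>n\<close> stays inside
  \<open>topspace (Euclidean_space n)\<close>; functions that agree there have the same partial
  derivatives there.\<close>

lemma Ck_Euclidean_cong:
  assumes "\<And>x. x \<in> topspace (Euclidean_space n) \<Longrightarrow> g x = h x" "Ck_Euclidean n k g"
  shows "Ck_Euclidean n k h"
  using assms
proof (induction k arbitrary: g h)
  case 0
  then show ?case using continuous_map_eq[of "Euclidean_space n" euclidean g h] by simp
next
  case (Suc k)
  have e: "(\<lambda>s. g (x(i := s))) = (\<lambda>s. h (x(i := s)))" if "x \<in> topspace (Euclidean_space n)" "i < n" for x i
  proof (rule ext, rule Suc.prems(1))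
    show "x(i := s) \<in> topspace (Euclidean_space n)" for s using that by (simp add: topspace_Euclidean_space)
  qed
  have "partial_deriv i g x = partial_deriv i h x" if "x \<in> topspace (Euclidean_space n)" "i < n" for x i
    unfolding partial_deriv_def e[OF that] ..
  then have "Ck_Euclidean n k (partial_deriv i h)" if "i < n" for i
    using Suc.IH[of "partial_deriv i g" "partial_deriv i h"] Suc.prems(2) that by simp
  moreover have "(\<lambda>s. h (x(i := s))) differentiable (at (x i))" if "i < n" "x \<in> topspace (Euclidean_space n)" for i x
    using Suc.prems(2) that unfolding Ck_Euclidean.simps e[OF that(2,1), symmetric] by blast
  ultimately show ?case by simp
qed

lemma Ck_Euclidean_linear:
  fixes g :: "(nat \<Rightarrow> real) \<Rightarrow> 'b::real_normed_vector" and L :: "'b \<Rightarrow> 'c::real_normed_vector"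
  assumes L: "bounded_linear L"
  shows "Ck_Euclidean n k g \<Longrightarrow> Ck_Euclidean n k (\<lambda>x. L (g x))"
proof (induction k arbitrary: g)
  case 0
  have "continuous_map euclidean euclidean L" using linear_continuous_on[OF L, of UNIV] by simp
  then show ?case using continuous_map_compose[of "Euclidean_space n" euclidean g euclidean L] 0 by (simp add: o_def)
next
  case (Suc k)
  have d: "((\<lambda>s. L (g (x(i := s)))) has_vector_derivative L (partial_deriv i g x)) (at (x i))"
    if "i < n" "x \<in> topspace (Euclidean_space n)" for i x
  proof (rule bounded_linear.has_vector_derivative[OF L])
    have "(\<lambda>s. g (x(i := s))) differentiable (at (x i))" using Suc.prems that unfolding Ck_Euclidean.simps by blast
    then show "((\<lambda>s. g (x(i := s))) has_vector_derivative partial_deriv i g x) (at (x i))"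
      unfolding partial_deriv_def by (rule vector_derivative_works[THEN iffD1])
  qed
  have "Ck_Euclidean n k (partial_deriv i (\<lambda>x. L (g x)))" if i: "i < n" for i
  proof (rule Ck_Euclidean_cong)
    show "Ck_Euclidean n k (\<lambda>x. L (partial_deriv i g x))" using Suc.IH Suc.prems i by simp
    show "L (partial_deriv i g x) = partial_deriv i (\<lambda>x. L (g x)) x" if "x \<in> topspace (Euclidean_space n)" for x
      unfolding partial_deriv_def[of i "\<lambda>x. L (g x)"] by (rule vector_derivative_at[OF d[OF i that], symmetric])
  qed
  then show ?case unfolding Ck_Euclidean.simps using differentiableI_vector[OF d] by blast
qed

text \<open>The exchange of the plane's coordinates in charts: the fibre coordinate is kept, since
  the exchange turns each of the two affine charts into the other.\<close>

definition swap3 :: "real \<times> real \<times> real \<Rightarrow> real \<times> real \<times> real" where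
  "swap3 w = (fst (snd w), fst w, snd (snd w))"

lemma swap3_swap3 [simp]: "swap3 (swap3 w) = w"
  by (simp add: swap3_def)

lemma bounded_linear_swap3: "bounded_linear swap3"
  unfolding swap3_def[abs_def]
  by (intro bounded_linear_Pair bounded_linear_compose[OF bounded_linear_fst] bounded_linear_compose[OF bounded_linear_snd]
    bounded_linear_fst bounded_linear_snd)

lemma bounded_linear_swap: "bounded_linear (prod.swap :: plane \<Rightarrow> plane)"
  unfolding prod.swap_def[abs_def] by (intro bounded_linear_Pair bounded_linear_fst bounded_linear_snd)

lemma diffeo_germ_swap3: "diffeo_germ swap3 w"
  by (rule diffeo_germI[where h' = swap3]) (simp_all add: smooth_germ_linear[OF bounded_linear_swap3 smooth_germ_id])

lemma swap_derivatives:
  assumes "\<And>z. smooth_germ f z"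
  shows "d_t (\<lambda>z. prod.swap (f z)) z = prod.swap (d_t f z)" "d_xi (\<lambda>z. prod.swap (f z)) z = prod.swap (d_xi f z)"
proof -
  note sm = smooth_germ_linear[OF bounded_linear_swap assms]
  note D = has_derivative_px_py[OF bounded_linear.has_derivative[OF bounded_linear_swap smooth_germ_plane[OF assms]]]
  show "d_t (\<lambda>z. prod.swap (f z)) z = prod.swap (d_t f z)" "d_xi (\<lambda>z. prod.swap (f z)) z = prod.swap (d_xi f z)"
    unfolding d_t_eq_py[OF sm] d_t_eq_py[OF assms] d_xi_eq_px[OF sm] d_xi_eq_px[OF assms] D by simp_all
qed

lemma span_swap: "span {prod.swap v} = prod.swap ` span {v :: plane}"
  using linear_span_image[OF bounded_linear.linear[OF bounded_linear_swap], of "{v}"] by simp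

lemma swap_eq_0: "prod.swap v = (0 :: plane) \<longleftrightarrow> v = 0"
  by (auto simp: prod_eq_iff)

lemma tangential_family_swap:
  assumes tf: "tangential_family f"
  shows "tangential_family (\<lambda>z. prod.swap (f z))"
proof -
  note sm = tangential_family_smooth[OF tf]
  have "homeomorphic_map euclidean euclidean (prod.swap :: plane \<Rightarrow> plane)"
    by (rule homeomorphic_map_involution) (use linear_continuous_on[OF bounded_linear_swap, of UNIV] in simp_all)
  then have e: "embedding_map euclidean euclidean (prod.swap :: plane \<Rightarrow> plane)"
    unfolding surjective_embedding_map[symmetric] by blast
  have "embedding_map euclidean euclidean (\<lambda>\<xi>. f (\<xi>, 0))" using tf unfolding tangential_family_def by blast
  from embedding_map_compose[OF this e]
  have 1: "embedding_map euclidean euclidean (\<lambda>\<xi>. prod.swap (f (\<xi>, 0)))" by (simp add: o_def)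
  have 2: "smooth_on (\<lambda>z. prod.swap (f z)) UNIV"
    unfolding smooth_on_def using Ck_on_of_smooth_germ[OF smooth_germ_linear[OF bounded_linear_swap sm]] by blast
  show ?thesis
    using tf 1 2 unfolding tangential_family_def swap_derivatives[OF sm] span_swap swap_eq_0 by simp
qed

lemma coordinate_expression_swap:
  assumes sm: "\<And>z. smooth_germ f z" and g: "coordinate_expression (legendrian_graph f) a g"
  shows "coordinate_expression (legendrian_graph (\<lambda>z. prod.swap (f z))) a (\<lambda>z. swap3 (g z))"
proof -
  have sw: "legendrian_graph (\<lambda>z. prod.swap (f z)) z = map_prod prod.swap ((`) prod.swap) (legendrian_graph f z)" for z
    by (simp add: legendrian_graph_def swap_derivatives[OF sm] span_swap)
  have x: "map_prod prod.swap ((`) prod.swap) (inv_chart_x w) = inv_chart_y (swap3 w)"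
    and y: "map_prod prod.swap ((`) prod.swap) (inv_chart_y w) = inv_chart_x (swap3 w)" for w
    by (cases w; simp add: inv_chart_x_def inv_chart_y_def swap3_def span_swap[symmetric])+
  show ?thesis
    using g unfolding coordinate_expression_def
  proof
    assume "\<forall>\<^sub>F z in nhds a. legendrian_graph f z = inv_chart_x (g z)"
    then have "\<forall>\<^sub>F z in nhds a. legendrian_graph (\<lambda>z. prod.swap (f z)) z = inv_chart_y (swap3 (g z))"
      by eventually_elim (simp add: sw x)
    then show "(\<forall>\<^sub>F z in nhds a. legendrian_graph (\<lambda>z. prod.swap (f z)) z = inv_chart_x (swap3 (g z))) \<or>
      (\<forall>\<^sub>F z in nhds a. legendrian_graph (\<lambda>z. prod.swap (f z)) z = inv_chart_y (swap3 (g z)))" by (rule disjI2)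
  next
    assume "\<forall>\<^sub>F z in nhds a. legendrian_graph f z = inv_chart_y (g z)"
    then have "\<forall>\<^sub>F z in nhds a. legendrian_graph (\<lambda>z. prod.swap (f z)) z = inv_chart_x (swap3 (g z))"
      by eventually_elim (simp add: sw y)
    then show "(\<forall>\<^sub>F z in nhds a. legendrian_graph (\<lambda>z. prod.swap (f z)) z = inv_chart_x (swap3 (g z))) \<or>
      (\<forall>\<^sub>F z in nhds a. legendrian_graph (\<lambda>z. prod.swap (f z)) z = inv_chart_y (swap3 (g z)))" by (rule disjI1)
  qed
qed

lemma left_right_equivalent_swap3:
  fixes g :: "plane \<Rightarrow> real \<times> real \<times> real"
  assumes "left_right_equivalent g a g' b"
  shows "left_right_equivalent (\<lambda>z. swap3 (g z)) a g' b"
    and "left_right_equivalent (\<lambda>z. swap3 (g z)) a (\<lambda>z. swap3 (g' z)) b"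
proof -
  obtain h k where hk: "diffeo_germ h a" "h a = b" "diffeo_germ k (g a)" "\<forall>\<^sub>F z in nhds a. k (g z) = g' (h z)"
    using assms by (rule left_right_equivalentE)
  have k: "diffeo_germ (\<lambda>w. k (swap3 w)) (swap3 (g a))"
    by (rule diffeo_germ_compose[where h = swap3, OF diffeo_germ_swap3]) (simp add: hk(3))
  show "left_right_equivalent (\<lambda>z. swap3 (g z)) a g' b"
    by (rule left_right_equivalentI[where g = "\<lambda>z. swap3 (g z)", OF hk(1,2) k]) (simp add: hk(4))
  have k': "diffeo_germ (\<lambda>w. swap3 (k (swap3 w))) (swap3 (g a))"
    by (rule diffeo_germ_compose[where k = swap3, OF k diffeo_germ_swap3])
  show "left_right_equivalent (\<lambda>z. swap3 (g z)) a (\<lambda>z. swap3 (g' z)) b"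
    by (rule left_right_equivalentI[where g = "\<lambda>z. swap3 (g z)", OF hk(1,2) k']) (rule eventually_mono[OF hk(4)], simp)
qed

lemma smooth_graph_germ_swap:
  assumes sm: "\<And>z. smooth_germ f z" and "smooth_graph_germ f"
  shows "smooth_graph_germ (\<lambda>z. prod.swap (f z))"
proof -
  obtain g g' where g: "coordinate_expression (legendrian_graph f) (0, 0) g" "(g has_derivative g') (at (0, 0))" "inj g'"
    using assms(2) unfolding smooth_graph_germ_def by blast
  have "inj swap3" by (rule inj_on_inverseI[where g = swap3]) simp
  then have "inj (\<lambda>v. swap3 (g' v))" using g(3) inj_compose[of swap3 g'] by (simp add: o_def)
  then show ?thesis
    unfolding smooth_graph_germ_def
    using coordinate_expression_swap[OF sm g(1)] bounded_linear.has_derivative[OF bounded_linear_swap3 g(2)] by blast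
qed

lemma graph_germ_of_type_swap:
  assumes sm: "\<And>z. smooth_germ f z" and "graph_germ_of_type N f"
  shows "graph_germ_of_type N (\<lambda>z. prod.swap (f z))"
  using assms(2) coordinate_expression_swap[OF sm] left_right_equivalent_swap3(1)
  unfolding graph_germ_of_type_def by blast

lemma graph_germs_diffeomorphic_swap:
  assumes "\<And>z. smooth_germ f z" "\<And>z. smooth_germ f' z" "graph_germs_diffeomorphic f a f' b"
  shows "graph_germs_diffeomorphic (\<lambda>z. prod.swap (f z)) a (\<lambda>z. prod.swap (f' z)) b"
  using assms(3) coordinate_expression_swap[OF assms(1)] coordinate_expression_swap[OF assms(2)] left_right_equivalent_swap3(2)
  unfolding graph_germs_diffeomorphic_def by blast

lemma tangential_deformation_swap:
  assumes "tangential_deformation p F f"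
  shows "tangential_deformation p (\<lambda>z \<mu>. prod.swap (F z \<mu>)) (\<lambda>z. prod.swap (f z))"
proof -
  have "smooth_Euclidean (2 + p) (\<lambda>y. prod.swap (F (y 0, y 1) (\<lambda>i. y (2 + i))))"
    using assms Ck_Euclidean_linear[OF bounded_linear_swap] unfolding tangential_deformation_def smooth_Euclidean_def by blast
  moreover have "\<forall>\<^sub>F z in nhds (0, 0). prod.swap (F z (\<lambda>_. 0)) = prod.swap (f z)"
    using assms unfolding tangential_deformation_def by (auto elim: eventually_mono)
  ultimately show ?thesis using assms tangential_family_swap unfolding tangential_deformation_def by blast
qed

text \<open>The exchange is an involution, so every deformation of the exchanged family is the
  exchange of a deformation of \<open>f\<close>, and the same points \<open>q\<close> serve.\<close>

lemma stable_graph_germ_swap: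
  assumes tf: "tangential_family f" and st: "stable_graph_germ f"
  shows "stable_graph_germ (\<lambda>z. prod.swap (f z))"
  unfolding stable_graph_germ_def
proof (intro allI impI)
  fix p F assume def: "tangential_deformation p F (\<lambda>z. prod.swap (f z))"
  let ?E = "Euclidean_space p" and ?o = "\<lambda>_ :: nat. 0 :: real"
  have "tangential_deformation p (\<lambda>z \<mu>. prod.swap (F z \<mu>)) f"
    using tangential_deformation_swap[OF def] by simp
  then obtain q where q: "(q \<longlongrightarrow> (0, 0)) (atin ?E ?o)"
    "\<forall>\<^sub>F \<mu> in nhdsin ?E ?o. graph_germs_diffeomorphic f (0, 0) (\<lambda>z. prod.swap (F z \<mu>)) (q \<mu>)"
    using st unfolding stable_graph_germ_def by blast
  have oE: "?o \<in> topspace ?E" by (simp add: topspace_Euclidean_space)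
  obtain N where N: "openin ?E N" "?o \<in> N" "\<And>\<mu>. \<mu> \<in> N \<Longrightarrow> graph_germs_diffeomorphic f (0, 0) (\<lambda>z. prod.swap (F z \<mu>)) (q \<mu>)"
    using q(2) oE unfolding eventually_nhdsin by blast
  have "graph_germs_diffeomorphic (\<lambda>z. prod.swap (f z)) (0, 0) (\<lambda>z. F z \<mu>) (q \<mu>)" if "\<mu> \<in> N" for \<mu>
  proof -
    have "\<mu> \<in> topspace ?E" using that openin_subset[OF N(1)] by blast
    note smF = tangential_family_smooth[OF member_tangential[OF def this]]
    show ?thesis
      using graph_germs_diffeomorphic_swap[OF tangential_family_smooth[OF tf] smooth_germ_linear[OF bounded_linear_swap smF] N(3)[OF that]]
      by simp
  qed
  then have "\<forall>\<^sub>F \<mu> in nhdsin ?E ?o. graph_germs_diffeomorphic (\<lambda>z. prod.swap (f z)) (0, 0) (\<lambda>z. F z \<mu>) (q \<mu>)"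
    unfolding eventually_nhdsin using N(1,2) by blast
  with q(1) show "\<exists>q. (q \<longlongrightarrow> (0, 0)) (atin ?E ?o) \<and>
      (\<forall>\<^sub>F \<mu> in nhdsin ?E ?o. graph_germs_diffeomorphic (\<lambda>z. prod.swap (f z)) (0, 0) (\<lambda>z. F z \<mu>) (q \<mu>))" by (intro exI[of _ q] conjI)
qed

lemma stable_iff_nonvertical:
  assumes tf: "tangential_family f" and nz: "fst (d_t f (0, 0)) \<noteq> 0"
  shows "stable_graph_germ f \<longleftrightarrow>
     smooth_graph_germ f \<or> graph_germ_of_type A1_plus f \<or> graph_germ_of_type A1_minus f"
proof -
  note ty = graph_germ_of_type_iff[OF tangential_family_smooth[OF tf] nz, folded zero_in_plane] smooth_graph_germ_iff[OF tf nz]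
  note A1 = A1_imp_stable[OF tf nz, folded zero_in_plane]
  show ?thesis
  proof
    assume st: "stable_graph_germ f"
    show "smooth_graph_germ f \<or> graph_germ_of_type A1_plus f \<or> graph_germ_of_type A1_minus f"
    proof (cases "graph_bracket f (0, 0) = 0")
      case True
      obtain \<epsilon> where "\<epsilon> = 1 \<or> \<epsilon> = - 1" "left_right_equivalent (graph_chart f) (0, 0) (A1_form \<epsilon>) 0"
        using tf nz st True by (rule stable_imp_A1)
      then show ?thesis unfolding ty A1_form_eq zero_in_plane by blast
    next
      case False
      then show ?thesis using ty(2) by blast
    qed
  next
    assume "smooth_graph_germ f \<or> graph_germ_of_type A1_plus f \<or> graph_germ_of_type A1_minus f"
    then show "stable_graph_germ f"
      unfolding ty A1_form_eq using smooth_imp_stable[OF tf nz] A1[of 1] A1[of "-1"] unfolding zero_in_plane by blast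
  qed
qed

theorem theorem2:
  fixes f :: "real \<times> real \<Rightarrow> real \<times> real"
  assumes "tangential_family f"
    and "f (0, 0) = (0, 0)"
  shows "stable_graph_germ f \<longleftrightarrow>
     smooth_graph_germ f \<or> graph_germ_of_type A1_plus f \<or> graph_germ_of_type A1_minus f"
proof (cases "fst (d_t f (0, 0)) = 0")
  case False
  then show ?thesis by (rule stable_iff_nonvertical[OF assms(1)])
next
  \<comment> \<open>A vertical tangent at the origin: the exchanged family has a non-vertical one,
    and all notions involved are invariant under the exchange.\<close>
  case True
  note sm = tangential_family_smooth[OF assms(1)]
  let ?f = "\<lambda>z. prod.swap (f z)"
  have tf: "tangential_family ?f" by (rule tangential_family_swap[OF assms(1)])
  note smf = tangential_family_smooth[OF tf]
  have ff: "(\<lambda>z. prod.swap (?f z)) = f" by simp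
  have "d_t f (0, 0) \<noteq> 0" using assms(1) unfolding tangential_family_def by blast
  then have "fst (d_t ?f (0, 0)) \<noteq> 0" unfolding swap_derivatives[OF sm] using True by (simp add: prod_eq_iff)
  note eq = stable_iff_nonvertical[OF tf this]
  have "stable_graph_germ f \<longleftrightarrow> stable_graph_germ ?f"
    using stable_graph_germ_swap[OF assms(1)] stable_graph_germ_swap[OF tf] unfolding ff by blast
  moreover have "smooth_graph_germ f \<longleftrightarrow> smooth_graph_germ ?f"
    using smooth_graph_germ_swap[OF sm] smooth_graph_germ_swap[OF smf] unfolding ff by blast
  moreover have "graph_germ_of_type N f \<longleftrightarrow> graph_germ_of_type N ?f" for N
    using graph_germ_of_type_swap[OF sm] graph_germ_of_type_swap[OF smf] unfolding ff by blast
  ultimately show ?thesis using eq by blast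
qed

end
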